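(* Let $A$ be an $\Omega$-algebra over a field $F$ and let $V\subseteq\mathrm{End}_F(A)$ be a unital pointwise finite dimensional subalgebra closed in the finite topology. Let $(\rho^{\mathbf{Hopf}}_{A,V})^\vee\colon\mathcal{H}^\square(A,V)^\circ\otimes A\to A$ be the action $h^*\otimes a\mapsto h^*(a_{(1)})a_{(0)}$, where $\rho^{\mathbf{Hopf}}_{A,V}(a)=a_{(0)}\otimes a_{(1)}$. Then the unique homomorphism of Hopf algebras $\theta^{\mathbf{Hopf}}\colon\mathcal{H}^\square(A,V)^\circ\to{}_\square\mathcal{H}(A,V)$ such that $\psi^{\mathbf{Hopf}}_{A,V}(\theta^{\mathbf{Hopf}}\otimes\mathrm{id}_A)=(\rho^{\mathbf{Hopf}}_{A,V})^\vee$ is an isomorphism. In particular, for any finite dimensional (unital associative) algebra $A$ and any finite dimensional coalgebra $C$ there are Hopf algebra isomorphisms $${}_\square\mathcal{H}(A)\cong\mathcal{H}^\square(A)^\circ,\qquad {}_{\blacksquare}\mathcal{H}(C)\cong\mathcal{H}^{\blacksquare}(C)^\circ .$$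
   Context: $F$ is a fixed field; everything is over $F$; coalgebras are coassociative and counital. $H^\circ$ is the finite dual (a Hopf algebra if $H$ is a Hopf algebra). $\Omega$ is a fixed set with two maps $s,t\colon\Omega\to\mathbb{Z}_+$. An $\Omega$-algebra is a vector space $A$ with a linear map $\omega_A\colon A^{\otimes s(\omega)}\to A^{\otimes t(\omega)}$ for every $\omega\in\Omega$, where $A^{\otimes 0}:=F$. Measurings and actions. For a coalgebra $P$ and linear $\psi\colon P\otimes A\to A$ put $\psi_0=\varepsilon_P$, $\psi_n(p\otimes a_1\otimes\dots\otimes a_n)=\psi(p_{(1)}\otimes a_1)\otimes\dots\otimes\psi(p_{(n)}\otimes a_n)$ for $n>0$; $\psi$ is a measuring if $\psi_{t(\omega)}(p\otimes\omega_A(x))=\omega_A(\psi_{s(\omega)}(p\otimes x))$ for all $\omega,p,x$. $\mathrm{cosupp}\,\psi=\{\psi(p\otimes(-))\mid p\in P\}$. An action of a bialgebra $B$ on $A$ is a unital left module structure $B\otimes A\to A$ that is a measuring. Comeasurings and coactions. For a unital associative algebra $Q$ and linear $\rho\colon A\to A\otimes Q$, $\rho(a)=a_{(0)}\otimes a_{(1)}$, put $\rho_0(\alpha)=\alpha1_Q$, $\rho_n(a_1\otimes\dots\otimes a_n)=(a_1)_{(0)}\otimes\dots\otimes(a_n)_{(0)}\otimes(a_1)_{(1)}\cdots(a_n)_{(1)}$ for $n>0$; $\rho$ is a comeasuring if $\rho_{t(\omega)}(\omega_A(x))=(\omega_A\otimes\mathrm{id}_Q)\rho_{s(\omega)}(x)$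 for all $\omega,x$. $\mathrm{cosupp}\,\rho$ is the set of all maps $a\mapsto q^*(a_{(1)})a_{(0)}$, $q^*\in Q^*$. A coaction of a bialgebra $B$ on $A$ is a counital right comodule structure $A\to A\otimes B$ that is a comeasuring. $({}_\square\mathcal{B}(A,V),\psi_{A,V})$, the $V$-universal acting bialgebra, is the terminal object in the category of measurings $\psi\colon P\otimes A\to A$ with $\mathrm{cosupp}\,\psi\subseteq V$ ($P$ a coalgebra; morphisms are coalgebra maps $\varphi$ with $\psi_2(\varphi\otimes\mathrm{id}_A)=\psi_1$), with the unique bialgebra structure making $\psi_{A,V}$ an action. $(\mathcal{B}^\square(A,V),\rho_{A,V})$, the $V$-universal coacting bialgebra, is the initial object in the category of comeasurings $\rho\colon A\to A\otimes Q$ with $\mathrm{cosupp}\,\rho\subseteq V$ ($Q$ a unital associative algebra; morphisms are unital algebra maps $\varphi$ with $(\mathrm{id}_A\otimes\varphi)\rho_1=\rho_2$), with the unique bialgebra structure making $\rho_{A,V}$ a coaction. Both exist under the hypotheses of the claim. Let $H_r$ and $H_l$ be the right and left adjoint functors of the embedding of Hopf algebras into bialgebras. ${}_\square\mathcal{H}(A,V):=H_r({}_\square\mathcal{B}(A,V))$, with action $\psi^{\mathbf{Hopf}}_{A,V}$ the composition of (counit ${}_\square\mathcal{H}(A,V)\to{}_\square\mathcal{B}(A,V)$)$\,\otimes\,\mathrm{id}_A$ with $\psi_{A,V}$; it is universal (terminal) among Hopf algebra actions on $A$ with cosupport in $V$. $\mathcal{H}^\square(A,V):=H_l(\mathcal{B}^\square(A,V))$,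 with coaction $\rho^{\mathbf{Hopf}}_{A,V}$ the composition of $\rho_{A,V}$ with $\mathrm{id}_A\otimes$(unit $\mathcal{B}^\square(A,V)\to\mathcal{H}^\square(A,V)$); it is universal (initial) among Hopf algebra coactions on $A$ with cosupport in $V$. For a unital associative algebra $A$, viewed as an $\Omega$-algebra with $\Omega=\{\mu,u\}$ (multiplication and unit map), ${}_\square\mathcal{H}(A):={}_\square\mathcal{H}(A,\mathrm{End}_F(A))$ and $\mathcal{H}^\square(A):=\mathcal{H}^\square(A,\mathrm{End}_F(A))$. For a coalgebra $C$, viewed as an $\Omega$-algebra with $\Omega=\{\Delta,\varepsilon\}$, ${}_{\blacksquare}\mathcal{H}(C):={}_\square\mathcal{H}(C,\mathrm{End}_F(C))$ and $\mathcal{H}^{\blacksquare}(C):=\mathcal{H}^\square(C,\mathrm{End}_F(C))$. The finite topology on $\mathrm{End}_F(A)$ has as base the sets $\{f\mid f(a_i)=b_i,\ 1\le i\le n\}$. $V$ is pointwise finite dimensional if $Va=\{v(a)\mid v\in V\}$ is finite dimensional for every $a\in A$. *)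

theory Defs
  imports "HOL-Analysis.Abstract_Topology" "HOL-Library.Function_Algebras"
begin

section \<open>Vector spaces\<close>

text \<open>
  The field of scalars is a type \<open>'k :: field\<close>. A vector space is a subspace \<open>vcar\<close> of a type which
  the scalar multiplication \<open>vscale\<close> turns into a vector space. Maps are functions on the ambient type,
  and only their values on the carrier matter; hence uniqueness of a morphism always means equality on
  the carrier (\<open>ex_unique_on\<close>). Linear maps out of \<open>V \<otimes> W\<close> are given as curried bilinear maps.
\<close>

record ('k, 'u) vsp =
  vcar :: "'u set"
  vscale :: "'k \<Rightarrow> 'u \<Rightarrow> 'u"

record ('k, 'u) alg = "('k, 'u) vsp" +
  amult :: "'u \<Rightarrow> 'u \<Rightarrow> 'u"
  aone :: 'u

definition vspace :: "('k::field, 'u::ab_group_add, 'z) vsp_scheme \<Rightarrow> bool" where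
  "vspace V \<longleftrightarrow> vector_space (vscale V) \<and> module.subspace (vscale V) (vcar V)"

definition fscale :: "'k::field \<Rightarrow> ('x \<Rightarrow> 'k) \<Rightarrow> ('x \<Rightarrow> 'k)" where
  "fscale c f = (\<lambda>x. c * f x)"

definition ground :: "('k::field, 'k) alg" where
  "ground = \<lparr>vcar = UNIV, vscale = (*), amult = (*), aone = 1\<rparr>"

definition lin_map :: "('k::field, 'u::ab_group_add, 'y) vsp_scheme
    \<Rightarrow> ('k, 'v::ab_group_add, 'z) vsp_scheme \<Rightarrow> ('u \<Rightarrow> 'v) \<Rightarrow> bool" where
  "lin_map V W f \<longleftrightarrow>
     (\<forall>x\<in>vcar V. f x \<in> vcar W) \<and>
     (\<forall>x\<in>vcar V. \<forall>y\<in>vcar V. f (x + y) = f x + f y) \<and>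
     (\<forall>c. \<forall>x\<in>vcar V. f (vscale V c x) = vscale W c (f x))"

definition bilin_map :: "('k::field, 'u::ab_group_add, 'x) vsp_scheme
    \<Rightarrow> ('k, 'v::ab_group_add, 'y) vsp_scheme \<Rightarrow> ('k, 'w::ab_group_add, 'z) vsp_scheme
    \<Rightarrow> ('u \<Rightarrow> 'v \<Rightarrow> 'w) \<Rightarrow> bool" where
  "bilin_map V W Z b \<longleftrightarrow>
     (\<forall>v\<in>vcar V. lin_map W Z (b v)) \<and> (\<forall>w\<in>vcar W. lin_map V Z (\<lambda>v. b v w))"

definition vlists :: "('k::field, 'u::ab_group_add, 'y) vsp_scheme \<Rightarrow> nat \<Rightarrow> 'u list set" where
  "vlists V n = {xs. length xs = n \<and> set xs \<subseteq> vcar V}"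

definition multilin_map :: "('k::field, 'u::ab_group_add, 'y) vsp_scheme \<Rightarrow> nat
    \<Rightarrow> ('k, 'w::ab_group_add, 'z) vsp_scheme \<Rightarrow> ('u list \<Rightarrow> 'w) \<Rightarrow> bool" where
  "multilin_map V n Z b \<longleftrightarrow>
     (\<forall>xs\<in>vlists V n. b xs \<in> vcar Z) \<and>
     (\<forall>xs\<in>vlists V n. \<forall>i<n. lin_map V Z (\<lambda>x. b (xs[i := x])))"

definition ex_unique_on :: "'x set \<Rightarrow> (('x \<Rightarrow> 'y) \<Rightarrow> bool) \<Rightarrow> bool" where
  "ex_unique_on C P \<longleftrightarrow> (\<exists>f. P f \<and> (\<forall>g. P g \<longrightarrow> (\<forall>x\<in>C. g x = f x)))"

section \<open>Tensor products\<close>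

text \<open>
  The pure tensor of \<open>v\<close> and \<open>w\<close> is the evaluation \<open>\<beta> \<mapsto> \<beta> v w\<close> of bilinear forms on \<open>V \<times> W\<close>, and
  \<open>V \<otimes> W\<close> is the span of the pure tensors. Over a field the bilinear forms separate the points of the
  abstract tensor product, so this is a model of it. The same applies to the \<open>n\<close>-th tensor power, whose
  pure tensors are indexed by lists of length \<open>n\<close>; its \<open>0\<close>-th instance is the line spanned by
  \<open>ptens V []\<close>, which stands for \<open>1\<close> under the identification with the ground field.
  All maps on these spaces are introduced by the universal property (\<open>tlift\<close>, \<open>plift\<close>).
\<close>

type_synonym ('u, 'v, 'k) tensor = "('u \<Rightarrow> 'v \<Rightarrow> 'k) \<Rightarrow> 'k"
type_synonym ('u, 'k) tpower = "('u list \<Rightarrow> 'k) \<Rightarrow> 'k"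

definition tens :: "('k::field, 'u::ab_group_add, 'y) vsp_scheme
    \<Rightarrow> ('k, 'v::ab_group_add, 'z) vsp_scheme \<Rightarrow> 'u \<Rightarrow> 'v \<Rightarrow> ('u, 'v, 'k) tensor" where
  "tens V W v w = (\<lambda>\<beta>. if bilin_map V W ground \<beta> then \<beta> v w else 0)"

definition tensor_space :: "('k::field, 'u::ab_group_add, 'y) vsp_scheme
    \<Rightarrow> ('k, 'v::ab_group_add, 'z) vsp_scheme \<Rightarrow> ('k, ('u, 'v, 'k) tensor) vsp" where
  "tensor_space V W =
     \<lparr>vcar = module.span fscale {tens V W v w | v w. v \<in> vcar V \<and> w \<in> vcar W}, vscale = fscale\<rparr>"

definition tlift :: "('k::field, 'u::ab_group_add, 'x) vsp_scheme
    \<Rightarrow> ('k, 'v::ab_group_add, 'y) vsp_scheme \<Rightarrow> ('k, 'w::ab_group_add, 'z) vsp_scheme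
    \<Rightarrow> ('u \<Rightarrow> 'v \<Rightarrow> 'w) \<Rightarrow> ('u, 'v, 'k) tensor \<Rightarrow> 'w" where
  "tlift V W Z b = (SOME L. lin_map (tensor_space V W) Z L \<and>
     (\<forall>v\<in>vcar V. \<forall>w\<in>vcar W. L (tens V W v w) = b v w))"

definition ptens :: "('k::field, 'u::ab_group_add, 'y) vsp_scheme \<Rightarrow> 'u list \<Rightarrow> ('u, 'k) tpower" where
  "ptens V xs = (\<lambda>\<beta>. if multilin_map V (length xs) ground \<beta> then \<beta> xs else 0)"

definition power_space :: "('k::field, 'u::ab_group_add, 'y) vsp_scheme \<Rightarrow> nat
    \<Rightarrow> ('k, ('u, 'k) tpower) vsp" where
  "power_space V n = \<lparr>vcar = module.span fscale (ptens V ` vlists V n), vscale = fscale\<rparr>"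

definition plift :: "('k::field, 'u::ab_group_add, 'y) vsp_scheme \<Rightarrow> nat
    \<Rightarrow> ('k, 'w::ab_group_add, 'z) vsp_scheme \<Rightarrow> ('u list \<Rightarrow> 'w) \<Rightarrow> ('u, 'k) tpower \<Rightarrow> 'w" where
  "plift V n Z b = (SOME L. lin_map (power_space V n) Z L \<and>
     (\<forall>xs\<in>vlists V n. L (ptens V xs) = b xs))"

definition tmap :: "('k::field, 'u::ab_group_add, 'w) vsp_scheme \<Rightarrow> ('k, 'v::ab_group_add, 'x) vsp_scheme
    \<Rightarrow> ('k, 'u'::ab_group_add, 'y) vsp_scheme \<Rightarrow> ('k, 'v'::ab_group_add, 'z) vsp_scheme
    \<Rightarrow> ('u \<Rightarrow> 'u') \<Rightarrow> ('v \<Rightarrow> 'v') \<Rightarrow> ('u, 'v, 'k) tensor \<Rightarrow> ('u', 'v', 'k) tensor" where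
  "tmap V W V' W' f g = tlift V W (tensor_space V' W') (\<lambda>v w. tens V' W' (f v) (g w))"

definition tassoc :: "('k::field, 'u::ab_group_add, 'x) vsp_scheme
    \<Rightarrow> ('k, 'v::ab_group_add, 'y) vsp_scheme \<Rightarrow> ('k, 'w::ab_group_add, 'z) vsp_scheme
    \<Rightarrow> (('u, 'v, 'k) tensor, 'w, 'k) tensor \<Rightarrow> ('u, ('v, 'w, 'k) tensor, 'k) tensor" where
  "tassoc U V W =
     tlift (tensor_space U V) W (tensor_space U (tensor_space V W))
       (\<lambda>X w. tlift U V (tensor_space U (tensor_space V W))
          (\<lambda>u v. tens U (tensor_space V W) u (tens V W v w)) X)"

text \<open>\<open>pcons V n x\<close> is \<open>X \<mapsto> x \<otimes> X\<close>, from the \<open>n\<close>-th to the \<open>(n+1)\<close>-st tensor power.\<close>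

definition pcons :: "('k::field, 'u::ab_group_add, 'y) vsp_scheme \<Rightarrow> nat \<Rightarrow> 'u
    \<Rightarrow> ('u, 'k) tpower \<Rightarrow> ('u, 'k) tpower" where
  "pcons V n x = plift V n (power_space V (Suc n)) (\<lambda>xs. ptens V (x # xs))"

text \<open>\<open>contract V W f\<close> is \<open>v \<otimes> w \<mapsto> f(w) v\<close>.\<close>

definition contract :: "('k::field, 'u::ab_group_add, 'y) vsp_scheme
    \<Rightarrow> ('k, 'v::ab_group_add, 'z) vsp_scheme \<Rightarrow> ('v \<Rightarrow> 'k) \<Rightarrow> ('u, 'v, 'k) tensor \<Rightarrow> 'u" where
  "contract V W f = tlift V W V (\<lambda>v w. vscale V (f w) v)"

section \<open>Algebras, coalgebras, bialgebras, Hopf algebras\<close>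

record ('k, 'u) coalg = "('k, 'u) vsp" +
  cdelta :: "'u \<Rightarrow> ('u, 'u, 'k) tensor"
  ceps :: "'u \<Rightarrow> 'k"

record ('k, 'u) bialg = "('k, 'u) alg" +
  bdelta :: "'u \<Rightarrow> ('u, 'u, 'k) tensor"
  beps :: "'u \<Rightarrow> 'k"

definition coalg_of :: "('k::field, 'u::ab_group_add) bialg \<Rightarrow> ('k, 'u) coalg" where
  "coalg_of B = \<lparr>vcar = vcar B, vscale = vscale B, cdelta = bdelta B, ceps = beps B\<rparr>"

definition algebra :: "('k::field, 'u::ab_group_add, 'z) alg_scheme \<Rightarrow> bool" where
  "algebra Q \<longleftrightarrow> vspace Q \<and> bilin_map Q Q Q (amult Q) \<and> aone Q \<in> vcar Q \<and>
     (\<forall>x\<in>vcar Q. \<forall>y\<in>vcar Q. \<forall>z\<in>vcar Q. amult Q (amult Q x y) z = amult Q x (amult Q y z)) \<and>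
     (\<forall>x\<in>vcar Q. amult Q (aone Q) x = x \<and> amult Q x (aone Q) = x)"

definition alg_hom :: "('k::field, 'u::ab_group_add, 'y) alg_scheme
    \<Rightarrow> ('k, 'v::ab_group_add, 'z) alg_scheme \<Rightarrow> ('u \<Rightarrow> 'v) \<Rightarrow> bool" where
  "alg_hom Q R f \<longleftrightarrow> lin_map Q R f \<and> f (aone Q) = aone R \<and>
     (\<forall>x\<in>vcar Q. \<forall>y\<in>vcar Q. f (amult Q x y) = amult R (f x) (f y))"

definition tensor_alg :: "('k::field, 'u::ab_group_add, 'y) alg_scheme
    \<Rightarrow> ('k, 'v::ab_group_add, 'z) alg_scheme \<Rightarrow> ('k, ('u, 'v, 'k) tensor) alg" where
  "tensor_alg Q R =
     \<lparr>vcar = vcar (tensor_space Q R), vscale = fscale,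
      amult = (\<lambda>X Y. tlift Q R (tensor_space Q R)
         (\<lambda>x y. tlift Q R (tensor_space Q R)
            (\<lambda>x' y'. tens Q R (amult Q x x') (amult R y y')) Y) X),
      aone = tens Q R (aone Q) (aone R)\<rparr>"

definition coalgebra :: "('k::field, 'u::ab_group_add) coalg \<Rightarrow> bool" where
  "coalgebra P \<longleftrightarrow> vspace P \<and> lin_map P (tensor_space P P) (cdelta P) \<and> lin_map P ground (ceps P) \<and>
     (\<forall>p\<in>vcar P.
        tassoc P P P (tmap P P (tensor_space P P) P (cdelta P) id (cdelta P p))
          = tmap P P P (tensor_space P P) id (cdelta P) (cdelta P p)) \<and>
     (\<forall>p\<in>vcar P. tlift P P P (\<lambda>x y. vscale P (ceps P x) y) (cdelta P p) = p \<and>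
                  tlift P P P (\<lambda>x y. vscale P (ceps P y) x) (cdelta P p) = p)"

definition coalg_hom :: "('k::field, 'u::ab_group_add) coalg \<Rightarrow> ('k, 'v::ab_group_add) coalg
    \<Rightarrow> ('u \<Rightarrow> 'v) \<Rightarrow> bool" where
  "coalg_hom P R f \<longleftrightarrow> lin_map P R f \<and>
     (\<forall>p\<in>vcar P. cdelta R (f p) = tmap P P R R f f (cdelta P p) \<and> ceps R (f p) = ceps P p)"

definition bialgebra :: "('k::field, 'u::ab_group_add) bialg \<Rightarrow> bool" where
  "bialgebra B \<longleftrightarrow> algebra B \<and> coalgebra (coalg_of B) \<and>
     alg_hom B (tensor_alg B B) (bdelta B) \<and> alg_hom B ground (beps B)"

definition bialg_hom :: "('k::field, 'u::ab_group_add) bialg \<Rightarrow> ('k, 'v::ab_group_add) bialg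
    \<Rightarrow> ('u \<Rightarrow> 'v) \<Rightarrow> bool" where
  "bialg_hom B D f \<longleftrightarrow> alg_hom B D f \<and> coalg_hom (coalg_of B) (coalg_of D) f"

definition is_antipode :: "('k::field, 'u::ab_group_add) bialg \<Rightarrow> ('u \<Rightarrow> 'u) \<Rightarrow> bool" where
  "is_antipode H S \<longleftrightarrow> lin_map H H S \<and>
     (\<forall>h\<in>vcar H.
        tlift H H H (\<lambda>x y. amult H (S x) y) (bdelta H h) = vscale H (beps H h) (aone H) \<and>
        tlift H H H (\<lambda>x y. amult H x (S y)) (bdelta H h) = vscale H (beps H h) (aone H))"

definition hopf_algebra :: "('k::field, 'u::ab_group_add) bialg \<Rightarrow> bool" where
  "hopf_algebra H \<longleftrightarrow> bialgebra H \<and> (\<exists>S. is_antipode H S)"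

text \<open>The antipode is unique and every bialgebra homomorphism between Hopf algebras commutes with it.\<close>

definition hopf_hom :: "('k::field, 'u::ab_group_add) bialg \<Rightarrow> ('k, 'v::ab_group_add) bialg
    \<Rightarrow> ('u \<Rightarrow> 'v) \<Rightarrow> bool" where
  "hopf_hom H K f \<longleftrightarrow> hopf_algebra H \<and> hopf_algebra K \<and> bialg_hom H K f"

definition hopf_iso :: "('k::field, 'u::ab_group_add) bialg \<Rightarrow> ('k, 'v::ab_group_add) bialg
    \<Rightarrow> ('u \<Rightarrow> 'v) \<Rightarrow> bool" where
  "hopf_iso H K f \<longleftrightarrow> hopf_hom H K f \<and> bij_betw f (vcar H) (vcar K)"

section \<open>The finite dual\<close>

definition finite_codim_ideal :: "('k::field, 'u::ab_group_add, 'z) alg_scheme \<Rightarrow> 'u set \<Rightarrow> bool" where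
  "finite_codim_ideal Q I \<longleftrightarrow>
     module.subspace (vscale Q) I \<and> I \<subseteq> vcar Q \<and>
     (\<forall>x\<in>vcar Q. \<forall>y\<in>I. amult Q x y \<in> I \<and> amult Q y x \<in> I) \<and>
     (\<exists>S. finite S \<and> module.span (vscale Q) (I \<union> S) = vcar Q)"

text \<open>
  Functionals on \<open>Q\<close> are extended by \<open>0\<close> outside the carrier, so that they form a subspace of the
  space of all functions.
\<close>

definition finite_dual_carrier :: "('k::field, 'u::ab_group_add, 'z) alg_scheme \<Rightarrow> ('u \<Rightarrow> 'k) set" where
  "finite_dual_carrier Q = {f. lin_map Q ground f \<and> (\<forall>x. x \<notin> vcar Q \<longrightarrow> f x = 0) \<and>
     (\<exists>I. finite_codim_ideal Q I \<and> (\<forall>x\<in>I. f x = 0))}"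

definition finite_dual_space :: "('k::field, 'u::ab_group_add, 'z) alg_scheme \<Rightarrow> ('k, 'u \<Rightarrow> 'k) vsp" where
  "finite_dual_space Q = \<lparr>vcar = finite_dual_carrier Q, vscale = fscale\<rparr>"

text \<open>The comultiplication of \<open>f\<close> is the tensor with \<open>f\<^sub>1(x) f\<^sub>2(y) = f(xy)\<close>.\<close>

definition finite_dual :: "('k::field, 'u::ab_group_add) bialg \<Rightarrow> ('k, 'u \<Rightarrow> 'k) bialg" where
  "finite_dual H =
     \<lparr>vcar = finite_dual_carrier H, vscale = fscale,
      amult = (\<lambda>f g x. if x \<in> vcar H then tlift H H ground (\<lambda>y z. f y * g z) (bdelta H x) else 0),
      aone = (\<lambda>x. if x \<in> vcar H then beps H x else 0),
      bdelta = (\<lambda>f. THE X. X \<in> vcar (tensor_space (finite_dual_space H) (finite_dual_space H)) \<and>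
         (\<forall>x\<in>vcar H. \<forall>y\<in>vcar H.
            tlift (finite_dual_space H) (finite_dual_space H) ground (\<lambda>g h. g x * h y) X
              = f (amult H x y))),
      beps = (\<lambda>f. f (aone H))\<rparr>"

section \<open>Omega-algebras, measurings and comeasurings\<close>

text \<open>
  The signature consists of the set \<open>Ops\<close> with arities \<open>osrc\<close>, \<open>otgt\<close>. The underlying space is a whole
  type, so that the linear endomorphisms are genuine functions.
\<close>

record ('k, 'a, 'o) omega_alg = "('k, 'a) vsp" +
  Ops :: "'o set"
  osrc :: "'o \<Rightarrow> nat"
  otgt :: "'o \<Rightarrow> nat"
  oper :: "'o \<Rightarrow> ('a, 'k) tpower \<Rightarrow> ('a, 'k) tpower"

definition omega_algebra :: "('k::field, 'a::ab_group_add, 'o) omega_alg \<Rightarrow> bool" where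
  "omega_algebra A \<longleftrightarrow> vspace A \<and> vcar A = UNIV \<and>
     (\<forall>w\<in>Ops A. lin_map (power_space A (osrc A w)) (power_space A (otgt A w)) (oper A w))"

text \<open>
  \<open>iter_delta P n\<close> is \<open>p \<mapsto> p\<^sub>1 \<otimes> \<dots> \<otimes> p\<^sub>n\<close>, with the counit for \<open>n = 0\<close>; for \<open>n = 1\<close> the recursion
  gives \<open>p\<^sub>1 \<epsilon>(p\<^sub>2) = p\<close>.
\<close>

primrec iter_delta :: "('k::field, 'p::ab_group_add) coalg \<Rightarrow> nat \<Rightarrow> 'p \<Rightarrow> ('p, 'k) tpower" where
  "iter_delta P 0 = (\<lambda>p. fscale (ceps P p) (ptens P []))"
| "iter_delta P (Suc n) = (\<lambda>p. tlift P P (power_space P (Suc n))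
     (\<lambda>x y. pcons P n x (iter_delta P n y)) (cdelta P p))"

definition psi_n :: "('k::field, 'p::ab_group_add) coalg \<Rightarrow> ('k, 'a::ab_group_add, 'o) omega_alg
    \<Rightarrow> ('p \<Rightarrow> 'a \<Rightarrow> 'a) \<Rightarrow> nat \<Rightarrow> 'p \<Rightarrow> ('a, 'k) tpower \<Rightarrow> ('a, 'k) tpower" where
  "psi_n P A \<psi> n p = plift A n (power_space A n)
     (\<lambda>as. plift P n (power_space A n) (\<lambda>ps. ptens A (map2 \<psi> ps as)) (iter_delta P n p))"

definition measuring :: "('k::field, 'p::ab_group_add) coalg \<Rightarrow> ('k, 'a::ab_group_add, 'o) omega_alg
    \<Rightarrow> ('p \<Rightarrow> 'a \<Rightarrow> 'a) \<Rightarrow> bool" where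
  "measuring P A \<psi> \<longleftrightarrow> coalgebra P \<and> bilin_map P A A \<psi> \<and>
     (\<forall>w\<in>Ops A. \<forall>p\<in>vcar P. \<forall>X\<in>vcar (power_space A (osrc A w)).
        psi_n P A \<psi> (otgt A w) p (oper A w X) = oper A w (psi_n P A \<psi> (osrc A w) p X))"

definition cosupp_meas :: "('k::field, 'p::ab_group_add) coalg \<Rightarrow> ('p \<Rightarrow> 'a \<Rightarrow> 'a) \<Rightarrow> ('a \<Rightarrow> 'a) set" where
  "cosupp_meas P \<psi> = \<psi> ` vcar P"

definition bialg_action :: "('k::field, 'b::ab_group_add) bialg \<Rightarrow> ('k, 'a::ab_group_add, 'o) omega_alg
    \<Rightarrow> ('b \<Rightarrow> 'a \<Rightarrow> 'a) \<Rightarrow> bool" where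
  "bialg_action B A \<psi> \<longleftrightarrow> bialgebra B \<and> measuring (coalg_of B) A \<psi> \<and>
     (\<forall>x\<in>vcar B. \<forall>y\<in>vcar B. \<forall>a. \<psi> (amult B x y) a = \<psi> x (\<psi> y a)) \<and>
     (\<forall>a. \<psi> (aone B) a = a)"

text \<open>
  \<open>rho_list\<close> is \<open>\<rho>\<^sub>n\<close> on pure tensors:
  \<open>(a\<^sub>1)\<^sub>0 \<otimes> \<dots> \<otimes> (a\<^sub>n)\<^sub>0 \<otimes> (a\<^sub>1)\<^sub>1 \<cdots> (a\<^sub>n)\<^sub>1\<close>, and \<open>1 \<otimes> 1\<close> for \<open>n = 0\<close>.
\<close>

primrec rho_list :: "('k::field, 'a::ab_group_add, 'o) omega_alg \<Rightarrow> ('k, 'q::ab_group_add, 'z) alg_scheme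
    \<Rightarrow> ('a \<Rightarrow> ('a, 'q, 'k) tensor) \<Rightarrow> 'a list \<Rightarrow> (('a, 'k) tpower, 'q, 'k) tensor" where
  "rho_list A Q \<rho> [] = tens (power_space A 0) Q (ptens A []) (aone Q)"
| "rho_list A Q \<rho> (a # as) =
     (let n = length as; T = tensor_space (power_space A (Suc n)) Q in
      tlift A Q T
        (\<lambda>x q. tlift (power_space A n) Q T
           (\<lambda>Y r. tens (power_space A (Suc n)) Q (pcons A n x Y) (amult Q q r)) (rho_list A Q \<rho> as))
        (\<rho> a))"

definition rho_n :: "('k::field, 'a::ab_group_add, 'o) omega_alg \<Rightarrow> ('k, 'q::ab_group_add, 'z) alg_scheme
    \<Rightarrow> ('a \<Rightarrow> ('a, 'q, 'k) tensor) \<Rightarrow> nat \<Rightarrow> ('a, 'k) tpower \<Rightarrow> (('a, 'k) tpower, 'q, 'k) tensor" where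
  "rho_n A Q \<rho> n = plift A n (tensor_space (power_space A n) Q) (rho_list A Q \<rho>)"

definition comeasuring :: "('k::field, 'q::ab_group_add, 'z) alg_scheme
    \<Rightarrow> ('k, 'a::ab_group_add, 'o) omega_alg \<Rightarrow> ('a \<Rightarrow> ('a, 'q, 'k) tensor) \<Rightarrow> bool" where
  "comeasuring Q A \<rho> \<longleftrightarrow> algebra Q \<and> lin_map A (tensor_space A Q) \<rho> \<and>
     (\<forall>w\<in>Ops A. \<forall>X\<in>vcar (power_space A (osrc A w)).
        rho_n A Q \<rho> (otgt A w) (oper A w X)
          = tmap (power_space A (osrc A w)) Q (power_space A (otgt A w)) Q (oper A w) id
              (rho_n A Q \<rho> (osrc A w) X))"

definition cosupp_comeas :: "('k::field, 'q::ab_group_add, 'z) alg_scheme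
    \<Rightarrow> ('k, 'a::ab_group_add, 'o) omega_alg \<Rightarrow> ('a \<Rightarrow> ('a, 'q, 'k) tensor) \<Rightarrow> ('a \<Rightarrow> 'a) set" where
  "cosupp_comeas Q A \<rho> = {\<lambda>a. contract A Q f (\<rho> a) | f. lin_map Q ground f}"

definition bialg_coaction :: "('k::field, 'b::ab_group_add) bialg \<Rightarrow> ('k, 'a::ab_group_add, 'o) omega_alg
    \<Rightarrow> ('a \<Rightarrow> ('a, 'b, 'k) tensor) \<Rightarrow> bool" where
  "bialg_coaction B A \<rho> \<longleftrightarrow> bialgebra B \<and> comeasuring B A \<rho> \<and>
     (\<forall>a. tassoc A B B (tmap A B (tensor_space A B) B \<rho> id (\<rho> a))
            = tmap A B A (tensor_space B B) id (bdelta B) (\<rho> a)) \<and>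
     (\<forall>a. contract A B (beps B) (\<rho> a) = a)"

text \<open>
  The action \<open>h\<^sup>* \<otimes> a \<mapsto> h\<^sup>*(a\<^sub>1) a\<^sub>0\<close> of the finite dual attached to a coaction.
\<close>

definition dual_action :: "('k::field, 'b::ab_group_add) bialg \<Rightarrow> ('k, 'a::ab_group_add, 'o) omega_alg
    \<Rightarrow> ('a \<Rightarrow> ('a, 'b, 'k) tensor) \<Rightarrow> ('b \<Rightarrow> 'k) \<Rightarrow> 'a \<Rightarrow> 'a" where
  "dual_action H A \<rho> f a = contract A H f (\<rho> a)"

section \<open>Universal objects\<close>

text \<open>
  HOL cannot quantify over all types inside a formula. Universal properties are therefore stated against
  all test objects whose carrier is a subspace of a type \<open>'t\<close> (with an arbitrary scalar multiplication),
  which plays the role of a universe. An object that is universal in the absolute sense has these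
  properties for every \<open>'t\<close>.
\<close>

definition universal_acting_bialgebra :: "'t::ab_group_add itself
    \<Rightarrow> ('k::field, 'a::ab_group_add, 'o) omega_alg \<Rightarrow> ('a \<Rightarrow> 'a) set
    \<Rightarrow> ('k, 'u::ab_group_add) bialg \<Rightarrow> ('u \<Rightarrow> 'a \<Rightarrow> 'a) \<Rightarrow> bool" where
  "universal_acting_bialgebra (_ :: 't itself) A V B \<psi> \<longleftrightarrow>
     bialg_action B A \<psi> \<and> cosupp_meas (coalg_of B) \<psi> \<subseteq> V \<and>
     (\<forall>(P :: ('k, 't) coalg) \<psi>'. measuring P A \<psi>' \<and> cosupp_meas P \<psi>' \<subseteq> V \<longrightarrow>
        ex_unique_on (vcar P)
          (\<lambda>\<phi>. coalg_hom P (coalg_of B) \<phi> \<and> (\<forall>p\<in>vcar P. \<forall>a. \<psi> (\<phi> p) a = \<psi>' p a)))"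

definition universal_coacting_bialgebra :: "'t::ab_group_add itself
    \<Rightarrow> ('k::field, 'a::ab_group_add, 'o) omega_alg \<Rightarrow> ('a \<Rightarrow> 'a) set
    \<Rightarrow> ('k, 'u::ab_group_add) bialg \<Rightarrow> ('a \<Rightarrow> ('a, 'u, 'k) tensor) \<Rightarrow> bool" where
  "universal_coacting_bialgebra (_ :: 't itself) A V B \<rho> \<longleftrightarrow>
     bialg_coaction B A \<rho> \<and> cosupp_comeas B A \<rho> \<subseteq> V \<and>
     (\<forall>(Q :: ('k, 't) alg) \<rho>'. comeasuring Q A \<rho>' \<and> cosupp_comeas Q A \<rho>' \<subseteq> V \<longrightarrow>
        ex_unique_on (vcar B)
          (\<lambda>\<phi>. alg_hom B Q \<phi> \<and> (\<forall>a. tmap A B A Q id \<phi> (\<rho> a) = \<rho>' a)))"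

text \<open>
  The values of the right and of the left adjoint of the embedding of Hopf algebras into bialgebras at
  \<open>B\<close>, together with the counit \<open>H \<rightarrow> B\<close> and the unit \<open>B \<rightarrow> H\<close>, as universal arrows.
\<close>

definition hopf_right_adjoint :: "'t::ab_group_add itself \<Rightarrow> ('k::field, 'u::ab_group_add) bialg
    \<Rightarrow> ('k, 'v::ab_group_add) bialg \<Rightarrow> ('v \<Rightarrow> 'u) \<Rightarrow> bool" where
  "hopf_right_adjoint (_ :: 't itself) B H \<eta> \<longleftrightarrow>
     hopf_algebra H \<and> bialg_hom H B \<eta> \<and>
     (\<forall>(L :: ('k, 't) bialg) f. hopf_algebra L \<and> bialg_hom L B f \<longrightarrow>
        ex_unique_on (vcar L) (\<lambda>g. hopf_hom L H g \<and> (\<forall>x\<in>vcar L. \<eta> (g x) = f x)))"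

definition hopf_left_adjoint :: "'t::ab_group_add itself \<Rightarrow> ('k::field, 'u::ab_group_add) bialg
    \<Rightarrow> ('k, 'v::ab_group_add) bialg \<Rightarrow> ('u \<Rightarrow> 'v) \<Rightarrow> bool" where
  "hopf_left_adjoint (_ :: 't itself) B H \<eta> \<longleftrightarrow>
     hopf_algebra H \<and> bialg_hom B H \<eta> \<and>
     (\<forall>(L :: ('k, 't) bialg) f. hopf_algebra L \<and> bialg_hom B L f \<longrightarrow>
        ex_unique_on (vcar H) (\<lambda>g. hopf_hom H L g \<and> (\<forall>x\<in>vcar B. g (\<eta> x) = f x)))"

definition universal_acting_hopf :: "'t::ab_group_add itself
    \<Rightarrow> ('k::field, 'a::ab_group_add, 'o) omega_alg \<Rightarrow> ('a \<Rightarrow> 'a) set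
    \<Rightarrow> ('k, 'u::ab_group_add) bialg \<Rightarrow> ('u \<Rightarrow> 'a \<Rightarrow> 'a) \<Rightarrow> bool" where
  "universal_acting_hopf T A V H \<psi>H \<longleftrightarrow>
     (\<exists>(B :: ('k, 'u) bialg) \<psi> \<eta>.
        universal_acting_bialgebra T A V B \<psi> \<and> hopf_right_adjoint T B H \<eta> \<and>
        \<psi>H = (\<lambda>h. \<psi> (\<eta> h)))"

definition universal_coacting_hopf :: "'t::ab_group_add itself
    \<Rightarrow> ('k::field, 'a::ab_group_add, 'o) omega_alg \<Rightarrow> ('a \<Rightarrow> 'a) set
    \<Rightarrow> ('k, 'u::ab_group_add) bialg \<Rightarrow> ('a \<Rightarrow> ('a, 'u, 'k) tensor) \<Rightarrow> bool" where
  "universal_coacting_hopf T A V H \<rho>H \<longleftrightarrow>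
     (\<exists>(B :: ('k, 'u) bialg) \<rho> \<eta>.
        universal_coacting_bialgebra T A V B \<rho> \<and> hopf_left_adjoint T B H \<eta> \<and>
        \<rho>H = (\<lambda>a. tmap A B A H id \<eta> (\<rho> a)))"

text \<open>
  \<open>'t\<close> is large compared with \<open>'u\<close>: it contains a copy of the space of all functions
  \<open>'u list \<Rightarrow> 'k\<close>, hence of the full duals of the tensor powers of every vector space carried by \<open>'u\<close>.
\<close>

definition large_universe :: "'k::field itself \<Rightarrow> 'u::ab_group_add itself \<Rightarrow> 't::ab_group_add itself \<Rightarrow> bool" where
  "large_universe (_ :: 'k itself) (_ :: 'u itself) (_ :: 't itself) \<longleftrightarrow>
     (\<exists>(scale :: 'k \<Rightarrow> 't \<Rightarrow> 't) (j :: ('u list \<Rightarrow> 'k) \<Rightarrow> 't).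
        Vector_Spaces.linear fscale scale j \<and> inj j)"

lemma vector_space_fscale: "vector_space (fscale :: 'k::field \<Rightarrow> ('x \<Rightarrow> 'k) \<Rightarrow> ('x \<Rightarrow> 'k))"
  by unfold_locales (auto simp: fscale_def fun_eq_iff algebra_simps)

lemma large_universe_functions:
  "large_universe TYPE('k::field) TYPE('u::ab_group_add) TYPE('u list \<Rightarrow> 'k)"
  unfolding large_universe_def
  by (rule exI[of _ fscale], rule exI[of _ id]) (auto intro: vector_space.linear_id vector_space_fscale)

section \<open>Endomorphisms and the finite topology\<close>

definition End :: "('k::field, 'a::ab_group_add, 'z) vsp_scheme \<Rightarrow> ('a \<Rightarrow> 'a) set" where
  "End A = {f. Vector_Spaces.linear (vscale A) (vscale A) f}"

definition unital_subalgebra :: "('k::field, 'a::ab_group_add, 'z) vsp_scheme \<Rightarrow> ('a \<Rightarrow> 'a) set \<Rightarrow> bool" where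
  "unital_subalgebra A V \<longleftrightarrow> V \<subseteq> End A \<and> module.subspace (\<lambda>c f x. vscale A c (f x)) V \<and>
     id \<in> V \<and> (\<forall>f\<in>V. \<forall>g\<in>V. f \<circ> g \<in> V)"

definition pointwise_finite_dim :: "('k::field, 'a::ab_group_add, 'z) vsp_scheme \<Rightarrow> ('a \<Rightarrow> 'a) set \<Rightarrow> bool" where
  "pointwise_finite_dim A V \<longleftrightarrow>
     (\<forall>a. \<exists>S. finite S \<and> module.span (vscale A) S = (\<lambda>v. v a) ` V)"

definition finite_topology :: "('k::field, 'a::ab_group_add, 'z) vsp_scheme \<Rightarrow> ('a \<Rightarrow> 'a) topology" where
  "finite_topology A = topology (arbitrary union_of
     (\<lambda>U. \<exists>S :: ('a \<times> 'a) set. finite S \<and> U = {f \<in> End A. \<forall>(a, b)\<in>S. f a = b}))"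

section \<open>Algebras and coalgebras as Omega-algebras\<close>

datatype alg_sig = Mult_op | Unit_op

definition omega_of_alg :: "('k::field, 'a::ab_group_add) alg \<Rightarrow> ('k, 'a, alg_sig) omega_alg" where
  "omega_of_alg R =
     \<lparr>vcar = vcar R, vscale = vscale R, Ops = UNIV,
      osrc = (\<lambda>w. case w of Mult_op \<Rightarrow> 2 | Unit_op \<Rightarrow> 0), otgt = (\<lambda>w. 1),
      oper = (\<lambda>w. case w of
          Mult_op \<Rightarrow> plift R 2 (power_space R 1) (\<lambda>xs. ptens R [amult R (xs ! 0) (xs ! 1)])
        | Unit_op \<Rightarrow> plift R 0 (power_space R 1) (\<lambda>xs. ptens R [aone R]))\<rparr>"

datatype coalg_sig = Comult_op | Counit_op

definition omega_of_coalg :: "('k::field, 'c::ab_group_add) coalg \<Rightarrow> ('k, 'c, coalg_sig) omega_alg" where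
  "omega_of_coalg C =
     \<lparr>vcar = vcar C, vscale = vscale C, Ops = UNIV,
      osrc = (\<lambda>w. 1), otgt = (\<lambda>w. case w of Comult_op \<Rightarrow> 2 | Counit_op \<Rightarrow> 0),
      oper = (\<lambda>w. case w of
          Comult_op \<Rightarrow> plift C 1 (power_space C 2)
            (\<lambda>xs. tlift C C (power_space C 2) (\<lambda>x y. ptens C [x, y]) (cdelta C (xs ! 0)))
        | Counit_op \<Rightarrow> plift C 1 (power_space C 0) (\<lambda>xs. fscale (ceps C (xs ! 0)) (ptens C [])))\<rparr>"

definition finite_dim_type :: "('k::field, 'a::ab_group_add, 'z) vsp_scheme \<Rightarrow> bool" where
  "finite_dim_type A \<longleftrightarrow> vcar A = UNIV \<and> (\<exists>S. finite S \<and> module.span (vscale A) S = UNIV)"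

end

theory Submission
  imports Defs
begin

text \<open>
  A coaction of \<open>H\<close> on \<open>A\<close> induces an action of \<open>H\<degree>\<close>. Conversely, an action of \<open>K\<close> whose orbits span
  finite dimensional spaces comes from a coaction of \<open>K\<degree>\<close>: in coordinates of \<open>V a\<close> the functionals
  \<open>k \<mapsto> k a\<close> lie in \<open>K\<degree>\<close>. Its cosupport consists of maps that agree on every finite set with the action
  of some \<open>k\<close>, so it lies in \<open>V\<close> because \<open>V\<close> is closed. The two universal properties now yield
  \<open>\<theta> : H\<degree> \<rightarrow> K\<close> and \<open>\<gamma> : H \<rightarrow> K\<degree>\<close>, and the transpose \<open>\<beta> : K \<rightarrow> H\<degree>\<close> of \<open>\<gamma>\<close> is the inverse of \<open>\<theta>\<close>.
  That \<open>\<theta> \<beta> = id\<close> is uniqueness for \<open>K\<close>. For \<open>\<beta> \<theta> = id\<close> one writes \<open>f \<in> H\<degree>\<close> as a combination of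
  coefficients \<open>M\<close> of a finite dimensional representation. Then \<open>M\<close> and \<open>\<beta> \<theta> M\<close> are algebra maps from \<open>H\<close> to
  a matrix algebra which agree on the image of the universal coacting bialgebra, by its uniqueness, and
  this image generates \<open>H\<close> as a Hopf algebra.
\<close>

text \<open>Two obstacles shape the argument. The universal properties range only over test objects
  carried by the type \<open>'t\<close>, whereas others are needed: finite duals, their tensor
  squares, the ground field, matrix algebras, a Hopf subalgebra of \<open>H\<close>. All of them
  embed linearly into the functions \<open>'u list \<Rightarrow> 'k\<close>, which
  \<open>large_universe\<close> places in \<open>'t\<close>, so each can be transported there and
  back.

  The two halves are not symmetric either. Uniqueness for \<open>K\<close> concerns maps into
  \<open>K\<close>. But \<beta>\<theta> is a map into the finite dual of \<open>H\<close>, while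
  \<open>H\<close> is universal for maps out of it, and distinct elements of the finite dual may act
  equally on \<open>A\<close>. Matrix coefficients turn such elements into maps out of
  \<open>H\<close>.

  Finally, universality first yields only a coalgebra map or an algebra map. That it respects the
  remaining structure is uniqueness once more, with a tensor square or the ground field as test
  object. Equalities of tensors are reduced to scalars by evaluating on bilinear forms.\<close>

interpretation fsc: vector_space "fscale :: 'k::field \<Rightarrow> ('x \<Rightarrow> 'k) \<Rightarrow> ('x \<Rightarrow> 'k)"
  by (rule vector_space_fscale)

lemma fscale_apply [simp]: "fscale c f x = c * f x"
  by (simp add: fscale_def)

lemma fun_sum_apply [simp]: "(\<Sum>i\<in>I. f i) x = (\<Sum>i\<in>I. f i x)"
  by (induction I rule: infinite_finite_induct) auto

lemma ground_simps [simp]: "vcar ground = UNIV" "vscale ground = (*)" "amult ground = (*)"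
  "aone ground = 1"
  by (auto simp: ground_def)

abbreviation lf :: "('k::field, 'u::ab_group_add, 'y) vsp_scheme \<Rightarrow> ('u \<Rightarrow> 'k) \<Rightarrow> bool" where
  "lf V \<equiv> lin_map V (ground :: ('k, 'k) alg)"

abbreviation bf :: "('k::field, 'u::ab_group_add, 'y) vsp_scheme
    \<Rightarrow> ('k, 'v::ab_group_add, 'z) vsp_scheme \<Rightarrow> ('u \<Rightarrow> 'v \<Rightarrow> 'k) \<Rightarrow> bool" where
  "bf V W \<equiv> bilin_map V W (ground :: ('k, 'k) alg)"

section \<open>Subspaces, linear and bilinear maps on carriers\<close>

lemma vspace_vector_space: "vspace V \<Longrightarrow> vector_space (vscale V)"
  by (simp add: vspace_def)

lemma vspaceI:
  "vector_space (vscale V) \<Longrightarrow> 0 \<in> vcar V \<Longrightarrow>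
    (\<And>x y. x \<in> vcar V \<Longrightarrow> y \<in> vcar V \<Longrightarrow> x + y \<in> vcar V) \<Longrightarrow>
    (\<And>c x. x \<in> vcar V \<Longrightarrow> vscale V c x \<in> vcar V) \<Longrightarrow> vspace V"
  by (simp add: vspace_def module.subspace_def module_iff_vector_space)

lemma
  assumes "vspace V"
  shows vs_zero: "0 \<in> vcar V"
    and vs_add: "x \<in> vcar V \<Longrightarrow> y \<in> vcar V \<Longrightarrow> x + y \<in> vcar V"
    and vs_scale: "x \<in> vcar V \<Longrightarrow> vscale V c x \<in> vcar V"
    and vs_diff: "x \<in> vcar V \<Longrightarrow> y \<in> vcar V \<Longrightarrow> x - y \<in> vcar V"
    and vs_scale_one: "vscale V 1 x = x"
    and vs_scale_zero: "vscale V 0 x = 0"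
    and vs_scale_add: "vscale V c (x + y) = vscale V c x + vscale V c y"
    and vs_add_scale: "vscale V (c + d) x = vscale V c x + vscale V d x"
    and vs_scale_scale: "vscale V c (vscale V d x) = vscale V (c * d) x"
proof -
  interpret vector_space "vscale V" using assms by (rule vspace_vector_space)
  have S: "subspace (vcar V)" using assms by (simp add: vspace_def)
  show "0 \<in> vcar V" "x \<in> vcar V \<Longrightarrow> y \<in> vcar V \<Longrightarrow> x + y \<in> vcar V"
    "x \<in> vcar V \<Longrightarrow> vscale V c x \<in> vcar V" "x \<in> vcar V \<Longrightarrow> y \<in> vcar V \<Longrightarrow> x - y \<in> vcar V"
    using S subspace_0 subspace_add subspace_scale subspace_diff by blast+
  show "vscale V 1 x = x" "vscale V 0 x = 0" "vscale V c (x + y) = vscale V c x + vscale V c y"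
    "vscale V (c + d) x = vscale V c x + vscale V d x"
    "vscale V c (vscale V d x) = vscale V (c * d) x"
    by (auto simp: scale_right_distrib scale_left_distrib)
qed

lemma vs_sum: "vspace V \<Longrightarrow> (\<And>i. i \<in> I \<Longrightarrow> f i \<in> vcar V) \<Longrightarrow> sum f I \<in> vcar V"
  by (induction I rule: infinite_finite_induct) (auto simp: vs_zero vs_add)

lemma vspace_ground [simp]: "vspace (ground :: ('k::field, 'k) alg)"
  by (rule vspaceI) (unfold_locales, auto simp: algebra_simps)

lemma lin_mapI:
  "(\<And>x. x \<in> vcar V \<Longrightarrow> f x \<in> vcar W) \<Longrightarrow>
   (\<And>x y. x \<in> vcar V \<Longrightarrow> y \<in> vcar V \<Longrightarrow> f (x + y) = f x + f y) \<Longrightarrow>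
   (\<And>c x. x \<in> vcar V \<Longrightarrow> f (vscale V c x) = vscale W c (f x)) \<Longrightarrow> lin_map V W f"
  by (simp add: lin_map_def)

lemma
  assumes "lin_map V W f"
  shows lin_mem: "x \<in> vcar V \<Longrightarrow> f x \<in> vcar W"
    and lin_add: "x \<in> vcar V \<Longrightarrow> y \<in> vcar V \<Longrightarrow> f (x + y) = f x + f y"
    and lin_scale: "x \<in> vcar V \<Longrightarrow> f (vscale V c x) = vscale W c (f x)"
  using assms by (auto simp: lin_map_def)

lemma lin_zero: "lin_map V W f \<Longrightarrow> vspace V \<Longrightarrow> f 0 = 0"
  using lin_add[of V W f 0 0] by (simp add: vs_zero)

lemma lin_diff:
  assumes "lin_map V W f" "vspace V" "x \<in> vcar V" "y \<in> vcar V"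
  shows "f (x - y) = f x - f y"
  using lin_add[OF assms(1), of "x - y" y] assms by (simp add: vs_diff)

lemma lin_sum:
  assumes "lin_map V W f" "vspace V" "\<And>i. i \<in> I \<Longrightarrow> g i \<in> vcar V"
  shows "f (sum g I) = (\<Sum>i\<in>I. f (g i))"
  using assms(3)
  by (induction I rule: infinite_finite_induct)
    (auto simp: lin_zero[OF assms(1,2)] lin_add[OF assms(1)] vs_sum[OF assms(2)])

lemma lin_cong:
  assumes "lin_map V W f" "vspace V" "\<And>x. x \<in> vcar V \<Longrightarrow> f x = g x"
  shows "lin_map V W g"
  using assms by (auto simp: lin_map_def vs_add vs_scale)

lemma lin_comp: "lin_map V W f \<Longrightarrow> lin_map U V g \<Longrightarrow> lin_map U W (\<lambda>x. f (g x))"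
  by (auto simp: lin_map_def)

lemma lin_id [intro]: "lin_map V V (\<lambda>x. x)"
  by (simp add: lin_map_def)

lemma lin_id' [intro, simp]: "lin_map V V id"
  by (simp add: lin_map_def)

lemma lf_mult_left: "lf V f \<Longrightarrow> lf V (\<lambda>x. c * f x)"
  by (auto simp: lin_map_def algebra_simps)

lemma lf_mult_right: "lf V f \<Longrightarrow> lf V (\<lambda>x. f x * c)"
  by (auto simp: lin_map_def algebra_simps)

lemma lf_sum: "(\<And>i. i \<in> I \<Longrightarrow> lf V (f i)) \<Longrightarrow> lf V (\<lambda>x. \<Sum>i\<in>I. f i x)"
  by (auto simp: lin_map_def sum.distrib sum_distrib_left intro!: sum.cong)

lemma lf_const0: "lf V (\<lambda>x. 0)"
  by (simp add: lin_map_def)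

lemma linear_lf:
  assumes "Vector_Spaces.linear (vscale V) (*) f"
  shows "lf V f"
proof -
  interpret Vector_Spaces.linear "vscale V" "(*)" f by fact
  show ?thesis by (auto intro!: lin_mapI simp: add scale)
qed

lemma bilin_mapI:
  "(\<And>w. w \<in> vcar W \<Longrightarrow> lin_map V Z (\<lambda>v. b v w)) \<Longrightarrow>
   (\<And>v. v \<in> vcar V \<Longrightarrow> lin_map W Z (\<lambda>w. b v w)) \<Longrightarrow> bilin_map V W Z b"
  by (simp add: bilin_map_def)

lemma
  assumes "bilin_map V W Z b"
  shows bilin_left: "w \<in> vcar W \<Longrightarrow> lin_map V Z (\<lambda>v. b v w)"
    and bilin_right: "v \<in> vcar V \<Longrightarrow> lin_map W Z (b v)"
    and bilin_mem: "v \<in> vcar V \<Longrightarrow> w \<in> vcar W \<Longrightarrow> b v w \<in> vcar Z"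
    and bilin_add_left: "v \<in> vcar V \<Longrightarrow> v' \<in> vcar V \<Longrightarrow> w \<in> vcar W \<Longrightarrow> b (v + v') w = b v w + b v' w"
    and bilin_add_right: "v \<in> vcar V \<Longrightarrow> w \<in> vcar W \<Longrightarrow> w' \<in> vcar W \<Longrightarrow> b v (w + w') = b v w + b v w'"
    and bilin_scale_left: "v \<in> vcar V \<Longrightarrow> w \<in> vcar W \<Longrightarrow> b (vscale V c v) w = vscale Z c (b v w)"
    and bilin_scale_right: "v \<in> vcar V \<Longrightarrow> w \<in> vcar W \<Longrightarrow> b v (vscale W c w) = vscale Z c (b v w)"
  using assms by (auto simp: bilin_map_def lin_map_def)

lemma bilin_cong:
  assumes "bilin_map V W Z b" "vspace V" "vspace W"
    "\<And>v w. v \<in> vcar V \<Longrightarrow> w \<in> vcar W \<Longrightarrow> b v w = b' v w"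
  shows "bilin_map V W Z b'"
  using assms by (auto simp: bilin_map_def intro: lin_cong)

lemma lin_bilin_left: "bilin_map V W Z b \<Longrightarrow> lin_map U V g \<Longrightarrow> w \<in> vcar W \<Longrightarrow> lin_map U Z (\<lambda>x. b (g x) w)"
  by (drule (1) bilin_left, drule (1) lin_comp)

lemma lin_bilin_right: "bilin_map V W Z b \<Longrightarrow> lin_map U W g \<Longrightarrow> v \<in> vcar V \<Longrightarrow> lin_map U Z (\<lambda>x. b v (g x))"
  by (drule (1) bilin_right, drule (1) lin_comp)

section \<open>Functionals and retractions\<close>

text \<open>A basis of \<open>W\<close> stays independent when \<open>x\<close> is added, so the
  value 1 at \<open>x\<close> and 0 on that basis can be prescribed.\<close>

lemma functional_avoiding:
  assumes "vector_space s" "module.subspace s W" "x \<notin> W"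
  obtains f where "Vector_Spaces.linear s (*) f" "f x = (1 :: 'k::field)" "\<And>w. w \<in> W \<Longrightarrow> f w = 0"
proof -
  interpret vector_space s by fact
  interpret p: vector_space_pair s "(*) :: 'k \<Rightarrow> 'k \<Rightarrow> 'k"
    by (intro vector_space_pair.intro assms(1) vspace_vector_space[OF vspace_ground, simplified])
  obtain B where B: "B \<subseteq> W" "independent B" "W \<subseteq> span B"
    by (rule maximal_independent_subset)
  have WB: "W = span B"
    using B assms(2) span_minimal by blast
  have "independent (insert x B)"
    using B(2) assms(3) WB by (intro independent_insertI) auto
  from p.linear_independent_extend[OF this, of "\<lambda>y. if y = x then 1 else 0"]
  obtain f where f: "Vector_Spaces.linear s (*) f" "\<forall>y\<in>insert x B. f y = (if y = x then 1 else 0)"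
    by blast
  interpret f: Vector_Spaces.linear s "(*)" f by (rule f)
  have "f w = 0" if "w \<in> W" for w
  proof -
    have "w \<in> span B" using that WB by simp
    then show ?thesis
      by (rule f.eq_0_on_span[rotated]) (use f(2) B(1) assms(3) in auto)
  qed
  then show thesis using f by (intro that[of f]) auto
qed

text \<open>A functional with value 1 on the difference tells the vectors apart. Identities between
  vectors can therefore be checked on scalars, which is the method of the whole development.\<close>

lemma functional_sep:
  assumes "vspace V" "x \<in> vcar V" "y \<in> vcar V" "\<And>f. lf V f \<Longrightarrow> f x = f y"
  shows "x = y"
proof (rule ccontr)
  assume "x \<noteq> y"
  interpret vector_space "vscale V" using assms(1) by (rule vspace_vector_space)
  obtain f where f: "Vector_Spaces.linear (vscale V) (*) f" "f (x - y) = 1"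
    by (rule functional_avoiding[of "vscale V" "{0}" "x - y"]) (use \<open>x \<noteq> y\<close> vector_space_axioms in auto)
  from linear_lf[OF f(1)] have "lf V f" .
  then show False using assms(4)[of f] f(2) lin_diff[of V ground f x y] assms(1-3) by simp
qed

text \<open>Over a field every injection splits. The retraction is needed because tensors are
  functions on forms: it extends a form on \<open>V\<close> to one on \<open>W\<close>.\<close>

lemma lin_left_inverse:
  assumes "vspace V" "vspace W" "lin_map V W j" "inj_on j (vcar V)"
  obtains r where "lin_map W V r" "\<And>x. x \<in> vcar V \<Longrightarrow> r (j x) = x"
proof -
  interpret v: vector_space "vscale V" using assms(1) by (rule vspace_vector_space)
  interpret w: vector_space "vscale W" using assms(2) by (rule vspace_vector_space)
  interpret p: vector_space_pair "vscale V" "vscale W" ..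
  have S: "v.subspace (vcar V)" using assms(1) by (simp add: vspace_def)
  obtain B where B: "B \<subseteq> vcar V" "v.independent B" "vcar V \<subseteq> v.span B"
    by (rule v.maximal_independent_subset)
  have VB: "vcar V = v.span B"
    using B S v.span_minimal by blast
  \<comment> \<open>\<open>j\<close> is linear only on the carrier. It is replaced by a map
    \<open>g\<close> that is linear on the whole type and agrees with \<open>j\<close> on a basis of
    the carrier, hence on the carrier.\<close>
  obtain g where g: "Vector_Spaces.linear (vscale V) (vscale W) g" "\<forall>x\<in>B. g x = j x"
    using p.linear_independent_extend[OF B(2)] by blast
  interpret g: Vector_Spaces.linear "vscale V" "vscale W" g by (rule g)
  have gj: "x \<in> vcar V \<and> g x = j x" if "x \<in> v.span B" for x
    using that
  proof (induction rule: v.span_induct_alt)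
    case base
    then show ?case using lin_zero[OF assms(3,1)] by (simp add: vs_zero[OF assms(1)] g.zero)
  next
    case (step c x y)
    then show ?case using B(1) g(2)
      by (auto simp: g.add g.scale lin_add[OF assms(3)] lin_scale[OF assms(3)] vs_add vs_scale assms(1) subset_iff)
  qed
  have "inj_on g (vcar V)" using assms(4) gj VB by (auto simp: inj_on_def)
  from p.linear_exists_left_inverse_on[OF g(1) S this]
  obtain r where r: "range r \<subseteq> vcar V" "Vector_Spaces.linear (vscale W) (vscale V) r"
    "\<forall>v\<in>vcar V. r (g v) = v" by auto
  interpret r: Vector_Spaces.linear "vscale W" "vscale V" r by (rule r)
  show thesis
    by (rule that[of r]) (use r gj VB in \<open>auto intro!: lin_mapI simp: r.add r.scale\<close>)
qed

text \<open>\<open>I\<close> is a basis chosen inside \<open>S\<close>. Its coordinate functions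
  come from an extension to a basis of the whole space, so they are linear everywhere although they
  reproduce only the vectors of the span.\<close>

lemma finite_span_coordinates:
  assumes "vector_space s" "finite S"
  obtains I c where "finite I" "I \<subseteq> S" "\<And>i. Vector_Spaces.linear s (*) (c i :: _ \<Rightarrow> 'k::field)"
    "\<And>x. x \<in> module.span s S \<Longrightarrow> x = (\<Sum>i\<in>I. s (c i x) i)"
proof -
  interpret vector_space s by fact
  obtain I where I: "I \<subseteq> S" "independent I" "S \<subseteq> span I"
    by (rule maximal_independent_subset)
  define c where "c i x = representation (extend_basis I) x i" for i x
  have "Vector_Spaces.linear s (*) (c i)" for i
    unfolding c_def using independent_extend_basis[OF I(2)] span_extend_basis[OF I(2)]
    by (rule linear_representation)
  moreover have "x = (\<Sum>i\<in>I. s (c i x) i)" if "x \<in> span S" for x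
  proof -
    have x: "x \<in> span I" using that I(3) by (metis span_mono span_span subsetD)
    have "representation (extend_basis I) x = representation I x"
      using representation_extend[OF independent_extend_basis[OF I(2)] x extend_basis_superset[OF I(2)]] .
    then show ?thesis
      unfolding c_def using sum_representation_eq[OF I(2) x finite_subset[OF I(1) assms(2)] order_refl]
      by simp
  qed
  ultimately show thesis using I assms(2) that by (meson finite_subset)
qed

section \<open>Tensor products as functions on bilinear forms\<close>

lemma tens_apply: "bf V W \<beta> \<Longrightarrow> tens V W v w \<beta> = \<beta> v w"
  by (simp add: tens_def)

lemma tens_apply_not: "\<not> bf V W \<beta> \<Longrightarrow> tens V W v w \<beta> = 0"
  by (simp add: tens_def)

lemma tensor_space_simps [simp]: "vscale (tensor_space V W) = fscale"
  by (simp add: tensor_space_def)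

lemma vspace_tensor [simp]: "vspace (tensor_space V W)"
  unfolding vspace_def tensor_space_def
  by (auto simp: vector_space_fscale)

lemma tens_mem: "v \<in> vcar V \<Longrightarrow> w \<in> vcar W \<Longrightarrow> tens V W v w \<in> vcar (tensor_space V W)"
  by (auto simp: tensor_space_def intro: fsc.span_base)

lemma tens_left: "w \<in> vcar W \<Longrightarrow> lin_map V (tensor_space V W) (\<lambda>v. tens V W v w)"
  by (rule lin_mapI, simp add: tens_mem)
    (auto simp: tens_def fun_eq_iff dest: bilin_add_left bilin_scale_left)

lemma tens_right: "v \<in> vcar V \<Longrightarrow> lin_map W (tensor_space V W) (\<lambda>w. tens V W v w)"
  by (rule lin_mapI, simp add: tens_mem)
    (auto simp: tens_def fun_eq_iff dest: bilin_add_right bilin_scale_right)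

lemma tens_bilin: "bilin_map V W (tensor_space V W) (tens V W)"
  by (intro bilin_mapI tens_left tens_right)

text \<open>Scalars are absorbed into the left factor, so no coefficients appear. The factors are
  total functions of the index, which keeps membership facts free of index bounds.\<close>

lemma tensor_sum_rep:
  assumes "X \<in> vcar (tensor_space V W)" "vspace V" "vspace W"
  obtains n :: nat and l r where "\<And>i. l i \<in> vcar V" "\<And>i. r i \<in> vcar W"
    "X = (\<Sum>i<n. tens V W (l i) (r i))"
proof -
  have "\<exists>(n::nat) l r. (\<forall>i. l i \<in> vcar V) \<and> (\<forall>i. r i \<in> vcar W) \<and> X = (\<Sum>i<n. tens V W (l i) (r i))"
    using assms(1)[unfolded tensor_space_def, simplified]
  proof (induction rule: fsc.span_induct_alt)
    case base
    then show ?case using assms(2,3) by (intro exI[of _ 0] exI[of _ "\<lambda>_. 0"]) (auto simp: vs_zero)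
  next
    case (step c t Y)
    then obtain v w n l r where *: "t = tens V W v w" "v \<in> vcar V" "w \<in> vcar W"
      "\<forall>i. l i \<in> vcar V" "\<forall>i. r i \<in> vcar W" "Y = (\<Sum>i<n::nat. tens V W (l i) (r i))" by blast
    then have "fscale c t + Y = (\<Sum>i<Suc n. tens V W ((l(n := vscale V c v)) i) ((r(n := w)) i))"
      using lin_scale[OF tens_left[OF *(3)], of v V c] by (simp add: add.commute)
    then show ?case using * assms(2,3)
      by (intro exI[of _ "Suc n"] exI[of _ "l(n := vscale V c v)"] exI[of _ "r(n := w)"])
        (auto simp: vs_scale)
  qed
  then show thesis using that by blast
qed

lemma tensor_apply_rep:
  assumes "X \<in> vcar (tensor_space V W)" "vspace V" "vspace W"
  obtains n :: nat and l r where "\<And>i. l i \<in> vcar V" "\<And>i. r i \<in> vcar W"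
    "\<And>\<beta>. bf V W \<beta> \<Longrightarrow> X \<beta> = (\<Sum>i<n. \<beta> (l i) (r i))"
    "\<And>\<beta>. \<not> bf V W \<beta> \<Longrightarrow> X \<beta> = 0"
    "X = (\<Sum>i<n. tens V W (l i) (r i))"
proof -
  obtain n :: nat and l r where "\<And>i. l i \<in> vcar V" "\<And>i. r i \<in> vcar W"
    "X = (\<Sum>i<n. tens V W (l i) (r i))" using tensor_sum_rep[OF assms] by blast
  then show thesis
    by (intro that[of l r n]) (auto simp: tens_apply tens_apply_not)
qed

text \<open>Off the bilinear forms every tensor takes the value 0, so comparing on forms is
  enough.\<close>

lemma tensor_ext:
  assumes "X \<in> vcar (tensor_space V W)" "Y \<in> vcar (tensor_space V W)" "vspace V" "vspace W"
    "\<And>\<beta>. bf V W \<beta> \<Longrightarrow> X \<beta> = Y \<beta>"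
  shows "X = Y"
proof
  fix \<beta>
  show "X \<beta> = Y \<beta>"
    using tensor_apply_rep[OF assms(1,3,4)] tensor_apply_rep[OF assms(2,3,4)] assms(5) by metis
qed

text \<open>Forms that agree on the carriers are both bilinear or both not, and in the second case
  both values are 0. This permits rewriting under a tensor without a proof of bilinearity.\<close>

lemma tensor_apply_cong:
  assumes "X \<in> vcar (tensor_space V W)" "vspace V" "vspace W"
    "\<And>v w. v \<in> vcar V \<Longrightarrow> w \<in> vcar W \<Longrightarrow> \<beta> v w = \<beta>' v w"
  shows "X \<beta> = X \<beta>'"
proof -
  have "bf V W \<beta> = bf V W \<beta>'"
    using bilin_cong[of V W ground \<beta> \<beta>'] bilin_cong[of V W ground \<beta>' \<beta>] assms(2-4) by auto
  then show ?thesis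
    using tensor_apply_rep[OF assms(1-3)] assms(4) by (metis (mono_tags, lifting) sum.cong)
qed

lemma lf_apply: "lf (tensor_space V W) (\<lambda>X. X \<beta>)"
  by (rule lin_mapI) auto

lemma lin_tensor_eqI:
  assumes "lin_map (tensor_space V W) Z f" "lin_map (tensor_space V W) Z g" "vspace V" "vspace W"
    "\<And>v w. v \<in> vcar V \<Longrightarrow> w \<in> vcar W \<Longrightarrow> f (tens V W v w) = g (tens V W v w)"
    "X \<in> vcar (tensor_space V W)"
  shows "f X = g X"
proof -
  obtain n :: nat and l r where *: "\<And>i. l i \<in> vcar V" "\<And>i. r i \<in> vcar W"
    "X = (\<Sum>i<n. tens V W (l i) (r i))" using tensor_sum_rep[OF assms(6,3,4)] by blast
  show ?thesis unfolding *(3)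
    by (simp add: lin_sum[OF assms(1) vspace_tensor tens_mem[OF *(1,2)]]
        lin_sum[OF assms(2) vspace_tensor tens_mem[OF *(1,2)]] assms(5)[OF *(1,2)])
qed

lemma lf_tensor_apply: "lin_map U (tensor_space V W) D \<Longrightarrow> lf U (\<lambda>u. D u \<beta>)"
  by (drule lin_comp[OF lf_apply])

lemma lf_tensor_param:
  assumes "X \<in> vcar (tensor_space V W)" "vspace V" "vspace W" "vspace U"
    "\<And>u. u \<in> vcar U \<Longrightarrow> bf V W (T u)"
    "\<And>v w. v \<in> vcar V \<Longrightarrow> w \<in> vcar W \<Longrightarrow> lf U (\<lambda>u. T u v w)"
  shows "lf U (\<lambda>u. X (T u))"
proof -
  obtain n :: nat and l r where *: "\<And>i. l i \<in> vcar V" "\<And>i. r i \<in> vcar W"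
    "\<And>\<beta>. bf V W \<beta> \<Longrightarrow> X \<beta> = (\<Sum>i<n. \<beta> (l i) (r i))"
    using tensor_apply_rep[OF assms(1-3)] by metis
  have "lf U (\<lambda>u. \<Sum>i<n. T u (l i) (r i))"
    by (rule lf_sum) (rule assms(6)[OF *(1,2)])
  then show ?thesis
    by (rule lin_cong[OF _ assms(4)]) (simp add: *(3) assms(5))
qed

text \<open>Both tensors are finite sums of evaluations, so this interchanges two finite sums. It
  takes the place of reordering Sweedler indices.\<close>

lemma tensor_fubini:
  assumes X: "X \<in> vcar (tensor_space V W)" "vspace V" "vspace W"
    and Y: "Y \<in> vcar (tensor_space V' W')" "vspace V'" "vspace W'"
    and T: "\<And>v w. v \<in> vcar V \<Longrightarrow> w \<in> vcar W \<Longrightarrow> bf V' W' (T v w)"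
      "\<And>v' w'. v' \<in> vcar V' \<Longrightarrow> w' \<in> vcar W' \<Longrightarrow> bf V W (\<lambda>v w. T v w v' w')"
  shows "X (\<lambda>v w. Y (\<lambda>v' w'. T v w v' w')) = Y (\<lambda>v' w'. X (\<lambda>v w. T v w v' w'))"
proof -
  obtain n :: nat and l r where x: "\<And>i. l i \<in> vcar V" "\<And>i. r i \<in> vcar W"
    "\<And>\<beta>. bf V W \<beta> \<Longrightarrow> X \<beta> = (\<Sum>i<n. \<beta> (l i) (r i))"
    using tensor_apply_rep[OF X] by metis
  obtain m :: nat and l' r' where y: "\<And>i. l' i \<in> vcar V'" "\<And>i. r' i \<in> vcar W'"
    "\<And>\<beta>. bf V' W' \<beta> \<Longrightarrow> Y \<beta> = (\<Sum>i<m. \<beta> (l' i) (r' i))"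
    using tensor_apply_rep[OF Y] by metis
  have bX: "bf V W (\<lambda>v w. Y (T v w))"
  proof (rule bilin_mapI)
    show "lf V (\<lambda>v. Y (T v w))" if "w \<in> vcar W" for w
      by (rule lf_tensor_param[OF Y X(2) T(1)[OF _ that]]) (assumption, rule bilin_left[OF T(2)], assumption+, rule that)
    show "lf W (\<lambda>w. Y (T v w))" if "v \<in> vcar V" for v
      by (rule lf_tensor_param[OF Y X(3) T(1)[OF that]]) (assumption, rule bilin_right[OF T(2)], assumption+, rule that)
  qed
  have bY: "bf V' W' (\<lambda>v' w'. X (\<lambda>v w. T v w v' w'))"
  proof (rule bilin_mapI)
    show "lf V' (\<lambda>v'. X (\<lambda>v w. T v w v' w'))" if "w' \<in> vcar W'" for w'
      by (rule lf_tensor_param[OF X Y(2) T(2)[OF _ that]]) (assumption, rule bilin_left[OF T(1)], assumption+, rule that)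
    show "lf W' (\<lambda>w'. X (\<lambda>v w. T v w v' w'))" if "v' \<in> vcar V'" for v'
      by (rule lf_tensor_param[OF X Y(3) T(2)[OF that]]) (assumption, rule bilin_right[OF T(1)], assumption+, rule that)
  qed
  have "X (\<lambda>v w. Y (T v w)) = (\<Sum>i<n. \<Sum>j<m. T (l i) (r i) (l' j) (r' j))"
    by (simp only: x(3)[OF bX] y(3)[OF T(1)[OF x(1,2)]])
  also have "\<dots> = (\<Sum>j<m. \<Sum>i<n. T (l i) (r i) (l' j) (r' j))"
    by (rule sum.swap)
  also have "\<dots> = Y (\<lambda>v' w'. X (\<lambda>v w. T v w v' w'))"
    by (simp only: y(3)[OF bY] x(3)[OF T(2)[OF y(1,2)]])
  finally show ?thesis .
qed

lemma lin_tensorI: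
  assumes "vspace U" "vspace V" "vspace W" "\<And>u. u \<in> vcar U \<Longrightarrow> D u \<in> vcar (tensor_space V W)"
    "\<And>\<beta>. bf V W \<beta> \<Longrightarrow> lf U (\<lambda>u. D u \<beta>)"
  shows "lin_map U (tensor_space V W) D"
proof (rule lin_mapI)
  fix x y c assume x: "x \<in> vcar U"
  show "D x \<in> vcar (tensor_space V W)" using assms(4) x .
  show "D (x + y) = D x + D y" if y: "y \<in> vcar U"
    by (rule tensor_ext[OF _ _ assms(2,3)])
      (use x y assms(1) in \<open>auto intro!: assms(4) vs_add vs_add[OF vspace_tensor] simp: lin_add[OF assms(5)]\<close>)
  show "D (vscale U c x) = vscale (tensor_space V W) c (D x)"
    by (rule tensor_ext[OF _ _ assms(2,3)])
      (use x assms(1) vs_scale[OF vspace_tensor, of "D x" V W] in \<open>auto intro!: assms(4) vs_scale simp: lin_scale[OF assms(5)]\<close>)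
qed

text \<open>The value at \<open>X\<close> is the vector \<open>z\<close> such that
  \<open>f z\<close> is \<open>X\<close> applied to the composed form, for all functionals
  \<open>f\<close>. Separation makes \<open>z\<close> unique, so independence of the chosen
  decomposition of \<open>X\<close> is automatic.\<close>

lemma
  assumes V: "vspace V" and W: "vspace W" and Z: "vspace Z" and b: "bilin_map V W Z b"
  shows tlift_lin: "lin_map (tensor_space V W) Z (tlift V W Z b)"
    and tlift_tens: "v \<in> vcar V \<Longrightarrow> w \<in> vcar W \<Longrightarrow> tlift V W Z b (tens V W v w) = b v w"
proof -
  define Q where "Q X z \<longleftrightarrow> z \<in> vcar Z \<and> (\<forall>f. lf Z f \<longrightarrow> f z = X (\<lambda>v w. f (b v w)))" for X z
  define L where "L X = (THE z. Q X z)" for X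
  have fb: "bf V W (\<lambda>v w. f (b v w))" if "lf Z f" for f
    using b that by (auto intro!: bilin_mapI lin_comp[OF that] bilin_left[OF b] bilin_right[OF b])
  have uni: "z = z'" if "Q X z" "Q X z'" for X z z'
    using that by (intro functional_sep[OF Z]) (auto simp: Q_def)
  have ex: "\<exists>z. Q X z" if X: "X \<in> vcar (tensor_space V W)" for X
  proof -
    obtain n :: nat and l r where *: "\<And>i. l i \<in> vcar V" "\<And>i. r i \<in> vcar W"
      "\<And>\<beta>. bf V W \<beta> \<Longrightarrow> X \<beta> = (\<Sum>i<n. \<beta> (l i) (r i))"
      using tensor_apply_rep[OF X V W] by metis
    have "Q X (\<Sum>i<n. b (l i) (r i))"
      unfolding Q_def using * fb
      by (auto intro!: vs_sum[OF Z] bilin_mem[OF b] lin_sum[OF _ Z])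
    then show ?thesis ..
  qed
  have L: "Q X (L X)" if "X \<in> vcar (tensor_space V W)" for X
    unfolding L_def using ex[OF that] uni by (blast intro: theI)
  have 1: "lin_map (tensor_space V W) Z L"
  proof (rule lin_mapI)
    fix X Y c assume X: "X \<in> vcar (tensor_space V W)"
    show "L X \<in> vcar Z" using L[OF X] by (simp add: Q_def)
    have "Q (fscale c X) (vscale Z c (L X))"
      using L[OF X] by (auto simp: Q_def lin_scale vs_scale[OF Z])
    then show "L (vscale (tensor_space V W) c X) = vscale Z c (L X)"
      using uni L vs_scale[OF vspace_tensor X] by (simp) blast
    assume Y: "Y \<in> vcar (tensor_space V W)"
    have "Q (X + Y) (L X + L Y)"
      using L[OF X] L[OF Y] by (auto simp: Q_def lin_add vs_add[OF Z])
    then show "L (X + Y) = L X + L Y"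
      using uni L[OF vs_add[OF vspace_tensor X Y]] by blast
  qed
  have 2: "L (tens V W v w) = b v w" if v: "v \<in> vcar V" and w: "w \<in> vcar W" for v w
  proof -
    have "Q (tens V W v w) (b v w)"
      using v w fb by (auto simp: Q_def bilin_mem[OF b] tens_apply)
    then show ?thesis using uni L[OF tens_mem[OF v w]] by blast
  qed
  have "lin_map (tensor_space V W) Z (tlift V W Z b) \<and>
      (\<forall>v\<in>vcar V. \<forall>w\<in>vcar W. tlift V W Z b (tens V W v w) = b v w)"
    unfolding tlift_def by (rule someI[of _ L]) (use 1 2 in auto)
  then show "lin_map (tensor_space V W) Z (tlift V W Z b)"
    and "v \<in> vcar V \<Longrightarrow> w \<in> vcar W \<Longrightarrow> tlift V W Z b (tens V W v w) = b v w" by auto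
qed

lemma lf_bilin: "bilin_map V W Z b \<Longrightarrow> lf Z f \<Longrightarrow> bf V W (\<lambda>v w. f (b v w))"
  by (rule bilin_mapI) (rule lin_comp, assumption, erule (1) bilin_left bilin_right)+

text \<open>The rule by which lifts are computed: tested on a functional, a lift becomes evaluation
  on a composed form.\<close>

lemma tlift_apply:
  assumes "vspace V" "vspace W" "vspace Z" "bilin_map V W Z b" "lf Z f" "X \<in> vcar (tensor_space V W)"
  shows "f (tlift V W Z b X) = X (\<lambda>v w. f (b v w))"
  by (rule lin_tensor_eqI[OF lin_comp[OF assms(5) tlift_lin[OF assms(1-4)]] lf_apply assms(1,2) _ assms(6)])
    (simp add: tlift_tens[OF assms(1-4)] tens_apply[OF lf_bilin[OF assms(4,5)]])

lemma tlift_mem: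
  "vspace V \<Longrightarrow> vspace W \<Longrightarrow> vspace Z \<Longrightarrow> bilin_map V W Z b \<Longrightarrow> X \<in> vcar (tensor_space V W) \<Longrightarrow>
    tlift V W Z b X \<in> vcar Z"
  by (rule lin_mem[OF tlift_lin])

lemma tlift_tensor_apply:
  assumes "vspace V" "vspace W" "bilin_map V W (tensor_space V' W') b" "X \<in> vcar (tensor_space V W)"
  shows "tlift V W (tensor_space V' W') b X \<beta> = X (\<lambda>v w. b v w \<beta>)"
  by (rule tlift_apply[OF assms(1,2) vspace_tensor assms(3) lf_apply assms(4)])

lemma tlift_ground:
  assumes "vspace V" "vspace W" "bf V W b" "X \<in> vcar (tensor_space V W)"
  shows "tlift V W (ground :: ('k::field, 'k) alg) b X = X b"
  by (rule tlift_apply[OF assms(1,2) vspace_ground assms(3) lin_id assms(4)])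

lemma tens_map_bilin:
  assumes "lin_map V V' f" "lin_map W W' g"
  shows "bilin_map V W (tensor_space V' W') (\<lambda>v w. tens V' W' (f v) (g w))"
  by (intro bilin_mapI lin_comp[OF tens_left assms(1)] lin_comp[OF tens_right assms(2)] lin_mem[OF assms(1)] lin_mem[OF assms(2)])

lemma
  assumes "vspace V" "vspace W" "lin_map V V' f" "lin_map W W' g"
  shows tmap_lin: "lin_map (tensor_space V W) (tensor_space V' W') (tmap V W V' W' f g)"
    and tmap_tens: "v \<in> vcar V \<Longrightarrow> w \<in> vcar W \<Longrightarrow> tmap V W V' W' f g (tens V W v w) = tens V' W' (f v) (g w)"
    and tmap_mem: "X \<in> vcar (tensor_space V W) \<Longrightarrow> tmap V W V' W' f g X \<in> vcar (tensor_space V' W')"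
    and tmap_apply: "bf V' W' \<beta> \<Longrightarrow> X \<in> vcar (tensor_space V W) \<Longrightarrow>
      tmap V W V' W' f g X \<beta> = X (\<lambda>v w. \<beta> (f v) (g w))"
  unfolding tmap_def
  using tlift_lin[OF assms(1,2) vspace_tensor tens_map_bilin[OF assms(3,4)]]
    tlift_tens[OF assms(1,2) vspace_tensor tens_map_bilin[OF assms(3,4)]]
    tlift_tensor_apply[OF assms(1,2) tens_map_bilin[OF assms(3,4)], of X \<beta>]
  by (auto simp: lin_mem tens_apply)

lemma bf_map: "bf V' W' \<beta> \<Longrightarrow> lin_map V V' f \<Longrightarrow> lin_map W W' g \<Longrightarrow> bf V W (\<lambda>v w. \<beta> (f v) (g w))"
  by (auto intro!: bilin_mapI intro: lin_bilin_left lin_bilin_right lin_mem)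

lemma bf_prod: "lf V f \<Longrightarrow> lf W g \<Longrightarrow> bf V W (\<lambda>v w. f v * g w)"
  by (auto intro!: bilin_mapI lf_mult_left lf_mult_right)

lemma contract_bilin: "vspace V \<Longrightarrow> lf W f \<Longrightarrow> bilin_map V W V (\<lambda>v w. vscale V (f w) v)"
  by (intro bilin_mapI lin_mapI)
    (auto simp: vs_scale vs_scale_add vs_add_scale vs_scale_scale lin_add lin_scale mult.commute)

lemma
  assumes "vspace V" "vspace W" "lf W f"
  shows contract_lin: "lin_map (tensor_space V W) V (contract V W f)"
    and contract_tens: "v \<in> vcar V \<Longrightarrow> w \<in> vcar W \<Longrightarrow> contract V W f (tens V W v w) = vscale V (f w) v"
    and contract_mem: "X \<in> vcar (tensor_space V W) \<Longrightarrow> contract V W f X \<in> vcar V"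
    and contract_apply: "lf V g \<Longrightarrow> X \<in> vcar (tensor_space V W) \<Longrightarrow>
      g (contract V W f X) = X (\<lambda>v w. g v * f w)"
proof -
  note b = contract_bilin[OF assms(1,3)]
  show l: "lin_map (tensor_space V W) V (contract V W f)"
    unfolding contract_def by (rule tlift_lin[OF assms(1,2,1) b])
  show "X \<in> vcar (tensor_space V W) \<Longrightarrow> contract V W f X \<in> vcar V" by (rule lin_mem[OF l])
  show "v \<in> vcar V \<Longrightarrow> w \<in> vcar W \<Longrightarrow> contract V W f (tens V W v w) = vscale V (f w) v"
    unfolding contract_def by (rule tlift_tens[OF assms(1,2,1) b])
  assume g: "lf V g" and X: "X \<in> vcar (tensor_space V W)"
  have "g (contract V W f X) = X (\<lambda>v w. g (vscale V (f w) v))"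
    unfolding contract_def by (rule tlift_apply[OF assms(1,2,1) b g X])
  also have "\<dots> = X (\<lambda>v w. g v * f w)"
    by (rule tensor_apply_cong[OF X assms(1,2)]) (simp add: lin_scale[OF g])
  finally show "g (contract V W f X) = X (\<lambda>v w. g v * f w)" .
qed

text \<open>A chosen family in place of all functionals: on a finite dual the evaluations at
  elements are enough, and they are the functionals whose values are known.\<close>

definition separates :: "('k::field, 'u::ab_group_add, 'y) vsp_scheme \<Rightarrow> ('u \<Rightarrow> 'k) set \<Rightarrow> bool" where
  "separates V F \<longleftrightarrow> (\<forall>f\<in>F. lf V f) \<and> (\<forall>v\<in>vcar V. (\<forall>f\<in>F. f v = 0) \<longrightarrow> v = 0)"

lemma separatesD: "separates V F \<Longrightarrow> f \<in> F \<Longrightarrow> lf V f"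
  by (simp add: separates_def)

lemma separates_eqI:
  assumes "separates V F" "vspace V" "x \<in> vcar V" "y \<in> vcar V" "\<And>f. f \<in> F \<Longrightarrow> f x = f y"
  shows "x = y"
proof -
  have "f (x - y) = 0" if "f \<in> F" for f
    using assms(5)[OF that] lin_diff[OF separatesD[OF assms(1) that] assms(2-4)] by simp
  then have "x - y = 0"
    using assms(1) vs_diff[OF assms(2-4)] by (auto simp: separates_def)
  then show ?thesis by simp
qed

lemma separates_all: "vspace V \<Longrightarrow> separates V {f. lf V f}"
  using functional_sep[of V _ 0] by (auto simp: separates_def lin_zero vs_zero)

text \<open>Slicing with a member of \<open>G\<close> gives a vector that \<open>F\<close> kills,
  hence 0, so \<open>F\<close> may be enlarged to all functionals; likewise \<open>G\<close>. A
  general bilinear form then reduces to products, because only the finitely many left factors of the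
  tensor matter.\<close>

lemma separates_tensor:
  assumes V: "vspace V" and W: "vspace W" and F: "separates V F" and G: "separates W G"
  shows "separates (tensor_space V W) {\<lambda>Z. Z (\<lambda>v w. f v * g w) | f g. f \<in> F \<and> g \<in> G}"
proof -
  have "Z = 0" if Z: "Z \<in> vcar (tensor_space V W)"
    and z: "\<And>f g. f \<in> F \<Longrightarrow> g \<in> G \<Longrightarrow> Z (\<lambda>v w. f v * g w) = 0" for Z
  proof -
    have 1: "Z (\<lambda>v w. f v * g w) = 0" if "lf V f" "g \<in> G" for f g
    proof -
      note g = separatesD[OF G \<open>g \<in> G\<close>]
      have "contract V W g Z = 0"
        using contract_mem[OF V W g Z] contract_apply[OF V W g _ Z] separatesD[OF F] z[OF _ \<open>g \<in> G\<close>] F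
        by (auto simp: separates_def)
      then show ?thesis
        using contract_apply[OF V W g \<open>lf V f\<close> Z] lin_zero[OF \<open>lf V f\<close> V] by simp
    qed
    have 2: "Z (\<lambda>v w. f v * g w) = 0" if f: "lf V f" and g: "lf W g" for f g
    proof -
      have b: "bilin_map V W W (\<lambda>v w. vscale W (f v) w)"
        by (intro bilin_mapI lin_mapI)
          (auto simp: vs_scale vs_scale_add vs_add_scale vs_scale_scale W lin_add[OF f] lin_scale[OF f] mult.commute)
      have eq: "h (tlift V W W (\<lambda>v w. vscale W (f v) w) Z) = Z (\<lambda>v w. f v * h w)" if h: "lf W h" for h
        unfolding tlift_apply[OF V W W b h Z]
        by (rule tensor_apply_cong[OF Z V W]) (simp add: lin_scale[OF h])
      have "tlift V W W (\<lambda>v w. vscale W (f v) w) Z = 0"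
        using tlift_mem[OF V W W b Z] eq separatesD[OF G] 1[OF f] G
        by (auto simp: separates_def)
      then show ?thesis using eq[OF g] lin_zero[OF g W] by simp
    qed
    show "Z = 0"
    proof (rule tensor_ext[OF Z vs_zero[OF vspace_tensor] V W])
      fix \<beta> assume \<beta>: "bf V W \<beta>"
      obtain n :: nat and l r where *: "\<And>i. l i \<in> vcar V" "\<And>i. r i \<in> vcar W"
        "\<And>\<beta>. bf V W \<beta> \<Longrightarrow> Z \<beta> = (\<Sum>i<n. \<beta> (l i) (r i))"
        using tensor_apply_rep[OF Z V W] by metis
      interpret vector_space "vscale V" using V by (rule vspace_vector_space)
      \<comment> \<open>On the span of the left factors the form is the sum, over a basis
        \<open>I\<close> of that span, of the products of \<open>c e\<close> with
        \<open>\<beta> e\<close>.\<close>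
      obtain I c where I: "finite I" "I \<subseteq> l ` {..<n}" "\<And>i. Vector_Spaces.linear (vscale V) (*) (c i)"
        "\<And>x. x \<in> span (l ` {..<n}) \<Longrightarrow> x = (\<Sum>i\<in>I. vscale V (c i x) i)"
        by (rule finite_span_coordinates[OF vspace_vector_space[OF V], of "l ` {..<n}"]) auto
      have IV: "e \<in> vcar V" if "e \<in> I" for e using that I(2) *(1) by auto
      have "Z \<beta> = (\<Sum>i<n. \<beta> (l i) (r i))" by (rule *(3)[OF \<beta>])
      also have "\<dots> = (\<Sum>i<n. \<Sum>e\<in>I. c e (l i) * \<beta> e (r i))"
      proof (rule sum.cong)
        fix i assume "i \<in> {..<n}"
        then have "l i = (\<Sum>e\<in>I. vscale V (c e (l i)) e)" by (intro I(4) span_base) auto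
        then have "\<beta> (l i) (r i) = \<beta> (\<Sum>e\<in>I. vscale V (c e (l i)) e) (r i)" by simp
        also have "\<dots> = (\<Sum>e\<in>I. \<beta> (vscale V (c e (l i)) e) (r i))"
          by (rule lin_sum[OF bilin_left[OF \<beta> *(2)] V]) (auto intro: vs_scale[OF V] IV)
        also have "\<dots> = (\<Sum>e\<in>I. c e (l i) * \<beta> e (r i))"
          by (rule sum.cong) (auto simp: bilin_scale_left[OF \<beta> IV *(2)])
        finally show "\<beta> (l i) (r i) = (\<Sum>e\<in>I. c e (l i) * \<beta> e (r i))" .
      qed simp
      also have "\<dots> = (\<Sum>e\<in>I. \<Sum>i<n. c e (l i) * \<beta> e (r i))" by (rule sum.swap)
      also have "\<dots> = (\<Sum>e\<in>I. Z (\<lambda>v w. c e v * \<beta> e w))"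
        by (rule sum.cong) (auto simp: *(3)[OF bf_prod[OF linear_lf[OF I(3)] bilin_right[OF \<beta> IV]]])
      also have "\<dots> = 0"
        by (rule sum.neutral) (use 2[OF linear_lf[OF I(3)] bilin_right[OF \<beta> IV]] in auto)
      finally show "Z \<beta> = 0 \<beta>" by simp
    qed
  qed
  then show ?thesis
    by (auto simp: separates_def intro: lf_apply)
qed

lemma tensor_eqI:
  assumes "vspace V" "vspace W" "separates V F" "separates W G"
    "X \<in> vcar (tensor_space V W)" "Y \<in> vcar (tensor_space V W)"
    "\<And>f g. f \<in> F \<Longrightarrow> g \<in> G \<Longrightarrow> X (\<lambda>v w. f v * g w) = Y (\<lambda>v w. f v * g w)"
  shows "X = Y"
  by (rule separates_eqI[OF separates_tensor[OF assms(1-4)] vspace_tensor assms(5,6)]) (use assms(7) in auto)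

text \<open>Retractions \<open>r\<close> and \<open>s\<close> carry a form on \<open>V\<close> and
  \<open>W\<close> to a form on \<open>V'\<close> and \<open>W'\<close>, so the image of a tensor
  determines each of its values.\<close>

lemma tmap_inj:
  assumes "vspace V" "vspace W" "vspace V'" "vspace W'" "lin_map V V' f" "lin_map W W' g"
    "inj_on f (vcar V)" "inj_on g (vcar W)"
  shows "inj_on (tmap V W V' W' f g) (vcar (tensor_space V W))"
proof (rule inj_onI)
  fix X Y assume X: "X \<in> vcar (tensor_space V W)" and Y: "Y \<in> vcar (tensor_space V W)"
    and eq: "tmap V W V' W' f g X = tmap V W V' W' f g Y"
  obtain r where r: "lin_map V' V r" "\<And>x. x \<in> vcar V \<Longrightarrow> r (f x) = x"
    using lin_left_inverse[OF assms(1,3,5,7)] by metis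
  obtain s where s: "lin_map W' W s" "\<And>x. x \<in> vcar W \<Longrightarrow> s (g x) = x"
    using lin_left_inverse[OF assms(2,4,6,8)] by metis
  show "X = Y"
  proof (rule tensor_ext[OF X Y assms(1,2)])
    fix \<beta> assume \<beta>: "bf V W \<beta>"
    have "Z \<beta> = tmap V W V' W' f g Z (\<lambda>v w. \<beta> (r v) (s w))" if "Z \<in> vcar (tensor_space V W)" for Z
      unfolding tmap_apply[OF assms(1,2,5,6) bf_map[OF \<beta> r(1) s(1)] that]
      by (rule tensor_apply_cong[OF that assms(1,2)]) (simp add: r s)
    from this[OF X] this[OF Y] show "X \<beta> = Y \<beta>" using eq by simp
  qed
qed

section \<open>Trilinear forms and associativity of triple tensor products\<close>

definition trilin :: "('k::field, 'u::ab_group_add, 'x) vsp_scheme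
    \<Rightarrow> ('k, 'v::ab_group_add, 'y) vsp_scheme \<Rightarrow> ('k, 'w::ab_group_add, 'z) vsp_scheme
    \<Rightarrow> ('u \<Rightarrow> 'v \<Rightarrow> 'w \<Rightarrow> 'k) \<Rightarrow> bool" where
  "trilin U V W T \<longleftrightarrow> (\<forall>b\<in>vcar V. \<forall>c\<in>vcar W. lf U (\<lambda>a. T a b c)) \<and>
     (\<forall>a\<in>vcar U. \<forall>c\<in>vcar W. lf V (\<lambda>b. T a b c)) \<and> (\<forall>a\<in>vcar U. \<forall>b\<in>vcar V. lf W (\<lambda>c. T a b c))"

lemma trilinI:
  "(\<And>b c. b \<in> vcar V \<Longrightarrow> c \<in> vcar W \<Longrightarrow> lf U (\<lambda>a. T a b c)) \<Longrightarrow>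
   (\<And>a c. a \<in> vcar U \<Longrightarrow> c \<in> vcar W \<Longrightarrow> lf V (\<lambda>b. T a b c)) \<Longrightarrow>
   (\<And>a b. a \<in> vcar U \<Longrightarrow> b \<in> vcar V \<Longrightarrow> lf W (\<lambda>c. T a b c)) \<Longrightarrow> trilin U V W T"
  by (auto simp: trilin_def)

lemma
  assumes "trilin U V W T"
  shows trilin_bf1: "a \<in> vcar U \<Longrightarrow> bf V W (\<lambda>b c. T a b c)"
    and trilin_bf3: "c \<in> vcar W \<Longrightarrow> bf U V (\<lambda>a b. T a b c)"
    and trilin_lf1: "b \<in> vcar V \<Longrightarrow> c \<in> vcar W \<Longrightarrow> lf U (\<lambda>a. T a b c)"
    and trilin_lf3: "a \<in> vcar U \<Longrightarrow> b \<in> vcar V \<Longrightarrow> lf W (\<lambda>c. T a b c)"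
  using assms by (auto simp: trilin_def intro!: bilin_mapI)

lemma trilin_prod: "lf U f \<Longrightarrow> lf V g \<Longrightarrow> lf W h \<Longrightarrow> trilin U V W (\<lambda>a b c. f a * g b * h c)"
  by (auto intro!: trilinI lf_mult_left lf_mult_right)

lemma
  assumes T: "trilin U V W T" and vs: "vspace U" "vspace V" "vspace W"
  shows bf_eval_right: "bf U (tensor_space V W) (\<lambda>a Y. Y (\<lambda>b c. T a b c))"
    and bf_eval_left: "bf (tensor_space U V) W (\<lambda>Y c. Y (\<lambda>a b. T a b c))"
proof -
  have "lf U (\<lambda>a. Y (\<lambda>b c. T a b c))" if "Y \<in> vcar (tensor_space V W)" for Y
    by (rule lf_tensor_param[OF that vs(2,3,1) trilin_bf1[OF T] trilin_lf1[OF T]])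
  then show "bf U (tensor_space V W) (\<lambda>a Y. Y (\<lambda>b c. T a b c))"
    by (intro bilin_mapI lf_apply)
  have "lf W (\<lambda>c. Y (\<lambda>a b. T a b c))" if "Y \<in> vcar (tensor_space U V)" for Y
    by (rule lf_tensor_param[OF that vs trilin_bf3[OF T] trilin_lf3[OF T]])
  then show "bf (tensor_space U V) W (\<lambda>Y c. Y (\<lambda>a b. T a b c))"
    by (intro bilin_mapI lf_apply)
qed

lemma lin_tlift_param:
  assumes "X \<in> vcar (tensor_space U V)" "vspace U" "vspace V" "vspace W" "vspace M" "vspace N"
    "\<And>w. w \<in> vcar W \<Longrightarrow> bilin_map U V (tensor_space M N) (b w)"
    "\<And>u v. u \<in> vcar U \<Longrightarrow> v \<in> vcar V \<Longrightarrow> lin_map W (tensor_space M N) (\<lambda>w. b w u v)"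
  shows "lin_map W (tensor_space M N) (\<lambda>w. tlift U V (tensor_space M N) (b w) X)"
proof (rule lin_tensorI[OF assms(4-6)])
  fix w assume "w \<in> vcar W"
  then show "tlift U V (tensor_space M N) (b w) X \<in> vcar (tensor_space M N)"
    by (intro tlift_mem assms vspace_tensor)
next
  fix \<beta> assume \<beta>: "bf M N \<beta>"
  have "lf W (\<lambda>w. X (\<lambda>u v. b w u v \<beta>))"
    by (rule lf_tensor_param[OF assms(1-4)]) (auto intro: lf_bilin[OF assms(7) lf_apply] lf_tensor_apply[OF assms(8)])
  then show "lf W (\<lambda>w. tlift U V (tensor_space M N) (b w) X \<beta>)"
    by (rule lin_cong[OF _ assms(4)]) (simp add: tlift_tensor_apply[OF assms(2,3,7,1)])
qed

lemma
  assumes U: "vspace U" and V: "vspace V" and W: "vspace W"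
  shows tassoc_lin: "lin_map (tensor_space (tensor_space U V) W) (tensor_space U (tensor_space V W)) (tassoc U V W)"
    and tassoc_apply: "X \<in> vcar (tensor_space (tensor_space U V) W) \<Longrightarrow> bf U (tensor_space V W) \<beta> \<Longrightarrow>
      tassoc U V W X \<beta> = X (\<lambda>Y w. Y (\<lambda>u v. \<beta> u (tens V W v w)))"
proof -
  let ?Z = "tensor_space U (tensor_space V W)"
  let ?b = "\<lambda>w u v. tens U (tensor_space V W) u (tens V W v w)"
  have b: "bilin_map U V ?Z (?b w)" if "w \<in> vcar W" for w
    using that by (intro bilin_mapI lin_bilin_right[OF tens_bilin] tens_left lin_bilin_left[OF tens_bilin] tens_mem lin_id)
  have b3: "lin_map W ?Z (\<lambda>w. ?b w u v)" if "u \<in> vcar U" "v \<in> vcar V" for u v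
    using that by (intro lin_bilin_right[OF tens_bilin] tens_right)
  have B: "bilin_map (tensor_space U V) W ?Z (\<lambda>X w. tlift U V ?Z (?b w) X)"
    by (intro bilin_mapI tlift_lin[OF U V vspace_tensor b] lin_tlift_param[OF _ U V W U vspace_tensor b b3])
  show "lin_map (tensor_space (tensor_space U V) W) ?Z (tassoc U V W)"
    unfolding tassoc_def by (rule tlift_lin[OF vspace_tensor W vspace_tensor B])
  assume X: "X \<in> vcar (tensor_space (tensor_space U V) W)" and \<beta>: "bf U (tensor_space V W) \<beta>"
  have "tassoc U V W X \<beta> = X (\<lambda>Y w. tlift U V ?Z (?b w) Y \<beta>)"
    unfolding tassoc_def by (rule tlift_tensor_apply[OF vspace_tensor W B X])
  also have "\<dots> = X (\<lambda>Y w. Y (\<lambda>u v. \<beta> u (tens V W v w)))"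
    by (rule tensor_apply_cong[OF X vspace_tensor W]) (simp add: tlift_tensor_apply[OF U V b] tens_apply[OF \<beta>])
  finally show "tassoc U V W X \<beta> = X (\<lambda>Y w. Y (\<lambda>u v. \<beta> u (tens V W v w)))" .
qed

text \<open>The diagram common to coassociativity and to the comodule law: \<open>D1\<close> splits
  the left factor of \<open>X\<close> and \<open>D2\<close> the right factor of \<open>X'\<close>.
  For a coaction, \<open>D1\<close> is the coaction and \<open>D2\<close> the
  comultiplication.\<close>

context
  fixes V1 :: "('k::field, 'u::ab_group_add, 'p) vsp_scheme" and V2 :: "('k, 'v::ab_group_add, 'q) vsp_scheme"
    and V3 :: "('k, 'w::ab_group_add, 'r) vsp_scheme" and M :: "('k, 'm::ab_group_add, 's) vsp_scheme"
    and N :: "('k, 'n::ab_group_add, 't) vsp_scheme" and D1 D2 X X'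
  assumes vs: "vspace V1" "vspace V2" "vspace V3" "vspace M" "vspace N"
    and D1: "lin_map M (tensor_space V1 V2) D1" and D2: "lin_map N (tensor_space V2 V3) D2"
    and X: "X \<in> vcar (tensor_space M V3)" and X': "X' \<in> vcar (tensor_space V1 N)"
begin

lemma tassoc_side_left:
  assumes "trilin V1 V2 V3 T"
  shows "tassoc V1 V2 V3 (tmap M V3 (tensor_space V1 V2) V3 D1 id X) (\<lambda>a Y. Y (\<lambda>b c. T a b c))
    = X (\<lambda>m c. D1 m (\<lambda>a b. T a b c))"
proof -
  have \<beta>: "bf V1 (tensor_space V2 V3) (\<lambda>a Y. Y (\<lambda>b c. T a b c))"
    by (rule bf_eval_right[OF assms vs(1-3)])
  have 1: "bf (tensor_space V1 V2) V3 (\<lambda>Y w. Y (\<lambda>u v. T u v w))"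
    by (rule bf_eval_left[OF assms vs(1-3)])
  have T: "tmap M V3 (tensor_space V1 V2) V3 D1 id X \<in> vcar (tensor_space (tensor_space V1 V2) V3)"
    by (rule tmap_mem[OF vs(4,3) D1 lin_id' X])
  have "tassoc V1 V2 V3 (tmap M V3 (tensor_space V1 V2) V3 D1 id X) (\<lambda>a Y. Y (\<lambda>b c. T a b c))
    = tmap M V3 (tensor_space V1 V2) V3 D1 id X (\<lambda>Y w. Y (\<lambda>u v. tens V2 V3 v w (\<lambda>b c. T u b c)))"
    by (rule tassoc_apply[OF vs(1-3) T \<beta>])
  also have "\<dots> = tmap M V3 (tensor_space V1 V2) V3 D1 id X (\<lambda>Y w. Y (\<lambda>u v. T u v w))"
    by (rule tensor_apply_cong[OF T vspace_tensor vs(3)], rule tensor_apply_cong[OF _ vs(1,2)])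
      (auto simp: tens_apply[OF trilin_bf1[OF assms]])
  also have "\<dots> = X (\<lambda>m c. D1 m (\<lambda>a b. T a b c))"
    by (simp add: tmap_apply[OF vs(4,3) D1 lin_id' 1 X])
  finally show ?thesis .
qed

lemma tassoc_side_right:
  assumes "trilin V1 V2 V3 T"
  shows "tmap V1 N V1 (tensor_space V2 V3) id D2 X' (\<lambda>a Y. Y (\<lambda>b c. T a b c))
    = X' (\<lambda>a n. D2 n (\<lambda>b c. T a b c))"
proof -
  have \<beta>: "bf V1 (tensor_space V2 V3) (\<lambda>a Y. Y (\<lambda>b c. T a b c))"
    by (rule bf_eval_right[OF assms vs(1-3)])
  show ?thesis by (simp add: tmap_apply[OF vs(1,5) lin_id' D2 \<beta> X'])
qed

lemma tassoc_eqD: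
  assumes "tassoc V1 V2 V3 (tmap M V3 (tensor_space V1 V2) V3 D1 id X)
      = tmap V1 N V1 (tensor_space V2 V3) id D2 X'" "trilin V1 V2 V3 T"
  shows "X (\<lambda>m c. D1 m (\<lambda>a b. T a b c)) = X' (\<lambda>a n. D2 n (\<lambda>b c. T a b c))"
  using tassoc_side_left[OF assms(2)] tassoc_side_right[OF assms(2)] assms(1) by simp

text \<open>Products of three functionals from separating families separate the triple tensor
  product, by applying the result for two factors twice.\<close>

lemma tassoc_eqI:
  assumes "separates V1 F1" "separates V2 F2" "separates V3 F3"
    "\<And>f g h. f \<in> F1 \<Longrightarrow> g \<in> F2 \<Longrightarrow> h \<in> F3 \<Longrightarrow>
      X (\<lambda>m c. D1 m (\<lambda>a b. f a * g b * h c)) = X' (\<lambda>a n. D2 n (\<lambda>b c. f a * g b * h c))"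
  shows "tassoc V1 V2 V3 (tmap M V3 (tensor_space V1 V2) V3 D1 id X)
      = tmap V1 N V1 (tensor_space V2 V3) id D2 X'" (is "?L = ?R")
proof -
  have L: "?L \<in> vcar (tensor_space V1 (tensor_space V2 V3))"
    by (rule lin_mem[OF tassoc_lin[OF vs(1-3)] tmap_mem[OF vs(4,3) D1 lin_id' X]])
  have R: "?R \<in> vcar (tensor_space V1 (tensor_space V2 V3))"
    by (rule tmap_mem[OF vs(1,5) lin_id' D2 X'])
  show ?thesis
  proof (rule tensor_eqI[OF vs(1) vspace_tensor assms(1) separates_tensor[OF vs(2,3) assms(2,3)] L R])
    fix f and g' :: "('v, 'w, 'k) tensor \<Rightarrow> 'k"
    assume f: "f \<in> F1" and "g' \<in> {\<lambda>Z. Z (\<lambda>v w. g v * h w) |g h. g \<in> F2 \<and> h \<in> F3}"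
    then obtain g h where g: "g \<in> F2" "h \<in> F3" "g' = (\<lambda>Z. Z (\<lambda>v w. g v * h w))" by blast
    note lfs = separatesD[OF assms(1) f] separatesD[OF assms(2) g(1)] separatesD[OF assms(3) g(2)]
    have eq: "Z (\<lambda>v w. f v * g' w) = Z (\<lambda>v Y. Y (\<lambda>b c. f v * g b * h c))"
      if Z: "Z \<in> vcar (tensor_space V1 (tensor_space V2 V3))" for Z :: "('u, ('v, 'w, 'k) tensor, 'k) tensor"
    proof (rule tensor_apply_cong[OF Z vs(1) vspace_tensor])
      fix v Y assume v: "v \<in> vcar V1" and Y: "Y \<in> vcar (tensor_space V2 V3)"
      obtain n :: nat and l r where *: "\<And>i. l i \<in> vcar V2" "\<And>i. r i \<in> vcar V3"
        "\<And>\<beta>. bf V2 V3 \<beta> \<Longrightarrow> Y \<beta> = (\<Sum>i<n. \<beta> (l i) (r i))"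
        using tensor_apply_rep[OF Y vs(2,3)] by metis
      show "f v * g' Y = Y (\<lambda>b c. f v * g b * h c)"
        unfolding g(3) *(3)[OF bf_prod[OF lfs(2,3)]] *(3)[OF trilin_bf1[OF trilin_prod[OF lfs] v]]
        by (simp add: sum_distrib_left mult.assoc)
    qed
    show "?L (\<lambda>v w. f v * g' w) = ?R (\<lambda>v w. f v * g' w)"
      unfolding eq[OF L] eq[OF R] tassoc_side_left[OF trilin_prod[OF lfs]] tassoc_side_right[OF trilin_prod[OF lfs]]
      by (rule assms(4)[OF f g(1,2)])
  qed
qed

end

lemma tensor_scale_left:
  assumes X: "X \<in> vcar (tensor_space V W)" and vs: "vspace V" "vspace W" and \<beta>: "bf V W \<beta>"
  shows "X (\<lambda>v w. c * \<beta> v w) = c * X \<beta>"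
proof -
  obtain n :: nat and l r where *: "\<And>\<beta>. bf V W \<beta> \<Longrightarrow> X \<beta> = (\<Sum>i<n. \<beta> (l i) (r i))"
    using tensor_apply_rep[OF X vs] by metis
  have "bf V W (\<lambda>v w. c * \<beta> v w)"
    by (intro bilin_mapI lf_mult_left bilin_left[OF \<beta>] bilin_right[OF \<beta>])
  then show ?thesis by (simp add: * \<beta> sum_distrib_left)
qed

lemma tensor_scale_right:
  assumes X: "X \<in> vcar (tensor_space V W)" and vs: "vspace V" "vspace W" and \<beta>: "bf V W \<beta>"
  shows "X (\<lambda>v w. \<beta> v w * c) = X \<beta> * c"
  using tensor_scale_left[OF assms] by (simp add: mult.commute)

section \<open>Coalgebras\<close>

lemma
  assumes "coalgebra P"
  shows coalg_vspace: "vspace P" and coalg_delta: "lin_map P (tensor_space P P) (cdelta P)"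
    and coalg_eps: "lf P (ceps P)"
  using assms by (auto simp: coalgebra_def)

lemma coassoc:
  assumes P: "coalgebra P" and p: "p \<in> vcar P" and T: "trilin P P P T"
  shows "cdelta P p (\<lambda>x y. cdelta P x (\<lambda>u v. T u v y)) = cdelta P p (\<lambda>x y. cdelta P y (\<lambda>u v. T x u v))"
proof -
  note [simp] = coalg_vspace[OF P]
  note D = coalg_delta[OF P]
  show ?thesis
    by (rule tassoc_eqD[OF _ _ _ _ _ D D lin_mem[OF D p] lin_mem[OF D p] _ T])
      (use P p in \<open>simp_all add: coalgebra_def\<close>)
qed

lemma counit_bilin:
  assumes "vspace P" "lf P e"
  shows "bilin_map P P P (\<lambda>x y. vscale P (e x) y)" "bilin_map P P P (\<lambda>x y. vscale P (e y) x)"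
  using assms by (auto intro!: bilin_mapI lin_mapI
      simp: vs_scale vs_scale_add vs_add_scale vs_scale_scale lin_add lin_scale mult.commute)

lemma
  assumes P: "coalgebra P" and p: "p \<in> vcar P" and f: "lf P f"
  shows counit_left: "cdelta P p (\<lambda>x y. ceps P x * f y) = f p"
    and counit_right: "cdelta P p (\<lambda>x y. f x * ceps P y) = f p"
proof -
  note vs = coalg_vspace[OF P]
  note D = lin_mem[OF coalg_delta[OF P] p]
  note b = counit_bilin[OF vs coalg_eps[OF P]]
  have "cdelta P p (\<lambda>x y. ceps P x * f y) = cdelta P p (\<lambda>x y. f (vscale P (ceps P x) y))"
    by (rule tensor_apply_cong[OF D vs vs]) (simp add: lin_scale[OF f])
  also have "\<dots> = f p"
    using P p unfolding tlift_apply[OF vs vs vs b(1) f D, symmetric] by (simp add: coalgebra_def)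
  finally show "cdelta P p (\<lambda>x y. ceps P x * f y) = f p" .
  have "cdelta P p (\<lambda>x y. f x * ceps P y) = cdelta P p (\<lambda>x y. f (vscale P (ceps P y) x))"
    by (rule tensor_apply_cong[OF D vs vs]) (simp add: lin_scale[OF f] mult.commute)
  also have "\<dots> = f p"
    using P p unfolding tlift_apply[OF vs vs vs b(2) f D, symmetric] by (simp add: coalgebra_def)
  finally show "cdelta P p (\<lambda>x y. f x * ceps P y) = f p" .
qed

lemma coalgebraI:
  assumes vs: "vspace P" and D: "lin_map P (tensor_space P P) (cdelta P)" and e: "lf P (ceps P)"
    and F: "separates P F"
    and coassoc: "\<And>p f g h. p \<in> vcar P \<Longrightarrow> f \<in> F \<Longrightarrow> g \<in> F \<Longrightarrow> h \<in> F \<Longrightarrow>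
      cdelta P p (\<lambda>x y. cdelta P x (\<lambda>u v. f u * g v * h y)) = cdelta P p (\<lambda>x y. cdelta P y (\<lambda>u v. f x * g u * h v))"
    and counit: "\<And>p f. p \<in> vcar P \<Longrightarrow> f \<in> F \<Longrightarrow> cdelta P p (\<lambda>x y. ceps P x * f y) = f p"
      "\<And>p f. p \<in> vcar P \<Longrightarrow> f \<in> F \<Longrightarrow> cdelta P p (\<lambda>x y. f x * ceps P y) = f p"
  shows "coalgebra P"
proof -
  note b = counit_bilin[OF vs e]
  have 1: "tassoc P P P (tmap P P (tensor_space P P) P (cdelta P) id (cdelta P p))
          = tmap P P P (tensor_space P P) id (cdelta P) (cdelta P p)" if p: "p \<in> vcar P" for p
    by (rule tassoc_eqI[OF vs vs vs vs vs D D lin_mem[OF D p] lin_mem[OF D p] F F F]) (rule coassoc[OF p])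
  have 2: "tlift P P P (\<lambda>x y. vscale P (ceps P x) y) (cdelta P p) = p" if p: "p \<in> vcar P" for p
  proof (rule separates_eqI[OF F vs tlift_mem[OF vs vs vs b(1) lin_mem[OF D p]] p])
    fix f assume f: "f \<in> F"
    have "cdelta P p (\<lambda>x y. f (vscale P (ceps P x) y)) = cdelta P p (\<lambda>x y. ceps P x * f y)"
      by (rule tensor_apply_cong[OF lin_mem[OF D p] vs vs]) (simp add: lin_scale[OF separatesD[OF F f]])
    then show "f (tlift P P P (\<lambda>x y. vscale P (ceps P x) y) (cdelta P p)) = f p"
      by (simp add: tlift_apply[OF vs vs vs b(1) separatesD[OF F f] lin_mem[OF D p]] counit(1)[OF p f])
  qed
  have 3: "tlift P P P (\<lambda>x y. vscale P (ceps P y) x) (cdelta P p) = p" if p: "p \<in> vcar P" for p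
  proof (rule separates_eqI[OF F vs tlift_mem[OF vs vs vs b(2) lin_mem[OF D p]] p])
    fix f assume f: "f \<in> F"
    have "cdelta P p (\<lambda>x y. f (vscale P (ceps P y) x)) = cdelta P p (\<lambda>x y. f x * ceps P y)"
      by (rule tensor_apply_cong[OF lin_mem[OF D p] vs vs]) (simp add: lin_scale[OF separatesD[OF F f]] mult.commute)
    then show "f (tlift P P P (\<lambda>x y. vscale P (ceps P y) x) (cdelta P p)) = f p"
      by (simp add: tlift_apply[OF vs vs vs b(2) separatesD[OF F f] lin_mem[OF D p]] counit(2)[OF p f])
  qed
  show ?thesis unfolding coalgebra_def using vs D e 1 2 3 by simp
qed

text \<open>These notions see only the carrier and the scaling. The rules let simplification pass
  between records that differ in their further fields, such as \<open>B\<close> and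
  \<open>coalg_of B\<close>.\<close>

lemma vsp_cong_left:
  assumes "vcar V = vcar V'" "vscale V = vscale V'"
  shows "vspace V = vspace V'" "lin_map V W = lin_map V' W" "bilin_map V W = bilin_map V' W"
    "tens V W = tens V' W" "tensor_space V W = tensor_space V' W" "tlift V W Z = tlift V' W Z"
    "tmap V W U Z = tmap V' W U Z"
proof -
  show v: "vspace V = vspace V'"
    by (simp add: vspace_def assms)
  show l: "\<And>W. lin_map V W = lin_map V' W"
    by (intro ext) (simp add: lin_map_def assms)
  show b: "bilin_map V W = bilin_map V' W"
    by (intro ext) (simp add: bilin_map_def l assms)
  show t: "tens V W = tens V' W"
    using assms by (auto simp: tens_def fun_eq_iff bilin_map_def lin_map_def)
  show s: "tensor_space V W = tensor_space V' W"
    by (simp add: tensor_space_def t assms)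
  show "tlift V W Z = tlift V' W Z"
    by (simp add: tlift_def fun_eq_iff t s assms)
  then show "tmap V W U Z = tmap V' W U Z"
    by (simp add: tmap_def fun_eq_iff tlift_def t s assms)
qed

lemma vsp_cong_right:
  assumes "vcar V = vcar V'" "vscale V = vscale V'"
  shows "lin_map W V = lin_map W V'" "bilin_map W V = bilin_map W V'" "bilin_map U W V = bilin_map U W V'"
    "tens W V = tens W V'" "tensor_space W V = tensor_space W V'" "tlift W V Z = tlift W V' Z"
    "tlift U W V = tlift U W V'" "tmap W V U Z = tmap W V' U Z" "tmap W U V Z = tmap W U V' Z"
    "tmap W U Z V = tmap W U Z V'"
proof -
  show l: "\<And>W. lin_map W V = lin_map W V'"
    using assms by (auto simp: lin_map_def fun_eq_iff)
  have l': "\<And>W. lin_map V W = lin_map V' W"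
    using assms by (auto simp: lin_map_def fun_eq_iff)
  show b: "\<And>W. bilin_map W V = bilin_map W V'"
    using assms by (auto simp: bilin_map_def l' fun_eq_iff)
  show b': "\<And>U W. bilin_map U W V = bilin_map U W V'"
    using assms by (auto simp: bilin_map_def l fun_eq_iff)
  show t: "\<And>W. tens W V = tens W V'"
    by (auto simp: tens_def fun_eq_iff b)
  show s: "\<And>W. tensor_space W V = tensor_space W V'"
    by (simp add: tensor_space_def t assms)
  have s': "\<And>W. tensor_space V W = tensor_space V' W" and t': "\<And>W. tens V W = tens V' W"
    using vsp_cong_left[OF assms] by auto
  show t3: "\<And>W Z. tlift W V Z = tlift W V' Z"
    by (simp add: tlift_def fun_eq_iff t s assms)
  show "\<And>U W. tlift U W V = tlift U W V'"
    by (simp add: tlift_def fun_eq_iff l)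
  show "tmap W V U Z = tmap W V' U Z" "tmap W U V Z = tmap W U V' Z" "tmap W U Z V = tmap W U Z V'"
    by (simp_all add: tmap_def t3 t t' s s' fun_eq_iff)
qed

lemma coalg_of_simps [simp]: "vcar (coalg_of B) = vcar B" "vscale (coalg_of B) = vscale B"
  "cdelta (coalg_of B) = bdelta B" "ceps (coalg_of B) = beps B"
  by (simp_all add: coalg_of_def)

lemmas coalg_of_cong [simp] =
  vsp_cong_left[of "coalg_of B" B for B, simplified] vsp_cong_right[of "coalg_of B" B for B, simplified]

lemma tensor_alg_simps [simp]: "vcar (tensor_alg Q R) = vcar (tensor_space Q R)"
  "vscale (tensor_alg Q R) = fscale" "aone (tensor_alg Q R) = tens Q R (aone Q) (aone R)"
  by (simp_all add: tensor_alg_def)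

lemmas tensor_alg_cong [simp] =
  vsp_cong_left[of "tensor_alg Q R" "tensor_space Q R" for Q R, simplified]
  vsp_cong_right[of "tensor_alg Q R" "tensor_space Q R" for Q R, simplified]

section \<open>Convolution\<close>

text \<open>The product of the dual algebra of \<open>P\<close>. Coassociativity and counit laws
  become associativity and unit laws of this product, and in that form they are proved
  below.\<close>

definition conv :: "('k::field, 'u::ab_group_add) coalg \<Rightarrow> ('u \<Rightarrow> 'k) \<Rightarrow> ('u \<Rightarrow> 'k) \<Rightarrow> 'u \<Rightarrow> 'k" where
  "conv P f g p = cdelta P p (\<lambda>x y. f x * g y)"

lemma lf_delta: "lin_map P (tensor_space P P) (cdelta P) \<Longrightarrow> lin_map U P g \<Longrightarrow> lf U (\<lambda>x. cdelta P (g x) \<beta>)"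
  by (rule lf_tensor_apply[OF lin_comp])

lemma lf_conv: "lin_map P (tensor_space P P) (cdelta P) \<Longrightarrow> lf P (conv P f g)"
  unfolding conv_def by (rule lf_delta[OF _ lin_id])

lemma conv_cong:
  assumes "lin_map P (tensor_space P P) (cdelta P)" "vspace P" "p \<in> vcar P"
    "\<And>x. x \<in> vcar P \<Longrightarrow> f x = f' x" "\<And>x. x \<in> vcar P \<Longrightarrow> g x = g' x"
  shows "conv P f g p = conv P f' g' p"
  unfolding conv_def
  by (rule tensor_apply_cong[OF lin_mem[OF assms(1,3)] assms(2,2)]) (simp add: assms(4,5))

lemma conv_conv_left:
  assumes D: "lin_map P (tensor_space P P) (cdelta P)" and vs: "vspace P" and p: "p \<in> vcar P"
    and fg: "lf P f" "lf P g"
  shows "conv P (conv P f g) h p = cdelta P p (\<lambda>x y. cdelta P x (\<lambda>u v. f u * g v * h y))"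
  unfolding conv_def
  by (rule tensor_apply_cong[OF lin_mem[OF D p] vs vs])
    (simp add: tensor_scale_right[OF lin_mem[OF D] vs vs bf_prod[OF fg]])

lemma conv_conv_right:
  assumes D: "lin_map P (tensor_space P P) (cdelta P)" and vs: "vspace P" and p: "p \<in> vcar P"
    and fg: "lf P g" "lf P h"
  shows "conv P f (conv P g h) p = cdelta P p (\<lambda>x y. cdelta P y (\<lambda>u v. f x * g u * h v))"
  unfolding conv_def
  by (rule tensor_apply_cong[OF lin_mem[OF D p] vs vs])
    (simp add: tensor_scale_left[OF lin_mem[OF D] vs vs bf_prod[OF fg]] mult.assoc)

lemma coalgebraI_conv:
  assumes vs: "vspace P" and D: "lin_map P (tensor_space P P) (cdelta P)" and e: "lf P (ceps P)"
    and F: "separates P F"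
    and "\<And>p f g h. p \<in> vcar P \<Longrightarrow> f \<in> F \<Longrightarrow> g \<in> F \<Longrightarrow> h \<in> F \<Longrightarrow>
      conv P (conv P f g) h p = conv P f (conv P g h) p"
    and "\<And>p f. p \<in> vcar P \<Longrightarrow> f \<in> F \<Longrightarrow> conv P (ceps P) f p = f p"
      "\<And>p f. p \<in> vcar P \<Longrightarrow> f \<in> F \<Longrightarrow> conv P f (ceps P) p = f p"
  shows "coalgebra P"
proof (rule coalgebraI[OF vs D e F])
  fix p f g h assume p: "p \<in> vcar P" and F': "f \<in> F" "g \<in> F" "h \<in> F"
  show "cdelta P p (\<lambda>x y. cdelta P x (\<lambda>u v. f u * g v * h y)) = cdelta P p (\<lambda>x y. cdelta P y (\<lambda>u v. f x * g u * h v))"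
    using assms(5)[OF p F'] F'[THEN separatesD[OF F]]
    by (simp add: conv_conv_left[OF D vs p] conv_conv_right[OF D vs p])
qed (use assms(6,7) in \<open>auto simp: conv_def\<close>)

lemma
  assumes P: "coalgebra P" and p: "p \<in> vcar P"
  shows conv_assoc: "lf P f \<Longrightarrow> lf P g \<Longrightarrow> lf P h \<Longrightarrow> conv P (conv P f g) h p = conv P f (conv P g h) p"
    and conv_eps_left: "lf P f \<Longrightarrow> conv P (ceps P) f p = f p"
    and conv_eps_right: "lf P f \<Longrightarrow> conv P f (ceps P) p = f p"
  using coassoc[OF P p trilin_prod[of P f P g P h]] counit_left[OF P p, of f] counit_right[OF P p, of f]
  by (auto simp: conv_conv_left[OF coalg_delta[OF P] coalg_vspace[OF P] p]
      conv_conv_right[OF coalg_delta[OF P] coalg_vspace[OF P] p]) (auto simp: conv_def)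

text \<open>A linear map preserves coproducts when its transpose preserves convolution, and a
  separating family on the target detects this.\<close>

lemma coalg_homI:
  assumes P: "coalgebra P" and R: "coalgebra R" and f: "lin_map P R f" and F: "separates R F"
    and 1: "\<And>p g h. p \<in> vcar P \<Longrightarrow> g \<in> F \<Longrightarrow> h \<in> F \<Longrightarrow> conv R g h (f p) = conv P (\<lambda>x. g (f x)) (\<lambda>x. h (f x)) p"
    and 2: "\<And>p. p \<in> vcar P \<Longrightarrow> ceps R (f p) = ceps P p"
  shows "coalg_hom P R f"
  unfolding coalg_hom_def
proof (intro conjI ballI f 2)
  fix p assume p: "p \<in> vcar P"
  note vs = coalg_vspace[OF P] coalg_vspace[OF R]
  note Dp = lin_mem[OF coalg_delta[OF P] p]
  show "cdelta R (f p) = tmap P P R R f f (cdelta P p)"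
  proof (rule tensor_eqI[OF vs(2,2) F F])
    show "cdelta R (f p) \<in> vcar (tensor_space R R)"
      by (rule lin_mem[OF coalg_delta[OF R] lin_mem[OF f p]])
    show "tmap P P R R f f (cdelta P p) \<in> vcar (tensor_space R R)"
      by (rule tmap_mem[OF vs(1,1) f f Dp])
    fix g h assume "g \<in> F" "h \<in> F"
    then show "cdelta R (f p) (\<lambda>v w. g v * h w) = tmap P P R R f f (cdelta P p) (\<lambda>v w. g v * h w)"
      using 1[OF p, of g h] by (simp add: conv_def tmap_apply[OF vs(1,1) f f _ Dp] bf_prod separatesD[OF F])
  qed
qed

lemma coalg_hom_lin: "coalg_hom P R f \<Longrightarrow> lin_map P R f"
  by (simp add: coalg_hom_def)

lemma coalg_hom_apply:
  assumes "coalgebra P" "coalg_hom P R f" "p \<in> vcar P" "bf R R \<beta>"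
  shows "cdelta R (f p) \<beta> = cdelta P p (\<lambda>x y. \<beta> (f x) (f y))"
  using assms(2,3) tmap_apply[OF coalg_vspace[OF assms(1)] coalg_vspace[OF assms(1)]
      coalg_hom_lin[OF assms(2)] coalg_hom_lin[OF assms(2)] assms(4) lin_mem[OF coalg_delta[OF assms(1)] assms(3)]]
  by (simp add: coalg_hom_def)

lemma coalg_hom_conv:
  "coalgebra P \<Longrightarrow> coalg_hom P R f \<Longrightarrow> p \<in> vcar P \<Longrightarrow> lf R g \<Longrightarrow> lf R h \<Longrightarrow>
    conv R g h (f p) = conv P (\<lambda>x. g (f x)) (\<lambda>x. h (f x)) p"
  by (simp add: conv_def coalg_hom_apply bf_prod)

lemma coalg_hom_eps: "coalg_hom P R f \<Longrightarrow> p \<in> vcar P \<Longrightarrow> ceps R (f p) = ceps P p"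
  by (simp add: coalg_hom_def)

lemma coalg_hom_comp:
  assumes P: "coalgebra P" and R: "coalgebra R" and S: "coalgebra S"
    and f: "coalg_hom P R f" and g: "coalg_hom R S g"
  shows "coalg_hom P S (\<lambda>x. g (f x))"
proof (rule coalg_homI[OF P S lin_comp[OF coalg_hom_lin[OF g] coalg_hom_lin[OF f]] separates_all[OF coalg_vspace[OF S]]])
  fix p h k assume p: "p \<in> vcar P" and "h \<in> {f. lf S f}" "k \<in> {f. lf S f}"
  then have h: "lf S h" and k: "lf S k" by auto
  have fp: "f p \<in> vcar R" by (rule lin_mem[OF coalg_hom_lin[OF f] p])
  note gl = coalg_hom_lin[OF g]
  show "conv S h k (g (f p)) = conv P (\<lambda>x. h (g (f x))) (\<lambda>x. k (g (f x))) p"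
    using coalg_hom_conv[OF R g fp h k] coalg_hom_conv[OF P f p lin_comp[OF h gl] lin_comp[OF k gl]] by simp
next
  fix p assume p: "p \<in> vcar P"
  have fp: "f p \<in> vcar R" by (rule lin_mem[OF coalg_hom_lin[OF f] p])
  show "ceps S (g (f p)) = ceps P p"
    by (simp add: coalg_hom_eps[OF g fp] coalg_hom_eps[OF f p])
qed

section \<open>Algebras\<close>

lemma
  assumes "algebra Q"
  shows alg_vspace: "vspace Q" and alg_bilin: "bilin_map Q Q Q (amult Q)" and alg_one: "aone Q \<in> vcar Q"
    and alg_assoc: "x \<in> vcar Q \<Longrightarrow> y \<in> vcar Q \<Longrightarrow> z \<in> vcar Q \<Longrightarrow> amult Q (amult Q x y) z = amult Q x (amult Q y z)"
    and alg_one_left: "x \<in> vcar Q \<Longrightarrow> amult Q (aone Q) x = x"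
    and alg_one_right: "x \<in> vcar Q \<Longrightarrow> amult Q x (aone Q) = x"
    and alg_mult: "x \<in> vcar Q \<Longrightarrow> y \<in> vcar Q \<Longrightarrow> amult Q x y \<in> vcar Q"
  using assms by (auto simp: algebra_def intro: bilin_mem)

lemma
  assumes "alg_hom Q R f"
  shows alg_hom_lin: "lin_map Q R f" and alg_hom_one: "f (aone Q) = aone R"
    and alg_hom_mult: "x \<in> vcar Q \<Longrightarrow> y \<in> vcar Q \<Longrightarrow> f (amult Q x y) = amult R (f x) (f y)"
  using assms by (auto simp: alg_hom_def)

lemma alg_hom_comp: "alg_hom Q R f \<Longrightarrow> alg_hom R S g \<Longrightarrow> alg_hom Q S (\<lambda>x. g (f x))"
  unfolding alg_hom_def by (auto intro: lin_comp) (auto simp: lin_map_def)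

lemma tensor_alg_bilin:
  assumes Q: "bilin_map Q Q Q (amult Q)" and R: "bilin_map R R R (amult R)" and vs: "vspace Q" "vspace R"
    and Y: "Y \<in> vcar (tensor_space Q R)"
  shows "bilin_map Q R (tensor_space Q R) (\<lambda>x y. tlift Q R (tensor_space Q R)
            (\<lambda>x' y'. tens Q R (amult Q x x') (amult R y y')) Y)"
    and "x \<in> vcar Q \<Longrightarrow> y \<in> vcar R \<Longrightarrow>
      bilin_map Q R (tensor_space Q R) (\<lambda>x' y'. tens Q R (amult Q x x') (amult R y y'))"
proof -
  show b: "bilin_map Q R (tensor_space Q R) (\<lambda>x' y'. tens Q R (amult Q x x') (amult R y y'))"
    if "x \<in> vcar Q" "y \<in> vcar R" for x y
    by (rule tens_map_bilin[OF bilin_right[OF Q that(1)] bilin_right[OF R that(2)]])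
  show "bilin_map Q R (tensor_space Q R) (\<lambda>x y. tlift Q R (tensor_space Q R)
            (\<lambda>x' y'. tens Q R (amult Q x x') (amult R y y')) Y)"
  proof (rule bilin_mapI)
    fix y assume y: "y \<in> vcar R"
    show "lin_map Q (tensor_space Q R) (\<lambda>x. tlift Q R (tensor_space Q R)
            (\<lambda>x' y'. tens Q R (amult Q x x') (amult R y y')) Y)"
      by (rule lin_tlift_param[OF Y vs vs(1) vs b[OF _ y]])
        (auto intro!: lin_bilin_left[OF tens_bilin] bilin_left[OF Q] bilin_mem[OF R] y)
  next
    fix x assume x: "x \<in> vcar Q"
    show "lin_map R (tensor_space Q R) (\<lambda>y. tlift Q R (tensor_space Q R)
            (\<lambda>x' y'. tens Q R (amult Q x x') (amult R y y')) Y)"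
      by (rule lin_tlift_param[OF Y vs vs(2) vs b[OF x]])
        (auto intro!: lin_bilin_right[OF tens_bilin] bilin_left[OF R] bilin_mem[OF Q] x)
  qed
qed

text \<open>The product of two tensors becomes an iterated evaluation; in this form associativity
  and the unit laws of the tensor product are those of the factors.\<close>

lemma
  assumes Q: "bilin_map Q Q Q (amult Q)" and R: "bilin_map R R R (amult R)" and vs: "vspace Q" "vspace R"
    and X: "X \<in> vcar (tensor_space Q R)" and Y: "Y \<in> vcar (tensor_space Q R)"
  shows tensor_alg_mem: "amult (tensor_alg Q R) X Y \<in> vcar (tensor_space Q R)"
    and tensor_alg_apply: "bf Q R \<beta> \<Longrightarrow> amult (tensor_alg Q R) X Y \<beta>
      = X (\<lambda>a b. Y (\<lambda>c d. \<beta> (amult Q a c) (amult R b d)))"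
proof -
  note b = tensor_alg_bilin[OF Q R vs Y]
  show "amult (tensor_alg Q R) X Y \<in> vcar (tensor_space Q R)"
    by (simp add: tensor_alg_def tlift_mem[OF vs vspace_tensor b(1) X])
  assume \<beta>: "bf Q R \<beta>"
  show "amult (tensor_alg Q R) X Y \<beta> = X (\<lambda>a b. Y (\<lambda>c d. \<beta> (amult Q a c) (amult R b d)))"
    unfolding tensor_alg_def
    by (simp add: tlift_tensor_apply[OF vs b(1) X], rule tensor_apply_cong[OF X vs])
      (simp add: tlift_tensor_apply[OF vs b(2) Y] tens_apply[OF \<beta>])
qed

lemma tensor_algebra:
  assumes Q: "algebra Q" and R: "algebra R"
  shows "algebra (tensor_alg Q R)"
proof -
  note vs = alg_vspace[OF Q] alg_vspace[OF R]
  note mQ = alg_bilin[OF Q] and mR = alg_bilin[OF R]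
  note ap = tensor_alg_apply[OF mQ mR vs] and mem = tensor_alg_mem[OF mQ mR vs]
  let ?T = "tensor_space Q R"
  have bl: "bf Q R (\<lambda>a b. \<beta> (amult Q x a) (amult R y b))"
    if "bf Q R \<beta>" "x \<in> vcar Q" "y \<in> vcar R" for \<beta> x y
    using that by (auto intro: bf_map bilin_left[OF mQ] bilin_left[OF mR] bilin_right[OF mQ] bilin_right[OF mR])
  have bY: "bf Q R (\<lambda>a b. Y (\<lambda>c d. \<beta> (amult Q a c) (amult R b d)))"
    if "bf Q R \<beta>" "Y \<in> vcar ?T" for \<beta> Y
  proof (rule bilin_mapI)
    fix b assume b: "b \<in> vcar R"
    show "lf Q (\<lambda>a. Y (\<lambda>c d. \<beta> (amult Q a c) (amult R b d)))"
      by (rule lf_tensor_param[OF that(2) vs vs(1) bl[OF that(1) _ b]])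
        (auto intro!: lin_bilin_left[OF that(1)] bilin_left[OF mQ] bilin_mem[OF mR] b)
  next
    fix a assume a: "a \<in> vcar Q"
    show "lf R (\<lambda>b. Y (\<lambda>c d. \<beta> (amult Q a c) (amult R b d)))"
      by (rule lf_tensor_param[OF that(2) vs vs(2) bl[OF that(1) a]])
        (auto intro!: lin_bilin_right[OF that(1)] bilin_left[OF mR] bilin_mem[OF mQ] a)
  qed
  have left: "lin_map ?T ?T (\<lambda>X. amult (tensor_alg Q R) X Y)" if Y: "Y \<in> vcar ?T" for Y
    by (rule lin_tensorI[OF vspace_tensor vs mem[OF _ Y]], assumption,
        rule lin_cong[OF lf_apply vspace_tensor ap[OF _ Y, symmetric]])
  have right: "lin_map ?T ?T (\<lambda>Y. amult (tensor_alg Q R) X Y)" if X: "X \<in> vcar ?T" for X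
  proof (rule lin_tensorI[OF vspace_tensor vs mem[OF X]], assumption)
    fix \<beta> assume \<beta>: "bf Q R \<beta>"
    have "lf ?T (\<lambda>Y. X (\<lambda>a b. Y (\<lambda>c d. \<beta> (amult Q a c) (amult R b d))))"
      by (rule lf_tensor_param[OF X vs vspace_tensor bY[OF \<beta>] lf_apply])
    then show "lf ?T (\<lambda>Y. amult (tensor_alg Q R) X Y \<beta>)"
      by (rule lin_cong[OF _ vspace_tensor ap[OF X _ \<beta>, symmetric]])
  qed
  have one: "tens Q R (aone Q) (aone R) \<in> vcar ?T"
    by (intro tens_mem alg_one Q R)
  have assoc: "amult (tensor_alg Q R) (amult (tensor_alg Q R) X Y) Z
      = amult (tensor_alg Q R) X (amult (tensor_alg Q R) Y Z)"
    if X: "X \<in> vcar ?T" and Y: "Y \<in> vcar ?T" and Z: "Z \<in> vcar ?T" for X Y Z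
  proof (rule tensor_ext[OF mem[OF mem[OF X Y] Z] mem[OF X mem[OF Y Z]] vs])
    fix \<beta> assume \<beta>: "bf Q R \<beta>"
    have "amult (tensor_alg Q R) (amult (tensor_alg Q R) X Y) Z \<beta>
      = X (\<lambda>a b. Y (\<lambda>c d. Z (\<lambda>e f. \<beta> (amult Q (amult Q a c) e) (amult R (amult R b d) f))))"
      by (simp add: ap[OF mem[OF X Y] Z \<beta>] ap[OF X Y bY[OF \<beta> Z]])
    also have "\<dots> = X (\<lambda>a b. Y (\<lambda>c d. Z (\<lambda>e f. \<beta> (amult Q a (amult Q c e)) (amult R b (amult R d f)))))"
      by (intro tensor_apply_cong[OF X vs] tensor_apply_cong[OF Y vs] tensor_apply_cong[OF Z vs])
        (simp add: alg_assoc[OF Q] alg_assoc[OF R])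
    also have "\<dots> = X (\<lambda>a b. amult (tensor_alg Q R) Y Z (\<lambda>c d. \<beta> (amult Q a c) (amult R b d)))"
      by (intro tensor_apply_cong[OF X vs]) (simp add: ap[OF Y Z bl[OF \<beta>]])
    also have "\<dots> = amult (tensor_alg Q R) X (amult (tensor_alg Q R) Y Z) \<beta>"
      by (simp add: ap[OF X mem[OF Y Z] \<beta>])
    finally show "amult (tensor_alg Q R) (amult (tensor_alg Q R) X Y) Z \<beta>
      = amult (tensor_alg Q R) X (amult (tensor_alg Q R) Y Z) \<beta>" .
  qed
  have unit: "amult (tensor_alg Q R) (tens Q R (aone Q) (aone R)) X = X"
     "amult (tensor_alg Q R) X (tens Q R (aone Q) (aone R)) = X" if X: "X \<in> vcar ?T" for X
  proof -
    show "amult (tensor_alg Q R) (tens Q R (aone Q) (aone R)) X = X"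
    proof (rule tensor_ext[OF mem[OF one X] X vs])
      fix \<beta> assume \<beta>: "bf Q R \<beta>"
      show "amult (tensor_alg Q R) (tens Q R (aone Q) (aone R)) X \<beta> = X \<beta>"
        unfolding ap[OF one X \<beta>] tens_apply[OF bY[OF \<beta> X]]
        by (rule tensor_apply_cong[OF X vs]) (simp add: alg_one_left[OF Q] alg_one_left[OF R])
    qed
    show "amult (tensor_alg Q R) X (tens Q R (aone Q) (aone R)) = X"
    proof (rule tensor_ext[OF mem[OF X one] X vs])
      fix \<beta> assume \<beta>: "bf Q R \<beta>"
      show "amult (tensor_alg Q R) X (tens Q R (aone Q) (aone R)) \<beta> = X \<beta>"
        unfolding ap[OF X one \<beta>]
        by (rule tensor_apply_cong[OF X vs])
          (simp add: tens_apply[OF bl[OF \<beta>]] alg_one_right[OF Q] alg_one_right[OF R])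
    qed
  qed
  show ?thesis
    unfolding algebra_def using one assoc unit by (auto intro!: bilin_mapI left right)
qed

lemma tmap_alg_hom:
  assumes Q: "algebra Q" and R: "algebra R" and Q': "algebra Q'" and R': "algebra R'"
    and f: "alg_hom Q Q' f" and g: "alg_hom R R' g"
  shows "alg_hom (tensor_alg Q R) (tensor_alg Q' R') (tmap Q R Q' R' f g)"
proof -
  note vs = alg_vspace[OF Q] alg_vspace[OF R] and vs' = alg_vspace[OF Q'] alg_vspace[OF R']
  note fl = alg_hom_lin[OF f] and gl = alg_hom_lin[OF g]
  note tl = tmap_lin[OF vs fl gl] and tm = tmap_mem[OF vs fl gl] and ta = tmap_apply[OF vs fl gl]
  note ap = tensor_alg_apply[OF alg_bilin[OF Q] alg_bilin[OF R] vs]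
    and mem = tensor_alg_mem[OF alg_bilin[OF Q] alg_bilin[OF R] vs]
  note ap' = tensor_alg_apply[OF alg_bilin[OF Q'] alg_bilin[OF R'] vs']
    and mem' = tensor_alg_mem[OF alg_bilin[OF Q'] alg_bilin[OF R'] vs']
  have "tmap Q R Q' R' f g (amult (tensor_alg Q R) X Y)
      = amult (tensor_alg Q' R') (tmap Q R Q' R' f g X) (tmap Q R Q' R' f g Y)"
    if X: "X \<in> vcar (tensor_space Q R)" and Y: "Y \<in> vcar (tensor_space Q R)" for X Y
  proof (rule tensor_ext[OF tm[OF mem[OF X Y]] mem'[OF tm[OF X] tm[OF Y]] vs'])
    fix \<beta> assume \<beta>: "bf Q' R' \<beta>"
    have bl: "bf Q' R' (\<lambda>a b. \<beta> (amult Q' x a) (amult R' y b))"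
      if "x \<in> vcar Q'" "y \<in> vcar R'" for x y
      using that by (auto intro: bf_map[OF \<beta>] bilin_left[OF alg_bilin[OF Q']] bilin_left[OF alg_bilin[OF R']]
        bilin_right[OF alg_bilin[OF Q']] bilin_right[OF alg_bilin[OF R']])
    have bY: "bf Q' R' (\<lambda>a b. Z (\<lambda>c d. \<beta> (amult Q' a c) (amult R' b d)))"
      if "Z \<in> vcar (tensor_space Q' R')" for Z
    proof (rule bilin_mapI)
      fix b assume b: "b \<in> vcar R'"
      show "lf Q' (\<lambda>a. Z (\<lambda>c d. \<beta> (amult Q' a c) (amult R' b d)))"
        by (rule lf_tensor_param[OF that vs' vs'(1) bl[OF _ b]])
          (auto intro!: lin_bilin_left[OF \<beta>] bilin_left[OF alg_bilin[OF Q']] alg_mult[OF R'] b)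
    next
      fix a assume a: "a \<in> vcar Q'"
      show "lf R' (\<lambda>b. Z (\<lambda>c d. \<beta> (amult Q' a c) (amult R' b d)))"
        by (rule lf_tensor_param[OF that vs' vs'(2) bl[OF a]])
          (auto intro!: lin_bilin_right[OF \<beta>] bilin_left[OF alg_bilin[OF R']] alg_mult[OF Q'] a)
    qed
    have "tmap Q R Q' R' f g (amult (tensor_alg Q R) X Y) \<beta>
      = X (\<lambda>a b. Y (\<lambda>c d. \<beta> (f (amult Q a c)) (g (amult R b d))))"
      by (simp add: ta[OF \<beta> mem[OF X Y]] ap[OF X Y bf_map[OF \<beta> fl gl]])
    also have "\<dots> = X (\<lambda>a b. Y (\<lambda>c d. \<beta> (amult Q' (f a) (f c)) (amult R' (g b) (g d))))"
      by (intro tensor_apply_cong[OF X vs] tensor_apply_cong[OF Y vs])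
        (simp add: alg_hom_mult[OF f] alg_hom_mult[OF g])
    also have "\<dots> = X (\<lambda>a b. tmap Q R Q' R' f g Y (\<lambda>c d. \<beta> (amult Q' (f a) c) (amult R' (g b) d)))"
      by (intro tensor_apply_cong[OF X vs]) (simp add: ta[OF bl Y] lin_mem[OF fl] lin_mem[OF gl])
    also have "\<dots> = amult (tensor_alg Q' R') (tmap Q R Q' R' f g X) (tmap Q R Q' R' f g Y) \<beta>"
      by (simp add: ap'[OF tm[OF X] tm[OF Y] \<beta>] ta[OF bY[OF tm[OF Y]] X])
    finally show "tmap Q R Q' R' f g (amult (tensor_alg Q R) X Y) \<beta>
      = amult (tensor_alg Q' R') (tmap Q R Q' R' f g X) (tmap Q R Q' R' f g Y) \<beta>" .
  qed
  moreover have "tmap Q R Q' R' f g (tens Q R (aone Q) (aone R)) = tens Q' R' (aone Q') (aone R')"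
    by (simp add: tmap_tens[OF vs fl gl] alg_one Q R alg_hom_one[OF f] alg_hom_one[OF g])
  ultimately show ?thesis
    unfolding alg_hom_def using tl by auto
qed

section \<open>The tensor product of coalgebras\<close>

abbreviation (input) prodf :: "('u \<Rightarrow> 'k::field) \<Rightarrow> ('v \<Rightarrow> 'k) \<Rightarrow> ('u, 'v, 'k) tensor \<Rightarrow> 'k" where
  "prodf f g \<equiv> \<lambda>Z. Z (\<lambda>v w. f v * g w)"

text \<open>The tensor product coalgebra: \<Delta>(p \<otimes> r) arises from \<Delta>(p) \<otimes>
  \<Delta>(r) by exchanging the two middle factors. It is the test coalgebra on which two bilinear
  maps into a coalgebra are compared.\<close>

definition tcoalg :: "('k::field, 'u::ab_group_add) coalg \<Rightarrow> ('k, 'v::ab_group_add) coalg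
    \<Rightarrow> ('k, ('u, 'v, 'k) tensor) coalg" where
  "tcoalg P R =
     \<lparr>vcar = vcar (tensor_space P R), vscale = fscale,
      cdelta = tlift P R (tensor_space (tensor_space P R) (tensor_space P R))
        (\<lambda>p r. tlift P P (tensor_space (tensor_space P R) (tensor_space P R))
          (\<lambda>a b. tlift R R (tensor_space (tensor_space P R) (tensor_space P R))
            (\<lambda>c d. tens (tensor_space P R) (tensor_space P R) (tens P R a c) (tens P R b d)) (cdelta R r)) (cdelta P p)),
      ceps = (\<lambda>X. X (\<lambda>p r. ceps P p * ceps R r))\<rparr>"

lemma tcoalg_simps [simp]: "vcar (tcoalg Q R) = vcar (tensor_space Q R)"
  "vscale (tcoalg Q R) = fscale" "ceps (tcoalg Q R) = (\<lambda>X. X (\<lambda>p r. ceps Q p * ceps R r))"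
  by (simp_all add: tcoalg_def)

lemmas tcoalg_cong [simp] =
  vsp_cong_left[of "tcoalg Q R" "tensor_space Q R" for Q R, simplified]
  vsp_cong_right[of "tcoalg Q R" "tensor_space Q R" for Q R, simplified]

context
  fixes P :: "('k::field, 'u::ab_group_add) coalg" and R :: "('k, 'v::ab_group_add) coalg"
  assumes P: "coalgebra P" and R: "coalgebra R"
begin

lemma tcoalg_aux1:
  assumes "a \<in> vcar P" "b \<in> vcar P"
  shows "bilin_map R R (tensor_space (tensor_space P R) (tensor_space P R)) (\<lambda>c d. tens (tensor_space P R) (tensor_space P R) (tens P R a c) (tens P R b d))"
  by (rule tens_map_bilin) (rule tens_right, fact)+

lemma tcoalg_aux2:
  assumes Y: "Y \<in> vcar (tensor_space R R)"
  shows "bilin_map P P (tensor_space (tensor_space P R) (tensor_space P R)) (\<lambda>a b. tlift R R (tensor_space (tensor_space P R) (tensor_space P R)) (\<lambda>c d. tens (tensor_space P R) (tensor_space P R) (tens P R a c) (tens P R b d)) Y)"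
proof (rule bilin_mapI)
  note vs = coalg_vspace[OF P] coalg_vspace[OF R]
  fix b assume b: "b \<in> vcar P"
  show "lin_map P (tensor_space (tensor_space P R) (tensor_space P R)) (\<lambda>a. tlift R R (tensor_space (tensor_space P R) (tensor_space P R)) (\<lambda>c d. tens (tensor_space P R) (tensor_space P R) (tens P R a c) (tens P R b d)) Y)"
    by (rule lin_tlift_param[OF Y vs(2,2,1) vspace_tensor vspace_tensor tcoalg_aux1[OF _ b]])
      (auto intro!: lin_bilin_left[OF tens_bilin] tens_left tens_mem b)
next
  note vs = coalg_vspace[OF P] coalg_vspace[OF R]
  fix a assume a: "a \<in> vcar P"
  show "lin_map P (tensor_space (tensor_space P R) (tensor_space P R)) (\<lambda>b. tlift R R (tensor_space (tensor_space P R) (tensor_space P R)) (\<lambda>c d. tens (tensor_space P R) (tensor_space P R) (tens P R a c) (tens P R b d)) Y)"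
    by (rule lin_tlift_param[OF Y vs(2,2,1) vspace_tensor vspace_tensor tcoalg_aux1[OF a]])
      (auto intro!: lin_bilin_right[OF tens_bilin] tens_left tens_mem a)
qed

lemma tcoalg_aux3:
  "bilin_map P R (tensor_space (tensor_space P R) (tensor_space P R)) (\<lambda>p r. tlift P P (tensor_space (tensor_space P R) (tensor_space P R)) (\<lambda>a b. tlift R R (tensor_space (tensor_space P R) (tensor_space P R))
      (\<lambda>c d. tens (tensor_space P R) (tensor_space P R) (tens P R a c) (tens P R b d)) (cdelta R r)) (cdelta P p))"
proof (rule bilin_mapI)
  note vs = coalg_vspace[OF P] coalg_vspace[OF R]
  fix r assume r: "r \<in> vcar R"
  note Dr = lin_mem[OF coalg_delta[OF R] r]
  show "lin_map P (tensor_space (tensor_space P R) (tensor_space P R)) (\<lambda>p. tlift P P (tensor_space (tensor_space P R) (tensor_space P R)) (\<lambda>a b. tlift R R (tensor_space (tensor_space P R) (tensor_space P R))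
      (\<lambda>c d. tens (tensor_space P R) (tensor_space P R) (tens P R a c) (tens P R b d)) (cdelta R r)) (cdelta P p))"
    by (rule lin_comp[OF tlift_lin[OF vs(1,1) vspace_tensor tcoalg_aux2[OF Dr]] coalg_delta[OF P]])
next
  note vs = coalg_vspace[OF P] coalg_vspace[OF R]
  fix p assume p: "p \<in> vcar P"
  note Dp = lin_mem[OF coalg_delta[OF P] p]
  show "lin_map R (tensor_space (tensor_space P R) (tensor_space P R)) (\<lambda>r. tlift P P (tensor_space (tensor_space P R) (tensor_space P R)) (\<lambda>a b. tlift R R (tensor_space (tensor_space P R) (tensor_space P R))
      (\<lambda>c d. tens (tensor_space P R) (tensor_space P R) (tens P R a c) (tens P R b d)) (cdelta R r)) (cdelta P p))"
    by (rule lin_tlift_param[OF Dp vs(1,1,2) vspace_tensor vspace_tensor tcoalg_aux2[OF lin_mem[OF coalg_delta[OF R]]]], assumption)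
      (rule lin_comp[OF tlift_lin[OF vs(2,2) vspace_tensor tcoalg_aux1] coalg_delta[OF R]])
qed

lemma tcoalg_delta: "lin_map (tensor_space P R) (tensor_space (tensor_space P R) (tensor_space P R)) (cdelta (tcoalg P R))"
  unfolding tcoalg_def
  using tlift_lin[OF coalg_vspace[OF P] coalg_vspace[OF R] vspace_tensor tcoalg_aux3] by simp

lemma tcoalg_delta_tens:
  assumes p: "p \<in> vcar P" and r: "r \<in> vcar R" and \<beta>: "bf (tensor_space P R) (tensor_space P R) \<beta>"
  shows "cdelta (tcoalg P R) (tens P R p r) \<beta>
    = cdelta P p (\<lambda>a b. cdelta R r (\<lambda>c d. \<beta> (tens P R a c) (tens P R b d)))"
proof -
  note vs = coalg_vspace[OF P] coalg_vspace[OF R]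
  note Dp = lin_mem[OF coalg_delta[OF P] p] and Dr = lin_mem[OF coalg_delta[OF R] r]
  show ?thesis
    unfolding tcoalg_def
    by (simp add: tlift_tens[OF vs vspace_tensor tcoalg_aux3 p r]
        tlift_tensor_apply[OF vs(1,1) tcoalg_aux2[OF Dr] Dp], rule tensor_apply_cong[OF Dp vs(1,1)])
      (simp add: tlift_tensor_apply[OF vs(2,2) tcoalg_aux1 Dr] tens_apply[OF \<beta>])
qed

text \<open>On products of functionals convolution acts factorwise. Since such products separate,
  the coalgebra laws pass from the factors to the tensor product.\<close>

lemma tcoalg_conv_prod:
  assumes f: "lf P f1" "lf R f2" and g: "lf P g1" "lf R g2" and X: "X \<in> vcar (tensor_space P R)"
  shows "conv (tcoalg P R) (\<lambda>Z. Z (\<lambda>v w. f1 v * f2 w)) (\<lambda>Z. Z (\<lambda>v w. g1 v * g2 w)) X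
    = X (\<lambda>v w. conv P f1 g1 v * conv R f2 g2 w)"
proof (rule lin_tensor_eqI[OF _ lf_apply coalg_vspace[OF P] coalg_vspace[OF R] _ X])
  note vs = coalg_vspace[OF P] coalg_vspace[OF R]
  show "lf (tensor_space P R) (conv (tcoalg P R) (\<lambda>Z. Z (\<lambda>v w. f1 v * f2 w)) (\<lambda>Z. Z (\<lambda>v w. g1 v * g2 w)))"
    using lf_conv[of "tcoalg P R"] tcoalg_delta by simp
  fix p r assume p: "p \<in> vcar P" and r: "r \<in> vcar R"
  note Dp = lin_mem[OF coalg_delta[OF P] p] and Dr = lin_mem[OF coalg_delta[OF R] r]
  have "conv (tcoalg P R) (\<lambda>Z. Z (\<lambda>v w. f1 v * f2 w)) (\<lambda>Z. Z (\<lambda>v w. g1 v * g2 w)) (tens P R p r)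
    = cdelta P p (\<lambda>a b. cdelta R r (\<lambda>c d. (f1 a * f2 c) * (g1 b * g2 d)))"
    unfolding conv_def
    by (simp add: tcoalg_delta_tens[OF p r bf_prod[OF lf_apply lf_apply]] tens_apply[OF bf_prod[OF f]] tens_apply[OF bf_prod[OF g]])
  also have "\<dots> = cdelta P p (\<lambda>a b. (f1 a * g1 b) * conv R f2 g2 r)"
    unfolding conv_def tensor_scale_left[OF Dr vs(2,2) bf_prod[OF f(2) g(2)], symmetric]
    by (simp add: mult.assoc mult.left_commute)
  also have "\<dots> = conv P f1 g1 p * conv R f2 g2 r"
    by (simp add: tensor_scale_right[OF Dp vs(1,1) bf_prod[OF f(1) g(1)]] conv_def)
  finally show "conv (tcoalg P R) (\<lambda>Z. Z (\<lambda>v w. f1 v * f2 w)) (\<lambda>Z. Z (\<lambda>v w. g1 v * g2 w)) (tens P R p r)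
    = tens P R p r (\<lambda>v w. conv P f1 g1 v * conv R f2 g2 w)"
    by (simp add: tens_apply[OF bf_prod[OF lf_conv[OF coalg_delta[OF P]] lf_conv[OF coalg_delta[OF R]]]])
qed

lemma tcoalg_coalgebra: "coalgebra (tcoalg P R)"
proof (rule coalgebraI_conv)
  note vs = coalg_vspace[OF P] coalg_vspace[OF R]
  note lc = lf_conv[OF coalg_delta[OF P]] lf_conv[OF coalg_delta[OF R]]
  let ?F = "{prodf f g | f g. f \<in> {f. lf P f} \<and> g \<in> {f. lf R f}}"
  show "vspace (tcoalg P R)" by simp
  show "lin_map (tcoalg P R) (tensor_space (tcoalg P R) (tcoalg P R)) (cdelta (tcoalg P R))"
    using tcoalg_delta by simp
  show "lf (tcoalg P R) (ceps (tcoalg P R))" by (simp add: lf_apply)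
  show "separates (tcoalg P R) ?F"
    using separates_tensor[OF vs separates_all[OF vs(1)] separates_all[OF vs(2)]] by (simp add: separates_def)
  fix X f assume "X \<in> vcar (tcoalg P R)" and "f \<in> ?F"
  then obtain f1 f2 where f: "f = (\<lambda>Z. Z (\<lambda>v w. f1 v * f2 w))" "lf P f1" "lf R f2"
    and X: "X \<in> vcar (tensor_space P R)" by auto
  show "conv (tcoalg P R) (ceps (tcoalg P R)) f X = f X"
    unfolding f(1) using tcoalg_conv_prod[OF coalg_eps[OF P] coalg_eps[OF R] f(2,3) X]
    by (simp, intro tensor_apply_cong[OF X vs]) (simp add: conv_eps_left P R f)
  show "conv (tcoalg P R) f (ceps (tcoalg P R)) X = f X"
    unfolding f(1) using tcoalg_conv_prod[OF f(2,3) coalg_eps[OF P] coalg_eps[OF R] X]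
    by (simp, intro tensor_apply_cong[OF X vs]) (simp add: conv_eps_right P R f)
  fix g h assume "g \<in> ?F" "h \<in> ?F"
  then obtain g1 g2 h1 h2 where g: "g = (\<lambda>Z. Z (\<lambda>v w. g1 v * g2 w))" "lf P g1" "lf R g2"
    and h: "h = (\<lambda>Z. Z (\<lambda>v w. h1 v * h2 w))" "lf P h1" "lf R h2" by auto
  have D: "lin_map (tcoalg P R) (tensor_space (tcoalg P R) (tcoalg P R)) (cdelta (tcoalg P R))"
    using tcoalg_delta by simp
  have "conv (tcoalg P R) (conv (tcoalg P R) f g) h X
    = conv (tcoalg P R) (\<lambda>Z. Z (\<lambda>v w. conv P f1 g1 v * conv R f2 g2 w)) h X"
    by (rule conv_cong[OF D]) (use X in \<open>auto simp: f(1) g(1) tcoalg_conv_prod[OF f(2,3) g(2,3)]\<close>)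
  also have "\<dots> = X (\<lambda>v w. conv P (conv P f1 g1) h1 v * conv R (conv R f2 g2) h2 w)"
    unfolding h(1) by (rule tcoalg_conv_prod[OF lc h(2,3) X])
  also have "\<dots> = X (\<lambda>v w. conv P f1 (conv P g1 h1) v * conv R f2 (conv R g2 h2) w)"
    by (rule tensor_apply_cong[OF X vs]) (simp add: conv_assoc[OF P] conv_assoc[OF R] f g h)
  also have "\<dots> = conv (tcoalg P R) f (\<lambda>Z. Z (\<lambda>v w. conv P g1 h1 v * conv R g2 h2 w)) X"
    unfolding f(1) by (rule tcoalg_conv_prod[OF f(2,3) lc X, symmetric])
  also have "\<dots> = conv (tcoalg P R) f (conv (tcoalg P R) g h) X"
    by (rule conv_cong[OF D]) (use X in \<open>auto simp: g(1) h(1) tcoalg_conv_prod[OF g(2,3) h(2,3)]\<close>)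
  finally show "conv (tcoalg P R) (conv (tcoalg P R) f g) h X = conv (tcoalg P R) f (conv (tcoalg P R) g h) X" .
qed

lemma tcoalg_homI:
  assumes S: "coalgebra S" and f: "lin_map (tensor_space P R) S f" and F: "separates S F"
    and 1: "\<And>p r g h. p \<in> vcar P \<Longrightarrow> r \<in> vcar R \<Longrightarrow> g \<in> F \<Longrightarrow> h \<in> F \<Longrightarrow>
      conv S g h (f (tens P R p r)) =
        cdelta P p (\<lambda>a b. cdelta R r (\<lambda>c d. g (f (tens P R a c)) * h (f (tens P R b d))))"
    and 2: "\<And>p r. p \<in> vcar P \<Longrightarrow> r \<in> vcar R \<Longrightarrow> ceps S (f (tens P R p r)) = ceps P p * ceps R r"
  shows "coalg_hom (tcoalg P R) S f"
proof (rule coalg_homI[OF tcoalg_coalgebra S _ F])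
  note vs = coalg_vspace[OF P] coalg_vspace[OF R]
  show "lin_map (tcoalg P R) S f" using f by simp
  fix X assume "X \<in> vcar (tcoalg P R)"
  then have X: "X \<in> vcar (tensor_space P R)" by simp
  show "ceps S (f X) = ceps (tcoalg P R) X"
    by (simp, rule lin_tensor_eqI[OF lin_comp[OF coalg_eps[OF S] f] lf_apply vs _ X])
      (simp add: 2 tens_apply[OF bf_prod[OF coalg_eps[OF P] coalg_eps[OF R]]])
  fix g h assume g: "g \<in> F" and h: "h \<in> F"
  note lgh = lin_comp[OF separatesD[OF F g] f] lin_comp[OF separatesD[OF F h] f]
  have c: "lf (tensor_space P R) (conv (tcoalg P R) (\<lambda>x. g (f x)) (\<lambda>x. h (f x)))"
    using lf_conv[of "tcoalg P R"] tcoalg_delta by simp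
  show "conv S g h (f X) = conv (tcoalg P R) (\<lambda>x. g (f x)) (\<lambda>x. h (f x)) X"
    by (rule lin_tensor_eqI[OF lin_comp[OF lf_conv[OF coalg_delta[OF S]] f] c vs _ X])
      (simp add: 1[OF _ _ g h] conv_def[of "tcoalg P R"] tcoalg_delta_tens[OF _ _ bf_prod[OF lgh]])
qed

end

lemma tcoalg_tmap_hom:
  assumes P: "coalgebra P" and R: "coalgebra R" and P': "coalgebra P'" and R': "coalgebra R'"
    and f: "coalg_hom P P' f" and g: "coalg_hom R R' g"
  shows "coalg_hom (tcoalg P R) (tcoalg P' R') (tmap P R P' R' f g)"
proof -
  note vs = coalg_vspace[OF P] coalg_vspace[OF R] and vs' = coalg_vspace[OF P'] coalg_vspace[OF R']
  note fl = coalg_hom_lin[OF f] and gl = coalg_hom_lin[OF g]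
  let ?F = "{prodf f g | f g. f \<in> {f. lf P' f} \<and> g \<in> {f. lf R' f}}"
  show ?thesis
  proof (rule tcoalg_homI[OF P R tcoalg_coalgebra[OF P' R']])
    show "lin_map (tensor_space P R) (tcoalg P' R') (tmap P R P' R' f g)"
      using tmap_lin[OF vs fl gl] by simp
    show "separates (tcoalg P' R') ?F"
      using separates_tensor[OF vs' separates_all[OF vs'(1)] separates_all[OF vs'(2)]] by (simp add: separates_def)
    fix p r assume p: "p \<in> vcar P" and r: "r \<in> vcar R"
    note Dp = lin_mem[OF coalg_delta[OF P] p] and Dr = lin_mem[OF coalg_delta[OF R] r]
    note mem = lin_mem[OF fl p] lin_mem[OF gl r]
    show "ceps (tcoalg P' R') (tmap P R P' R' f g (tens P R p r)) = ceps P p * ceps R r"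
      using mem by (simp add: tmap_tens[OF vs fl gl p r]
        tens_apply[OF bf_prod[OF coalg_eps[OF P'] coalg_eps[OF R']]] coalg_hom_eps[OF f p] coalg_hom_eps[OF g r])
    fix h k assume "h \<in> ?F" "k \<in> ?F"
    then obtain h1 h2 k1 k2 where h: "h = (\<lambda>Z. Z (\<lambda>v w. h1 v * h2 w))" "lf P' h1" "lf R' h2"
      and k: "k = (\<lambda>Z. Z (\<lambda>v w. k1 v * k2 w))" "lf P' k1" "lf R' k2" by auto
    note bfs = bf_prod[OF h(2,3)] bf_prod[OF k(2,3)]
    have "conv (tcoalg P' R') h k (tmap P R P' R' f g (tens P R p r))
      = conv P' h1 k1 (f p) * conv R' h2 k2 (g r)"
      unfolding h(1) k(1) tmap_tens[OF vs fl gl p r]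
        tcoalg_conv_prod[OF P' R' h(2,3) k(2,3) tens_mem[OF mem]]
      by (rule tens_apply[OF bf_prod[OF lf_conv[OF coalg_delta[OF P']] lf_conv[OF coalg_delta[OF R']]]])
    also have "\<dots> = conv P (\<lambda>x. h1 (f x)) (\<lambda>x. k1 (f x)) p * conv R (\<lambda>x. h2 (g x)) (\<lambda>x. k2 (g x)) r"
      by (simp add: coalg_hom_conv[OF P f p h(2) k(2)] coalg_hom_conv[OF R g r h(3) k(3)])
    also have "\<dots> = cdelta P p (\<lambda>a b. (h1 (f a) * k1 (f b)) * conv R (\<lambda>x. h2 (g x)) (\<lambda>x. k2 (g x)) r)"
      using tensor_scale_right[OF Dp vs(1,1) bf_prod[OF lin_comp[OF h(2) fl] lin_comp[OF k(2) fl]]]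
      by (simp add: conv_def)
    also have "\<dots> = cdelta P p (\<lambda>a b. cdelta R r (\<lambda>c d. (h1 (f a) * k1 (f b)) * (h2 (g c) * k2 (g d))))"
      using tensor_scale_left[OF Dr vs(2,2) bf_prod[OF lin_comp[OF h(3) gl] lin_comp[OF k(3) gl]]]
      by (simp add: conv_def)
    also have "\<dots> = cdelta P p (\<lambda>a b. cdelta R r (\<lambda>c d. h (tmap P R P' R' f g (tens P R a c)) * k (tmap P R P' R' f g (tens P R b d))))"
      by (intro tensor_apply_cong[OF Dp vs(1,1)] tensor_apply_cong[OF Dr vs(2,2)])
        (simp add: tmap_tens[OF vs fl gl] h(1) k(1) tens_apply[OF bfs(1)] tens_apply[OF bfs(2)] mult_ac)
    finally show "conv (tcoalg P' R') h k (tmap P R P' R' f g (tens P R p r))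
      = cdelta P p (\<lambda>a b. cdelta R r (\<lambda>c d. h (tmap P R P' R' f g (tens P R a c)) * k (tmap P R P' R' f g (tens P R b d))))" .
  qed
qed

section \<open>Bialgebras and antipodes\<close>

lemma trilin_coalg_of [simp]: "trilin (coalg_of B) (coalg_of B) (coalg_of B) = trilin B B B"
  by (simp add: trilin_def fun_eq_iff)

lemma
  assumes "bialgebra B"
  shows bi_alg: "algebra B" and bi_coalg: "coalgebra (coalg_of B)"
    and bi_delta_hom: "alg_hom B (tensor_alg B B) (bdelta B)"
    and bi_eps_hom: "alg_hom B (ground :: ('k::field, 'k) alg) (beps B)"
  using assms by (auto simp: bialgebra_def)

lemma
  assumes B: "bialgebra B"
  shows bi_vspace: "vspace B" and bi_delta: "lin_map B (tensor_space B B) (bdelta B)" and bi_eps: "lf B (beps B)"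
    and bi_eps_mult: "x \<in> vcar B \<Longrightarrow> y \<in> vcar B \<Longrightarrow> beps B (amult B x y) = beps B x * beps B y"
    and bi_eps_one: "beps B (aone B) = 1"
    and bi_delta_one: "bdelta B (aone B) = tens B B (aone B) (aone B)"
  using alg_vspace[OF bi_alg[OF B]] coalg_delta[OF bi_coalg[OF B]] coalg_eps[OF bi_coalg[OF B]]
    alg_hom_mult[OF bi_eps_hom[OF B]] alg_hom_one[OF bi_eps_hom[OF B]] alg_hom_one[OF bi_delta_hom[OF B]]
  by simp_all

lemma bi_delta_mult:
  assumes B: "bialgebra B" and x: "x \<in> vcar B" and y: "y \<in> vcar B" and \<beta>: "bf B B \<beta>"
  shows "bdelta B (amult B x y) \<beta> = bdelta B x (\<lambda>a b. bdelta B y (\<lambda>c d. \<beta> (amult B a c) (amult B b d)))"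
  unfolding alg_hom_mult[OF bi_delta_hom[OF B] x y]
  by (rule tensor_alg_apply[OF alg_bilin alg_bilin]) (auto intro: bi_alg bi_vspace B lin_mem[OF bi_delta[OF B]] x y \<beta>)

lemmas bi_coassoc = coassoc[OF bi_coalg, simplified]
lemmas bi_counit_left = counit_left[OF bi_coalg, simplified]
lemmas bi_counit_right = counit_right[OF bi_coalg, simplified]

lemma bialg_hom_comp:
  assumes "bialgebra B" "bialgebra D" "bialgebra E" "bialg_hom B D f" "bialg_hom D E g"
  shows "bialg_hom B E (\<lambda>x. g (f x))"
  using assms coalg_hom_comp[OF bi_coalg bi_coalg bi_coalg] alg_hom_comp
  by (auto simp: bialg_hom_def)

text \<open>The bialgebra axiom read as a property of the multiplication instead of the
  comultiplication.\<close>

lemma mult_coalg_hom: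
  assumes B: "bialgebra B"
  shows "coalg_hom (tcoalg (coalg_of B) (coalg_of B)) (coalg_of B) (tlift B B B (amult B))"
proof (rule tcoalg_homI[OF bi_coalg[OF B] bi_coalg[OF B] bi_coalg[OF B] _ separates_all])
  note vs = bi_vspace[OF B] and m = alg_bilin[OF bi_alg[OF B]]
  note t = tlift_tens[OF vs vs vs m]
  show "lin_map (tensor_space (coalg_of B) (coalg_of B)) (coalg_of B) (tlift B B B (amult B))"
    using tlift_lin[OF vs vs vs m] by simp
  show "vspace (coalg_of B)" using vs by simp
  fix x y assume "x \<in> vcar (coalg_of B)" "y \<in> vcar (coalg_of B)"
  then have x: "x \<in> vcar B" and y: "y \<in> vcar B" by auto
  note Dx = lin_mem[OF bi_delta[OF B] x] and Dy = lin_mem[OF bi_delta[OF B] y]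
  show "ceps (coalg_of B) (tlift B B B (amult B) (tens (coalg_of B) (coalg_of B) x y))
      = ceps (coalg_of B) x * ceps (coalg_of B) y"
    by (simp add: t x y bi_eps_mult[OF B])
  fix g h assume "g \<in> {f. lf (coalg_of B) f}" "h \<in> {f. lf (coalg_of B) f}"
  then have g: "lf B g" and h: "lf B h" by auto
  show "conv (coalg_of B) g h (tlift B B B (amult B) (tens (coalg_of B) (coalg_of B) x y)) =
       cdelta (coalg_of B) x (\<lambda>a b. cdelta (coalg_of B) y (\<lambda>c d.
         g (tlift B B B (amult B) (tens (coalg_of B) (coalg_of B) a c)) *
         h (tlift B B B (amult B) (tens (coalg_of B) (coalg_of B) b d))))"
    by (simp add: t x y conv_def bi_delta_mult[OF B x y bf_prod[OF g h]])
      (intro tensor_apply_cong[OF Dx vs vs] tensor_apply_cong[OF Dy vs vs], simp add: t)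
qed

text \<open>In the convolution algebra Hom(C, Q) the map \<open>L\<close> is a left and
  \<open>N\<close> a right inverse of \<open>M\<close>, so both equal the triple product of
  \<open>L\<close>, \<open>M\<close> and \<open>N\<close>. Each equation is stated after applying a
  functional of \<open>Q\<close>.\<close>

lemma conv_inverse_unique:
  assumes C: "coalgebra C" and Q: "algebra Q"
    and lin: "lin_map C Q L" "lin_map C Q M" "lin_map C Q N"
    and LM: "\<And>c \<phi>. c \<in> vcar C \<Longrightarrow> lf Q \<phi> \<Longrightarrow> cdelta C c (\<lambda>x y. \<phi> (amult Q (L x) (M y))) = ceps C c * \<phi> (aone Q)"
    and MN: "\<And>c \<phi>. c \<in> vcar C \<Longrightarrow> lf Q \<phi> \<Longrightarrow> cdelta C c (\<lambda>x y. \<phi> (amult Q (M x) (N y))) = ceps C c * \<phi> (aone Q)"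
    and c: "c \<in> vcar C"
  shows "L c = N c"
proof (rule functional_sep[OF alg_vspace[OF Q] lin_mem[OF lin(1) c] lin_mem[OF lin(3) c]])
  fix \<phi> assume \<phi>: "lf Q \<phi>"
  note vs = coalg_vspace[OF C] and Dc = lin_mem[OF coalg_delta[OF C] c]
  note m = alg_bilin[OF Q]
  note mem = lin_mem[OF lin(1)] lin_mem[OF lin(2)] lin_mem[OF lin(3)] alg_mult[OF Q]
  have \<phi>l: "lf Q (\<lambda>q. \<phi> (amult Q q z))" and \<phi>r: "lf Q (\<lambda>q. \<phi> (amult Q z q))" if "z \<in> vcar Q" for z
    by (rule lin_comp[OF \<phi> bilin_left[OF m that]], rule lin_comp[OF \<phi> bilin_right[OF m that]])
  have tri: "trilin C C C (\<lambda>x y z. \<phi> (amult Q (amult Q (L x) (M y)) (N z)))"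
    by (rule trilinI; rule lin_comp[OF \<phi>])
      (auto intro!: lin_bilin_left[OF m] lin_bilin_right[OF m] lin mem)
  have "\<phi> (N c) = cdelta C c (\<lambda>x y. ceps C x * \<phi> (N y))"
    using counit_left[OF C c lin_comp[OF \<phi> lin(3)]] by simp
  also have "\<dots> = cdelta C c (\<lambda>x y. cdelta C x (\<lambda>u v. \<phi> (amult Q (amult Q (L u) (M v)) (N y))))"
    by (rule tensor_apply_cong[OF Dc vs vs]) (simp add: LM[OF _ \<phi>l] mem alg_one_left[OF Q])
  also have "\<dots> = cdelta C c (\<lambda>x y. cdelta C y (\<lambda>u v. \<phi> (amult Q (amult Q (L x) (M u)) (N v))))"
    by (rule coassoc[OF C c tri])
  also have "\<dots> = cdelta C c (\<lambda>x y. cdelta C y (\<lambda>u v. \<phi> (amult Q (L x) (amult Q (M u) (N v)))))"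
    by (intro tensor_apply_cong[OF Dc vs vs] tensor_apply_cong[OF lin_mem[OF coalg_delta[OF C]] vs vs])
      (auto simp: alg_assoc[OF Q] mem)
  also have "\<dots> = cdelta C c (\<lambda>x y. \<phi> (L x) * ceps C y)"
    by (rule tensor_apply_cong[OF Dc vs vs]) (simp add: MN[OF _ \<phi>r] mem alg_one_right[OF Q])
  also have "\<dots> = \<phi> (L c)"
    by (rule counit_right[OF C c lin_comp[OF \<phi> lin(1)]])
  finally show "\<phi> (L c) = \<phi> (N c)" by simp
qed

lemma antipode_bilin:
  assumes H: "bialgebra H" and S: "lin_map H H S"
  shows "bilin_map H H H (\<lambda>x y. amult H (S x) y)" "bilin_map H H H (\<lambda>x y. amult H x (S y))"
proof -
  note m = alg_bilin[OF bi_alg[OF H]]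
  show "bilin_map H H H (\<lambda>x y. amult H (S x) y)"
    by (rule bilin_mapI) (auto intro!: lin_bilin_left[OF m] lin_bilin_right[OF m] S lin_mem[OF S])
  show "bilin_map H H H (\<lambda>x y. amult H x (S y))"
    by (rule bilin_mapI) (auto intro!: lin_bilin_left[OF m] lin_bilin_right[OF m] S lin_mem[OF S])
qed

lemma
  assumes H: "bialgebra H" and S: "is_antipode H S" and h: "h \<in> vcar H" and \<phi>: "lf H \<phi>"
  shows antipode_left: "bdelta H h (\<lambda>x y. \<phi> (amult H (S x) y)) = beps H h * \<phi> (aone H)"
    and antipode_right: "bdelta H h (\<lambda>x y. \<phi> (amult H x (S y))) = beps H h * \<phi> (aone H)"
proof -
  note vs = bi_vspace[OF H] and Dh = lin_mem[OF bi_delta[OF H] h]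
  have l: "lin_map H H S" using S by (simp add: is_antipode_def)
  note b = antipode_bilin[OF H l]
  show "bdelta H h (\<lambda>x y. \<phi> (amult H (S x) y)) = beps H h * \<phi> (aone H)"
    using S h tlift_apply[OF vs vs vs b(1) \<phi> Dh] lin_scale[OF \<phi> alg_one[OF bi_alg[OF H]]]
    by (simp add: is_antipode_def)
  show "bdelta H h (\<lambda>x y. \<phi> (amult H x (S y))) = beps H h * \<phi> (aone H)"
    using S h tlift_apply[OF vs vs vs b(2) \<phi> Dh] lin_scale[OF \<phi> alg_one[OF bi_alg[OF H]]]
    by (simp add: is_antipode_def)
qed

lemma is_antipodeI:
  assumes H: "bialgebra H" and S: "lin_map H H S" and F: "separates H F"
    and 1: "\<And>h \<phi>. h \<in> vcar H \<Longrightarrow> \<phi> \<in> F \<Longrightarrow> bdelta H h (\<lambda>x y. \<phi> (amult H (S x) y)) = beps H h * \<phi> (aone H)"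
    and 2: "\<And>h \<phi>. h \<in> vcar H \<Longrightarrow> \<phi> \<in> F \<Longrightarrow> bdelta H h (\<lambda>x y. \<phi> (amult H x (S y))) = beps H h * \<phi> (aone H)"
  shows "is_antipode H S"
  unfolding is_antipode_def
proof (intro conjI ballI S)
  fix h assume h: "h \<in> vcar H"
  note vs = bi_vspace[OF H] and Dh = lin_mem[OF bi_delta[OF H] h] and b = antipode_bilin[OF H S]
  note one = alg_one[OF bi_alg[OF H]]
  show "tlift H H H (\<lambda>x y. amult H (S x) y) (bdelta H h) = vscale H (beps H h) (aone H)"
    by (rule separates_eqI[OF F vs tlift_mem[OF vs vs vs b(1) Dh] vs_scale[OF vs one]])
      (simp add: tlift_apply[OF vs vs vs b(1) separatesD[OF F] Dh] 1[OF h] lin_scale[OF separatesD[OF F] one])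
  show "tlift H H H (\<lambda>x y. amult H x (S y)) (bdelta H h) = vscale H (beps H h) (aone H)"
    by (rule separates_eqI[OF F vs tlift_mem[OF vs vs vs b(2) Dh] vs_scale[OF vs one]])
      (simp add: tlift_apply[OF vs vs vs b(2) separatesD[OF F] Dh] 2[OF h] lin_scale[OF separatesD[OF F] one])
qed

section \<open>The antipode reverses products and coproducts\<close>

context
  fixes H :: "('k::field, 'u::ab_group_add) bialg" and S
  assumes H: "bialgebra H" and S: "is_antipode H S"
begin

lemma antipode_lin: "lin_map H H S"
  using S by (simp add: is_antipode_def)

lemma antipode_mem: "x \<in> vcar H \<Longrightarrow> S x \<in> vcar H"
  by (rule lin_mem[OF antipode_lin])

text \<open>As maps on the tensor square of \<open>H\<close>, the two sides are a left and a right
  convolution inverse of the multiplication.\<close>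

lemma antipode_antimult:
  assumes x: "x \<in> vcar H" and y: "y \<in> vcar H"
  shows "S (amult H x y) = amult H (S y) (S x)"
proof -
  note vs = bi_vspace[OF H] and A = bi_alg[OF H] and C = bi_coalg[OF H]
  note m = alg_bilin[OF A] and mm = alg_mult[OF A]
  let ?C = "tcoalg (coalg_of H) (coalg_of H)"
  let ?m = "tlift H H H (amult H)"
  let ?N = "tlift H H H (\<lambda>x y. amult H (S y) (S x))"
  note ml = tlift_lin[OF vs vs vs m] and mt = tlift_tens[OF vs vs vs m]
  have b: "bilin_map H H H (\<lambda>x y. amult H (S y) (S x))"
    by (rule bilin_mapI) (auto intro!: lin_bilin_left[OF m] lin_bilin_right[OF m] antipode_lin antipode_mem)
  note Nl = tlift_lin[OF vs vs vs b] and Nt = tlift_tens[OF vs vs vs b]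
  have D: "lin_map (tensor_space H H) (tensor_space ?C ?C) (cdelta ?C)"
    using tcoalg_delta[OF C C] by simp
  note Dm = lin_mem[OF bi_delta[OF H]]
  have td: "cdelta ?C (tens H H a b) \<beta> = bdelta H a (\<lambda>a1 a2. bdelta H b (\<lambda>b1 b2. \<beta> (tens H H a1 b1) (tens H H a2 b2)))"
    if "a \<in> vcar H" "b \<in> vcar H" "bf (tensor_space H H) (tensor_space H H) \<beta>" for a b \<beta>
    using tcoalg_delta_tens[OF C C, of a b \<beta>] that by simp
  have "(\<lambda>X. S (?m X)) (tens H H x y) = ?N (tens H H x y)"
  proof (rule conv_inverse_unique[OF tcoalg_coalgebra[OF C C] A, where L = "\<lambda>X. S (?m X)" and M = ?m and N = ?N])
    show "lin_map ?C H (\<lambda>X. S (?m X))" using lin_comp[OF antipode_lin ml] by simp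
    show "lin_map ?C H ?m" using ml by simp
    show "lin_map ?C H ?N" using Nl by simp
    show "tens H H x y \<in> vcar ?C" using tens_mem[OF x y] by simp
    fix X \<phi> assume "X \<in> vcar ?C" and \<phi>: "lf H \<phi>"
    then have X: "X \<in> vcar (tensor_space H H)" by simp
    note \<phi>S = lf_bilin[OF antipode_bilin(1)[OF H antipode_lin] \<phi>]
    have R: "lf (tensor_space H H) (\<lambda>X. ceps ?C X * \<phi> (aone H))"
      by (simp add: lf_mult_right lf_apply)
    show "cdelta ?C X (\<lambda>u v. \<phi> (amult H (S (?m u)) (?m v))) = ceps ?C X * \<phi> (aone H)"
    proof (rule lin_tensor_eqI[OF lf_tensor_apply[OF D] R vs vs _ X])
      fix a b assume a: "a \<in> vcar H" and b: "b \<in> vcar H"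
      have "cdelta ?C (tens H H a b) (\<lambda>u v. \<phi> (amult H (S (?m u)) (?m v)))
        = bdelta H a (\<lambda>a1 a2. bdelta H b (\<lambda>b1 b2. \<phi> (amult H (S (?m (tens H H a1 b1))) (?m (tens H H a2 b2)))))"
        by (rule td[OF a b bf_map[OF \<phi>S ml ml]])
      also have "\<dots> = bdelta H a (\<lambda>a1 a2. bdelta H b (\<lambda>b1 b2. \<phi> (amult H (S (amult H a1 b1)) (amult H a2 b2))))"
        by (intro tensor_apply_cong[OF Dm[OF a] vs vs] tensor_apply_cong[OF Dm[OF b] vs vs]) (simp add: mt)
      also have "\<dots> = ceps ?C (tens H H a b) * \<phi> (aone H)"
        using bi_delta_mult[OF H a b \<phi>S] antipode_left[OF H S mm[OF a b] \<phi>]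
        by (simp add: tens_apply[OF bf_prod[OF bi_eps[OF H] bi_eps[OF H]]] bi_eps_mult[OF H a b])
      finally show "cdelta ?C (tens H H a b) (\<lambda>u v. \<phi> (amult H (S (?m u)) (?m v))) = ceps ?C (tens H H a b) * \<phi> (aone H)" .
    qed
    show "cdelta ?C X (\<lambda>u v. \<phi> (amult H (?m u) (?N v))) = ceps ?C X * \<phi> (aone H)"
    proof (rule lin_tensor_eqI[OF lf_tensor_apply[OF D] R vs vs _ X])
      fix a b assume a: "a \<in> vcar H" and b: "b \<in> vcar H"
      have "cdelta ?C (tens H H a b) (\<lambda>u v. \<phi> (amult H (?m u) (?N v)))
        = bdelta H a (\<lambda>a1 a2. bdelta H b (\<lambda>b1 b2. \<phi> (amult H (?m (tens H H a1 b1)) (?N (tens H H a2 b2)))))"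
        by (rule td[OF a b bf_map[OF lf_bilin[OF m \<phi>] ml Nl]])
      \<comment> \<open>Reassociated so that \<open>b1\<close> meets the antipode of
        \<open>b2\<close>: the inner sum collapses to a counit, and the outer one is then treated in
        the same way.\<close>
      also have "\<dots> = bdelta H a (\<lambda>a1 a2. bdelta H b (\<lambda>b1 b2. \<phi> (amult H a1 (amult H (amult H b1 (S b2)) (S a2)))))"
        by (intro tensor_apply_cong[OF Dm[OF a] vs vs] tensor_apply_cong[OF Dm[OF b] vs vs])
          (simp add: mt Nt alg_assoc[OF A] mm antipode_mem)
      also have "\<dots> = bdelta H a (\<lambda>a1 a2. beps H b * \<phi> (amult H a1 (S a2)))"
      proof (rule tensor_apply_cong[OF Dm[OF a] vs vs])
        fix a1 a2 assume a1: "a1 \<in> vcar H" and a2: "a2 \<in> vcar H"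
        have "lf H (\<lambda>q. \<phi> (amult H a1 (amult H q (S a2))))"
          by (intro lin_comp[OF \<phi>] lin_bilin_right[OF m] bilin_left[OF m] a1 antipode_mem a2)
        from antipode_right[OF H S b this]
        show "bdelta H b (\<lambda>b1 b2. \<phi> (amult H a1 (amult H (amult H b1 (S b2)) (S a2)))) = beps H b * \<phi> (amult H a1 (S a2))"
          by (simp add: alg_one_left[OF A] antipode_mem a2)
      qed
      also have "\<dots> = ceps ?C (tens H H a b) * \<phi> (aone H)"
        using antipode_right[OF H S a \<phi>] tensor_scale_left[OF Dm[OF a] vs vs lf_bilin[OF antipode_bilin(2)[OF H antipode_lin] \<phi>]]
        by (simp add: tens_apply[OF bf_prod[OF bi_eps[OF H] bi_eps[OF H]]])
      finally show "cdelta ?C (tens H H a b) (\<lambda>u v. \<phi> (amult H (?m u) (?N v))) = ceps ?C (tens H H a b) * \<phi> (aone H)" .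
    qed
  qed
  then show ?thesis by (simp add: mt Nt x y)
qed

text \<open>The same argument in Hom(H, H \<otimes> H), where the comultiplication is the map that
  is inverted on both sides.\<close>

lemma antipode_anticomult:
  assumes h: "h \<in> vcar H" and \<beta>: "bf H H \<beta>"
  shows "bdelta H (S h) \<beta> = bdelta H h (\<lambda>x y. \<beta> (S y) (S x))"
proof -
  note vs = bi_vspace[OF H] and A = bi_alg[OF H] and C = bi_coalg[OF H]
  note m = alg_bilin[OF A] and mm = alg_mult[OF A]
  note D = bi_delta[OF H] and Dm = lin_mem[OF bi_delta[OF H]]
  let ?Q = "tensor_alg H H" and ?T = "tensor_space H H"
  let ?N = "\<lambda>h. tlift H H ?T (\<lambda>x y. tens H H (S y) (S x)) (bdelta H h)"
  have b: "bilin_map H H ?T (\<lambda>x y. tens H H (S y) (S x))"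
    by (rule bilin_mapI) (auto intro!: lin_bilin_left[OF tens_bilin] lin_bilin_right[OF tens_bilin] antipode_lin antipode_mem)
  have Nl: "lin_map H ?T ?N" by (rule lin_comp[OF tlift_lin[OF vs vs vspace_tensor b] D])
  have Na: "?N y \<beta> = bdelta H y (\<lambda>c d. \<beta> (S d) (S c))" if "y \<in> vcar H" "bf H H \<beta>" for y \<beta>
    by (simp add: tlift_tensor_apply[OF vs vs b Dm[OF that(1)]] tens_apply[OF that(2)])
  have Q: "algebra ?Q" by (rule tensor_algebra[OF A A])
  have "bdelta H (S h) = ?N h"
  proof (rule conv_inverse_unique[OF C Q, where L = "\<lambda>h. bdelta H (S h)" and M = "bdelta H" and N = ?N])
    show "lin_map (coalg_of H) ?Q (\<lambda>h. bdelta H (S h))" "lin_map (coalg_of H) ?Q (bdelta H)" "lin_map (coalg_of H) ?Q ?N"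
      using lin_comp[OF D antipode_lin] D Nl by simp_all
    show "h \<in> vcar (coalg_of H)" using h by simp
    fix c \<phi> assume "c \<in> vcar (coalg_of H)" and "lf ?Q \<phi>"
    then have c: "c \<in> vcar H" and \<phi>: "lf ?T \<phi>" by auto
    have "bdelta H c (\<lambda>x y. \<phi> (amult ?Q (bdelta H (S x)) (bdelta H y))) = bdelta H c (\<lambda>x y. \<phi> (bdelta H (amult H (S x) y)))"
      by (rule tensor_apply_cong[OF Dm[OF c] vs vs]) (simp add: alg_hom_mult[OF bi_delta_hom[OF H]] antipode_mem)
    then show "cdelta (coalg_of H) c (\<lambda>x y. \<phi> (amult ?Q (bdelta H (S x)) (bdelta H y))) = ceps (coalg_of H) c * \<phi> (aone ?Q)"
      using antipode_left[OF H S c lin_comp[OF \<phi> D]] by (simp add: bi_delta_one[OF H])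
    have B: "bilin_map H H ?T (\<lambda>x y. amult ?Q (bdelta H x) (?N y))"
      using alg_bilin[OF Q]
      by (intro bilin_mapI) (auto intro!: lin_bilin_left[of ?T ?T ?T "amult ?Q"] lin_bilin_right[of ?T ?T ?T "amult ?Q"] D Nl lin_mem[OF Nl] Dm)
    let ?W = "tlift H H ?T (\<lambda>x y. amult ?Q (bdelta H x) (?N y)) (bdelta H c)"
    have W: "?W \<in> vcar ?T" by (rule tlift_mem[OF vs vs vspace_tensor B Dm[OF c]])
    have one: "tens H H (aone H) (aone H) \<in> vcar ?T" by (intro tens_mem alg_one A)
    have "?W = fscale (beps H c) (tens H H (aone H) (aone H))"
    proof (rule tensor_ext[OF W _ vs vs])
      show "fscale (beps H c) (tens H H (aone H) (aone H)) \<in> vcar ?T"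
        using vs_scale[OF vspace_tensor one] by simp
      fix \<beta> assume \<beta>: "bf H H \<beta>"
      have bm: "lin_map H H (\<lambda>a. amult H a z)" "lin_map H H (amult H z)" if "z \<in> vcar H" for z
        using bilin_left[OF m that] bilin_right[OF m that] .
      have b1: "bf H H (\<lambda>c d. \<beta> (amult H u (S d)) (amult H v (S c)))" if "u \<in> vcar H" "v \<in> vcar H" for u v
        by (intro bilin_mapI lin_bilin_left[OF \<beta>] lin_bilin_right[OF \<beta>] lin_bilin_right[OF m] antipode_lin mm antipode_mem that)
      have tri: "trilin H H H (\<lambda>u v y. bdelta H y (\<lambda>c d. \<beta> (amult H u (S d)) (amult H v (S c))))"
      proof (rule trilinI)
        fix v y assume v: "v \<in> vcar H" and y: "y \<in> vcar H"
        show "lf H (\<lambda>u. bdelta H y (\<lambda>c d. \<beta> (amult H u (S d)) (amult H v (S c))))"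
          by (rule lf_tensor_param[OF Dm[OF y] vs vs vs b1[OF _ v]], assumption)
            (intro lin_bilin_left[OF \<beta>] bm mm antipode_mem v)
      next
        fix u y assume u: "u \<in> vcar H" and y: "y \<in> vcar H"
        show "lf H (\<lambda>v. bdelta H y (\<lambda>c d. \<beta> (amult H u (S d)) (amult H v (S c))))"
          by (rule lf_tensor_param[OF Dm[OF y] vs vs vs b1[OF u]], assumption)
            (intro lin_bilin_right[OF \<beta>] bm mm antipode_mem u)
      next
        fix u v assume "u \<in> vcar H" "v \<in> vcar H"
        show "lf H (\<lambda>y. bdelta H y (\<lambda>c d. \<beta> (amult H u (S d)) (amult H v (S c))))"
          by (rule lf_tensor_apply[OF D])
      qed
      have tri2: "trilin H H H (\<lambda>u c d. \<beta> (amult H x (S d)) (amult H u (S c)))" if "x \<in> vcar H" for x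
        by (intro trilinI lin_bilin_left[OF \<beta>] lin_bilin_right[OF \<beta>] lin_bilin_right[OF m] bm antipode_lin mm antipode_mem that)
      have "?W \<beta> = bdelta H c (\<lambda>x y. amult ?Q (bdelta H x) (?N y) \<beta>)"
        by (rule tlift_tensor_apply[OF vs vs B Dm[OF c]])
      also have "\<dots> = bdelta H c (\<lambda>x y. bdelta H x (\<lambda>u v. bdelta H y (\<lambda>c d. \<beta> (amult H u (S d)) (amult H v (S c)))))"
      proof (rule tensor_apply_cong[OF Dm[OF c] vs vs])
        fix x y assume x: "x \<in> vcar H" and y: "y \<in> vcar H"
        have "amult ?Q (bdelta H x) (?N y) \<beta> = bdelta H x (\<lambda>u v. ?N y (\<lambda>c d. \<beta> (amult H u c) (amult H v d)))"
          by (rule tensor_alg_apply[OF m m vs vs Dm[OF x] _ \<beta>]) (rule lin_mem[OF Nl y])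
        moreover have "bdelta H x (\<lambda>u v. ?N y (\<lambda>c d. \<beta> (amult H u c) (amult H v d)))
            = bdelta H x (\<lambda>u v. bdelta H y (\<lambda>c d. \<beta> (amult H u (S d)) (amult H v (S c))))"
          by (rule tensor_apply_cong[OF Dm[OF x] vs vs]) (rule Na[OF y], rule bf_map[OF \<beta>]; rule bm)
        ultimately show "amult ?Q (bdelta H x) (?N y) \<beta> = bdelta H x (\<lambda>u v. bdelta H y (\<lambda>c d. \<beta> (amult H u (S d)) (amult H v (S c))))"
          by simp
      qed
      \<comment> \<open>Two rebracketings of the fourfold coproduct bring its middle factors
        together, where the product with the antipode reduces to a counit; the outer pair is
        contracted afterwards.\<close>
      also have "\<dots> = bdelta H c (\<lambda>x y. bdelta H y (\<lambda>u v. bdelta H v (\<lambda>c d. \<beta> (amult H x (S d)) (amult H u (S c)))))"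
        by (rule bi_coassoc[OF H c tri])
      also have "\<dots> = bdelta H c (\<lambda>x y. \<beta> (amult H x (S y)) (aone H))"
      proof (rule tensor_apply_cong[OF Dm[OF c] vs vs])
        fix x y assume x: "x \<in> vcar H" and y: "y \<in> vcar H"
        have "bdelta H y (\<lambda>u v. bdelta H v (\<lambda>c d. \<beta> (amult H x (S d)) (amult H u (S c))))
          = bdelta H y (\<lambda>p q. bdelta H p (\<lambda>u c. \<beta> (amult H x (S q)) (amult H u (S c))))"
          by (rule bi_coassoc[OF H y tri2[OF x], symmetric])
        also have "\<dots> = bdelta H y (\<lambda>p q. beps H p * \<beta> (amult H x (S q)) (aone H))"
          by (rule tensor_apply_cong[OF Dm[OF y] vs vs])
            (rule antipode_right[OF H S _ bilin_right[OF \<beta>]], auto intro: mm antipode_mem x)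
        also have "\<dots> = \<beta> (amult H x (S y)) (aone H)"
          by (rule bi_counit_left[OF H y]) (intro lin_bilin_left[OF \<beta>] lin_bilin_right[OF m] antipode_lin x alg_one[OF A])
        finally show "bdelta H y (\<lambda>u v. bdelta H v (\<lambda>c d. \<beta> (amult H x (S d)) (amult H u (S c)))) = \<beta> (amult H x (S y)) (aone H)" .
      qed
      also have "\<dots> = beps H c * \<beta> (aone H) (aone H)"
        by (rule antipode_right[OF H S c bilin_left[OF \<beta> alg_one[OF A]]])
      finally show "?W \<beta> = fscale (beps H c) (tens H H (aone H) (aone H)) \<beta>"
        by (simp add: tens_apply[OF \<beta>])
    qed
    then show "cdelta (coalg_of H) c (\<lambda>x y. \<phi> (amult ?Q (bdelta H x) (?N y))) = ceps (coalg_of H) c * \<phi> (aone ?Q)"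
      using tlift_apply[OF vs vs vspace_tensor B \<phi> Dm[OF c]] lin_scale[OF \<phi> one, of "beps H c"] by simp
  qed
  then show ?thesis by (simp add: Na[OF h \<beta>])
qed

end

section \<open>Structures reflected along injective linear maps\<close>

lemma separates_inj:
  assumes vs: "vspace V" "vspace W" and j: "lin_map V W j" "inj_on j (vcar V)"
  shows "separates V {\<lambda>x. f (j x) | f. lf W f}"
proof -
  have "v = 0" if v: "v \<in> vcar V" and z: "\<And>f. lf W f \<Longrightarrow> f (j v) = 0" for v
  proof -
    have "j v = 0"
      using separates_all[OF vs(2)] lin_mem[OF j(1) v] z by (auto simp: separates_def)
    then show "v = 0"
      using inj_onD[OF j(2), of v 0] v vs_zero[OF vs(1)] lin_zero[OF j(1) vs(1)] by simp
  qed
  then show ?thesis by (auto simp: separates_def intro: lin_comp[OF _ j(1)])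
qed

text \<open>Functionals pulled back along \<open>j\<close> separate \<open>P'\<close> and convolve
  as on \<open>P\<close>, so the laws of \<open>P\<close> hold on \<open>P'\<close>. This serves for
  copies in another type as well as for subobjects.\<close>

lemma coalgebra_reflect:
  assumes P: "coalgebra P" and vs': "vspace P'" and j: "lin_map P' P j" "inj_on j (vcar P')"
    and D: "lin_map P' (tensor_space P' P') (cdelta P')"
    and Dj: "\<And>x. x \<in> vcar P' \<Longrightarrow> tmap P' P' P P j j (cdelta P' x) = cdelta P (j x)"
    and ej: "\<And>x. x \<in> vcar P' \<Longrightarrow> ceps P' x = ceps P (j x)"
  shows "coalgebra P'" "coalg_hom P' P j"
proof -
  note vs = coalg_vspace[OF P]
  let ?F = "{\<lambda>x. f (j x) | f. lf P f}"
  have F: "separates P' ?F" by (rule separates_inj[OF vs' vs j])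
  have c: "conv P' (\<lambda>x. f (j x)) (\<lambda>x. g (j x)) x = conv P f g (j x)" if "x \<in> vcar P'" "lf P f" "lf P g" for x f g
    unfolding conv_def Dj[OF that(1), symmetric]
    by (rule tmap_apply[OF vs' vs' j(1) j(1) bf_prod[OF that(2,3)] lin_mem[OF D that(1)], symmetric])
  have jm: "x \<in> vcar P' \<Longrightarrow> j x \<in> vcar P" for x by (rule lin_mem[OF j(1)])
  show "coalgebra P'"
  proof (rule coalgebraI_conv[OF vs' D _ F])
    show "lf P' (ceps P')" by (rule lin_cong[OF lin_comp[OF coalg_eps[OF P] j(1)] vs']) (simp add: ej)
    fix p f assume p: "p \<in> vcar P'" and "f \<in> ?F"
    then obtain f' where f: "f = (\<lambda>x. f' (j x))" "lf P f'" by auto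
    have "conv P' (ceps P') f p = conv P' (\<lambda>x. ceps P (j x)) f p"
      by (rule conv_cong[OF D vs' p]) (auto simp: ej)
    then show "conv P' (ceps P') f p = f p"
      by (simp add: f(1) c[OF p coalg_eps[OF P] f(2)] conv_eps_left[OF P jm[OF p] f(2)])
    have "conv P' f (ceps P') p = conv P' f (\<lambda>x. ceps P (j x)) p"
      by (rule conv_cong[OF D vs' p]) (auto simp: ej)
    then show "conv P' f (ceps P') p = f p"
      by (simp add: f(1) c[OF p f(2) coalg_eps[OF P]] conv_eps_right[OF P jm[OF p] f(2)])
    fix g h assume "g \<in> ?F" "h \<in> ?F"
    then obtain g' h' where g: "g = (\<lambda>x. g' (j x))" "lf P g'" and h: "h = (\<lambda>x. h' (j x))" "lf P h'" by auto
    note lc = lf_conv[OF coalg_delta[OF P]]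
    have "conv P' (conv P' f g) h p = conv P' (\<lambda>x. conv P f' g' (j x)) h p"
      by (rule conv_cong[OF D vs' p]) (auto simp: f g c)
    also have "\<dots> = conv P' f (\<lambda>x. conv P g' h' (j x)) p"
      by (simp add: f g h c p lc conv_assoc[OF P jm[OF p]])
    also have "\<dots> = conv P' f (conv P' g h) p"
      by (rule conv_cong[OF D vs' p]) (auto simp: g h c)
    finally show "conv P' (conv P' f g) h p = conv P' f (conv P' g h) p" .
  qed
  show "coalg_hom P' P j"
    using j(1) Dj ej by (simp add: coalg_hom_def)
qed

lemma algebra_reflect:
  assumes Q: "algebra Q" and vs': "vspace Q'" and j: "lin_map Q' Q j" "inj_on j (vcar Q')"
    and m: "\<And>x y. x \<in> vcar Q' \<Longrightarrow> y \<in> vcar Q' \<Longrightarrow> amult Q' x y \<in> vcar Q'"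
      "\<And>x y. x \<in> vcar Q' \<Longrightarrow> y \<in> vcar Q' \<Longrightarrow> j (amult Q' x y) = amult Q (j x) (j y)"
    and one: "aone Q' \<in> vcar Q'" "j (aone Q') = aone Q"
  shows "algebra Q'" "alg_hom Q' Q j"
proof -
  note jm = lin_mem[OF j(1)] and mb = alg_bilin[OF Q]
  note I = inj_onD[OF j(2)] and a = vs_add[OF vs'] vs_scale[OF vs']
  note js = lin_add[OF j(1)] lin_scale[OF j(1)]
  have l: "lin_map Q' Q' (\<lambda>x. amult Q' x y)" if y: "y \<in> vcar Q'" for y
    by (rule lin_mapI; (rule I)?)
      (auto simp: m a js y jm bilin_add_left[OF mb] bilin_scale_left[OF mb])
  have r: "lin_map Q' Q' (amult Q' y)" if y: "y \<in> vcar Q'" for y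
    by (rule lin_mapI; (rule I)?)
      (auto simp: m a js y jm bilin_add_right[OF mb] bilin_scale_right[OF mb])
  have "amult Q' (amult Q' x y) z = amult Q' x (amult Q' y z)"
    if "x \<in> vcar Q'" "y \<in> vcar Q'" "z \<in> vcar Q'" for x y z
    by (rule I) (use that in \<open>auto simp: m jm alg_assoc[OF Q]\<close>)
  moreover have "amult Q' (aone Q') x = x" "amult Q' x (aone Q') = x" if "x \<in> vcar Q'" for x
    by (rule I; use that in \<open>auto simp: m one jm alg_one_left[OF Q] alg_one_right[OF Q]\<close>)+
  ultimately show "algebra Q'"
    using vs' one(1) by (auto simp: algebra_def intro!: bilin_mapI l r)
  show "alg_hom Q' Q j" using j(1) m(2) one(2) by (simp add: alg_hom_def)
qed

text \<open>Multiplicativity of the comultiplication is an equation in B' \<otimes> B'. It is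
  checked in B \<otimes> B, into which the tensor square of \<open>j\<close> is injective.\<close>

lemma bialgebra_reflect:
  assumes B: "bialgebra B" and vs': "vspace B'" and j: "lin_map B' B j" "inj_on j (vcar B')"
    and m: "\<And>x y. x \<in> vcar B' \<Longrightarrow> y \<in> vcar B' \<Longrightarrow> amult B' x y \<in> vcar B'"
      "\<And>x y. x \<in> vcar B' \<Longrightarrow> y \<in> vcar B' \<Longrightarrow> j (amult B' x y) = amult B (j x) (j y)"
    and one: "aone B' \<in> vcar B'" "j (aone B') = aone B"
    and D: "lin_map B' (tensor_space B' B') (bdelta B')"
    and Dj: "\<And>x. x \<in> vcar B' \<Longrightarrow> tmap B' B' B B j j (bdelta B' x) = bdelta B (j x)"
    and ej: "\<And>x. x \<in> vcar B' \<Longrightarrow> beps B' x = beps B (j x)"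
  shows "bialgebra B'" "bialg_hom B' B j"
proof -
  note vs = bi_vspace[OF B] and A = bi_alg[OF B]
  note A' = algebra_reflect[OF A vs' j m one, simplified]
  note C' = coalgebra_reflect[OF bi_coalg[OF B], of "coalg_of B'" j, simplified, OF vs' j D Dj ej]
  note t = tmap_alg_hom[OF A'(1) A'(1) A A A'(2) A'(2)]
  note inj = inj_onD[OF tmap_inj[OF vs' vs' vs vs j(1) j(1) j(2) j(2)]]
  note A'T = tensor_algebra[OF A'(1) A'(1)]
  note Dm = lin_mem[OF D] and jm = lin_mem[OF j(1)]
  have "bdelta B' (amult B' x y) = amult (tensor_alg B' B') (bdelta B' x) (bdelta B' y)"
    if x: "x \<in> vcar B'" and y: "y \<in> vcar B'" for x y
  proof (rule inj)
    show "bdelta B' (amult B' x y) \<in> vcar (tensor_space B' B')" by (rule Dm[OF m(1)[OF x y]])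
    show "amult (tensor_alg B' B') (bdelta B' x) (bdelta B' y) \<in> vcar (tensor_space B' B')"
      using alg_mult[OF A'T] Dm x y by simp
    show "tmap B' B' B B j j (bdelta B' (amult B' x y))
        = tmap B' B' B B j j (amult (tensor_alg B' B') (bdelta B' x) (bdelta B' y))"
      using alg_hom_mult[OF t] alg_hom_mult[OF bi_delta_hom[OF B]] Dm x y m jm by (simp add: Dj)
  qed
  moreover have "bdelta B' (aone B') = tens B' B' (aone B') (aone B')"
    by (rule inj) (use Dm[OF one(1)] tens_mem one in
      \<open>auto simp: Dj bi_delta_one[OF B] tmap_tens[OF vs' vs' j(1) j(1)]\<close>)
  ultimately have "alg_hom B' (tensor_alg B' B') (bdelta B')"
    using D by (simp add: alg_hom_def)
  moreover have "alg_hom B' ground (beps B')"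
    using coalg_eps[OF C'(1)] by (simp add: alg_hom_def ej m one jm bi_eps_mult[OF B] bi_eps_one[OF B])
  ultimately show "bialgebra B'" using A'(1) C'(1) by (simp add: bialgebra_def)
  show "bialg_hom B' B j" using A'(2) C'(2) by (simp add: bialg_hom_def)
qed

lemma hopf_reflect:
  assumes B': "bialgebra B'" and B: "bialgebra B" and S: "is_antipode B S"
    and j: "bialg_hom B' B j" "inj_on j (vcar B')"
    and S': "\<And>x. x \<in> vcar B' \<Longrightarrow> S' x \<in> vcar B'" "\<And>x. x \<in> vcar B' \<Longrightarrow> j (S' x) = S (j x)"
  shows "hopf_algebra B'"
proof -
  note vs' = bi_vspace[OF B'] and vs = bi_vspace[OF B]
  have jh: "alg_hom B' B j" and jc: "coalg_hom (coalg_of B') (coalg_of B) j" using j(1) by (auto simp: bialg_hom_def)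
  note jl = alg_hom_lin[OF jh] and Sl = antipode_lin[OF B S]
  note jm = lin_mem[OF jl] and I = inj_onD[OF j(2)]
  have S'l: "lin_map B' B' S'"
    by (rule lin_mapI; (rule I)?)
      (auto simp: S' vs_add[OF vs'] vs_scale[OF vs'] lin_add[OF jl] lin_scale[OF jl] lin_add[OF Sl] lin_scale[OF Sl] jm)
  have "is_antipode B' S'"
  proof (rule is_antipodeI[OF B' S'l separates_inj[OF vs' vs jl j(2)]])
    fix h \<phi>' assume h: "h \<in> vcar B'" and "\<phi>' \<in> {\<lambda>x. f (j x) | f. lf B f}"
    then obtain \<phi> where \<phi>: "\<phi>' = (\<lambda>x. \<phi> (j x))" "lf B \<phi>" by auto
    note Dh = lin_mem[OF bi_delta[OF B'] h]
    have *: "bdelta B' h (\<lambda>x y. \<beta> (j x) (j y)) = bdelta B (j h) \<beta>" if "bf B B \<beta>" for \<beta>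
      using coalg_hom_apply[OF bi_coalg[OF B'] jc, of h \<beta>] h that by simp
    note b = antipode_bilin[OF B Sl, THEN lf_bilin, OF \<phi>(2)]
    have e: "beps B' h = beps B (j h)" using coalg_hom_eps[OF jc, of h] h by simp
    have "bdelta B' h (\<lambda>x y. \<phi>' (amult B' (S' x) y)) = bdelta B' h (\<lambda>x y. \<phi> (amult B (S (j x)) (j y)))"
      by (rule tensor_apply_cong[OF Dh vs' vs']) (simp add: \<phi> alg_hom_mult[OF jh] S')
    then show "bdelta B' h (\<lambda>x y. \<phi>' (amult B' (S' x) y)) = beps B' h * \<phi>' (aone B')"
      using *[OF b(1)] antipode_left[OF B S jm[OF h] \<phi>(2)] by (simp add: \<phi>(1) e alg_hom_one[OF jh])
    have "bdelta B' h (\<lambda>x y. \<phi>' (amult B' x (S' y))) = bdelta B' h (\<lambda>x y. \<phi> (amult B (j x) (S (j y))))"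
      by (rule tensor_apply_cong[OF Dh vs' vs']) (simp add: \<phi> alg_hom_mult[OF jh] S')
    then show "bdelta B' h (\<lambda>x y. \<phi>' (amult B' x (S' y))) = beps B' h * \<phi>' (aone B')"
      using *[OF b(2)] antipode_right[OF B S jm[OF h] \<phi>(2)] by (simp add: \<phi>(1) e alg_hom_one[OF jh])
  qed
  then show ?thesis using B' by (auto simp: hopf_algebra_def)
qed

section \<open>Transport to the universe of test objects\<close>

text \<open>The scaling \<open>s\<close> is arbitrary because test objects may carry any scalar
  multiplication of \<open>'t\<close>; the image of the carrier then becomes a test object.\<close>

definition embeds :: "('k::field, 'u::ab_group_add, 'z) vsp_scheme \<Rightarrow> ('k \<Rightarrow> 't \<Rightarrow> 't::ab_group_add) \<Rightarrow> ('u \<Rightarrow> 't) \<Rightarrow> bool" where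
  "embeds V s j \<longleftrightarrow> vector_space s \<and> lin_map V \<lparr>vcar = UNIV, vscale = s\<rparr> j \<and> inj_on j (vcar V)"

abbreviation (input) tvsp :: "('k::field, 'u::ab_group_add, 'z) vsp_scheme \<Rightarrow> ('k \<Rightarrow> 't \<Rightarrow> 't::ab_group_add) \<Rightarrow> ('u \<Rightarrow> 't) \<Rightarrow> ('k, 't) vsp" where
  "tvsp V s j \<equiv> \<lparr>vcar = j ` vcar V, vscale = s\<rparr>"

lemma
  assumes V: "vspace V" and j: "embeds V s j"
  shows tvsp_vspace: "vspace (tvsp V s j)" and tvsp_lin: "lin_map V (tvsp V s j) j"
    and tvsp_inv: "lin_map (tvsp V s j) V (inv_into (vcar V) j)"
    and tvsp_inv_inj: "inj_on (inv_into (vcar V) j) (j ` vcar V)"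
    and tvsp_inv_f: "x \<in> vcar V \<Longrightarrow> inv_into (vcar V) j (j x) = x"
proof -
  have l: "lin_map V \<lparr>vcar = UNIV, vscale = s\<rparr> j" and i: "inj_on j (vcar V)" and s: "vector_space s"
    using j by (auto simp: embeds_def)
  note js = lin_add[OF l] lin_scale[OF l, simplified] lin_zero[OF l V]
  note js' = js[symmetric]
  show inv: "inv_into (vcar V) j (j x) = x" if "x \<in> vcar V" for x using that i by simp
  show "vspace (tvsp V s j)"
    by (rule vspaceI) (use s V vs_zero[OF V] js(3) in
      \<open>auto simp: js'(1,2) vs_add[OF V] vs_scale[OF V] intro: rev_image_eqI\<close>)
  show "lin_map V (tvsp V s j) j" by (rule lin_mapI) (auto simp: js)
  show "lin_map (tvsp V s j) V (inv_into (vcar V) j)"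
    by (rule lin_mapI) (auto simp: js'(1,2) inv vs_add[OF V] vs_scale[OF V])
  show "inj_on (inv_into (vcar V) j) (j ` vcar V)" by (rule inj_on_inv_into) simp
qed

lemma tmap_tmap_id:
  assumes "vspace V" "vspace W" "lin_map V V' f" "lin_map W W' g" "vspace V'" "vspace W'"
    "lin_map V' V f'" "lin_map W' W g'" "\<And>x. x \<in> vcar V \<Longrightarrow> f' (f x) = x" "\<And>x. x \<in> vcar W \<Longrightarrow> g' (g x) = x"
    and X: "X \<in> vcar (tensor_space V W)"
  shows "tmap V' W' V W f' g' (tmap V W V' W' f g X) = X"
proof (rule tensor_ext[OF tmap_mem[OF assms(5-8) tmap_mem[OF assms(1-4) X]] X assms(1,2)])
  fix \<beta> assume \<beta>: "bf V W \<beta>"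
  show "tmap V' W' V W f' g' (tmap V W V' W' f g X) \<beta> = X \<beta>"
    unfolding tmap_apply[OF assms(5-8) \<beta> tmap_mem[OF assms(1-4) X]] tmap_apply[OF assms(1-4) bf_map[OF \<beta> assms(7,8)] X]
    by (rule tensor_apply_cong[OF X assms(1,2)]) (simp add: assms)
qed

text \<open>Structure carried over to the image of \<open>j\<close>. The inverse of \<open>j\<close>
  is the injection along which the laws are reflected.\<close>

definition ctrans where
  "ctrans P s j = \<lparr>vcar = j ` vcar P, vscale = s,
     cdelta = \<lambda>x. tmap P P (tvsp P s j) (tvsp P s j) j j (cdelta P (inv_into (vcar P) j x)),
     ceps = \<lambda>x. ceps P (inv_into (vcar P) j x)\<rparr>"

definition atrans :: "('k::field, 'u::ab_group_add, 'z) alg_scheme \<Rightarrow> ('k \<Rightarrow> 't \<Rightarrow> 't::ab_group_add) \<Rightarrow> ('u \<Rightarrow> 't) \<Rightarrow> ('k, 't) alg" where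
  "atrans Q s j = \<lparr>vcar = j ` vcar Q, vscale = s,
     amult = \<lambda>x y. j (amult Q (inv_into (vcar Q) j x) (inv_into (vcar Q) j y)), aone = j (aone Q)\<rparr>"

definition btrans where
  "btrans B s j = \<lparr>vcar = j ` vcar B, vscale = s,
     amult = \<lambda>x y. j (amult B (inv_into (vcar B) j x) (inv_into (vcar B) j y)), aone = j (aone B),
     bdelta = \<lambda>x. tmap B B (tvsp B s j) (tvsp B s j) j j (bdelta B (inv_into (vcar B) j x)),
     beps = \<lambda>x. beps B (inv_into (vcar B) j x)\<rparr>"

lemma ctrans_simps [simp]: "vcar (ctrans P s j) = j ` vcar P" "vscale (ctrans P s j) = s"
  by (simp_all add: ctrans_def)

lemmas ctrans_cong [simp] =
  vsp_cong_left[of "ctrans P s j" "tvsp P s j" for P s j, simplified]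
  vsp_cong_right[of "ctrans P s j" "tvsp P s j" for P s j, simplified]

lemma btrans_simps [simp]: "vcar (btrans P s j) = j ` vcar P" "vscale (btrans P s j) = s"
  by (simp_all add: btrans_def)

lemmas btrans_cong [simp] =
  vsp_cong_left[of "btrans P s j" "tvsp P s j" for P s j, simplified]
  vsp_cong_right[of "btrans P s j" "tvsp P s j" for P s j, simplified]

lemma atrans_simps [simp]: "vcar (atrans P s j) = j ` vcar P" "vscale (atrans P s j) = s"
  by (simp_all add: atrans_def)

lemmas atrans_cong [simp] =
  vsp_cong_left[of "atrans P s j" "tvsp P s j" for P s j, simplified]
  vsp_cong_right[of "atrans P s j" "tvsp P s j" for P s j, simplified]

lemma
  assumes P: "coalgebra P" and j: "embeds P s j"
  shows ctrans_coalgebra: "coalgebra (ctrans P s j)"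
    and ctrans_hom: "coalg_hom P (ctrans P s j) j"
    and ctrans_inv_hom: "coalg_hom (ctrans P s j) P (inv_into (vcar P) j)"
proof -
  note vs = coalg_vspace[OF P]
  note t = tvsp_vspace[OF vs j] tvsp_lin[OF vs j] tvsp_inv[OF vs j] tvsp_inv_inj[OF vs j] and inv = tvsp_inv_f[OF vs j]
  have D: "lin_map (tvsp P s j) (tensor_space (tvsp P s j) (tvsp P s j)) (cdelta (ctrans P s j))"
    unfolding ctrans_def by (simp add: lin_comp[OF tmap_lin[OF vs vs t(2,2)] lin_comp[OF coalg_delta[OF P] t(3)]])
  have Dj: "tmap (tvsp P s j) (tvsp P s j) P P (inv_into (vcar P) j) (inv_into (vcar P) j) (cdelta (ctrans P s j) x)
      = cdelta P (inv_into (vcar P) j x)" if "x \<in> j ` vcar P" for x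
    unfolding ctrans_def using lin_mem[OF coalg_delta[OF P], of "inv_into (vcar P) j x"] that
    by (simp add: tmap_tmap_id[OF vs vs t(2,2,1,1,3,3) inv inv] inv_into_into)
  note r = coalgebra_reflect[OF P, of "ctrans P s j" "inv_into (vcar P) j", simplified, OF t(1,3,4) D Dj]
  show "coalgebra (ctrans P s j)" "coalg_hom (ctrans P s j) P (inv_into (vcar P) j)"
    by (rule r; simp add: ctrans_def)+
  show "coalg_hom P (ctrans P s j) j"
    using t(2) by (simp add: coalg_hom_def) (simp add: ctrans_def inv)
qed

lemma
  assumes Q: "algebra Q" and j: "embeds Q s j"
  shows atrans_algebra: "algebra (atrans Q s j)"
    and atrans_hom: "alg_hom Q (atrans Q s j) j"
    and atrans_inv_hom: "alg_hom (atrans Q s j) Q (inv_into (vcar Q) j)"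
proof -
  note vs = alg_vspace[OF Q]
  note t = tvsp_vspace[OF vs j] tvsp_lin[OF vs j] tvsp_inv[OF vs j] tvsp_inv_inj[OF vs j] and inv = tvsp_inv_f[OF vs j]
  note r = algebra_reflect[OF Q, of "atrans Q s j" "inv_into (vcar Q) j", simplified, OF t(1,3,4)]
  show "algebra (atrans Q s j)" "alg_hom (atrans Q s j) Q (inv_into (vcar Q) j)"
    by (rule r; auto simp: atrans_def inv alg_mult[OF Q] alg_one[OF Q])+
  show "alg_hom Q (atrans Q s j) j"
    using t(2) by (simp add: alg_hom_def) (simp add: atrans_def inv)
qed

lemma
  assumes H: "hopf_algebra H" and j: "embeds H s j"
  shows btrans_hopf: "hopf_algebra (btrans H s j)"
    and btrans_hom: "bialg_hom H (btrans H s j) j"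
    and btrans_inv_hom: "bialg_hom (btrans H s j) H (inv_into (vcar H) j)"
proof -
  obtain S where B: "bialgebra H" and S: "is_antipode H S" using H by (auto simp: hopf_algebra_def)
  note vs = bi_vspace[OF B]
  let ?i = "inv_into (vcar H) j"
  note t = tvsp_vspace[OF vs j] tvsp_lin[OF vs j] tvsp_inv[OF vs j] tvsp_inv_inj[OF vs j] and inv = tvsp_inv_f[OF vs j]
  have D: "lin_map (tvsp H s j) (tensor_space (tvsp H s j) (tvsp H s j)) (bdelta (btrans H s j))"
    unfolding btrans_def by (simp add: lin_comp[OF tmap_lin[OF vs vs t(2,2)] lin_comp[OF bi_delta[OF B] t(3)]])
  have Dj: "tmap (tvsp H s j) (tvsp H s j) H H ?i ?i (bdelta (btrans H s j) x) = bdelta H (?i x)" if "x \<in> j ` vcar H" for x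
    unfolding btrans_def using lin_mem[OF bi_delta[OF B], of "inv_into (vcar H) j x"] that
    by (simp add: tmap_tmap_id[OF vs vs t(2,2,1,1,3,3) inv inv] inv_into_into)
  note r = bialgebra_reflect[OF B, of "btrans H s j" "inv_into (vcar H) j", simplified, OF t(1,3,4) _ _ _ _ D Dj]
  have 1: "bialgebra (btrans H s j)" and 2: "bialg_hom (btrans H s j) H ?i"
    by (rule r; auto simp: btrans_def inv alg_mult[OF bi_alg[OF B]] alg_one[OF bi_alg[OF B]])+
  then show "bialg_hom (btrans H s j) H ?i" by simp
  show "hopf_algebra (btrans H s j)"
    by (rule hopf_reflect[OF 1 B S 2, of "\<lambda>x. j (S (?i x))"]) (use t(4) in \<open>auto simp: inv antipode_mem[OF B S]\<close>)
  show "bialg_hom H (btrans H s j) j"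
    using t(2) by (simp add: bialg_hom_def alg_hom_def coalg_hom_def) (simp add: btrans_def inv)
qed

text \<open>The test object \<open>L\<close> is replaced by its copy in \<open>'t\<close>;
  composition with \<open>j\<close> and its inverse moves arrows back and forth, and uniqueness with
  them.\<close>

lemma hopf_right_adjoint_embeds:
  assumes U: "hopf_right_adjoint TYPE('t::ab_group_add) B H \<eta>" and L: "hopf_algebra L"
    and j: "embeds L s (j :: _ \<Rightarrow> 't)" and f: "bialg_hom L B f" and B: "bialgebra B"
  shows "ex_unique_on (vcar L) (\<lambda>g. hopf_hom L H g \<and> (\<forall>x\<in>vcar L. \<eta> (g x) = f x))"
proof -
  let ?L = "btrans L s j" and ?i = "inv_into (vcar L) j"
  have bL: "bialgebra L" and H: "hopf_algebra H" "bialgebra H"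
    using L U by (auto simp: hopf_algebra_def hopf_right_adjoint_def)
  note L' = btrans_hopf[OF L j] and h = btrans_hom[OF L j] btrans_inv_hom[OF L j]
  have bL': "bialgebra ?L" using L' by (simp add: hopf_algebra_def)
  have inv: "?i (j x) = x" if "x \<in> vcar L" for x using j that by (simp add: embeds_def)
  have "bialg_hom ?L B (\<lambda>x. f (?i x))" by (rule bialg_hom_comp[OF bL' bL B h(2) f])
  then have "ex_unique_on (vcar ?L) (\<lambda>g. hopf_hom ?L H g \<and> (\<forall>x\<in>vcar ?L. \<eta> (g x) = f (?i x)))"
    using U L' unfolding hopf_right_adjoint_def by blast
  then obtain g where g: "hopf_hom ?L H g" "\<forall>x\<in>vcar ?L. \<eta> (g x) = f (?i x)"
    and u: "\<And>g'. hopf_hom ?L H g' \<Longrightarrow> \<forall>x\<in>vcar ?L. \<eta> (g' x) = f (?i x) \<Longrightarrow> \<forall>x\<in>vcar ?L. g' x = g x"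
    unfolding ex_unique_on_def by blast
  show ?thesis unfolding ex_unique_on_def
  proof (intro exI[of _ "\<lambda>x. g (j x)"] conjI allI impI ballI)
    show "hopf_hom L H (\<lambda>x. g (j x))"
      using g(1) L H bialg_hom_comp[OF bL bL' H(2) h(1)] by (simp add: hopf_hom_def)
    show "\<eta> (g (j x)) = f x" if "x \<in> vcar L" for x using g(2) that inv by simp
    fix g' x assume g': "hopf_hom L H g' \<and> (\<forall>x\<in>vcar L. \<eta> (g' x) = f x)" and x: "x \<in> vcar L"
    have "hopf_hom ?L H (\<lambda>x. g' (?i x))"
      using g' L' H bialg_hom_comp[OF bL' bL H(2) h(2)] by (simp add: hopf_hom_def)
    then have "\<forall>x\<in>vcar ?L. g' (?i x) = g x" by (rule u) (use g' inv in auto)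
    then show "g' x = g (j x)" using x inv by auto
  qed
qed

lemma hopf_left_adjoint_embeds:
  assumes U: "hopf_left_adjoint TYPE('t::ab_group_add) B H \<eta>" and L: "hopf_algebra L"
    and j: "embeds L s (j :: _ \<Rightarrow> 't)" and f: "bialg_hom B L f" and B: "bialgebra B"
  shows "ex_unique_on (vcar H) (\<lambda>g. hopf_hom H L g \<and> (\<forall>x\<in>vcar B. g (\<eta> x) = f x))"
proof -
  let ?L = "btrans L s j" and ?i = "inv_into (vcar L) j"
  have bL: "bialgebra L" and H: "hopf_algebra H" "bialgebra H" and \<eta>: "bialg_hom B H \<eta>"
    using L U by (auto simp: hopf_algebra_def hopf_left_adjoint_def)
  note L' = btrans_hopf[OF L j] and h = btrans_hom[OF L j] btrans_inv_hom[OF L j]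
  have bL': "bialgebra ?L" using L' by (simp add: hopf_algebra_def)
  have inv: "?i (j x) = x" if "x \<in> vcar L" for x using j that by (simp add: embeds_def)
  have "bialg_hom B ?L (\<lambda>x. j (f x))" by (rule bialg_hom_comp[OF B bL bL' f h(1)])
  then have "ex_unique_on (vcar H) (\<lambda>g. hopf_hom H ?L g \<and> (\<forall>x\<in>vcar B. g (\<eta> x) = j (f x)))"
    using U L' unfolding hopf_left_adjoint_def by blast
  then obtain g where g: "hopf_hom H ?L g" "\<forall>x\<in>vcar B. g (\<eta> x) = j (f x)"
    and u: "\<And>g'. hopf_hom H ?L g' \<Longrightarrow> \<forall>x\<in>vcar B. g' (\<eta> x) = j (f x) \<Longrightarrow> \<forall>x\<in>vcar H. g' x = g x"
    unfolding ex_unique_on_def by blast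
  show ?thesis unfolding ex_unique_on_def
  proof (intro exI[of _ "\<lambda>x. ?i (g x)"] conjI allI impI ballI)
    show "hopf_hom H L (\<lambda>x. ?i (g x))"
      using g(1) L H bialg_hom_comp[OF H(2) bL' bL _ h(2)] by (simp add: hopf_hom_def)
    show "?i (g (\<eta> x)) = f x" if "x \<in> vcar B" for x
      using g(2) that inv bspec[OF g(2) that] lin_mem[of B L f x] f by (simp add: bialg_hom_def alg_hom_def)
    fix g' x assume g': "hopf_hom H L g' \<and> (\<forall>x\<in>vcar B. g' (\<eta> x) = f x)" and x: "x \<in> vcar H"
    have "hopf_hom H ?L (\<lambda>x. j (g' x))"
      using g' L' H bialg_hom_comp[OF H(2) bL bL' _ h(1)] by (simp add: hopf_hom_def)
    then have "\<forall>x\<in>vcar H. j (g' x) = g x" by (rule u) (use g' inv in auto)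
    then have "g x = j (g' x)" using x by simp
    moreover have "g' x \<in> vcar L" using g' x lin_mem[of H L g' x] by (simp add: hopf_hom_def bialg_hom_def alg_hom_def)
    ultimately show "g' x = ?i (g x)" using inv by simp
  qed
qed

section \<open>The finite dual\<close>

lemma tensor_apply_sum:
  assumes X: "X \<in> vcar (tensor_space V W)" and vs: "vspace V" "vspace W" and \<beta>: "\<And>i. i \<in> I \<Longrightarrow> bf V W (\<beta> i)"
  shows "X (\<lambda>v w. \<Sum>i\<in>I. \<beta> i v w) = (\<Sum>i\<in>I. X (\<beta> i))"
proof -
  obtain n :: nat and l r where *: "\<And>\<beta>. bf V W \<beta> \<Longrightarrow> X \<beta> = (\<Sum>i<n. \<beta> (l i) (r i))"
    using tensor_apply_rep[OF X vs] by metis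
  have "bf V W (\<lambda>v w. \<Sum>i\<in>I. \<beta> i v w)"
    by (intro bilin_mapI lf_sum) (auto dest: bilin_left[OF \<beta>] bilin_right[OF \<beta>])
  then have "X (\<lambda>v w. \<Sum>i\<in>I. \<beta> i v w) = (\<Sum>k<n. \<Sum>i\<in>I. \<beta> i (l k) (r k))" by (rule *)
  also have "\<dots> = (\<Sum>i\<in>I. \<Sum>k<n. \<beta> i (l k) (r k))" by (rule sum.swap)
  also have "\<dots> = (\<Sum>i\<in>I. X (\<beta> i))" by (rule sum.cong) (auto simp: *[OF \<beta>])
  finally show ?thesis .
qed

lemma tensor_rep_ex:
  assumes "X \<in> vcar (tensor_space V W)" "vspace V" "vspace W"
  shows "\<exists>(n :: nat) l r. (\<forall>i. l i \<in> vcar V) \<and> (\<forall>i. r i \<in> vcar W) \<and>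
    (\<forall>\<beta>. bf V W \<beta> \<longrightarrow> X \<beta> = (\<Sum>i<n. \<beta> (l i) (r i)))"
  by (rule tensor_apply_rep[OF assms]) blast

text \<open>The common kernel of finitely many functionals has finite codimension, and
  \<open>S\<close> spans the quotient by it. In the induction a vector is added only if the new
  functional is nonzero on the kernel of the earlier ones.\<close>

lemma finite_codim_kernel:
  assumes V: "vspace V" and J: "finite J" "\<And>j. j \<in> J \<Longrightarrow> lf V (k j)"
  shows "\<exists>S. finite S \<and> S \<subseteq> vcar V \<and> (\<forall>x\<in>vcar V. \<exists>y\<in>module.span (vscale V) S. \<forall>j\<in>J. k j x = k j y)"
  using J
proof (induction J)
  case empty
  interpret vector_space "vscale V" using V by (rule vspace_vector_space)
  show ?case by (intro exI[of _ "{}"]) simp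
next
  case (insert j J)
  interpret vector_space "vscale V" using V by (rule vspace_vector_space)
  have sub: "span S \<subseteq> vcar V" if "S \<subseteq> vcar V" for S
    using span_minimal[OF that] V by (simp add: vspace_def)
  obtain S where S: "finite S" "S \<subseteq> vcar V" "\<And>x. x \<in> vcar V \<Longrightarrow> \<exists>y\<in>span S. \<forall>j\<in>J. k j x = k j y"
    using insert.IH insert.prems by auto
  have lj: "lf V (k j)" and lJ: "\<And>i. i \<in> J \<Longrightarrow> lf V (k i)" using insert.prems by auto
  show ?case
  proof (cases "\<exists>z\<in>vcar V. (\<forall>i\<in>J. k i z = 0) \<and> k j z \<noteq> 0")
    case True
    then obtain z where z: "z \<in> vcar V" "\<And>i. i \<in> J \<Longrightarrow> k i z = 0" "k j z \<noteq> 0" by blast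
    show ?thesis
    proof (intro exI[of _ "insert z S"] conjI ballI)
      fix x assume x: "x \<in> vcar V"
      obtain y where y: "y \<in> span S" "\<forall>j\<in>J. k j x = k j y" using S(3)[OF x] by blast
      have yV: "y \<in> vcar V" using y(1) sub[OF S(2)] by auto
      let ?c = "(k j x - k j y) / k j z"
      have "vscale V ?c z + y \<in> span (insert z S)"
        using subsetD[OF span_mono[of S "insert z S"] y(1)] by (intro span_add span_scale) (auto intro: span_base)
      moreover have "k i x = k i (vscale V ?c z + y)" if "i \<in> insert j J" for i
        using that y(2) z lin_add[OF lj vs_scale[OF V z(1)] yV] lin_scale[OF lj z(1)]
          lin_add[OF lJ vs_scale[OF V z(1)] yV] lin_scale[OF lJ z(1)] by auto
      ultimately show "\<exists>y\<in>span (insert z S). \<forall>j\<in>insert j J. k j x = k j y" by blast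
    qed (use S z in auto)
  next
    case False
    show ?thesis
    proof (intro exI[of _ S] conjI ballI)
      fix x assume x: "x \<in> vcar V"
      obtain y where y: "y \<in> span S" "\<forall>j\<in>J. k j x = k j y" using S(3)[OF x] by blast
      have yV: "y \<in> vcar V" using y(1) sub[OF S(2)] by auto
      have "k j (x - y) = 0"
        using False vs_diff[OF V x yV] y(2) lin_diff[OF lJ V x yV] by auto
      then show "\<exists>y\<in>span S. \<forall>j\<in>insert j J. k j x = k j y"
        using y lin_diff[OF lj V x yV] by auto
    qed (use S in auto)
  qed
qed

text \<open>Representatives in \<open>S\<close> of a basis of the quotient by \<open>I\<close>, with
  the dual basis as functionals killing \<open>I\<close>. The set \<open>C\<close> is the part that
  is added when a basis of \<open>I\<close> is completed to one of the span of \<open>I\<close> and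
  \<open>S\<close>.\<close>

lemma codim_coordinates:
  assumes s: "vector_space s" and I: "module.subspace s I" and S: "finite S"
  shows "\<exists>C c. finite C \<and> C \<subseteq> S \<and> (\<forall>b\<in>C. Vector_Spaces.linear s (*) (c b :: _ \<Rightarrow> 'k::field)) \<and>
    (\<forall>b\<in>C. \<forall>x\<in>I. c b x = 0) \<and> (\<forall>x\<in>module.span s (I \<union> S). x - (\<Sum>b\<in>C. s (c b x) b) \<in> I) \<and>
    (\<forall>b\<in>C. \<forall>b'\<in>C. c b b' = (if b' = b then 1 else 0))"
proof -
  interpret vector_space s by fact
  interpret p: vector_space_pair s "(*) :: 'k \<Rightarrow> 'k \<Rightarrow> 'k"
    by (intro vector_space_pair.intro s vspace_vector_space[OF vspace_ground, simplified])
  obtain BI where BI: "BI \<subseteq> I" "independent BI" "I \<subseteq> span BI" by (rule maximal_independent_subset)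
  have IB: "I = span BI" using BI I span_minimal by blast
  obtain B where B: "BI \<subseteq> B" "B \<subseteq> BI \<union> S" "independent B" "BI \<union> S \<subseteq> span B"
    using maximal_independent_subset_extend[of BI "BI \<union> S"] BI(2) by blast
  define C where "C = B - BI"
  have C: "finite C" "C \<subseteq> S" using B S finite_subset[of C S] by (auto simp: C_def)
  have "\<exists>f. Vector_Spaces.linear s (*) f \<and> (\<forall>x\<in>B. f x = (if x = b then 1 else 0))" for b
    by (rule p.linear_independent_extend[OF B(3)])
  then obtain c where c: "\<And>b. Vector_Spaces.linear s (*) (c b)" "\<And>b x. x \<in> B \<Longrightarrow> c b x = (if x = b then 1 else 0)"
    by metis
  have c0: "c b x = 0" if b: "b \<in> C" and x: "x \<in> I" for b x
  proof -
    interpret f: Vector_Spaces.linear s "(*)" "c b" by (rule c)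
    have "x \<in> span BI" using x IB by simp
    then show ?thesis
      by (rule f.eq_0_on_span[rotated]) (use b B c(2) in \<open>auto simp: C_def subset_iff\<close>)
  qed
  have "x - (\<Sum>b\<in>C. s (c b x) b) \<in> I" if "x \<in> span (I \<union> S)" for x
  proof -
    have "span (I \<union> S) \<subseteq> span B"
      using B(4) IB span_mono[of BI B] B(1) by (intro span_minimal) auto
    then have "x \<in> span B" using that by auto
    then show ?thesis
    proof (induction rule: span_induct_alt)
      case base
      have "c b 0 = 0" for b
      proof -
        interpret f: Vector_Spaces.linear s "(*)" "c b" by (rule c)
        show ?thesis by (rule f.zero)
      qed
      then show ?case using I subspace_0 by simp
    next
      case (step a x y)
      have lin: "c b (s a x + y) = a * c b x + c b y" for b
      proof -
        interpret f: Vector_Spaces.linear s "(*)" "c b" by (rule c)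
        show ?thesis by (simp add: f.add f.scale)
      qed
      have "x - (\<Sum>b\<in>C. s (c b x) b) \<in> I"
      proof (cases "x \<in> BI")
        case True
        then have "(\<Sum>b\<in>C. s (c b x) b) = 0"
          using step(1) by (intro sum.neutral) (auto simp: c(2) C_def)
        then show ?thesis using True BI(1) by auto
      next
        case False
        then have "x \<in> C" using step(1) by (simp add: C_def)
        then have "(\<Sum>b\<in>C. s (c b x) b) = s (c x x) x + (\<Sum>b\<in>C - {x}. s (c b x) b)"
          by (rule sum.remove[OF C(1)])
        also have "(\<Sum>b\<in>C - {x}. s (c b x) b) = 0"
          using step(1) by (intro sum.neutral) (auto simp: c(2))
        finally show ?thesis using step(1) I subspace_0 by (simp add: c(2))
      qed
      then have "s a (x - (\<Sum>b\<in>C. s (c b x) b)) + (y - (\<Sum>b\<in>C. s (c b y) b)) \<in> I"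
        using step(2) I by (intro subspace_add subspace_scale)
      moreover have "s a (x - (\<Sum>b\<in>C. s (c b x) b)) + (y - (\<Sum>b\<in>C. s (c b y) b))
          = s a x + y - (\<Sum>b\<in>C. s (c b (s a x + y)) b)"
        by (simp add: lin scale_right_diff_distrib scale_sum_right scale_left_distrib sum.distrib)
      ultimately show ?case by simp
    qed
  qed
  moreover have "c b b' = (if b' = b then 1 else 0)" if "b' \<in> C" for b b'
    using that c(2) by (simp add: C_def)
  ultimately show ?thesis using C c(1) c0 by (intro exI[of _ C] exI[of _ c]) auto
qed

lemma finite_dual_carrierD:
  assumes "f \<in> finite_dual_carrier Q"
  shows "lf Q f" "x \<notin> vcar Q \<Longrightarrow> f x = 0"
  using assms by (auto simp: finite_dual_carrier_def)

text \<open>The finite rank criterion. The largest two-sided ideal in the kernel of \<open>f\<close>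
  has finite codimension, because f(xzy) depends on \<open>x\<close> only through the finitely many
  \<open>g j x\<close> and on \<open>y\<close> only through the \<open>h j y\<close>.\<close>

lemma finite_dual_carrierI:
  assumes Q: "algebra Q" and f: "lf Q f" "\<And>x. x \<notin> vcar Q \<Longrightarrow> f x = 0"
    and J: "finite J" "\<And>j. j \<in> J \<Longrightarrow> lf Q (g j)" "\<And>j. j \<in> J \<Longrightarrow> lf Q (h j)"
    and fJ: "\<And>x y. x \<in> vcar Q \<Longrightarrow> y \<in> vcar Q \<Longrightarrow> f (amult Q x y) = (\<Sum>j\<in>J. g j x * h j y)"
  shows "f \<in> finite_dual_carrier Q"
proof -
  note vs = alg_vspace[OF Q] and mb = alg_bilin[OF Q] and mm = alg_mult[OF Q]
  interpret vector_space "vscale Q" using vs by (rule vspace_vector_space)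
  have sub: "subspace (vcar Q)" using vs by (simp add: vspace_def)
  obtain S where S': "finite S" "S \<subseteq> vcar Q" "\<forall>x\<in>vcar Q. \<exists>y\<in>span S. \<forall>j\<in>J. g j x = g j y"
    using finite_codim_kernel[OF vs J(1), of g, OF J(2)] by blast
  note S = S'(1,2) bspec[OF S'(3)]
  obtain T where T': "finite T" "T \<subseteq> vcar Q" "\<forall>x\<in>vcar Q. \<exists>y\<in>span T. \<forall>j\<in>J. h j x = h j y"
    using finite_codim_kernel[OF vs J(1), of h, OF J(3)] by blast
  note T = T'(1,2) bspec[OF T'(3)]
  have SQ: "span S \<subseteq> vcar Q" "span T \<subseteq> vcar Q" using span_minimal[OF S(2) sub] span_minimal[OF T(2) sub] by auto
  define I where "I = {z \<in> vcar Q. \<forall>x\<in>vcar Q. \<forall>y\<in>vcar Q. f (amult Q (amult Q x z) y) = 0}"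
  have lf3: "lf Q (\<lambda>x. f (amult Q (amult Q x z) y))" "lf Q (\<lambda>z. f (amult Q (amult Q x z) y))" "lf Q (\<lambda>y. f (amult Q (amult Q x z) y))"
    if "x \<in> vcar Q" "y \<in> vcar Q" "z \<in> vcar Q" for x y z
    by (intro lin_comp[OF f(1)] lin_bilin_left[OF mb] lin_bilin_right[OF mb] bilin_left[OF mb] bilin_right[OF mb] that mm lin_id)+
  have I: "subspace I"
    unfolding I_def
    by (rule subspaceI) (auto simp: vs_zero[OF vs] vs_add[OF vs] vs_scale[OF vs] lin_add[OF lf3(2)] lin_scale[OF lf3(2)] lin_zero[OF lf3(2) vs])
  have ideal: "amult Q x y \<in> I \<and> amult Q y x \<in> I" if "x \<in> vcar Q" "y \<in> I" for x y
  proof -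
    have y: "y \<in> vcar Q" "\<And>a b. a \<in> vcar Q \<Longrightarrow> b \<in> vcar Q \<Longrightarrow> f (amult Q (amult Q a y) b) = 0"
      using that by (auto simp: I_def)
    have "f (amult Q (amult Q a (amult Q x y)) b) = 0" "f (amult Q (amult Q a (amult Q y x)) b) = 0" if "a \<in> vcar Q" "b \<in> vcar Q" for a b
      using y(2)[of "amult Q a x" b] y(2)[of a "amult Q x b"] that \<open>x \<in> vcar Q\<close> y(1) by (auto simp: alg_assoc[OF Q] mm)
    then show ?thesis using that y(1) by (auto simp: I_def mm)
  qed
  have If: "f z = 0" if "z \<in> I" for z
    using that alg_one[OF Q] by (auto simp: I_def alg_one_left[OF Q] alg_one_right[OF Q] dest!: bspec[of _ _ "aone Q"])
  \<comment> \<open>It suffices to test with the finite sets \<open>S\<close> and \<open>T\<close>,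
    so \<open>I\<close> is cut out by finitely many functionals.\<close>
  have ker: "z \<in> I" if z: "z \<in> vcar Q" and st: "\<And>s t. s \<in> S \<Longrightarrow> t \<in> T \<Longrightarrow> f (amult Q (amult Q s z) t) = 0" for z
  proof -
    have 1: "f (amult Q (amult Q x z) t) = 0" if x: "x \<in> span S" and t: "t \<in> T" for x t
    proof -
      have "x \<in> vcar Q \<and> f (amult Q (amult Q x z) t) = 0" using x
      proof (induction rule: span_induct_alt)
        case base
        then show ?case using lin_zero[OF lf3(1) vs] t T(2) z by (auto simp: vs_zero[OF vs])
      next
        case (step c x y)
        then show ?case using t T(2) S(2) z st
          by (auto simp: vs_add[OF vs] vs_scale[OF vs] lin_add[OF lf3(1)] lin_scale[OF lf3(1)] subset_iff)
      qed
      then show ?thesis by simp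
    qed
    have 2: "f (amult Q (amult Q x z) y) = 0" if x: "x \<in> span S" and y: "y \<in> span T" for x y
    proof -
      have xQ: "x \<in> vcar Q" using x SQ by auto
      have "y \<in> vcar Q \<and> f (amult Q (amult Q x z) y) = 0" using y
      proof (induction rule: span_induct_alt)
        case base
        then show ?case using lin_zero[OF lf3(3) vs] xQ z by (auto simp: vs_zero[OF vs])
      next
        case (step c t y)
        then show ?case using xQ T(2) S(2) z 1[OF x]
          by (auto simp: vs_add[OF vs] vs_scale[OF vs] lin_add[OF lf3(3)] lin_scale[OF lf3(3)] subset_iff)
      qed
      then show ?thesis by simp
    qed
    have "f (amult Q (amult Q x z) y) = 0" if x: "x \<in> vcar Q" and y: "y \<in> vcar Q" for x y
    proof -
      obtain x' where x': "x' \<in> span S" "\<forall>j\<in>J. g j x = g j x'" using S(3)[OF x] by blast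
      obtain y' where y': "y' \<in> span T" "\<forall>j\<in>J. h j y = h j y'" using T(3)[OF y] by blast
      have Q': "x' \<in> vcar Q" "y' \<in> vcar Q" using x' y' SQ by auto
      \<comment> \<open>Splitting the triple product after \<open>z\<close> allows \<open>y\<close>
        to be exchanged for \<open>y'\<close>; splitting it after \<open>x\<close> then allows
        \<open>x\<close> to be exchanged for \<open>x'\<close>.\<close>
      have "f (amult Q (amult Q x z) y) = f (amult Q (amult Q x z) y')"
        using x z y y'(2) Q' by (simp add: fJ mm)
      also have "\<dots> = f (amult Q x (amult Q z y'))" using x z Q' by (simp add: alg_assoc[OF Q])
      also have "\<dots> = f (amult Q x' (amult Q z y'))" using x z x'(2) Q' by (simp add: fJ mm)
      also have "\<dots> = f (amult Q (amult Q x' z) y')" using z Q' by (simp add: alg_assoc[OF Q])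
      also have "\<dots> = 0" by (rule 2[OF x'(1) y'(1)])
      finally show ?thesis .
    qed
    then show ?thesis using z by (simp add: I_def)
  qed
  obtain U where U: "finite U" "U \<subseteq> vcar Q"
    "\<And>x. x \<in> vcar Q \<Longrightarrow> \<exists>y\<in>span U. \<forall>p\<in>S \<times> T. f (amult Q (amult Q (fst p) x) (snd p)) = f (amult Q (amult Q (fst p) y) (snd p))"
    using finite_codim_kernel[OF vs, of "S \<times> T" "\<lambda>p z. f (amult Q (amult Q (fst p) z) (snd p))"] S(1,2) T(1,2) lf3(2) vs_zero[OF vs]
    by (auto simp: subset_iff)
  have "span (I \<union> U) = vcar Q"
  proof
    show "span (I \<union> U) \<subseteq> vcar Q" using U(2) by (intro span_minimal sub) (auto simp: I_def)
    show "vcar Q \<subseteq> span (I \<union> U)"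
    proof
      fix x assume x: "x \<in> vcar Q"
      obtain y where y: "y \<in> span U" "\<forall>p\<in>S \<times> T. f (amult Q (amult Q (fst p) x) (snd p)) = f (amult Q (amult Q (fst p) y) (snd p))"
        using U(3)[OF x] by blast
      have yQ: "y \<in> vcar Q" using y(1) span_minimal[OF U(2) sub] by auto
      have "x - y \<in> I"
      proof (rule ker[OF vs_diff[OF vs x yQ]])
        fix s t assume "s \<in> S" "t \<in> T"
        then show "f (amult Q (amult Q s (x - y)) t) = 0"
          using y(2) S(2) T(2) lin_diff[OF lf3(2) vs x yQ, of s t] x by (auto simp: subset_iff)
      qed
      then have "(x - y) + y \<in> span (I \<union> U)"
        using y(1) span_mono[of U "I \<union> U"] by (intro span_add) (auto intro: span_base)
      then show "x \<in> span (I \<union> U)" by simp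
    qed
  qed
  then have "finite_codim_ideal Q I"
    unfolding finite_codim_ideal_def using I ideal U(1) by (auto simp: I_def)
  then show ?thesis using f If by (auto simp: finite_dual_carrier_def)
qed

text \<open>A finite expression for the coproduct of \<open>f\<close> with both families again in
  the finite dual. It supplies the tensor whose existence the definition of \<open>bdelta\<close> on
  the finite dual presupposes.\<close>

definition factors :: "('k::field, 'u::ab_group_add, 'z) alg_scheme \<Rightarrow> ('u \<Rightarrow> 'k) \<Rightarrow> 'u set
    \<Rightarrow> ('u \<Rightarrow> 'u \<Rightarrow> 'k) \<Rightarrow> ('u \<Rightarrow> 'u \<Rightarrow> 'k) \<Rightarrow> bool" where
  "factors Q f C c h \<longleftrightarrow> finite C \<and> (\<forall>b\<in>C. c b \<in> finite_dual_carrier Q) \<and> (\<forall>b\<in>C. h b \<in> finite_dual_carrier Q) \<and>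
    (\<forall>x\<in>vcar Q. \<forall>y\<in>vcar Q. f (amult Q x y) = (\<Sum>b\<in>C. c b x * h b y))"

lemma factorsD:
  assumes "factors Q f C c h"
  shows "finite C" "b \<in> C \<Longrightarrow> c b \<in> finite_dual_carrier Q" "b \<in> C \<Longrightarrow> h b \<in> finite_dual_carrier Q"
    "x \<in> vcar Q \<Longrightarrow> y \<in> vcar Q \<Longrightarrow> f (amult Q x y) = (\<Sum>b\<in>C. c b x * h b y)"
  using assms by (simp_all add: factors_def)

text \<open>\<open>C\<close> and \<open>c\<close> are dual bases of the quotient by an ideal that
  \<open>f\<close> kills, so every functional killing this ideal expands in \<open>c\<close> with
  its values on \<open>C\<close> as coefficients.\<close>

lemma finite_dual_coordinates:
  fixes Q :: "('k::field, 'u::ab_group_add, 'z) alg_scheme"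
  assumes Q: "algebra Q" and f: "f \<in> finite_dual_carrier Q"
  shows "\<exists>I C c. finite_codim_ideal Q I \<and> (\<forall>x\<in>I. f x = 0) \<and> finite C \<and> C \<subseteq> vcar Q \<and>
    (\<forall>b\<in>C. lf Q (c b)) \<and> (\<forall>b\<in>C. \<forall>x\<in>I. c b x = 0) \<and> (\<forall>b\<in>C. \<forall>b'\<in>C. c b b' = (if b' = b then 1 else 0)) \<and>
    (\<forall>g. lf Q g \<longrightarrow> (\<forall>x\<in>I. g x = 0) \<longrightarrow> (\<forall>y\<in>vcar Q. g y = (\<Sum>b\<in>C. c b y * g b)))"
proof -
  note vs = alg_vspace[OF Q]
  interpret vector_space "vscale Q" using vs by (rule vspace_vector_space)
  obtain I where I: "finite_codim_ideal Q I" "\<forall>x\<in>I. f x = 0"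
    using f by (auto simp: finite_dual_carrier_def)
  then obtain S where S: "finite S" "span (I \<union> S) = vcar Q" and Is: "subspace I" "I \<subseteq> vcar Q"
    by (auto simp: finite_codim_ideal_def)
  have SQ: "S \<subseteq> vcar Q" using S(2) span_superset[of "I \<union> S"] by auto
  obtain C c where C': "finite C" "C \<subseteq> S" "\<forall>b\<in>C. Vector_Spaces.linear (vscale Q) (*) (c b)"
    "\<forall>b\<in>C. \<forall>x\<in>I. c b x = 0" "\<forall>x\<in>span (I \<union> S). x - (\<Sum>b\<in>C. vscale Q (c b x) b) \<in> I"
    "\<forall>b\<in>C. \<forall>b'\<in>C. c b b' = (if b' = b then 1 else 0)"
    using codim_coordinates[OF vector_space_axioms Is(1) S(1)] by blast
  have CQ: "C \<subseteq> vcar Q" using C'(2) SQ by blast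
  have "g y = (\<Sum>b\<in>C. c b y * g b)" if g: "lf Q g" "\<forall>x\<in>I. g x = 0" and y: "y \<in> vcar Q" for g y
  proof -
    let ?s = "\<Sum>b\<in>C. vscale Q (c b y) b"
    have s: "?s \<in> vcar Q" by (rule vs_sum[OF vs]) (use CQ in \<open>auto intro: vs_scale[OF vs]\<close>)
    have "g (y - ?s) = 0" using bspec[OF C'(5), of y] y S(2) g(2) by auto
    then have "g y = g ?s" using lin_diff[OF g(1) vs y s] by simp
    also have "\<dots> = (\<Sum>b\<in>C. g (vscale Q (c b y) b))"
      by (rule lin_sum[OF g(1) vs]) (use CQ in \<open>auto intro: vs_scale[OF vs]\<close>)
    finally show ?thesis using lin_scale[OF g(1)] CQ by (simp add: subset_iff)
  qed
  then have "\<forall>g. lf Q g \<longrightarrow> (\<forall>x\<in>I. g x = 0) \<longrightarrow> (\<forall>y\<in>vcar Q. g y = (\<Sum>b\<in>C. c b y * g b))" by blast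
  moreover have "\<forall>b\<in>C. lf Q (c b)" using C'(3) linear_lf by blast
  ultimately show ?thesis using I C'(1,4,6) CQ
    by (intro exI[of _ I] exI[of _ C] exI[of _ c] conjI)
qed

text \<open>For fixed \<open>y\<close> the functional x \<mapsto> f(xy) kills the ideal, hence
  expands in the coordinates \<open>c\<close>. The coefficients f(by), as functionals of
  \<open>y\<close>, kill the ideal too.\<close>

lemma finite_dual_factor:
  fixes Q :: "('k::field, 'u::ab_group_add, 'z) alg_scheme"
  assumes Q: "algebra Q" and f: "f \<in> finite_dual_carrier Q"
  shows "\<exists>C c h. factors Q f C c h"
proof -
  note vs = alg_vspace[OF Q] and mb = alg_bilin[OF Q] and fl = finite_dual_carrierD[OF f]
  obtain I C c where I: "finite_codim_ideal Q I" "\<forall>x\<in>I. f x = 0" and C: "finite C" "C \<subseteq> vcar Q" "\<forall>b\<in>C. lf Q (c b)"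
    "\<forall>b\<in>C. \<forall>x\<in>I. c b x = 0"
    and key: "\<forall>g. lf Q g \<longrightarrow> (\<forall>x\<in>I. g x = 0) \<longrightarrow> (\<forall>y\<in>vcar Q. g y = (\<Sum>b\<in>C. c b y * g b))"
    using finite_dual_coordinates[OF Q f] by blast
  have IQ: "I \<subseteq> vcar Q" and Ii: "\<And>x y. x \<in> vcar Q \<Longrightarrow> y \<in> I \<Longrightarrow> amult Q x y \<in> I \<and> amult Q y x \<in> I"
    using I(1) by (auto simp: finite_codim_ideal_def)
  \<comment> \<open>Membership in \<open>finite_dual_carrier\<close> demands the value 0 off the
    carrier.\<close>
  define c' where "c' b x = (if x \<in> vcar Q then c b x else 0)" for b x
  define h where "h b x = (if x \<in> vcar Q then f (amult Q b x) else 0)" for b x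
  have fin: "g \<in> finite_dual_carrier Q" if "lf Q g" "\<And>x. x \<notin> vcar Q \<Longrightarrow> g x = 0" "\<And>x. x \<in> I \<Longrightarrow> g x = 0" for g
    using that I(1) by (auto simp: finite_dual_carrier_def)
  have "factors Q f C c' h"
    unfolding factors_def
  proof (intro conjI ballI)
    show "finite C" by (rule C(1))
    fix b assume b: "b \<in> C"
    then have bQ: "b \<in> vcar Q" using C(2) by blast
    show "c' b \<in> finite_dual_carrier Q"
    proof (rule fin)
      show "lf Q (c' b)" by (rule lin_cong[OF bspec[OF C(3) b] vs]) (simp add: c'_def)
    qed (use C(4) b IQ in \<open>auto simp: c'_def\<close>)
    show "h b \<in> finite_dual_carrier Q"
    proof (rule fin)
      show "lf Q (h b)" by (rule lin_cong[OF lin_comp[OF fl(1) bilin_right[OF mb bQ]] vs]) (simp add: h_def)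
    qed (use Ii[OF bQ] I(2) in \<open>auto simp: h_def\<close>)
  next
    fix x y assume x: "x \<in> vcar Q" and y: "y \<in> vcar Q"
    have "\<forall>x\<in>I. f (amult Q x y) = 0" using Ii[OF y] I(2) by blast
    then have "f (amult Q x y) = (\<Sum>b\<in>C. c b x * f (amult Q b y))"
      using key lin_comp[OF fl(1) bilin_left[OF mb y]] x by blast
    then show "f (amult Q x y) = (\<Sum>b\<in>C. c' b x * h b y)" by (simp add: c'_def h_def x y)
  qed
  then show ?thesis by blast
qed

section \<open>The finite dual as a bialgebra and as a Hopf algebra\<close>

lemma finite_dual_simps [simp]: "vcar (finite_dual H) = finite_dual_carrier H" "vscale (finite_dual H) = fscale"
  "beps (finite_dual H) = (\<lambda>f. f (aone H))"
  by (simp_all add: finite_dual_def)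

lemma finite_dual_space_simps [simp]: "vcar (finite_dual_space H) = finite_dual_carrier H"
  "vscale (finite_dual_space H) = fscale"
  by (simp_all add: finite_dual_space_def)

lemmas finite_dual_space_cong =
  vsp_cong_left[of "finite_dual_space H" "finite_dual H" for H, simplified]
  vsp_cong_right[of "finite_dual_space H" "finite_dual H" for H, simplified]

lemma lf_add: "lf V f \<Longrightarrow> lf V g \<Longrightarrow> lf V (f + g)"
  by (auto simp: lin_map_def algebra_simps)

text \<open>Sums are handled by the finite rank criterion with the disjoint union of the two index
  sets, which avoids intersecting ideals of finite codimension.\<close>

lemma finite_dual_vspace:
  assumes Q: "algebra Q"
  shows "vspace (finite_dual_space Q)"
proof (rule vspaceI)
  show "vector_space (vscale (finite_dual_space Q))" by (simp add: vector_space_fscale)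
  show "0 \<in> vcar (finite_dual_space Q)"
    by simp (rule finite_dual_carrierI[OF Q, of _ "{}"], auto simp: zero_fun_def lf_const0)
  fix f g assume "f \<in> vcar (finite_dual_space Q)" "g \<in> vcar (finite_dual_space Q)"
  then have f: "f \<in> finite_dual_carrier Q" and g: "g \<in> finite_dual_carrier Q" by auto
  note fl = finite_dual_carrierD[OF f] and gl = finite_dual_carrierD[OF g]
  obtain C c h where C0: "factors Q f C c h"
    using finite_dual_factor[OF Q f] by blast
  note C = factorsD[OF C0]
  obtain C' c' h' where C'0: "factors Q g C' c' h'"
    using finite_dual_factor[OF Q g] by blast
  note C' = factorsD[OF C'0]
  have "f + g \<in> finite_dual_carrier Q"
    by (rule finite_dual_carrierI[OF Q, of _ "C <+> C'" "case_sum c c'" "case_sum h h'"])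
      (use C(1,4) C'(1,4) fl(2) gl(2) C(2,3)[THEN finite_dual_carrierD(1)] C'(2,3)[THEN finite_dual_carrierD(1)] lf_add[OF fl(1) gl(1)]
        in \<open>auto simp: sum.Plus\<close>)
  then show "f + g \<in> vcar (finite_dual_space Q)" by simp
next
  fix a f assume "f \<in> vcar (finite_dual_space Q)"
  then have f: "f \<in> finite_dual_carrier Q" by auto
  note fl = finite_dual_carrierD[OF f]
  have "fscale a f \<in> finite_dual_carrier Q"
    using f lf_mult_left[OF fl(1), of a] by (auto simp: finite_dual_carrier_def fscale_def)
  then show "vscale (finite_dual_space Q) a f \<in> vcar (finite_dual_space Q)" by simp
qed

lemma finite_dual_vspace' [simp]: "algebra H \<Longrightarrow> vspace (finite_dual H)"
  using finite_dual_vspace[of H] by (simp add: finite_dual_space_cong)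

lemma lf_eval: "lf (finite_dual H) (\<lambda>f. f x)"
  by (rule lin_mapI) auto

abbreviation evals :: "('k::field, 'u::ab_group_add, 'z) vsp_scheme \<Rightarrow> (('u \<Rightarrow> 'k) \<Rightarrow> 'k) set" where
  "evals H \<equiv> {\<lambda>f. f x | x. x \<in> vcar H}"

text \<open>Functionals with the same values on the carrier are equal as functions, since both are 0
  elsewhere.\<close>

lemma separates_evals: "separates (finite_dual H) (evals H)"
proof -
  have "f = 0" if "f \<in> finite_dual_carrier H" "\<forall>e\<in>evals H. e f = 0" for f
  proof
    fix x show "f x = 0 x" using that finite_dual_carrierD(2)[of f H x] by (cases "x \<in> vcar H") auto
  qed
  then show ?thesis by (auto simp: separates_def lf_eval)
qed

context
  fixes H :: "('k::field, 'u::ab_group_add) bialg"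
  assumes H: "bialgebra H"
begin

text \<open>Multiplicativity of the comultiplication combines factorisations of \<open>f\<close> and
  of \<open>g\<close> into one of their convolution. This gives both the closure of the finite dual
  under products and the multiplicativity of its own comultiplication.\<close>

lemma conv_factor:
  assumes f: "lf H f" and g: "lf H g" and I: "finite I" "\<And>i. i \<in> I \<Longrightarrow> lf H (f1 i)" "\<And>i. i \<in> I \<Longrightarrow> lf H (f2 i)"
    and J: "finite J" "\<And>i. i \<in> J \<Longrightarrow> lf H (g1 i)" "\<And>i. i \<in> J \<Longrightarrow> lf H (g2 i)"
    and fI: "\<And>x y. x \<in> vcar H \<Longrightarrow> y \<in> vcar H \<Longrightarrow> f (amult H x y) = (\<Sum>i\<in>I. f1 i x * f2 i y)"
    and gJ: "\<And>x y. x \<in> vcar H \<Longrightarrow> y \<in> vcar H \<Longrightarrow> g (amult H x y) = (\<Sum>i\<in>J. g1 i x * g2 i y)"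
    and x: "x \<in> vcar H" and y: "y \<in> vcar H"
  shows "conv (coalg_of H) f g (amult H x y)
    = (\<Sum>(i, j)\<in>I \<times> J. conv (coalg_of H) (f1 i) (g1 j) x * conv (coalg_of H) (f2 i) (g2 j) y)"
proof -
  note vs = bi_vspace[OF H]
  note Dx = lin_mem[OF bi_delta[OF H] x] and Dy = lin_mem[OF bi_delta[OF H] y]
  have "conv (coalg_of H) f g (amult H x y) = bdelta H x (\<lambda>a b. bdelta H y (\<lambda>c d. f (amult H a c) * g (amult H b d)))"
    by (simp add: conv_def bi_delta_mult[OF H x y bf_prod[OF f g]])
  also have "\<dots> = bdelta H x (\<lambda>a b. bdelta H y (\<lambda>c d. \<Sum>p\<in>I \<times> J. (f1 (fst p) a * g1 (snd p) b) * (f2 (fst p) c * g2 (snd p) d)))"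
    by (intro tensor_apply_cong[OF Dx vs vs] tensor_apply_cong[OF Dy vs vs])
      (simp add: fI gJ sum_product sum.cartesian_product case_prod_unfold mult_ac)
  also have "\<dots> = bdelta H x (\<lambda>a b. \<Sum>p\<in>I \<times> J. (f1 (fst p) a * g1 (snd p) b) * conv (coalg_of H) (f2 (fst p)) (g2 (snd p)) y)"
  proof (rule tensor_apply_cong[OF Dx vs vs])
    fix a b
    have bfp: "bf H H (\<lambda>c d. f2 (fst p) c * g2 (snd p) d)" if "p \<in> I \<times> J" for p
      using that by (intro bf_prod I J) auto
    have "bdelta H y (\<lambda>c d. \<Sum>p\<in>I \<times> J. (f1 (fst p) a * g1 (snd p) b) * (f2 (fst p) c * g2 (snd p) d))
      = (\<Sum>p\<in>I \<times> J. bdelta H y (\<lambda>c d. (f1 (fst p) a * g1 (snd p) b) * (f2 (fst p) c * g2 (snd p) d)))"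
      by (rule tensor_apply_sum[OF Dy vs vs])
        (intro bilin_mapI lf_mult_left bilin_left[OF bfp] bilin_right[OF bfp])
    also have "\<dots> = (\<Sum>p\<in>I \<times> J. (f1 (fst p) a * g1 (snd p) b) * conv (coalg_of H) (f2 (fst p)) (g2 (snd p)) y)"
      by (rule sum.cong[OF refl]) (simp add: tensor_scale_left[OF Dy vs vs bfp] conv_def)
    finally show "bdelta H y (\<lambda>c d. \<Sum>p\<in>I \<times> J. (f1 (fst p) a * g1 (snd p) b) * (f2 (fst p) c * g2 (snd p) d))
      = (\<Sum>p\<in>I \<times> J. (f1 (fst p) a * g1 (snd p) b) * conv (coalg_of H) (f2 (fst p)) (g2 (snd p)) y)" .
  qed
  also have "\<dots> = (\<Sum>p\<in>I \<times> J. bdelta H x (\<lambda>a b. (f1 (fst p) a * g1 (snd p) b) * conv (coalg_of H) (f2 (fst p)) (g2 (snd p)) y))"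
  proof (rule tensor_apply_sum[OF Dx vs vs])
    fix p assume "p \<in> I \<times> J"
    then have bfp: "bf H H (\<lambda>a b. f1 (fst p) a * g1 (snd p) b)" by (intro bf_prod I J) auto
    show "bf H H (\<lambda>a b. (f1 (fst p) a * g1 (snd p) b) * conv (coalg_of H) (f2 (fst p)) (g2 (snd p)) y)"
      by (intro bilin_mapI lf_mult_right bilin_left[OF bfp] bilin_right[OF bfp])
  qed
  also have "\<dots> = (\<Sum>p\<in>I \<times> J. conv (coalg_of H) (f1 (fst p)) (g1 (snd p)) x * conv (coalg_of H) (f2 (fst p)) (g2 (snd p)) y)"
  proof (rule sum.cong[OF refl])
    fix p assume "p \<in> I \<times> J"
    then have bfp: "bf H H (\<lambda>a b. f1 (fst p) a * g1 (snd p) b)" by (intro bf_prod I J) auto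
    show "bdelta H x (\<lambda>a b. (f1 (fst p) a * g1 (snd p) b) * conv (coalg_of H) (f2 (fst p)) (g2 (snd p)) y)
      = conv (coalg_of H) (f1 (fst p)) (g1 (snd p)) x * conv (coalg_of H) (f2 (fst p)) (g2 (snd p)) y"
      by (simp add: tensor_scale_right[OF Dx vs vs bfp] conv_def)
  qed
  finally show ?thesis by (simp add: case_prod_unfold)
qed

lemma finite_dual_mult:
  assumes f: "lf H f" and g: "lf H g"
  shows "amult (finite_dual H) f g x = (if x \<in> vcar H then conv (coalg_of H) f g x else 0)"
  using tlift_ground[OF bi_vspace[OF H] bi_vspace[OF H] bf_prod[OF f g] lin_mem[OF bi_delta[OF H]]]
  by (simp add: finite_dual_def conv_def)

lemma finite_dual_mult_mem:
  assumes f: "f \<in> finite_dual_carrier H" and g: "g \<in> finite_dual_carrier H"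
  shows "amult (finite_dual H) f g \<in> finite_dual_carrier H"
proof -
  note Q = bi_alg[OF H]
  note fl = finite_dual_carrierD[OF f] and gl = finite_dual_carrierD[OF g]
  obtain C c h where C0: "factors H f C c h"
    using finite_dual_factor[OF Q f] by blast
  note C = factorsD[OF C0]
  obtain C' c' h' where C'0: "factors H g C' c' h'"
    using finite_dual_factor[OF Q g] by blast
  note C' = factorsD[OF C'0]
  have lc: "lf H (conv (coalg_of H) p q)" for p q
    using lf_conv[of "coalg_of H" p q] bi_delta[OF H] by simp
  show ?thesis
  proof (rule finite_dual_carrierI[OF Q, of _ "C \<times> C'" "\<lambda>p. conv (coalg_of H) (c (fst p)) (c' (snd p))" "\<lambda>p. conv (coalg_of H) (h (fst p)) (h' (snd p))"])
    show "lf H (amult (finite_dual H) f g)"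
      by (rule lin_cong[OF lc[of f g] bi_vspace[OF H]]) (simp add: finite_dual_mult fl gl)
    show "amult (finite_dual H) f g (amult H x y) =
      (\<Sum>j\<in>C \<times> C'. conv (coalg_of H) (c (fst j)) (c' (snd j)) x * conv (coalg_of H) (h (fst j)) (h' (snd j)) y)"
      if "x \<in> vcar H" "y \<in> vcar H" for x y
      using conv_factor[OF fl(1) gl(1) C(1) _ _ C'(1) _ _ C(4) C'(4) that] C(2,3) C'(2,3) alg_mult[OF Q] that
      by (simp add: finite_dual_mult fl gl finite_dual_carrierD(1) case_prod_unfold)
  qed (use C(1) C'(1) lc in \<open>auto simp: finite_dual_mult fl gl\<close>)
qed

lemma finite_dual_algebra: "algebra (finite_dual H)"
proof -
  note Q = bi_alg[OF H] and vs = bi_vspace[OF H] and C = bi_coalg[OF H]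
  note mem = finite_dual_mult_mem and fl = finite_dual_carrierD(1)
  have D: "lin_map (coalg_of H) (tensor_space (coalg_of H) (coalg_of H)) (cdelta (coalg_of H))"
    using bi_delta[OF H] by simp
  have addl: "conv (coalg_of H) (f + f') g x = conv (coalg_of H) f g x + conv (coalg_of H) f' g x"
    "conv (coalg_of H) g (f + f') x = conv (coalg_of H) g f x + conv (coalg_of H) g f' x"
    if "lf H f" "lf H f'" "lf H g" "x \<in> vcar H" for f f' g x
  proof -
    note Dx = lin_mem[OF bi_delta[OF H] that(4)]
    \<comment> \<open>Additivity is obtained from the rule for finite sums, with the two summands
      indexed by truth values.\<close>
    have "bdelta H x (\<lambda>v w. \<Sum>i\<in>{True, False}. (if i then f else f') v * g w) = (\<Sum>i\<in>{True, False}. bdelta H x (\<lambda>v w. (if i then f else f') v * g w))"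
      "bdelta H x (\<lambda>v w. \<Sum>i\<in>{True, False}. g v * (if i then f else f') w) = (\<Sum>i\<in>{True, False}. bdelta H x (\<lambda>v w. g v * (if i then f else f') w))"
      using that by (intro tensor_apply_sum[OF Dx vs vs] bf_prod; simp)+
    then show "conv (coalg_of H) (f + f') g x = conv (coalg_of H) f g x + conv (coalg_of H) f' g x"
      "conv (coalg_of H) g (f + f') x = conv (coalg_of H) g f x + conv (coalg_of H) g f' x"
      by (simp_all add: conv_def distrib_left distrib_right)
  qed
  have sc: "conv (coalg_of H) (fscale c f) g x = c * conv (coalg_of H) f g x"
    "conv (coalg_of H) g (fscale c f) x = c * conv (coalg_of H) g f x"
    if "lf H f" "lf H g" "x \<in> vcar H" for c f g x
    using tensor_scale_left[OF lin_mem[OF bi_delta[OF H] that(3)] vs vs bf_prod[OF that(1,2)], of c]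
      tensor_scale_left[OF lin_mem[OF bi_delta[OF H] that(3)] vs vs bf_prod[OF that(2,1)], of c]
    by (simp_all add: conv_def mult_ac)
  have fadd: "lf H (f + g)" if "lf H f" "lf H g" for f g
    using that by (auto simp: lin_map_def algebra_simps)
  have fsc: "lf H (fscale c f)" if "lf H f" for c f
    using lf_mult_left[OF that, of c] by (simp add: fscale_def)
  have one: "aone (finite_dual H) \<in> finite_dual_carrier H"
    by (rule finite_dual_carrierI[OF Q, of _ "{()}" "\<lambda>_. beps H" "\<lambda>_. beps H"])
      (auto simp: finite_dual_def bi_eps[OF H] bi_eps_mult[OF H] alg_mult[OF Q] intro: lin_cong[OF bi_eps[OF H] vs])
  have oneq: "aone (finite_dual H) x = ceps (coalg_of H) x" if "x \<in> vcar H" for x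
    using that by (simp add: finite_dual_def)
  show ?thesis
    unfolding algebra_def
  proof (intro conjI ballI bilin_mapI lin_mapI)
    show "vspace (finite_dual H)" by (simp add: Q)
    show "aone (finite_dual H) \<in> vcar (finite_dual H)" using one by simp
    fix f assume "f \<in> vcar (finite_dual H)"
    then have f: "f \<in> finite_dual_carrier H" by simp
    show "amult (finite_dual H) (aone (finite_dual H)) f = f"
    proof
      fix x show "amult (finite_dual H) (aone (finite_dual H)) f x = f x"
        using finite_dual_carrierD(2)[OF f, of x] conv_eps_left[OF C, of x f] fl[OF f]
          conv_cong[OF D, of x "aone (finite_dual H)" "ceps (coalg_of H)" f f] oneq vs
        by (cases "x \<in> vcar H") (simp_all add: finite_dual_mult fl one f)
    qed
    show "amult (finite_dual H) f (aone (finite_dual H)) = f"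
    proof
      fix x show "amult (finite_dual H) f (aone (finite_dual H)) x = f x"
        using finite_dual_carrierD(2)[OF f, of x] conv_eps_right[OF C, of x f] fl[OF f]
          conv_cong[OF D, of x f f "aone (finite_dual H)" "ceps (coalg_of H)"] oneq vs
        by (cases "x \<in> vcar H") (simp_all add: finite_dual_mult fl one f)
    qed
    fix g assume "g \<in> vcar (finite_dual H)"
    then have g: "g \<in> finite_dual_carrier H" by simp
    show "amult (finite_dual H) f g \<in> vcar (finite_dual H)" "amult (finite_dual H) f g \<in> vcar (finite_dual H)"
      using mem f g by simp_all
    show "amult (finite_dual H) (vscale (finite_dual H) c f) g = vscale (finite_dual H) c (amult (finite_dual H) f g)" for c
      by (rule ext) (simp add: finite_dual_mult fl f g fsc sc)
    show "amult (finite_dual H) f (vscale (finite_dual H) c g) = vscale (finite_dual H) c (amult (finite_dual H) f g)" for c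
      by (rule ext) (simp add: finite_dual_mult fl f g fsc sc)
    fix h assume "h \<in> vcar (finite_dual H)"
    then have h: "h \<in> finite_dual_carrier H" by simp
    show "amult (finite_dual H) (amult (finite_dual H) f g) h = amult (finite_dual H) f (amult (finite_dual H) g h)"
    proof
      fix x
      have "conv (coalg_of H) (amult (finite_dual H) f g) h x = conv (coalg_of H) f (amult (finite_dual H) g h) x" if x: "x \<in> vcar H"
      proof -
        have "conv (coalg_of H) (amult (finite_dual H) f g) h x = conv (coalg_of H) (conv (coalg_of H) f g) h x"
          by (rule conv_cong[OF D]) (use x vs in \<open>auto simp: finite_dual_mult fl f g\<close>)
        also have "\<dots> = conv (coalg_of H) f (conv (coalg_of H) g h) x"
          by (rule conv_assoc[OF C]) (use x fl f g h in auto)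
        also have "\<dots> = conv (coalg_of H) f (amult (finite_dual H) g h) x"
          by (rule conv_cong[OF D]) (use x vs in \<open>auto simp: finite_dual_mult fl g h\<close>)
        finally show ?thesis .
      qed
      then show "amult (finite_dual H) (amult (finite_dual H) f g) h x = amult (finite_dual H) f (amult (finite_dual H) g h) x"
        by (simp add: finite_dual_mult[OF fl[OF mem[OF f g]] fl[OF h]] finite_dual_mult[OF fl[OF f] fl[OF mem[OF g h]]])
    qed
  next
    fix f g h assume "f \<in> vcar (finite_dual H)" "g \<in> vcar (finite_dual H)" "h \<in> vcar (finite_dual H)"
    then have l: "lf H f" "lf H g" "lf H h" by (auto simp: fl)
    show "amult (finite_dual H) (g + h) f = amult (finite_dual H) g f + amult (finite_dual H) h f"
      by (rule ext) (simp add: finite_dual_mult l fadd addl)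
    show "amult (finite_dual H) f (g + h) = amult (finite_dual H) f g + amult (finite_dual H) f h"
      by (rule ext) (simp add: finite_dual_mult l fadd addl)
  qed
qed

text \<open>The description by \<open>THE\<close> is legitimate: a factorisation of \<open>f\<close>
  provides a tensor, and pairs of evaluations separate the tensor square.\<close>

lemma
  assumes f: "f \<in> finite_dual_carrier H"
  shows finite_dual_delta_mem: "bdelta (finite_dual H) f \<in> vcar (tensor_space (finite_dual H) (finite_dual H))"
    and finite_dual_delta: "x \<in> vcar H \<Longrightarrow> y \<in> vcar H \<Longrightarrow> bdelta (finite_dual H) f (\<lambda>g h. g x * h y) = f (amult H x y)"
proof -
  note Q = bi_alg[OF H]
  have vs: "vspace (finite_dual H)" by (simp add: Q)
  let ?T = "tensor_space (finite_dual H) (finite_dual H)"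
  define P where "P X \<longleftrightarrow> X \<in> vcar ?T \<and> (\<forall>x\<in>vcar H. \<forall>y\<in>vcar H. X (\<lambda>g h. g x * h y) = f (amult H x y))" for X
  obtain C c h where C0: "factors H f C c h"
    using finite_dual_factor[OF Q f] by blast
  note C = factorsD[OF C0]
  have bfe: "bf (finite_dual H) (finite_dual H) (\<lambda>g h. g x * h y)" for x y
    by (rule bf_prod[OF lf_eval lf_eval])
  have 1: "P (\<Sum>b\<in>C. tens (finite_dual H) (finite_dual H) (c b) (h b))"
    unfolding P_def using C by (auto intro!: vs_sum[OF vspace_tensor] tens_mem simp: tens_apply[OF bfe])
  have 2: "X = Y" if "P X" "P Y" for X Y
    by (rule tensor_eqI[OF vs vs separates_evals separates_evals]) (use that in \<open>auto simp: P_def\<close>)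
  have eq: "(X \<in> vcar (tensor_space (finite_dual_space H) (finite_dual_space H)) \<and> (\<forall>x\<in>vcar H. \<forall>y\<in>vcar H.
      tlift (finite_dual_space H) (finite_dual_space H) ground (\<lambda>g h. g x * h y) X = f (amult H x y))) = P X" for X
    using tlift_ground[OF vs vs bfe, of X] by (auto simp: P_def finite_dual_space_cong)
  have "bdelta (finite_dual H) f = (THE X. P X)"
    unfolding eq[symmetric] by (simp add: finite_dual_def)
  then have "P (bdelta (finite_dual H) f)"
    using theI[of P, OF 1 2[OF _ 1]] by simp
  then show "bdelta (finite_dual H) f \<in> vcar ?T"
    "x \<in> vcar H \<Longrightarrow> y \<in> vcar H \<Longrightarrow> bdelta (finite_dual H) f (\<lambda>g h. g x * h y) = f (amult H x y)"
    by (auto simp: P_def)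
qed

text \<open>Convolving the evaluations at \<open>x\<close> and at \<open>y\<close> gives the
  evaluation at their product, so the coalgebra laws are the associativity and unit laws of
  \<open>H\<close>.\<close>

lemma finite_dual_coalgebra: "coalgebra (coalg_of (finite_dual H))"
proof (rule coalgebraI_conv)
  note Q = bi_alg[OF H] and mm = alg_mult[OF bi_alg[OF H]]
  let ?C = "coalg_of (finite_dual H)" and ?T = "tensor_space (finite_dual H) (finite_dual H)"
  have vs: "vspace (finite_dual H)" by (simp add: Q)
  note a = vs_add[OF vs, simplified] vs_scale[OF vs, simplified]
  have D: "lin_map (finite_dual H) ?T (bdelta (finite_dual H))"
  proof (rule lin_mapI)
    fix f c assume "f \<in> vcar (finite_dual H)"
    then have f: "f \<in> finite_dual_carrier H" by simp
    show "bdelta (finite_dual H) f \<in> vcar ?T" by (rule finite_dual_delta_mem[OF f])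
    show "bdelta (finite_dual H) (vscale (finite_dual H) c f) = vscale ?T c (bdelta (finite_dual H) f)"
      by (rule tensor_eqI[OF vs vs separates_evals separates_evals])
        (use f a vs_scale[OF vspace_tensor finite_dual_delta_mem[OF f]] in \<open>auto simp: finite_dual_delta finite_dual_delta_mem\<close>)
    fix g assume "g \<in> vcar (finite_dual H)"
    then have g: "g \<in> finite_dual_carrier H" by simp
    show "bdelta (finite_dual H) (f + g) = bdelta (finite_dual H) f + bdelta (finite_dual H) g"
      by (rule tensor_eqI[OF vs vs separates_evals separates_evals])
        (use f g a vs_add[OF vspace_tensor finite_dual_delta_mem[OF f] finite_dual_delta_mem[OF g]] in \<open>auto simp: finite_dual_delta finite_dual_delta_mem\<close>)
  qed
  then show D': "lin_map ?C (tensor_space ?C ?C) (cdelta ?C)" by simp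
  show vs': "vspace ?C" using vs by simp
  show "lf ?C (ceps ?C)" by (simp add: lf_eval)
  show "separates ?C (evals H)" using separates_evals[of H] by (simp add: separates_def)
  have c: "conv ?C (\<lambda>f. f x) (\<lambda>f. f y) f = f (amult H x y)" if "x \<in> vcar H" "y \<in> vcar H" "f \<in> finite_dual_carrier H" for x y f
    using that by (simp add: conv_def finite_dual_delta)
  fix f e1 assume "f \<in> vcar ?C" and "e1 \<in> evals H"
  then obtain x where f: "f \<in> finite_dual_carrier H" and e1: "e1 = (\<lambda>f. f x)" and x: "x \<in> vcar H" by auto
  note one = alg_one[OF Q]
  show "conv ?C (ceps ?C) e1 f = e1 f" "conv ?C e1 (ceps ?C) f = e1 f"
    using c[OF one x f] c[OF x one f] by (simp_all add: e1 alg_one_left[OF Q x] alg_one_right[OF Q x])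
  fix e2 e3 assume "e2 \<in> evals H" "e3 \<in> evals H"
  then obtain y z where e2: "e2 = (\<lambda>f. f y)" and e3: "e3 = (\<lambda>f. f z)" and y: "y \<in> vcar H" and z: "z \<in> vcar H" by auto
  have "conv ?C (conv ?C e1 e2) e3 f = conv ?C (\<lambda>f. f (amult H x y)) e3 f"
    by (rule conv_cong[OF D' vs']) (use f in \<open>auto simp: e1 e2 c x y\<close>)
  also have "\<dots> = conv ?C e1 (\<lambda>f. f (amult H y z)) f"
    by (simp add: e1 e3 c x y z f mm alg_assoc[OF Q])
  also have "\<dots> = conv ?C e1 (conv ?C e2 e3) f"
    by (rule conv_cong[OF D' vs']) (use f in \<open>auto simp: e2 e3 c y z\<close>)
  finally show "conv ?C (conv ?C e1 e2) e3 f = conv ?C e1 (conv ?C e2 e3) f" .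
qed

lemma finite_dual_bialgebra: "bialgebra (finite_dual H)"
proof -
  note Q = bi_alg[OF H] and mm = alg_mult[OF bi_alg[OF H]]
  note A = finite_dual_algebra and C = finite_dual_coalgebra
  let ?D = "finite_dual H" and ?T = "tensor_space (finite_dual H) (finite_dual H)"
  note vs = alg_vspace[OF A] and mb = alg_bilin[OF A] and fl = finite_dual_carrierD(1)
  note sep = tensor_eqI[OF vs vs separates_evals separates_evals]
  have D: "lin_map ?D ?T (bdelta ?D)" using coalg_delta[OF C] by simp
  note Dm = lin_mem[OF D]
  have one: "aone ?D \<in> finite_dual_carrier H" using alg_one[OF A] by simp
  have "bdelta ?D (amult ?D f g) = amult (tensor_alg ?D ?D) (bdelta ?D f) (bdelta ?D g)"
    if "f \<in> vcar ?D" "g \<in> vcar ?D" for f g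
  proof (rule sep)
    have f: "f \<in> finite_dual_carrier H" and g: "g \<in> finite_dual_carrier H" using that by auto
    note Df = Dm[OF that(1)] and Dg = Dm[OF that(2)]
    show "bdelta ?D (amult ?D f g) \<in> vcar ?T" by (rule Dm[OF alg_mult[OF A that]])
    show "amult (tensor_alg ?D ?D) (bdelta ?D f) (bdelta ?D g) \<in> vcar ?T"
      by (rule tensor_alg_mem[OF mb mb vs vs Df Dg])
    fix e1 e2 assume "e1 \<in> evals H" "e2 \<in> evals H"
    then obtain x y where e: "e1 = (\<lambda>f. f x)" "e2 = (\<lambda>f. f y)" and x: "x \<in> vcar H" and y: "y \<in> vcar H" by auto
    obtain n :: nat and l r where fr0: "\<forall>i. l i \<in> vcar ?D" "\<forall>i. r i \<in> vcar ?D"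
      "\<forall>\<beta>. bf ?D ?D \<beta> \<longrightarrow> bdelta ?D f \<beta> = (\<Sum>i<n. \<beta> (l i) (r i))" using tensor_rep_ex[OF Df vs vs] by blast
    note fr = spec[OF fr0(1)] spec[OF fr0(2)] mp[OF spec[OF fr0(3)]]
    obtain m :: nat and l' r' where gr0: "\<forall>i. l' i \<in> vcar ?D" "\<forall>i. r' i \<in> vcar ?D"
      "\<forall>\<beta>. bf ?D ?D \<beta> \<longrightarrow> bdelta ?D g \<beta> = (\<Sum>i<m. \<beta> (l' i) (r' i))" using tensor_rep_ex[OF Dg vs vs] by blast
    note gr = spec[OF gr0(1)] spec[OF gr0(2)] mp[OF spec[OF gr0(3)]]
    have lr: "lf H (l i)" "lf H (r i)" "lf H (l' i)" "lf H (r' i)" for i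
      using fr(1,2)[of i] gr(1,2)[of i] by (auto simp: fl)
    have be: "bf ?D ?D (\<lambda>g h. g x * h y)" for x y by (rule bf_prod[OF lf_eval lf_eval])
    have ev: "lf ?D (\<lambda>f. f z)" for z by (rule lf_eval)
    have b2: "bf ?D ?D (\<lambda>c d. amult ?D a c x * amult ?D b d y)" if "a \<in> vcar ?D" "b \<in> vcar ?D" for a b
      by (rule bf_prod[OF lin_comp[OF ev bilin_right[OF mb that(1)]] lin_comp[OF ev bilin_right[OF mb that(2)]]])
    have b1: "bf ?D ?D (\<lambda>a b. bdelta ?D g (\<lambda>c d. amult ?D a c x * amult ?D b d y))"
    proof (rule bilin_mapI)
      show "lf ?D (\<lambda>a. bdelta ?D g (\<lambda>c d. amult ?D a c x * amult ?D b d y))" if "b \<in> vcar ?D" for b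
        by (rule lf_tensor_param[OF Dg vs vs vs b2[OF _ that]], assumption)
          (intro lf_mult_right lin_comp[OF ev] bilin_left[OF mb])
      show "lf ?D (\<lambda>b. bdelta ?D g (\<lambda>c d. amult ?D a c x * amult ?D b d y))" if "a \<in> vcar ?D" for a
        by (rule lf_tensor_param[OF Dg vs vs vs b2[OF that]], assumption)
          (intro lf_mult_left lin_comp[OF ev] bilin_left[OF mb])
    qed
    have "bdelta ?D (amult ?D f g) (\<lambda>v w. e1 v * e2 w) = conv (coalg_of H) f g (amult H x y)"
      using finite_dual_delta[OF finite_dual_mult_mem[OF f g] x y] by (simp add: e finite_dual_mult fl f g mm x y)
    \<comment> \<open>Decompositions of the two coproducts serve as factorisations of
      \<open>f\<close> and \<open>g\<close>, and both sides become the same double sum.\<close>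
    also have "\<dots> = (\<Sum>(i, j)\<in>{..<n} \<times> {..<m}. conv (coalg_of H) (l i) (l' j) x * conv (coalg_of H) (r i) (r' j) y)"
    proof (rule conv_factor[OF fl[OF f] fl[OF g] _ lr(1,2) _ lr(3,4) _ _ x y])
      fix a b assume a: "a \<in> vcar H" and b: "b \<in> vcar H"
      show "f (amult H a b) = (\<Sum>i<n. l i a * r i b)" using finite_dual_delta[OF f a b] fr(3)[OF be] by simp
      show "g (amult H a b) = (\<Sum>i<m. l' i a * r' i b)" using finite_dual_delta[OF g a b] gr(3)[OF be] by simp
    qed auto
    also have "\<dots> = (\<Sum>i<n. \<Sum>j<m. amult ?D (l i) (l' j) x * amult ?D (r i) (r' j) y)"
      by (simp add: sum.cartesian_product finite_dual_mult lr x y)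
    also have "\<dots> = bdelta ?D f (\<lambda>a b. bdelta ?D g (\<lambda>c d. amult ?D a c x * amult ?D b d y))"
      by (simp only: fr(3)[OF b1] gr(3)[OF b2[OF fr(1) fr(2)]])
    also have "\<dots> = amult (tensor_alg ?D ?D) (bdelta ?D f) (bdelta ?D g) (\<lambda>v w. e1 v * e2 w)"
      unfolding e by (rule tensor_alg_apply[OF mb mb vs vs Df Dg be, symmetric])
    finally show "bdelta ?D (amult ?D f g) (\<lambda>v w. e1 v * e2 w) = amult (tensor_alg ?D ?D) (bdelta ?D f) (bdelta ?D g) (\<lambda>v w. e1 v * e2 w)" .
  qed
  moreover have "bdelta ?D (aone ?D) = tens ?D ?D (aone ?D) (aone ?D)"
  proof (rule sep)
    show "bdelta ?D (aone ?D) \<in> vcar ?T" by (rule Dm) (simp add: one)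
    show "tens ?D ?D (aone ?D) (aone ?D) \<in> vcar ?T" by (intro tens_mem) (simp_all add: one)
    fix e1 e2 assume "e1 \<in> evals H" "e2 \<in> evals H"
    then obtain x y where e: "e1 = (\<lambda>f. f x)" "e2 = (\<lambda>f. f y)" and x: "x \<in> vcar H" and y: "y \<in> vcar H" by auto
    show "bdelta ?D (aone ?D) (\<lambda>v w. e1 v * e2 w) = tens ?D ?D (aone ?D) (aone ?D) (\<lambda>v w. e1 v * e2 w)"
      unfolding e by (simp add: finite_dual_delta[OF one x y] tens_apply[OF bf_prod[OF lf_eval lf_eval]])
        (simp add: finite_dual_def x y mm bi_eps_mult[OF H x y])
  qed
  ultimately have 1: "alg_hom ?D (tensor_alg ?D ?D) (bdelta ?D)" using D by (simp add: alg_hom_def)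
  have "amult ?D f g (aone H) = f (aone H) * g (aone H)" if "f \<in> finite_dual_carrier H" "g \<in> finite_dual_carrier H" for f g
    using that by (simp add: finite_dual_mult fl alg_one[OF Q] conv_def bi_delta_one[OF H] tens_apply[OF bf_prod])
  moreover have "aone ?D (aone H) = 1" by (simp add: finite_dual_def alg_one[OF Q] bi_eps_one[OF H])
  ultimately have "alg_hom ?D ground (beps ?D)" by (simp add: alg_hom_def lf_eval)
  then show ?thesis using A C 1 by (simp add: bialgebra_def)
qed

text \<open>The antipode is precomposition with \<open>S\<close>. It preserves the finite dual
  because \<open>S\<close> reverses products, which merely swaps the two families of a
  factorisation. The antipode laws follow by interchanging the evaluations of the two
  coproducts.\<close>

lemma finite_dual_hopf:
  assumes S: "is_antipode H S"
  shows "hopf_algebra (finite_dual H)"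
proof -
  note Q = bi_alg[OF H] and mm = alg_mult[OF bi_alg[OF H]] and vsH = bi_vspace[OF H]
  let ?D = "finite_dual H" and ?T = "tensor_space (finite_dual H) (finite_dual H)"
  note B = finite_dual_bialgebra
  note vs = bi_vspace[OF B] and fl = finite_dual_carrierD(1)
  note Sl = antipode_lin[OF H S] and Sm = antipode_mem[OF H S]
  define S' where "S' f x = (if x \<in> vcar H then f (S x) else 0)" for f :: "'u \<Rightarrow> 'k" and x
  have lS: "lf H (\<lambda>x. f (S x))" if "lf H f" for f by (rule lin_comp[OF that Sl])
  have S'm: "S' f \<in> finite_dual_carrier H" if f: "f \<in> finite_dual_carrier H" for f
  proof -
    obtain C c h where C0: "factors H f C c h"
      using finite_dual_factor[OF Q f] by blast
    note C = factorsD[OF C0]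
    show ?thesis
      by (rule finite_dual_carrierI[OF Q, of _ C "\<lambda>b x. h b (S x)" "\<lambda>b x. c b (S x)"])
        (use C f in \<open>auto simp: S'_def mm Sm antipode_antimult[OF H S] mult.commute fl intro!: lS intro: lin_cong[OF lS[OF fl[OF f]] vsH]\<close>)
  qed
  have S'l: "lin_map ?D ?D S'" by (rule lin_mapI) (auto simp: S'm S'_def fun_eq_iff)
  have "is_antipode ?D S'"
  proof (rule is_antipodeI[OF B S'l separates_evals])
    fix f e assume "f \<in> vcar ?D" and "e \<in> evals H"
    then obtain x where f: "f \<in> finite_dual_carrier H" and e: "e = (\<lambda>f. f x)" and x: "x \<in> vcar H" by auto
    note Df = finite_dual_delta_mem[OF f] and Dx = lin_mem[OF bi_delta[OF H] x]
    have rhs: "aone ?D x = beps H x" by (simp add: finite_dual_def x)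
    have "bdelta ?D f (\<lambda>g h. e (amult ?D (S' g) h)) = bdelta ?D f (\<lambda>g h. bdelta H x (\<lambda>a b. g (S a) * h b))"
    proof (rule tensor_apply_cong[OF Df vs vs])
      fix g h assume "g \<in> vcar ?D" "h \<in> vcar ?D"
      then show "e (amult ?D (S' g) h) = bdelta H x (\<lambda>a b. g (S a) * h b)"
        by (simp add: e finite_dual_mult fl S'm x conv_def) (rule tensor_apply_cong[OF Dx vsH vsH], simp add: S'_def)
    qed
    also have "\<dots> = bdelta H x (\<lambda>a b. bdelta ?D f (\<lambda>g h. g (S a) * h b))"
      by (rule tensor_fubini[OF Df vs vs Dx vsH vsH]) (auto intro!: bf_prod lS lf_eval simp: fl)
    also have "\<dots> = bdelta H x (\<lambda>a b. f (amult H (S a) b))"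
      by (rule tensor_apply_cong[OF Dx vsH vsH]) (simp add: finite_dual_delta[OF f] Sm)
    also have "\<dots> = beps H x * f (aone H)" by (rule antipode_left[OF H S x fl[OF f]])
    finally show "bdelta ?D f (\<lambda>g h. e (amult ?D (S' g) h)) = beps ?D f * e (aone ?D)" by (simp add: e rhs)
    have "bdelta ?D f (\<lambda>g h. e (amult ?D g (S' h))) = bdelta ?D f (\<lambda>g h. bdelta H x (\<lambda>a b. g a * h (S b)))"
    proof (rule tensor_apply_cong[OF Df vs vs])
      fix g h assume "g \<in> vcar ?D" "h \<in> vcar ?D"
      then show "e (amult ?D g (S' h)) = bdelta H x (\<lambda>a b. g a * h (S b))"
        by (simp add: e finite_dual_mult fl S'm x conv_def) (rule tensor_apply_cong[OF Dx vsH vsH], simp add: S'_def)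
    qed
    also have "\<dots> = bdelta H x (\<lambda>a b. bdelta ?D f (\<lambda>g h. g a * h (S b)))"
      by (rule tensor_fubini[OF Df vs vs Dx vsH vsH]) (auto intro!: bf_prod lS lf_eval simp: fl)
    also have "\<dots> = bdelta H x (\<lambda>a b. f (amult H a (S b)))"
      by (rule tensor_apply_cong[OF Dx vsH vsH]) (simp add: finite_dual_delta[OF f] Sm)
    also have "\<dots> = beps H x * f (aone H)" by (rule antipode_right[OF H S x fl[OF f]])
    finally show "bdelta ?D f (\<lambda>g h. e (amult ?D g (S' h))) = beps ?D f * e (aone ?D)" by (simp add: e rhs)
  qed
  then show ?thesis using B by (auto simp: hopf_algebra_def)
qed

end

section \<open>Tensor powers\<close>

abbreviation mf :: "('k::field, 'u::ab_group_add, 'y) vsp_scheme \<Rightarrow> nat \<Rightarrow> ('u list \<Rightarrow> 'k) \<Rightarrow> bool" where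
  "mf V n \<equiv> multilin_map V n (ground :: ('k, 'k) alg)"

lemma vlists_Nil [simp]: "xs \<in> vlists V 0 \<longleftrightarrow> xs = []"
  by (auto simp: vlists_def)

lemma vlists_Cons [simp]: "x # xs \<in> vlists V (Suc n) \<longleftrightarrow> x \<in> vcar V \<and> xs \<in> vlists V n"
  by (auto simp: vlists_def)

lemma vlists_update: "xs \<in> vlists V n \<Longrightarrow> x \<in> vcar V \<Longrightarrow> xs[i := x] \<in> vlists V n"
  by (auto simp: vlists_def dest: set_update_subset_insert[THEN subsetD])

lemma vlists_length: "xs \<in> vlists V n \<Longrightarrow> length xs = n"
  by (simp add: vlists_def)

lemma vlists_nth: "xs \<in> vlists V n \<Longrightarrow> i < n \<Longrightarrow> xs ! i \<in> vcar V"
  by (auto simp: vlists_def)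

lemma multilinI:
  "(\<And>xs. xs \<in> vlists V n \<Longrightarrow> b xs \<in> vcar Z) \<Longrightarrow>
   (\<And>xs i. xs \<in> vlists V n \<Longrightarrow> i < n \<Longrightarrow> lin_map V Z (\<lambda>x. b (xs[i := x]))) \<Longrightarrow> multilin_map V n Z b"
  by (simp add: multilin_map_def)

lemma
  assumes "multilin_map V n Z b"
  shows multilin_mem: "xs \<in> vlists V n \<Longrightarrow> b xs \<in> vcar Z"
    and multilin_lin: "xs \<in> vlists V n \<Longrightarrow> i < n \<Longrightarrow> lin_map V Z (\<lambda>x. b (xs[i := x]))"
  using assms by (auto simp: multilin_map_def)

lemma multilin_comp: "lin_map Z W f \<Longrightarrow> multilin_map V n Z b \<Longrightarrow> multilin_map V n W (\<lambda>xs. f (b xs))"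
  by (rule multilinI) (auto intro: lin_mem multilin_mem lin_comp[of Z W f] multilin_lin)

lemma multilin_Cons:
  assumes "multilin_map V (Suc n) Z b" "x \<in> vcar V"
  shows "multilin_map V n Z (\<lambda>xs. b (x # xs))"
proof (rule multilinI)
  fix xs i assume "xs \<in> vlists V n" "i < n"
  then show "lin_map V Z (\<lambda>y. b (x # xs[i := y]))"
    using multilin_lin[OF assms(1), of "x # xs" "Suc i"] assms(2) by simp
qed (use assms in \<open>auto intro: multilin_mem\<close>)

text \<open>Linearity in a slot is expressed by updating an existing list, so 0 is put at the head
  as a placeholder.\<close>

lemma multilin_hd:
  assumes "multilin_map V (Suc n) Z b" "vspace V" "xs \<in> vlists V n"
  shows "lin_map V Z (\<lambda>x. b (x # xs))"
  using multilin_lin[OF assms(1), of "0 # xs" 0] assms(2,3) by (simp add: vs_zero)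

lemma multilin_ConsI:
  assumes "\<And>x xs. x \<in> vcar V \<Longrightarrow> xs \<in> vlists V n \<Longrightarrow> lin_map V Z (\<lambda>x. b (x # xs))"
    and "\<And>x. x \<in> vcar V \<Longrightarrow> multilin_map V n Z (\<lambda>xs. b (x # xs))"
  shows "multilin_map V (Suc n) Z b"
proof (rule multilinI)
  fix xs assume xs: "xs \<in> vlists V (Suc n)"
  then obtain y ys where y: "xs = y # ys" "y \<in> vcar V" "ys \<in> vlists V n"
    by (cases xs) (auto simp: vlists_def)
  show "b xs \<in> vcar Z" using multilin_mem[OF assms(2)] y by simp
  fix i assume "i < Suc n"
  then show "lin_map V Z (\<lambda>x. b (xs[i := x]))"
    using assms(1)[OF y(2,3)] multilin_lin[OF assms(2)[OF y(2)] y(3)] y(1) by (cases i) auto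
qed

lemma power_space_simps [simp]: "vscale (power_space V n) = fscale"
  by (simp add: power_space_def)

lemma vspace_power [simp]: "vspace (power_space V n)"
  unfolding vspace_def power_space_def by (auto simp: vector_space_fscale)

lemma ptens_apply: "mf V n \<beta> \<Longrightarrow> xs \<in> vlists V n \<Longrightarrow> ptens V xs \<beta> = \<beta> xs"
  by (simp add: ptens_def vlists_length)

lemma ptens_mem: "xs \<in> vlists V n \<Longrightarrow> ptens V xs \<in> vcar (power_space V n)"
  by (auto simp: power_space_def intro: fsc.span_base)

lemma ptens_multilin: "vspace V \<Longrightarrow> multilin_map V n (power_space V n) (ptens V)"
proof (rule multilinI)
  fix xs i assume vs: "vspace V" and xs: "xs \<in> vlists V n" and i: "i < n"
  have len: "length xs = n" using xs by (rule vlists_length)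
  show "lin_map V (power_space V n) (\<lambda>x. ptens V (xs[i := x]))"
  proof (rule lin_mapI)
    fix x y c assume x: "x \<in> vcar V"
    show "ptens V (xs[i := x]) \<in> vcar (power_space V n)" by (intro ptens_mem vlists_update xs x)
    have "\<beta> (xs[i := vscale V c x]) = c * \<beta> (xs[i := x])" if "mf V n \<beta>" for \<beta>
      using lin_scale[OF multilin_lin[OF that xs i] x] by simp
    then show "ptens V (xs[i := vscale V c x]) = vscale (power_space V n) c (ptens V (xs[i := x]))"
      by (auto simp: ptens_def len fun_eq_iff)
    assume y: "y \<in> vcar V"
    have "\<beta> (xs[i := x + y]) = \<beta> (xs[i := x]) + \<beta> (xs[i := y])" if "mf V n \<beta>" for \<beta>
      using lin_add[OF multilin_lin[OF that xs i] x y] by simp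
    then show "ptens V (xs[i := x + y]) = ptens V (xs[i := x]) + ptens V (xs[i := y])"
      by (auto simp: ptens_def len fun_eq_iff)
  qed
qed (rule ptens_mem)

text \<open>Coefficients are kept here: for \<open>n = 0\<close> a pure tensor has no factor that
  could absorb a scalar.\<close>

lemma power_rep_ex:
  assumes X: "X \<in> vcar (power_space V n)" and vs: "vspace V"
  shows "\<exists>(m :: nat) c xs. (\<forall>i. xs i \<in> vlists V n) \<and> X = (\<Sum>i<m. fscale (c i) (ptens V (xs i)))"
  using X[unfolded power_space_def, simplified]
proof (induction rule: fsc.span_induct_alt)
  case base
  have "replicate n 0 \<in> vlists V n" using vs by (auto simp: vlists_def vs_zero)
  then show ?case by (intro exI[of _ 0] exI[of _ "\<lambda>_. 0"] exI[of _ "\<lambda>_. replicate n 0"]) auto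
next
  case (step a t Y)
  then obtain ys m c xs where *: "t = ptens V ys" "ys \<in> vlists V n"
    "\<forall>i. xs i \<in> vlists V n" "Y = (\<Sum>i<m::nat. fscale (c i) (ptens V (xs i)))" by blast
  then show ?case
    by (intro exI[of _ "Suc m"] exI[of _ "c(m := a)"] exI[of _ "xs(m := ys)"]) (auto simp: add.commute)
qed

lemma power_apply_rep:
  assumes X: "X \<in> vcar (power_space V n)" and vs: "vspace V"
  shows "\<exists>(m :: nat) c xs. (\<forall>i. xs i \<in> vlists V n) \<and> (\<forall>\<beta>. mf V n \<beta> \<longrightarrow> X \<beta> = (\<Sum>i<m. c i * \<beta> (xs i))) \<and>
    (\<forall>\<beta>. \<not> mf V n \<beta> \<longrightarrow> X \<beta> = 0)"
proof -
  obtain m :: nat and c xs where *: "\<forall>i. xs i \<in> vlists V n" "X = (\<Sum>i<m. fscale (c i) (ptens V (xs i)))"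
    using power_rep_ex[OF assms] by blast
  then show ?thesis
    using vlists_length[OF spec[OF *(1)]]
    by (intro exI[of _ m] exI[of _ c] exI[of _ xs]) (auto simp: ptens_def)
qed

lemma power_ext:
  assumes "X \<in> vcar (power_space V n)" "Y \<in> vcar (power_space V n)" "vspace V"
    "\<And>\<beta>. mf V n \<beta> \<Longrightarrow> X \<beta> = Y \<beta>"
  shows "X = Y"
proof
  fix \<beta> show "X \<beta> = Y \<beta>"
    using power_apply_rep[OF assms(1,3)] power_apply_rep[OF assms(2,3)] assms(4)[of \<beta>] by (cases "mf V n \<beta>") auto
qed

lemma power_apply_cong:
  assumes X: "X \<in> vcar (power_space V n)" and vs: "vspace V" and eq: "\<And>xs. xs \<in> vlists V n \<Longrightarrow> \<beta> xs = \<beta>' xs"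
    and m: "mf V n \<beta>" "mf V n \<beta>'"
  shows "X \<beta> = X \<beta>'"
  using power_apply_rep[OF X vs] m eq by auto

lemma lf_apply_power: "lf (power_space V n) (\<lambda>X. X \<beta>)"
  by (rule lin_mapI) auto

lemma lin_power_eqI:
  assumes f: "lin_map (power_space V n) Z f" and g: "lin_map (power_space V n) Z g" and vs: "vspace V"
    and eq: "\<And>xs. xs \<in> vlists V n \<Longrightarrow> f (ptens V xs) = g (ptens V xs)"
    and X: "X \<in> vcar (power_space V n)"
  shows "f X = g X"
proof -
  obtain m :: nat and c xs where *: "\<forall>i. xs i \<in> vlists V n" "X = (\<Sum>i<m. fscale (c i) (ptens V (xs i)))"
    using power_rep_ex[OF X vs] by blast
  have mem: "fscale (c i) (ptens V (xs i)) \<in> vcar (power_space V n)" for i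
    using vs_scale[OF vspace_power ptens_mem[OF spec[OF *(1)]]] by simp
  have "f (fscale (c i) (ptens V (xs i))) = g (fscale (c i) (ptens V (xs i)))" for i
    using lin_scale[OF f ptens_mem[OF spec[OF *(1)]]] lin_scale[OF g ptens_mem[OF spec[OF *(1)]]] eq *(1) by simp
  then show ?thesis
    unfolding *(2) by (simp add: lin_sum[OF f vspace_power mem] lin_sum[OF g vspace_power mem])
qed

lemma lf_power_param:
  assumes X: "X \<in> vcar (power_space V n)" and vs: "vspace V" "vspace U"
    and "\<And>u. u \<in> vcar U \<Longrightarrow> mf V n (T u)" "\<And>xs. xs \<in> vlists V n \<Longrightarrow> lf U (\<lambda>u. T u xs)"
  shows "lf U (\<lambda>u. X (T u))"
proof -
  obtain m :: nat and c xs where *: "\<forall>i. xs i \<in> vlists V n"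
    "\<forall>\<beta>. mf V n \<beta> \<longrightarrow> X \<beta> = (\<Sum>i<m. c i * \<beta> (xs i))" using power_apply_rep[OF X vs(1)] by blast
  have "lf U (\<lambda>u. \<Sum>i<m. c i * T u (xs i))"
    by (intro lf_sum lf_mult_left assms(5)) (use * in auto)
  then show ?thesis by (rule lin_cong[OF _ vs(2)]) (use * assms(4) in auto)
qed

text \<open>As for \<open>tlift\<close>, the value is pinned down by all functionals at once, which
  makes it independent of decompositions.\<close>

lemma
  assumes V: "vspace V" and Z: "vspace Z" and b: "multilin_map V n Z b"
  shows plift_lin: "lin_map (power_space V n) Z (plift V n Z b)"
    and plift_ptens: "xs \<in> vlists V n \<Longrightarrow> plift V n Z b (ptens V xs) = b xs"
proof -
  define Q where "Q X z \<longleftrightarrow> z \<in> vcar Z \<and> (\<forall>f. lf Z f \<longrightarrow> f z = X (\<lambda>xs. f (b xs)))" for X z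
  define L where "L X = (THE z. Q X z)" for X
  have fb: "mf V n (\<lambda>xs. f (b xs))" if "lf Z f" for f
    by (rule multilin_comp[OF that b])
  have uni: "z = z'" if "Q X z" "Q X z'" for X z z'
    using that by (intro functional_sep[OF Z]) (auto simp: Q_def)
  have ex: "\<exists>z. Q X z" if X: "X \<in> vcar (power_space V n)" for X
  proof -
    obtain m :: nat and c xs where *: "\<forall>i. xs i \<in> vlists V n"
      "\<forall>\<beta>. mf V n \<beta> \<longrightarrow> X \<beta> = (\<Sum>i<m. c i * \<beta> (xs i))" using power_apply_rep[OF X V] by blast
    have mem: "vscale Z (c i) (b (xs i)) \<in> vcar Z" for i
      using * by (intro vs_scale[OF Z] multilin_mem[OF b]) auto
    have "f (\<Sum>i<m. vscale Z (c i) (b (xs i))) = X (\<lambda>xs. f (b xs))" if f: "lf Z f" for f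
      using * fb[OF f] by (simp add: lin_sum[OF f Z mem] lin_scale[OF f multilin_mem[OF b]])
    then have "Q X (\<Sum>i<m. vscale Z (c i) (b (xs i)))"
      unfolding Q_def using mem by (auto intro!: vs_sum[OF Z])
    then show ?thesis ..
  qed
  have L: "Q X (L X)" if "X \<in> vcar (power_space V n)" for X
    unfolding L_def using ex[OF that] uni by (blast intro: theI)
  have 1: "lin_map (power_space V n) Z L"
  proof (rule lin_mapI)
    fix X Y c assume X: "X \<in> vcar (power_space V n)"
    show "L X \<in> vcar Z" using L[OF X] by (simp add: Q_def)
    have "Q (fscale c X) (vscale Z c (L X))"
      using L[OF X] by (auto simp: Q_def lin_scale vs_scale[OF Z])
    then show "L (vscale (power_space V n) c X) = vscale Z c (L X)"
      using uni L vs_scale[OF vspace_power X] by (simp) blast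
    assume Y: "Y \<in> vcar (power_space V n)"
    have "Q (X + Y) (L X + L Y)"
      using L[OF X] L[OF Y] by (auto simp: Q_def lin_add vs_add[OF Z])
    then show "L (X + Y) = L X + L Y"
      using uni L[OF vs_add[OF vspace_power X Y]] by blast
  qed
  have 2: "L (ptens V xs) = b xs" if xs: "xs \<in> vlists V n" for xs
  proof -
    have "Q (ptens V xs) (b xs)"
      using xs ptens_apply[OF fb xs] by (auto simp: Q_def multilin_mem[OF b])
    then show ?thesis using uni L[OF ptens_mem[OF xs]] by blast
  qed
  have "lin_map (power_space V n) Z (plift V n Z b) \<and> (\<forall>xs\<in>vlists V n. plift V n Z b (ptens V xs) = b xs)"
    unfolding plift_def by (rule someI[of _ L]) (use 1 2 in auto)
  then show "lin_map (power_space V n) Z (plift V n Z b)"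
    and "xs \<in> vlists V n \<Longrightarrow> plift V n Z b (ptens V xs) = b xs" by auto
qed

lemma plift_apply:
  assumes "vspace V" "vspace Z" "multilin_map V n Z b" "lf Z f" "X \<in> vcar (power_space V n)"
  shows "f (plift V n Z b X) = X (\<lambda>xs. f (b xs))"
  by (rule lin_power_eqI[OF lin_comp[OF assms(4) plift_lin[OF assms(1-3)]] lf_apply_power assms(1) _ assms(5)])
    (simp add: plift_ptens[OF assms(1-3)] ptens_apply[OF multilin_comp[OF assms(4,3)]])

lemma plift_mem: "vspace V \<Longrightarrow> vspace Z \<Longrightarrow> multilin_map V n Z b \<Longrightarrow> X \<in> vcar (power_space V n) \<Longrightarrow> plift V n Z b X \<in> vcar Z"
  by (rule lin_mem[OF plift_lin])

lemma lin_powerI: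
  assumes "vspace U" "vspace V" "\<And>u. u \<in> vcar U \<Longrightarrow> D u \<in> vcar (power_space V n)"
    "\<And>\<beta>. mf V n \<beta> \<Longrightarrow> lf U (\<lambda>u. D u \<beta>)"
  shows "lin_map U (power_space V n) D"
proof (rule lin_mapI)
  fix x y c assume x: "x \<in> vcar U"
  show "D x \<in> vcar (power_space V n)" using assms(3) x .
  show "D (x + y) = D x + D y" if y: "y \<in> vcar U"
    by (rule power_ext[OF _ _ assms(2)])
      (use x y assms(1) in \<open>auto intro!: assms(3) vs_add vs_add[OF vspace_power] simp: lin_add[OF assms(4)]\<close>)
  show "D (vscale U c x) = vscale (power_space V n) c (D x)"
    by (rule power_ext[OF _ _ assms(2)])
      (use x assms(1) vs_scale[OF vspace_power, of "D x" V n] in \<open>auto intro!: assms(3) vs_scale simp: lin_scale[OF assms(4)]\<close>)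
qed

lemma
  assumes vs: "vspace V" and x: "x \<in> vcar V"
  shows pcons_lin: "lin_map (power_space V n) (power_space V (Suc n)) (pcons V n x)"
    and pcons_apply: "mf V (Suc n) \<beta> \<Longrightarrow> Y \<in> vcar (power_space V n) \<Longrightarrow> pcons V n x Y \<beta> = Y (\<lambda>xs. \<beta> (x # xs))"
proof -
  have m: "multilin_map V n (power_space V (Suc n)) (\<lambda>xs. ptens V (x # xs))"
    by (rule multilin_Cons[OF ptens_multilin[OF vs] x])
  show "lin_map (power_space V n) (power_space V (Suc n)) (pcons V n x)"
    unfolding pcons_def by (rule plift_lin[OF vs vspace_power m])
  assume \<beta>: "mf V (Suc n) \<beta>" and Y: "Y \<in> vcar (power_space V n)"
  have "pcons V n x Y \<beta> = Y (\<lambda>xs. ptens V (x # xs) \<beta>)"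
    unfolding pcons_def by (rule plift_apply[OF vs vspace_power m lf_apply_power Y])
  also have "\<dots> = Y (\<lambda>xs. \<beta> (x # xs))"
    by (rule power_apply_cong[OF Y vs]) (auto simp: ptens_apply[OF \<beta>] x intro: multilin_Cons[OF \<beta> x] multilin_comp[OF lf_apply_power m])
  finally show "pcons V n x Y \<beta> = Y (\<lambda>xs. \<beta> (x # xs))" .
qed

lemma pcons_bilin:
  assumes vs: "vspace V"
  shows "bilin_map V (power_space V n) (power_space V (Suc n)) (pcons V n)"
proof (rule bilin_mapI)
  fix Y assume Y: "Y \<in> vcar (power_space V n)"
  show "lin_map V (power_space V (Suc n)) (\<lambda>x. pcons V n x Y)"
  proof (rule lin_powerI[OF vs vs])
    show "pcons V n x Y \<in> vcar (power_space V (Suc n))" if "x \<in> vcar V" for x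
      by (rule lin_mem[OF pcons_lin[OF vs that] Y])
    fix \<beta> assume \<beta>: "mf V (Suc n) \<beta>"
    have "lf V (\<lambda>x. Y (\<lambda>xs. \<beta> (x # xs)))"
      by (rule lf_power_param[OF Y vs vs multilin_Cons[OF \<beta>] multilin_hd[OF \<beta> vs]])
    then show "lf V (\<lambda>x. pcons V n x Y \<beta>)"
      by (rule lin_cong[OF _ vs]) (simp add: pcons_apply[OF vs _ \<beta> Y])
  qed
qed (rule pcons_lin[OF vs])

section \<open>Iterated comultiplication and the maps \<open>psi_n\<close>\<close>

lemma iter_delta_bilin:
  assumes P: "coalgebra P" and D: "lin_map P (power_space P n) (iter_delta P n)"
  shows "bilin_map P P (power_space P (Suc n)) (\<lambda>x y. pcons P n x (iter_delta P n y))"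
  by (intro bilin_mapI lin_bilin_left[OF pcons_bilin[OF coalg_vspace[OF P]]] lin_bilin_right[OF pcons_bilin[OF coalg_vspace[OF P]]] D lin_id lin_mem[OF D])

lemma iter_delta_lin:
  assumes P: "coalgebra P"
  shows "lin_map P (power_space P n) (iter_delta P n)"
proof (induction n)
  case 0
  have m: "ptens P [] \<in> vcar (power_space P 0)" by (rule ptens_mem) simp
  show ?case
  proof (rule lin_powerI[OF coalg_vspace[OF P] coalg_vspace[OF P]])
    show "iter_delta P 0 p \<in> vcar (power_space P 0)" for p
      unfolding iter_delta.simps using vs_scale[OF vspace_power m] unfolding power_space_simps .
    show "lf P (\<lambda>p. iter_delta P 0 p \<beta>)" for \<beta>
      by (simp add: lf_mult_right coalg_eps[OF P])
  qed
next
  case (Suc n)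
  note vs = coalg_vspace[OF P]
  show ?case
    using lin_comp[OF tlift_lin[OF vs vs vspace_power iter_delta_bilin[OF P Suc]] coalg_delta[OF P]] by simp
qed

lemma iter_delta_0: "mf P 0 \<beta> \<Longrightarrow> iter_delta P 0 p \<beta> = ceps P p * \<beta> []"
  by (simp add: ptens_apply[of P 0])

lemma iter_delta_Suc:
  assumes P: "coalgebra P" and p: "p \<in> vcar P" and \<beta>: "mf P (Suc n) \<beta>"
  shows "iter_delta P (Suc n) p \<beta> = cdelta P p (\<lambda>x y. iter_delta P n y (\<lambda>ps. \<beta> (x # ps)))"
proof -
  note vs = coalg_vspace[OF P] and D = iter_delta_lin[OF P] and Dp = lin_mem[OF coalg_delta[OF P] p]
  have "iter_delta P (Suc n) p \<beta> = cdelta P p (\<lambda>x y. pcons P n x (iter_delta P n y) \<beta>)"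
    using tlift_apply[OF vs vs vspace_power iter_delta_bilin[OF P D] lf_apply_power Dp] by simp
  also have "\<dots> = cdelta P p (\<lambda>x y. iter_delta P n y (\<lambda>ps. \<beta> (x # ps)))"
    by (rule tensor_apply_cong[OF Dp vs vs]) (rule pcons_apply[OF vs _ \<beta> lin_mem[OF D]])
  finally show ?thesis .
qed

lemma map2_update_left: "i < length ps \<Longrightarrow> length ps = length as \<Longrightarrow> map2 f (ps[i := p]) as = (map2 f ps as)[i := f p (as ! i)]"
  by (rule nth_equalityI) (auto simp: nth_list_update)

lemma map2_update_right: "i < length ps \<Longrightarrow> length ps = length as \<Longrightarrow> map2 f ps (as[i := a]) = (map2 f ps as)[i := f (ps ! i) a]"
  by (rule nth_equalityI) (auto simp: nth_list_update)

context
  fixes P :: "('k::field, 'p::ab_group_add) coalg" and A :: "('k, 'a::ab_group_add, 'o) omega_alg" and \<psi>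
  assumes P: "coalgebra P" and A: "vspace A" and \<psi>: "bilin_map P A A \<psi>"
begin

lemma map2_mem: "ps \<in> vlists P n \<Longrightarrow> as \<in> vlists A n \<Longrightarrow> map2 \<psi> ps as \<in> vlists A n"
  by (auto simp: vlists_def set_zip subset_iff intro!: bilin_mem[OF \<psi>])

lemma map2_multilin_left:
  assumes \<mu>: "multilin_map A n Z \<mu>" and as: "as \<in> vlists A n"
  shows "multilin_map P n Z (\<lambda>ps. \<mu> (map2 \<psi> ps as))"
proof (rule multilinI)
  fix ps i assume ps: "ps \<in> vlists P n" and i: "i < n"
  have "lin_map P Z (\<lambda>x. \<mu> ((map2 \<psi> ps as)[i := \<psi> x (as ! i)]))"
    by (rule lin_comp[OF multilin_lin[OF \<mu> map2_mem[OF ps as] i] bilin_left[OF \<psi> vlists_nth[OF as i]]])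
  then show "lin_map P Z (\<lambda>x. \<mu> (map2 \<psi> (ps[i := x]) as))"
    using i ps as by (simp add: map2_update_left vlists_length)
qed (use multilin_mem[OF \<mu> map2_mem[OF _ as]] in auto)

lemma map2_multilin_right:
  assumes \<mu>: "multilin_map A n Z \<mu>" and ps: "ps \<in> vlists P n"
  shows "multilin_map A n Z (\<lambda>as. \<mu> (map2 \<psi> ps as))"
proof (rule multilinI)
  fix as i assume as: "as \<in> vlists A n" and i: "i < n"
  have "lin_map A Z (\<lambda>x. \<mu> ((map2 \<psi> ps as)[i := \<psi> (ps ! i) x]))"
    by (rule lin_comp[OF multilin_lin[OF \<mu> map2_mem[OF ps as] i] bilin_right[OF \<psi> vlists_nth[OF ps i]]])
  then show "lin_map A Z (\<lambda>x. \<mu> (map2 \<psi> ps (as[i := x])))"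
    using i ps as by (simp add: map2_update_right vlists_length)
qed (use multilin_mem[OF \<mu> map2_mem[OF ps]] in auto)

lemma psi_aux_apply:
  assumes as: "as \<in> vlists A n" and W: "W \<in> vcar (power_space P n)" and \<mu>: "mf A n \<mu>"
  shows "plift P n (power_space A n) (\<lambda>ps. ptens A (map2 \<psi> ps as)) W \<mu> = W (\<lambda>ps. \<mu> (map2 \<psi> ps as))"
proof -
  note vs = coalg_vspace[OF P]
  note m = map2_multilin_left[OF ptens_multilin[OF A] as]
  have "plift P n (power_space A n) (\<lambda>ps. ptens A (map2 \<psi> ps as)) W \<mu> = W (\<lambda>ps. ptens A (map2 \<psi> ps as) \<mu>)"
    by (rule plift_apply[OF vs vspace_power m lf_apply_power W])
  also have "\<dots> = W (\<lambda>ps. \<mu> (map2 \<psi> ps as))"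
    by (rule power_apply_cong[OF W vs])
      (auto simp: ptens_apply[OF \<mu> map2_mem[OF _ as]] intro: map2_multilin_left[OF \<mu> as] multilin_comp[OF lf_apply_power m])
  finally show ?thesis .
qed

lemma psi_aux_multilin:
  assumes W: "W \<in> vcar (power_space P n)"
  shows "multilin_map A n (power_space A n) (\<lambda>as. plift P n (power_space A n) (\<lambda>ps. ptens A (map2 \<psi> ps as)) W)"
proof (rule multilinI)
  note vs = coalg_vspace[OF P]
  have mem: "plift P n (power_space A n) (\<lambda>ps. ptens A (map2 \<psi> ps as)) W \<in> vcar (power_space A n)" if "as \<in> vlists A n" for as
    by (rule plift_mem[OF vs vspace_power map2_multilin_left[OF ptens_multilin[OF A] that] W])
  show "plift P n (power_space A n) (\<lambda>ps. ptens A (map2 \<psi> ps as)) W \<in> vcar (power_space A n)" if "as \<in> vlists A n" for as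
    by (rule mem[OF that])
  fix as i assume as: "as \<in> vlists A n" and i: "i < n"
  show "lin_map A (power_space A n) (\<lambda>x. plift P n (power_space A n) (\<lambda>ps. ptens A (map2 \<psi> ps (as[i := x]))) W)"
  proof (rule lin_powerI[OF A A])
    show "plift P n (power_space A n) (\<lambda>ps. ptens A (map2 \<psi> ps (as[i := u]))) W \<in> vcar (power_space A n)" if "u \<in> vcar A" for u
      by (rule mem[OF vlists_update[OF as that]])
    fix \<mu> assume \<mu>: "mf A n \<mu>"
    have "lf A (\<lambda>x. W (\<lambda>ps. \<mu> (map2 \<psi> ps (as[i := x]))))"
      by (rule lf_power_param[OF W vs A map2_multilin_left[OF \<mu> vlists_update[OF as]] multilin_lin[OF map2_multilin_right[OF \<mu>] as i]])
    then show "lf A (\<lambda>x. plift P n (power_space A n) (\<lambda>ps. ptens A (map2 \<psi> ps (as[i := x]))) W \<mu>)"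
      by (rule lin_cong[OF _ A]) (simp add: psi_aux_apply[OF vlists_update[OF as] W \<mu>])
  qed
qed

text \<open>On pure tensors, and evaluated on a form, \<open>psi_n\<close> distributes the legs of
  the iterated coproduct over the arguments. Later computations with \<open>psi_n\<close> start from
  this description.\<close>

lemma
  assumes p: "p \<in> vcar P"
  shows psi_n_lin: "lin_map (power_space A n) (power_space A n) (psi_n P A \<psi> n p)"
    and psi_n_ptens: "as \<in> vlists A n \<Longrightarrow> mf A n \<mu> \<Longrightarrow> psi_n P A \<psi> n p (ptens A as) \<mu> = iter_delta P n p (\<lambda>ps. \<mu> (map2 \<psi> ps as))"
proof -
  note W = lin_mem[OF iter_delta_lin[OF P] p]
  note m = psi_aux_multilin[OF W]
  show "lin_map (power_space A n) (power_space A n) (psi_n P A \<psi> n p)"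
    unfolding psi_n_def by (rule plift_lin[OF A vspace_power m])
  show "psi_n P A \<psi> n p (ptens A as) \<mu> = iter_delta P n p (\<lambda>ps. \<mu> (map2 \<psi> ps as))" if "as \<in> vlists A n" "mf A n \<mu>"
    unfolding psi_n_def plift_ptens[OF A vspace_power m that(1)] by (rule psi_aux_apply[OF that(1) W that(2)])
qed

end

lemma iter_delta_hom:
  assumes P: "coalgebra P" and R: "coalgebra R" and f: "coalg_hom P R f" and p: "p \<in> vcar P" and \<mu>: "mf R n \<mu>"
  shows "iter_delta R n (f p) \<mu> = iter_delta P n p (\<lambda>ps. \<mu> (map f ps))"
proof -
  note vsP = coalg_vspace[OF P] and vsR = coalg_vspace[OF R] and fl = coalg_hom_lin[OF f]
  have fm: "map f ps \<in> vlists R n" if "ps \<in> vlists P n" for n ps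
    using that lin_mem[OF fl] by (auto simp: vlists_def)
  have mm: "mf P n (\<lambda>ps. \<mu> (map f ps))" if "mf R n \<mu>" for n \<mu>
  proof (rule multilinI)
    fix ps i assume ps: "ps \<in> vlists P n" and i: "i < n"
    show "lf P (\<lambda>x. \<mu> (map f (ps[i := x])))"
      using lin_comp[OF multilin_lin[OF that fm[OF ps] i] fl] by (simp add: map_update)
  qed simp
  show ?thesis using p \<mu>
  proof (induction n arbitrary: p \<mu>)
    case 0
    then show ?case using coalg_hom_eps[OF f] mm[OF 0(2)] by (simp add: ptens_apply[of _ 0])
  next
    case (Suc n)
    note fp = lin_mem[OF fl Suc.prems(1)] and Dp = lin_mem[OF coalg_delta[OF P] Suc.prems(1)]
    have b: "bf R R (\<lambda>x y. iter_delta R n y (\<lambda>ps. \<mu> (x # ps)))"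
    proof (rule bilin_mapI)
      show "lf R (\<lambda>x. iter_delta R n y (\<lambda>ps. \<mu> (x # ps)))" if "y \<in> vcar R" for y
        by (rule lf_power_param[OF lin_mem[OF iter_delta_lin[OF R] that] vsR vsR multilin_Cons[OF Suc.prems(2)] multilin_hd[OF Suc.prems(2) vsR]])
      show "lf R (\<lambda>y. iter_delta R n y (\<lambda>ps. \<mu> (x # ps)))" for x
        by (rule lin_comp[OF lf_apply_power iter_delta_lin[OF R]])
    qed
    have "iter_delta R (Suc n) (f p) \<mu> = cdelta P p (\<lambda>x y. iter_delta R n (f y) (\<lambda>ps. \<mu> (f x # ps)))"
      by (simp only: iter_delta_Suc[OF R fp Suc.prems(2)] coalg_hom_apply[OF P f Suc.prems(1) b])
    also have "\<dots> = cdelta P p (\<lambda>x y. iter_delta P n y (\<lambda>ps. \<mu> (f x # map f ps)))"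
      by (rule tensor_apply_cong[OF Dp vsP vsP]) (rule Suc.IH, assumption, rule multilin_Cons[OF Suc.prems(2)], rule lin_mem[OF fl])
    also have "\<dots> = iter_delta P (Suc n) p (\<lambda>ps. \<mu> (map f ps))"
      by (simp only: iter_delta_Suc[OF P Suc.prems(1) mm[OF Suc.prems(2)]] list.map)
    finally show ?case .
  qed
qed

text \<open>Iterated coproducts commute with coalgebra maps, so \<open>psi_n\<close> of the
  pulled-back map at \<open>p\<close> is \<open>psi_n\<close> of \<psi> at \<open>f p\<close>, and
  the measuring identities are inherited.\<close>

lemma measuring_hom:
  assumes P: "coalgebra P" and f: "coalg_hom P R f" and \<psi>: "measuring R A \<psi>" and A: "omega_algebra A"
  shows "measuring P A (\<lambda>p. \<psi> (f p))"
proof -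
  have R: "coalgebra R" and b: "bilin_map R A A \<psi>" using \<psi> by (auto simp: measuring_def)
  have vA: "vspace A" and ops: "\<And>w. w \<in> Ops A \<Longrightarrow> lin_map (power_space A (osrc A w)) (power_space A (otgt A w)) (oper A w)"
    using A by (auto simp: omega_algebra_def)
  note fl = coalg_hom_lin[OF f]
  have b': "bilin_map P A A (\<lambda>p. \<psi> (f p))"
    by (intro bilin_mapI lin_bilin_left[OF b fl] bilin_right[OF b] lin_mem[OF fl])
  have map2: "map2 (\<lambda>p. \<psi> (f p)) ps as = map2 \<psi> (map f ps) as" for ps as
    by (simp add: zip_map1 case_prod_unfold)
  have eq: "psi_n P A (\<lambda>p. \<psi> (f p)) n p X = psi_n R A \<psi> n (f p) X"
    if p: "p \<in> vcar P" and X: "X \<in> vcar (power_space A n)" for n p X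
  proof (rule lin_power_eqI[OF psi_n_lin[OF P vA b' p] psi_n_lin[OF R vA b lin_mem[OF fl p]] vA _ X])
    fix as assume as: "as \<in> vlists A n"
    show "psi_n P A (\<lambda>p. \<psi> (f p)) n p (ptens A as) = psi_n R A \<psi> n (f p) (ptens A as)"
    proof (rule power_ext[OF lin_mem[OF psi_n_lin[OF P vA b' p] ptens_mem[OF as]] lin_mem[OF psi_n_lin[OF R vA b lin_mem[OF fl p]] ptens_mem[OF as]] vA])
      fix \<mu> assume \<mu>: "mf A n \<mu>"
      show "psi_n P A (\<lambda>p. \<psi> (f p)) n p (ptens A as) \<mu> = psi_n R A \<psi> n (f p) (ptens A as) \<mu>"
        unfolding psi_n_ptens[OF P vA b' p as \<mu>] psi_n_ptens[OF R vA b lin_mem[OF fl p] as \<mu>]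
        unfolding iter_delta_hom[OF P R f p map2_multilin_left[OF R vA b \<mu> as]] map2 ..
    qed
  qed
  show ?thesis
    unfolding measuring_def
  proof (intro conjI P b' ballI)
    fix w p X assume w: "w \<in> Ops A" and p: "p \<in> vcar P" and X: "X \<in> vcar (power_space A (osrc A w))"
    show "psi_n P A (\<lambda>p. \<psi> (f p)) (otgt A w) p (oper A w X) = oper A w (psi_n P A (\<lambda>p. \<psi> (f p)) (osrc A w) p X)"
      unfolding eq[OF p X] eq[OF p lin_mem[OF ops[OF w] X]]
      using \<psi> w lin_mem[OF fl p] X by (simp add: measuring_def)
  qed
qed

section \<open>Measurings and comeasurings\<close>

lemma omegaD:
  assumes "omega_algebra A"
  shows "vspace A" "x \<in> vcar A" "w \<in> Ops A \<Longrightarrow> lin_map (power_space A (osrc A w)) (power_space A (otgt A w)) (oper A w)"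
  using assms by (auto simp: omega_algebra_def)

section \<open>The maps \<open>rho_n\<close> of a coaction\<close>

context
  fixes Q :: "('k::field, 'q::ab_group_add, 'z) alg_scheme" and A :: "('k, 'a::ab_group_add, 'o) omega_alg" and \<rho>
  assumes Q: "algebra Q" and A: "vspace A" and \<rho>: "lin_map A (tensor_space A Q) \<rho>"
begin

lemma rho_aux1:
  assumes x: "x \<in> vcar A" and q: "q \<in> vcar Q"
  shows "bilin_map (power_space A n) Q (tensor_space (power_space A (Suc n)) Q)
    (\<lambda>Y r. tens (power_space A (Suc n)) Q (pcons A n x Y) (amult Q q r))"
  by (rule tens_map_bilin[OF pcons_lin[OF A x] bilin_right[OF alg_bilin[OF Q] q]])

lemma rho_aux2:
  assumes R: "R \<in> vcar (tensor_space (power_space A n) Q)"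
  shows "bilin_map A Q (tensor_space (power_space A (Suc n)) Q) (\<lambda>x q. tlift (power_space A n) Q (tensor_space (power_space A (Suc n)) Q)
           (\<lambda>Y r. tens (power_space A (Suc n)) Q (pcons A n x Y) (amult Q q r)) R)"
proof (rule bilin_mapI)
  note vQ = alg_vspace[OF Q] and m = alg_bilin[OF Q]
  fix q assume q: "q \<in> vcar Q"
  show "lin_map A (tensor_space (power_space A (Suc n)) Q) (\<lambda>x. tlift (power_space A n) Q (tensor_space (power_space A (Suc n)) Q)
           (\<lambda>Y r. tens (power_space A (Suc n)) Q (pcons A n x Y) (amult Q q r)) R)"
    by (rule lin_tlift_param[OF R vspace_power vQ A vspace_power vQ rho_aux1[OF _ q]], assumption)
      (intro lin_bilin_left[OF tens_bilin] bilin_left[OF pcons_bilin[OF A]] alg_mult[OF Q] q)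
next
  note vQ = alg_vspace[OF Q] and m = alg_bilin[OF Q]
  fix x assume x: "x \<in> vcar A"
  show "lin_map Q (tensor_space (power_space A (Suc n)) Q) (\<lambda>q. tlift (power_space A n) Q (tensor_space (power_space A (Suc n)) Q)
           (\<lambda>Y r. tens (power_space A (Suc n)) Q (pcons A n x Y) (amult Q q r)) R)"
    by (rule lin_tlift_param[OF R vspace_power vQ vQ vspace_power vQ rho_aux1[OF x]], assumption)
      (intro lin_bilin_right[OF tens_bilin] bilin_left[OF m] lin_mem[OF pcons_lin[OF A x]])
qed

lemma rho_list_mem: "as \<in> vlists A n \<Longrightarrow> rho_list A Q \<rho> as \<in> vcar (tensor_space (power_space A n) Q)"
proof (induction as arbitrary: n)
  case Nil
  then have "n = 0" by (auto simp: vlists_def)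
  then show ?case by (auto intro!: tens_mem ptens_mem alg_one[OF Q])
next
  case (Cons a as)
  then obtain m where n: "n = Suc m" and a: "a \<in> vcar A" and as: "as \<in> vlists A m" by (auto simp: vlists_def)
  have "length as = m" using as by (rule vlists_length)
  then show ?case
    using tlift_mem[OF A alg_vspace[OF Q] vspace_tensor rho_aux2[OF Cons.IH[OF as]] lin_mem[OF \<rho> a]] n by (simp add: Let_def)
qed

lemma rho_aux3:
  assumes \<beta>: "bf (power_space A (Suc n)) Q \<beta>" and x: "x \<in> vcar A" and q: "q \<in> vcar Q"
  shows "bf (power_space A n) Q (\<lambda>Y r. \<beta> (pcons A n x Y) (amult Q q r))"
  by (rule bf_map[OF \<beta> pcons_lin[OF A x] bilin_right[OF alg_bilin[OF Q] q]])

lemma rho_list_Cons: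
  assumes a: "a \<in> vcar A" and as: "as \<in> vlists A n" and \<beta>: "bf (power_space A (Suc n)) Q \<beta>"
  shows "rho_list A Q \<rho> (a # as) \<beta> = \<rho> a (\<lambda>x q. rho_list A Q \<rho> as (\<lambda>Y r. \<beta> (pcons A n x Y) (amult Q q r)))"
proof -
  note vQ = alg_vspace[OF Q] and R = rho_list_mem[OF as]
  have len: "length as = n" using as by (rule vlists_length)
  show ?thesis
    by (simp add: Let_def len tlift_tensor_apply[OF A vQ rho_aux2[OF R] lin_mem[OF \<rho> a]])
      (rule tensor_apply_cong[OF lin_mem[OF \<rho> a] A vQ],
        simp add: tlift_tensor_apply[OF vspace_power vQ rho_aux1 R] tens_apply[OF \<beta>])
qed

lemma rho_list_multilin: "multilin_map A n (tensor_space (power_space A n) Q) (rho_list A Q \<rho>)"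
proof (induction n)
  case 0
  then show ?case by (rule multilinI) (use rho_list_mem[of _ 0] in auto)
next
  case (Suc n)
  note vQ = alg_vspace[OF Q]
  show ?case
  proof (rule multilin_ConsI)
    fix as assume as: "as \<in> vlists A n"
    have len: "length as = n" using as by (rule vlists_length)
    show "lin_map A (tensor_space (power_space A (Suc n)) Q) (\<lambda>x. rho_list A Q \<rho> (x # as))"
      using lin_comp[OF tlift_lin[OF A vQ vspace_tensor rho_aux2[OF rho_list_mem[OF as]]] \<rho>] len by (simp add: Let_def)
  next
    fix a assume a: "a \<in> vcar A"
    show "multilin_map A n (tensor_space (power_space A (Suc n)) Q) (\<lambda>as. rho_list A Q \<rho> (a # as))"
    proof (rule multilinI)
      show "rho_list A Q \<rho> (a # as) \<in> vcar (tensor_space (power_space A (Suc n)) Q)" if "as \<in> vlists A n" for as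
        using rho_list_mem[of "a # as" "Suc n"] that a by simp
      fix as i assume as: "as \<in> vlists A n" and i: "i < n"
      show "lin_map A (tensor_space (power_space A (Suc n)) Q) (\<lambda>y. rho_list A Q \<rho> (a # as[i := y]))"
      proof (rule lin_tensorI[OF A vspace_power vQ])
        show "rho_list A Q \<rho> (a # as[i := u]) \<in> vcar (tensor_space (power_space A (Suc n)) Q)" if "u \<in> vcar A" for u
          using rho_list_mem[of "a # as[i := u]" "Suc n"] vlists_update[OF as that] a by simp
        fix \<beta> assume \<beta>: "bf (power_space A (Suc n)) Q \<beta>"
        have b: "bf A Q (\<lambda>x q. R (\<lambda>Y r. \<beta> (pcons A n x Y) (amult Q q r)))" if R: "R \<in> vcar (tensor_space (power_space A n) Q)" for R
        proof (rule bilin_mapI)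
          show "lf A (\<lambda>x. R (\<lambda>Y r. \<beta> (pcons A n x Y) (amult Q q r)))" if q: "q \<in> vcar Q" for q
            by (rule lf_tensor_param[OF R vspace_power vQ A rho_aux3[OF \<beta> _ q]], assumption)
              (intro lin_bilin_left[OF \<beta>] bilin_left[OF pcons_bilin[OF A]] alg_mult[OF Q] q)
          show "lf Q (\<lambda>q. R (\<lambda>Y r. \<beta> (pcons A n x Y) (amult Q q r)))" if x: "x \<in> vcar A" for x
            by (rule lf_tensor_param[OF R vspace_power vQ vQ rho_aux3[OF \<beta> x]], assumption)
              (intro lin_bilin_right[OF \<beta>] bilin_left[OF alg_bilin[OF Q]] lin_mem[OF pcons_lin[OF A x]])
        qed
        have "lf A (\<lambda>y. \<rho> a (\<lambda>x q. rho_list A Q \<rho> (as[i := y]) (\<lambda>Y r. \<beta> (pcons A n x Y) (amult Q q r))))"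
          by (rule lf_tensor_param[OF lin_mem[OF \<rho> a] A vQ A b[OF rho_list_mem[OF vlists_update[OF as]]]], assumption)
            (rule lf_tensor_apply[OF multilin_lin[OF Suc as i]])
        then show "lf A (\<lambda>y. rho_list A Q \<rho> (a # as[i := y]) \<beta>)"
          by (rule lin_cong[OF _ A]) (rule rho_list_Cons[OF a vlists_update[OF as] \<beta>, symmetric])
      qed
    qed
  qed
qed

lemma rho_n_lin: "lin_map (power_space A n) (tensor_space (power_space A n) Q) (rho_n A Q \<rho> n)"
  unfolding rho_n_def by (rule plift_lin[OF A vspace_tensor rho_list_multilin])

lemma rho_n_ptens: "as \<in> vlists A n \<Longrightarrow> rho_n A Q \<rho> n (ptens A as) = rho_list A Q \<rho> as"
  unfolding rho_n_def by (rule plift_ptens[OF A vspace_tensor rho_list_multilin])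

end

lemma contract_tmap:
  assumes vs: "vspace V" "vspace W" "vspace V'" "vspace W'" and g: "lin_map V V' g" and h: "lin_map W W' h"
    and f: "lf W' f" and X: "X \<in> vcar (tensor_space V W)"
  shows "contract V' W' f (tmap V W V' W' g h X) = g (contract V W (\<lambda>w. f (h w)) X)"
  by (rule lin_tensor_eqI[OF lin_comp[OF contract_lin[OF vs(3,4) f] tmap_lin[OF vs(1,2) g h]]
        lin_comp[OF g contract_lin[OF vs(1,2) lin_comp[OF f h]]] vs(1,2) _ X])
    (simp add: tmap_tens[OF vs(1,2) g h] contract_tens[OF vs(3,4) f] contract_tens[OF vs(1,2) lin_comp[OF f h]]
      lin_mem[OF g] lin_mem[OF h] lin_scale[OF g])

text \<open>
  A pairing of a coalgebra with an algebra that turns the comultiplication into the multiplication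
  relates \<open>\<psi>\<^sub>n\<close> and \<open>\<rho>\<^sub>n\<close>; it is applied to a Hopf algebra and its finite dual, in both orders.
\<close>

context
  fixes P :: "('k::field, 'p::ab_group_add) coalg" and Q :: "('k, 'q::ab_group_add, 'z) alg_scheme"
    and A :: "('k, 'a::ab_group_add, 'o) omega_alg" and pr \<rho> \<psi>
  assumes P: "coalgebra P" and Q: "algebra Q" and A: "vspace A" and \<rho>: "lin_map A (tensor_space A Q) \<rho>"
    and pr: "bf P Q pr"
    and pr_mult: "\<And>p q r. p \<in> vcar P \<Longrightarrow> q \<in> vcar Q \<Longrightarrow> r \<in> vcar Q \<Longrightarrow>
      pr p (amult Q q r) = cdelta P p (\<lambda>x y. pr x q * pr y r)"
    and pr_one: "\<And>p. p \<in> vcar P \<Longrightarrow> pr p (aone Q) = ceps P p"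
    and \<psi>: "\<And>p a. p \<in> vcar P \<Longrightarrow> a \<in> vcar A \<Longrightarrow> \<psi> p a = contract A Q (pr p) (\<rho> a)"
begin

lemma pairing_psi_apply: "p \<in> vcar P \<Longrightarrow> a \<in> vcar A \<Longrightarrow> lf A f \<Longrightarrow> f (\<psi> p a) = \<rho> a (\<lambda>x q. f x * pr p q)"
  using contract_apply[OF A alg_vspace[OF Q] bilin_right[OF pr] _ lin_mem[OF \<rho>]] by (simp add: \<psi>)

lemma pairing_bilin: "bilin_map P A A \<psi>"
proof (rule bilin_mapI)
  note vQ = alg_vspace[OF Q] and prl = bilin_right[OF pr]
  have mem: "\<psi> p a \<in> vcar A" if "p \<in> vcar P" "a \<in> vcar A" for p a
    using contract_mem[OF A vQ prl lin_mem[OF \<rho>]] that by (simp add: \<psi>)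
  show "lin_map A A (\<lambda>a. \<psi> p a)" if p: "p \<in> vcar P" for p
    by (rule lin_cong[OF lin_comp[OF contract_lin[OF A vQ prl[OF p]] \<rho>] A]) (simp add: \<psi> p)
  fix a assume a: "a \<in> vcar A"
  note \<rho>a = lin_mem[OF \<rho> a]
  have l: "lf P (\<lambda>p. f (\<psi> p a))" if f: "lf A f" for f
  proof -
    have "lf P (\<lambda>p. \<rho> a (\<lambda>x q. f x * pr p q))"
      by (rule lf_tensor_param[OF \<rho>a A vQ coalg_vspace[OF P] bf_prod[OF f prl]], assumption)
        (intro lf_mult_left bilin_left[OF pr])
    then show ?thesis by (rule lin_cong[OF _ coalg_vspace[OF P]]) (simp add: pairing_psi_apply a f)
  qed
  show "lin_map P A (\<lambda>p. \<psi> p a)"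
  proof (rule lin_mapI)
    fix p c assume p: "p \<in> vcar P"
    note vP = coalg_vspace[OF P]
    show "\<psi> p a \<in> vcar A" by (rule mem[OF p a])
    show "\<psi> (vscale P c p) a = vscale A c (\<psi> p a)"
      by (rule functional_sep[OF A]) (auto simp: mem vs_scale A vP p a lin_scale[OF l p] lin_scale[of A ground])
    fix p' assume p': "p' \<in> vcar P"
    show "\<psi> (p + p') a = \<psi> p a + \<psi> p' a"
      by (rule functional_sep[OF A]) (auto simp: mem vs_add A vP p p' a lin_add[OF l p p'] lin_add[of A ground])
  qed
qed

text \<open>The pairing turns the product of the algebra legs into the coproduct of
  \<open>p\<close>, one list entry at a time: the first leg of the coproduct acts on the head, the
  second goes into the induction hypothesis.\<close>

lemma pairing_list:
  assumes "p \<in> vcar P" "as \<in> vlists A n" "mf A n \<mu>"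
  shows "rho_list A Q \<rho> as (\<lambda>Y r. Y \<mu> * pr p r) = iter_delta P n p (\<lambda>ps. \<mu> (map2 \<psi> ps as))"
  using assms
proof (induction as arbitrary: n \<mu> p)
  case Nil
  then have n: "n = 0" by (auto simp: vlists_def)
  have \<mu>: "mf A 0 \<mu>" using Nil n by simp
  have b: "bf (power_space A 0) Q (\<lambda>Y r. Y \<mu> * pr p r)"
    by (rule bf_prod[OF lf_apply_power bilin_right[OF pr Nil(1)]])
  have m: "mf P 0 (\<lambda>ps. \<mu> [])" by (rule multilinI) auto
  show ?case
    using iter_delta_0[OF m, of p] unfolding n
    by (simp add: tens_apply[OF b] ptens_apply[OF \<mu>] ptens_apply[OF m] pr_one Nil(1))
next
  case (Cons a as)
  then obtain m where n: "n = Suc m" and a: "a \<in> vcar A" and as: "as \<in> vlists A m" by (auto simp: vlists_def)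
  note p = Cons.prems(1)
  have \<mu>: "mf A (Suc m) \<mu>" using Cons.prems n by simp
  note vQ = alg_vspace[OF Q] and vP = coalg_vspace[OF P] and prl = bilin_right[OF pr]
  note \<rho>a = lin_mem[OF \<rho> a] and Dp = lin_mem[OF coalg_delta[OF P] p] and R = rho_list_mem[OF Q A \<rho> as]
  \<comment> \<open>\<open>G x p'\<close> is the contribution of the tail once the head has produced
    \<open>x\<close>. Named separately, it can be treated as a form linear in each argument when
    evaluations are interchanged.\<close>
  define G where "G x p' = rho_list A Q \<rho> as (\<lambda>Y r. Y (\<lambda>ys. \<mu> (x # ys)) * pr p' r)" for x p'
  have bG: "bf (power_space A m) Q (\<lambda>Y r. Y (\<lambda>ys. \<mu> (x # ys)) * pr p' r)" if "p' \<in> vcar P" for x p'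
    by (rule bf_prod[OF lf_apply_power prl[OF that]])
  have Gx: "lf A (\<lambda>x. G x p')" if "p' \<in> vcar P" for p'
    unfolding G_def
    by (rule lf_tensor_param[OF R vspace_power vQ A bG[OF that]])
      (intro lf_mult_right lf_power_param[OF _ A A multilin_Cons[OF \<mu>] multilin_hd[OF \<mu> A]])
  have Gp: "lf P (\<lambda>p'. G x p')" for x
    unfolding G_def
    by (rule lf_tensor_param[OF R vspace_power vQ vP bG], assumption) (intro lf_mult_left bilin_left[OF pr])
  have IH: "G x p' = iter_delta P m p' (\<lambda>ps. \<mu> (x # map2 \<psi> ps as))" if "x \<in> vcar A" "p' \<in> vcar P" for x p'
    unfolding G_def by (rule Cons.IH[OF that(2) as multilin_Cons[OF \<mu> that(1)]])
  have "rho_list A Q \<rho> (a # as) (\<lambda>Y r. Y \<mu> * pr p r)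
      = \<rho> a (\<lambda>x q. rho_list A Q \<rho> as (\<lambda>Y r. pcons A m x Y \<mu> * pr p (amult Q q r)))"
    by (rule rho_list_Cons[OF Q A \<rho> a as bf_prod[OF lf_apply_power prl[OF p]]])
  also have "\<dots> = \<rho> a (\<lambda>x q. cdelta P p (\<lambda>p1 p2. G x p2 * pr p1 q))"
  proof (rule tensor_apply_cong[OF \<rho>a A vQ])
    fix x q assume x: "x \<in> vcar A" and q: "q \<in> vcar Q"
    have "rho_list A Q \<rho> as (\<lambda>Y r. pcons A m x Y \<mu> * pr p (amult Q q r))
      = rho_list A Q \<rho> as (\<lambda>Y r. cdelta P p (\<lambda>p1 p2. Y (\<lambda>ys. \<mu> (x # ys)) * (pr p1 q * pr p2 r)))"
      by (rule tensor_apply_cong[OF R vspace_power vQ])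
        (simp add: pcons_apply[OF A x \<mu>] pr_mult[OF p q] tensor_scale_left[OF Dp vP vP bf_prod[OF bilin_left[OF pr q] bilin_left[OF pr]]])
    also have "\<dots> = cdelta P p (\<lambda>p1 p2. rho_list A Q \<rho> as (\<lambda>Y r. Y (\<lambda>ys. \<mu> (x # ys)) * (pr p1 q * pr p2 r)))"
    proof (rule tensor_fubini[OF R vspace_power vQ Dp vP vP])
      fix Y r assume "Y \<in> vcar (power_space A m)" and r: "r \<in> vcar Q"
      show "bf P P (\<lambda>p1 p2. Y (\<lambda>ys. \<mu> (x # ys)) * (pr p1 q * pr p2 r))"
        by (intro bilin_mapI lf_mult_left lf_mult_right bilin_left[OF pr] q r)
    next
      fix p1 p2 assume "p1 \<in> vcar P" "p2 \<in> vcar P"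
      then show "bf (power_space A m) Q (\<lambda>Y r. Y (\<lambda>ys. \<mu> (x # ys)) * (pr p1 q * pr p2 r))"
        by (intro bf_prod lf_apply_power lf_mult_left prl)
    qed
    also have "\<dots> = cdelta P p (\<lambda>p1 p2. G x p2 * pr p1 q)"
    proof (rule tensor_apply_cong[OF Dp vP vP])
      fix p1 p2 assume "p1 \<in> vcar P" and p2: "p2 \<in> vcar P"
      have "rho_list A Q \<rho> as (\<lambda>Y r. Y (\<lambda>ys. \<mu> (x # ys)) * (pr p1 q * pr p2 r))
        = rho_list A Q \<rho> as (\<lambda>Y r. pr p1 q * (Y (\<lambda>ys. \<mu> (x # ys)) * pr p2 r))" by (simp add: mult_ac)
      also have "\<dots> = pr p1 q * G x p2" unfolding G_def by (rule tensor_scale_left[OF R vspace_power vQ bG[OF p2]])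
      finally show "rho_list A Q \<rho> as (\<lambda>Y r. Y (\<lambda>ys. \<mu> (x # ys)) * (pr p1 q * pr p2 r)) = G x p2 * pr p1 q"
        by (simp add: mult.commute)
    qed
    finally show "rho_list A Q \<rho> as (\<lambda>Y r. pcons A m x Y \<mu> * pr p (amult Q q r)) = cdelta P p (\<lambda>p1 p2. G x p2 * pr p1 q)" .
  qed
  \<comment> \<open>With \<rho> evaluated innermost, pairing its algebra leg with \<open>p1\<close>
    is exactly the action of \<open>p1\<close> on the head.\<close>
  also have "\<dots> = cdelta P p (\<lambda>p1 p2. \<rho> a (\<lambda>x q. G x p2 * pr p1 q))"
  proof (rule tensor_fubini[OF \<rho>a A vQ Dp vP vP])
    show "bf P P (\<lambda>p1 p2. G x p2 * pr p1 q)" if "x \<in> vcar A" "q \<in> vcar Q" for x q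
      by (intro bilin_mapI lf_mult_left lf_mult_right bilin_left[OF pr] Gp that)
    show "bf A Q (\<lambda>x q. G x p2 * pr p1 q)" if "p1 \<in> vcar P" "p2 \<in> vcar P" for p1 p2
      by (intro bf_prod Gx prl that)
  qed
  also have "\<dots> = cdelta P p (\<lambda>p1 p2. G (\<psi> p1 a) p2)"
    by (rule tensor_apply_cong[OF Dp vP vP]) (simp add: pairing_psi_apply[OF _ a Gx])
  also have "\<dots> = cdelta P p (\<lambda>p1 p2. iter_delta P m p2 (\<lambda>ps. \<mu> (map2 \<psi> (p1 # ps) (a # as))))"
    by (rule tensor_apply_cong[OF Dp vP vP]) (simp add: IH bilin_mem[OF pairing_bilin] a)
  also have "\<dots> = iter_delta P (Suc m) p (\<lambda>ps. \<mu> (map2 \<psi> ps (a # as)))"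
    by (rule iter_delta_Suc[OF P p map2_multilin_left[OF P A pairing_bilin \<mu>], symmetric]) (use a as in simp)
  finally show ?case by (simp only: n)
qed

lemma pairing_power:
  assumes p: "p \<in> vcar P" and X: "X \<in> vcar (power_space A n)"
  shows "contract (power_space A n) Q (pr p) (rho_n A Q \<rho> n X) = psi_n P A \<psi> n p X"
proof -
  note vQ = alg_vspace[OF Q] and prp = bilin_right[OF pr p]
  note cl = contract_lin[OF vspace_power vQ prp] and rl = rho_n_lin[OF Q A \<rho>]
  note pl = psi_n_lin[OF P A pairing_bilin p]
  show ?thesis
  proof (rule lin_power_eqI[OF lin_comp[OF cl rl] pl A _ X])
    fix as assume as: "as \<in> vlists A n"
    note R = rho_list_mem[OF Q A \<rho> as]
    show "contract (power_space A n) Q (pr p) (rho_n A Q \<rho> n (ptens A as)) = psi_n P A \<psi> n p (ptens A as)"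
    proof (rule power_ext[OF lin_mem[OF cl lin_mem[OF rl ptens_mem[OF as]]] lin_mem[OF pl ptens_mem[OF as]] A])
      fix \<mu> assume \<mu>: "mf A n \<mu>"
      have "contract (power_space A n) Q (pr p) (rho_n A Q \<rho> n (ptens A as)) \<mu> = rho_list A Q \<rho> as (\<lambda>Y r. Y \<mu> * pr p r)"
        unfolding rho_n_ptens[OF Q A \<rho> as] by (rule contract_apply[OF vspace_power vQ prp lf_apply_power R])
      also have "\<dots> = psi_n P A \<psi> n p (ptens A as) \<mu>"
        by (simp only: pairing_list[OF p as \<mu>] psi_n_ptens[OF P A pairing_bilin p as \<mu>])
      finally show "contract (power_space A n) Q (pr p) (rho_n A Q \<rho> n (ptens A as)) \<mu> = psi_n P A \<psi> n p (ptens A as) \<mu>" .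
    qed
  qed
qed

lemma pairing_oper:
  assumes om: "omega_algebra A" and w: "w \<in> Ops A" and p: "p \<in> vcar P" and X: "X \<in> vcar (power_space A (osrc A w))"
  shows "contract (power_space A (otgt A w)) Q (pr p) (tmap (power_space A (osrc A w)) Q (power_space A (otgt A w)) Q (oper A w) id
              (rho_n A Q \<rho> (osrc A w) X)) = oper A w (psi_n P A \<psi> (osrc A w) p X)"
  using contract_tmap[OF vspace_power alg_vspace[OF Q] vspace_power alg_vspace[OF Q] omegaD(3)[OF om w] lin_id' bilin_right[OF pr p]
      lin_mem[OF rho_n_lin[OF Q A \<rho>] X]]
  by (simp add: pairing_power[OF p X])

text \<open>The measuring identity at \<open>p\<close> is the comeasuring identity contracted with
  \<open>pr p\<close>.\<close>

lemma pairing_measuring: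
  assumes om: "omega_algebra A" and co: "comeasuring Q A \<rho>"
  shows "measuring P A \<psi>"
  unfolding measuring_def
proof (intro conjI P pairing_bilin ballI)
  fix w p X assume w: "w \<in> Ops A" and p: "p \<in> vcar P" and X: "X \<in> vcar (power_space A (osrc A w))"
  show "psi_n P A \<psi> (otgt A w) p (oper A w X) = oper A w (psi_n P A \<psi> (osrc A w) p X)"
    unfolding pairing_power[OF p lin_mem[OF omegaD(3)[OF om w] X], symmetric] pairing_oper[OF om w p X, symmetric]
    using co w X by (simp add: comeasuring_def)
qed

text \<open>For the converse the functionals \<open>pr p\<close> must separate \<open>Q\<close>; the
  contracted identities then recover the identity of tensors.\<close>

lemma pairing_comeasuring:
  assumes om: "omega_algebra A" and me: "measuring P A \<psi>" and sep: "separates Q {pr p | p. p \<in> vcar P}"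
  shows "comeasuring Q A \<rho>"
  unfolding comeasuring_def
proof (intro conjI Q \<rho> ballI)
  fix w X assume w: "w \<in> Ops A" and X: "X \<in> vcar (power_space A (osrc A w))"
  note vQ = alg_vspace[OF Q] and rl = rho_n_lin[OF Q A \<rho>] and ol = omegaD(3)[OF om w]
  let ?L = "rho_n A Q \<rho> (otgt A w) (oper A w X)"
  let ?R = "tmap (power_space A (osrc A w)) Q (power_space A (otgt A w)) Q (oper A w) id (rho_n A Q \<rho> (osrc A w) X)"
  show "?L = ?R"
  proof (rule tensor_eqI[OF vspace_power vQ separates_all[OF vspace_power] sep])
    show L: "?L \<in> vcar (tensor_space (power_space A (otgt A w)) Q)" by (rule lin_mem[OF rl lin_mem[OF ol X]])
    show R: "?R \<in> vcar (tensor_space (power_space A (otgt A w)) Q)" by (rule tmap_mem[OF vspace_power vQ ol lin_id' lin_mem[OF rl X]])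
    fix f g assume "f \<in> {f. lf (power_space A (otgt A w)) f}" and "g \<in> {pr p | p. p \<in> vcar P}"
    then obtain p where f: "lf (power_space A (otgt A w)) f" and g: "g = pr p" and p: "p \<in> vcar P" by auto
    have "contract (power_space A (otgt A w)) Q (pr p) ?L = contract (power_space A (otgt A w)) Q (pr p) ?R"
      unfolding pairing_power[OF p lin_mem[OF ol X]] pairing_oper[OF om w p X]
      using me w p X by (simp add: measuring_def)
    then show "?L (\<lambda>v w. f v * g w) = ?R (\<lambda>v w. f v * g w)"
      unfolding g using contract_apply[OF vspace_power vQ bilin_right[OF pr p] f L]
        contract_apply[OF vspace_power vQ bilin_right[OF pr p] f R] by simp
  qed
qed

end

text \<open>An algebra map applied to the product of the algebra legs may be applied to each leg, so
  it commutes with \<open>rho_n\<close>.\<close>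

lemma comeasuring_hom:
  assumes om: "omega_algebra A" and co: "comeasuring Q A \<rho>" and R: "algebra R" and f: "alg_hom Q R f"
  shows "comeasuring R A (\<lambda>a. tmap A Q A R id f (\<rho> a))"
proof -
  let ?\<rho> = "\<lambda>a. tmap A Q A R id f (\<rho> a)"
  have Q: "algebra Q" and \<rho>: "lin_map A (tensor_space A Q) \<rho>" using co by (auto simp: comeasuring_def)
  note A = omegaD(1)[OF om] and vQ = alg_vspace[OF Q] and vR = alg_vspace[OF R] and fl = alg_hom_lin[OF f]
  have \<rho>': "lin_map A (tensor_space A R) ?\<rho>" by (rule lin_comp[OF tmap_lin[OF A vQ lin_id' fl] \<rho>])
  have list: "rho_list A R ?\<rho> as \<beta> = rho_list A Q \<rho> as (\<lambda>Y q. \<beta> Y (f q))"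
    if "as \<in> vlists A n" "bf (power_space A n) R \<beta>" for as n \<beta>
    using that
  proof (induction as arbitrary: n \<beta>)
    case Nil
    then have n: "n = 0" by (auto simp: vlists_def)
    show ?case using Nil(2) bf_map[OF Nil(2) lin_id' fl] unfolding n
      by (simp add: tens_apply alg_hom_one[OF f])
  next
    case (Cons a as)
    then obtain m where n: "n = Suc m" and a: "a \<in> vcar A" and as: "as \<in> vlists A m" by (auto simp: vlists_def)
    have \<beta>: "bf (power_space A (Suc m)) R \<beta>" using Cons.prems n by simp
    note \<rho>a = lin_mem[OF \<rho> a]
    have b: "bf A R (\<lambda>x r. rho_list A R ?\<rho> as (\<lambda>Y r'. \<beta> (pcons A m x Y) (amult R r r')))"
    proof -
      note Rl = rho_list_mem[OF R A \<rho>' as]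
      show ?thesis
      proof (rule bilin_mapI)
        show "lf A (\<lambda>x. rho_list A R ?\<rho> as (\<lambda>Y r'. \<beta> (pcons A m x Y) (amult R r r')))" if r: "r \<in> vcar R" for r
          by (rule lf_tensor_param[OF Rl vspace_power vR A rho_aux3[OF R A \<rho>' \<beta> _ r]], assumption)
            (intro lin_bilin_left[OF \<beta>] bilin_left[OF pcons_bilin[OF A]] alg_mult[OF R] r)
        show "lf R (\<lambda>r. rho_list A R ?\<rho> as (\<lambda>Y r'. \<beta> (pcons A m x Y) (amult R r r')))" if x: "x \<in> vcar A" for x
          by (rule lf_tensor_param[OF Rl vspace_power vR vR rho_aux3[OF R A \<rho>' \<beta> x]], assumption)
            (intro lin_bilin_right[OF \<beta>] bilin_left[OF alg_bilin[OF R]] lin_mem[OF pcons_lin[OF A x]])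
      qed
    qed
    have "rho_list A R ?\<rho> (a # as) \<beta> = \<rho> a (\<lambda>x q. rho_list A R ?\<rho> as (\<lambda>Y r'. \<beta> (pcons A m x Y) (amult R (f q) r')))"
      by (simp only: rho_list_Cons[OF R A \<rho>' a as \<beta>] tmap_apply[OF A vQ lin_id' fl b \<rho>a] id_apply)
    also have "\<dots> = \<rho> a (\<lambda>x q. rho_list A Q \<rho> as (\<lambda>Y r. \<beta> (pcons A m x Y) (f (amult Q q r))))"
    proof (rule tensor_apply_cong[OF \<rho>a A vQ])
      fix x q assume x: "x \<in> vcar A" and q: "q \<in> vcar Q"
      have "rho_list A R ?\<rho> as (\<lambda>Y r'. \<beta> (pcons A m x Y) (amult R (f q) r'))
        = rho_list A Q \<rho> as (\<lambda>Y r. \<beta> (pcons A m x Y) (amult R (f q) (f r)))"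
        by (rule Cons.IH[OF as rho_aux3[OF R A \<rho>' \<beta> x lin_mem[OF fl q]]])
      also have "\<dots> = rho_list A Q \<rho> as (\<lambda>Y r. \<beta> (pcons A m x Y) (f (amult Q q r)))"
        by (rule tensor_apply_cong[OF rho_list_mem[OF Q A \<rho> as] vspace_power vQ]) (simp add: alg_hom_mult[OF f q])
      finally show "rho_list A R ?\<rho> as (\<lambda>Y r'. \<beta> (pcons A m x Y) (amult R (f q) r'))
        = rho_list A Q \<rho> as (\<lambda>Y r. \<beta> (pcons A m x Y) (f (amult Q q r)))" .
    qed
    also have "\<dots> = rho_list A Q \<rho> (a # as) (\<lambda>Y q. \<beta> Y (f q))"
      by (rule rho_list_Cons[OF Q A \<rho> a as bf_map[OF \<beta> lin_id fl], symmetric])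
    finally show ?case .
  qed
  have eq: "rho_n A R ?\<rho> n X = tmap (power_space A n) Q (power_space A n) R id f (rho_n A Q \<rho> n X)"
    if X: "X \<in> vcar (power_space A n)" for n X
  proof -
    note tl = tmap_lin[OF vspace_power vQ lin_id' fl] and rl = rho_n_lin[OF Q A \<rho>] and rl' = rho_n_lin[OF R A \<rho>']
    show ?thesis
    proof (rule lin_power_eqI[OF rl' lin_comp[OF tl rl] A _ X])
      fix as assume as: "as \<in> vlists A n"
      note m = rho_list_mem[OF Q A \<rho> as]
      show "rho_n A R ?\<rho> n (ptens A as) = tmap (power_space A n) Q (power_space A n) R id f (rho_n A Q \<rho> n (ptens A as))"
        unfolding rho_n_ptens[OF R A \<rho>' as] rho_n_ptens[OF Q A \<rho> as]
        by (rule tensor_ext[OF rho_list_mem[OF R A \<rho>' as] lin_mem[OF tl m] vspace_power vR])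
          (simp add: list[OF as] tmap_apply[OF vspace_power vQ lin_id' fl _ m])
    qed
  qed
  show ?thesis
    unfolding comeasuring_def
  proof (intro conjI R \<rho>' ballI)
    fix w X assume w: "w \<in> Ops A" and X: "X \<in> vcar (power_space A (osrc A w))"
    note ol = omegaD(3)[OF om w] and rl = rho_n_lin[OF Q A \<rho>]
    note r = lin_mem[OF rl X]
    let ?s = "power_space A (osrc A w)" and ?t = "power_space A (otgt A w)"
    have "rho_n A R ?\<rho> (otgt A w) (oper A w X) = tmap ?t Q ?t R id f (tmap ?s Q ?t Q (oper A w) id (rho_n A Q \<rho> (osrc A w) X))"
      using co w X by (simp add: eq[OF lin_mem[OF ol X]] comeasuring_def)
    also have "\<dots> = tmap ?s R ?t R (oper A w) id (tmap ?s Q ?s R id f (rho_n A Q \<rho> (osrc A w) X))" (is "?L = ?R")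
    proof (rule tensor_ext[OF _ _ vspace_power vR])
      show "?L \<in> vcar (tensor_space ?t R)" by (intro tmap_mem vspace_power vQ vR lin_id' fl ol r)
      show "?R \<in> vcar (tensor_space ?t R)" by (intro tmap_mem vspace_power vQ vR lin_id' fl ol r)
      fix \<beta> assume \<beta>: "bf ?t R \<beta>"
      show "?L \<beta> = ?R \<beta>"
        using bf_map[OF \<beta> lin_id' fl] bf_map[OF \<beta> ol lin_id']
        by (simp add: tmap_apply[OF vspace_power vQ lin_id' fl \<beta>] tmap_apply[OF vspace_power vR ol lin_id' \<beta>]
            tmap_apply[OF vspace_power vQ ol lin_id'] tmap_apply[OF vspace_power vQ lin_id' fl]
            tmap_mem[OF vspace_power vQ ol lin_id' r] tmap_mem[OF vspace_power vQ lin_id' fl r] r)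
    qed
    finally show "rho_n A R ?\<rho> (otgt A w) (oper A w X)
          = tmap ?s R ?t R (oper A w) id (rho_n A R ?\<rho> (osrc A w) X)" by (simp add: eq[OF X])
  qed
qed

section \<open>Universal properties for test objects outside the universe\<close>

lemma tmap_tmap:
  assumes "vspace V" "vspace W" "lin_map V V' f" "lin_map W W' g" "vspace V'" "vspace W'"
    "lin_map V' V'' f'" "lin_map W' W'' g'" "vspace V''" "vspace W''" and X: "X \<in> vcar (tensor_space V W)"
  shows "tmap V' W' V'' W'' f' g' (tmap V W V' W' f g X) = tmap V W V'' W'' (\<lambda>x. f' (f x)) (\<lambda>x. g' (g x)) X"
proof -
  note l = lin_comp[OF assms(7,3)] lin_comp[OF assms(8,4)]
  show ?thesis
    by (rule tensor_ext[OF tmap_mem[OF assms(5-8) tmap_mem[OF assms(1-4) X]] tmap_mem[OF assms(1,2) l X] assms(9,10)])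
      (simp add: tmap_apply[OF assms(5-8) _ tmap_mem[OF assms(1-4) X]] tmap_apply[OF assms(1-4) bf_map[OF _ assms(7,8)] X] tmap_apply[OF assms(1,2) l _ X])
qed

lemma tmap_cong:
  assumes "vspace V" "vspace W" "lin_map V V' f" "lin_map W W' g" "vspace V'" "vspace W'"
    "\<And>x. x \<in> vcar V \<Longrightarrow> f x = f' x" "\<And>x. x \<in> vcar W \<Longrightarrow> g x = g' x" and X: "X \<in> vcar (tensor_space V W)"
  shows "tmap V W V' W' f g X = tmap V W V' W' f' g' X"
proof -
  have l: "lin_map V V' f'" "lin_map W W' g'"
    by (rule lin_cong[OF assms(3,1)], erule assms(7), rule lin_cong[OF assms(4,2)], erule assms(8))
  show ?thesis
    by (rule tensor_ext[OF tmap_mem[OF assms(1-4) X] tmap_mem[OF assms(1,2) l X] assms(5,6)])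
      (simp add: tmap_apply[OF assms(1-4) _ X] tmap_apply[OF assms(1,2) l _ X],
        rule tensor_apply_cong[OF X assms(1,2)], simp add: assms(7,8))
qed

text \<open>The measuring is moved to the copy of \<open>P\<close> in \<open>'t\<close> along the
  inverse of \<open>j\<close>. The operators on \<open>A\<close> stay the same, and with them the
  cosupport.\<close>

lemma universal_acting_embeds:
  assumes U: "universal_acting_bialgebra TYPE('t::ab_group_add) A V B \<psi>" and om: "omega_algebra A"
    and P: "coalgebra P" and j: "embeds P s (j :: _ \<Rightarrow> 't)"
    and me: "measuring P A \<psi>'" and co: "cosupp_meas P \<psi>' \<subseteq> V"
  shows "ex_unique_on (vcar P) (\<lambda>\<phi>. coalg_hom P (coalg_of B) \<phi> \<and> (\<forall>p\<in>vcar P. \<forall>a. \<psi> (\<phi> p) a = \<psi>' p a))"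
proof -
  let ?P = "ctrans P s j" and ?i = "inv_into (vcar P) j"
  have B: "coalgebra (coalg_of B)"
    using U by (auto simp: universal_acting_bialgebra_def bialg_action_def bialgebra_def)
  note P' = ctrans_coalgebra[OF P j] and h = ctrans_hom[OF P j] ctrans_inv_hom[OF P j]
  have inv: "?i (j x) = x" if "x \<in> vcar P" for x using j that by (simp add: embeds_def)
  have "measuring ?P A (\<lambda>p. \<psi>' (?i p))" by (rule measuring_hom[OF P' h(2) me om])
  moreover have "cosupp_meas ?P (\<lambda>p. \<psi>' (?i p)) \<subseteq> V"
    using co inv by (auto simp: cosupp_meas_def image_subset_iff)
  ultimately have "ex_unique_on (vcar ?P) (\<lambda>\<phi>. coalg_hom ?P (coalg_of B) \<phi> \<and> (\<forall>p\<in>vcar ?P. \<forall>a. \<psi> (\<phi> p) a = \<psi>' (?i p) a))"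
    using U unfolding universal_acting_bialgebra_def by blast
  then obtain g where g: "coalg_hom ?P (coalg_of B) g" "\<forall>p\<in>vcar ?P. \<forall>a. \<psi> (g p) a = \<psi>' (?i p) a"
    and u: "\<And>g'. coalg_hom ?P (coalg_of B) g' \<Longrightarrow> \<forall>p\<in>vcar ?P. \<forall>a. \<psi> (g' p) a = \<psi>' (?i p) a \<Longrightarrow> \<forall>x\<in>vcar ?P. g' x = g x"
    unfolding ex_unique_on_def by blast
  show ?thesis unfolding ex_unique_on_def
  proof (intro exI[of _ "\<lambda>x. g (j x)"] conjI allI impI ballI)
    show "coalg_hom P (coalg_of B) (\<lambda>x. g (j x))" by (rule coalg_hom_comp[OF P P' B h(1) g(1)])
    show "\<psi> (g (j p)) a = \<psi>' p a" if "p \<in> vcar P" for p a using g(2) that inv by simp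
    fix g' x assume g': "coalg_hom P (coalg_of B) g' \<and> (\<forall>p\<in>vcar P. \<forall>a. \<psi> (g' p) a = \<psi>' p a)" and x: "x \<in> vcar P"
    have "coalg_hom ?P (coalg_of B) (\<lambda>x. g' (?i x))"
      using g' coalg_hom_comp[OF P' P B h(2)] by simp
    then have "\<forall>x\<in>vcar ?P. g' (?i x) = g x" by (rule u) (use g' inv in auto)
    then show "g' x = g (j x)" using x inv by auto
  qed
qed

text \<open>The comeasuring is pushed forward along \<open>j\<close>. Its cosupport stays in
  \<open>V\<close>, because a functional on the copy composed with \<open>j\<close> is a functional
  on \<open>Q\<close>.\<close>

lemma universal_coacting_embeds:
  assumes U: "universal_coacting_bialgebra TYPE('t::ab_group_add) A V B \<rho>" and om: "omega_algebra A"
    and Q: "algebra (Q :: ('k::field, 'q::ab_group_add, 'z) alg_scheme)" and j: "embeds Q s (j :: _ \<Rightarrow> 't)"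
    and me: "comeasuring Q A \<rho>'" and co: "cosupp_comeas Q A \<rho>' \<subseteq> V"
  shows "ex_unique_on (vcar B) (\<lambda>\<phi>. alg_hom B Q \<phi> \<and> (\<forall>a. tmap A B A Q id \<phi> (\<rho> a) = \<rho>' a))"
proof -
  let ?Q = "atrans Q s j" and ?i = "inv_into (vcar Q) j"
  have B: "algebra B" and \<rho>: "lin_map A (tensor_space A B) \<rho>"
    using U by (auto simp: universal_coacting_bialgebra_def bialg_coaction_def bialgebra_def comeasuring_def)
  note vA = omegaD(1)[OF om] and vB = alg_vspace[OF B] and vQ = alg_vspace[OF Q]
  have \<rho>': "lin_map A (tensor_space A Q) \<rho>'" using me by (simp add: comeasuring_def)
  note \<rho>m = lin_mem[OF \<rho> omegaD(2)[OF om]] and \<rho>'m = lin_mem[OF \<rho>' omegaD(2)[OF om]]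
  note Q' = atrans_algebra[OF Q j] and h = atrans_hom[OF Q j] atrans_inv_hom[OF Q j]
  note vQ' = alg_vspace[OF Q'] and hl = alg_hom_lin[OF h(1)] alg_hom_lin[OF h(2)]
  have inv: "?i (j x) = x" if "x \<in> vcar Q" for x using j that by (simp add: embeds_def)
  let ?\<rho> = "\<lambda>a. tmap A Q A ?Q id j (\<rho>' a)"
  have "comeasuring ?Q A ?\<rho>" by (rule comeasuring_hom[OF om me Q' h(1)])
  moreover have "cosupp_comeas ?Q A ?\<rho> \<subseteq> V"
  proof
    fix v assume "v \<in> cosupp_comeas ?Q A ?\<rho>"
    then obtain f where f: "lf ?Q f" "v = (\<lambda>a. contract A ?Q f (?\<rho> a))" by (auto simp: cosupp_comeas_def simp del: atrans_cong)
    have "v = (\<lambda>a. contract A Q (\<lambda>x. f (j x)) (\<rho>' a))"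
      unfolding f(2) using contract_tmap[OF vA vQ vA vQ' lin_id' hl(1) f(1) \<rho>'m] by simp
    then show "v \<in> V" using co lin_comp[OF f(1) hl(1)] by (auto simp: cosupp_comeas_def)
  qed
  ultimately have "ex_unique_on (vcar B) (\<lambda>\<phi>. alg_hom B ?Q \<phi> \<and> (\<forall>a. tmap A B A ?Q id \<phi> (\<rho> a) = ?\<rho> a))"
    using U unfolding universal_coacting_bialgebra_def by blast
  then obtain g where g: "alg_hom B ?Q g" "\<forall>a. tmap A B A ?Q id g (\<rho> a) = ?\<rho> a"
    and u: "\<And>g'. alg_hom B ?Q g' \<Longrightarrow> \<forall>a. tmap A B A ?Q id g' (\<rho> a) = ?\<rho> a \<Longrightarrow> \<forall>x\<in>vcar B. g' x = g x"
    unfolding ex_unique_on_def by blast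
  note gl = alg_hom_lin[OF g(1)]
  show ?thesis unfolding ex_unique_on_def
  proof (intro exI[of _ "\<lambda>x. ?i (g x)"] conjI allI impI ballI)
    show "alg_hom B Q (\<lambda>x. ?i (g x))" by (rule alg_hom_comp[OF g(1) h(2)])
    show "tmap A B A Q id (\<lambda>x. ?i (g x)) (\<rho> a) = \<rho>' a" for a
    proof -
      have "tmap A B A Q id (\<lambda>x. ?i (g x)) (\<rho> a) = tmap A ?Q A Q id ?i (tmap A B A ?Q id g (\<rho> a))"
        using tmap_tmap[OF vA vB lin_id' gl vA vQ' lin_id' hl(2) vA vQ \<rho>m] by (simp add: id_def)
      also have "\<dots> = tmap A ?Q A Q id ?i (tmap A Q A ?Q id j (\<rho>' a))" using g(2) by simp
      also have "\<dots> = \<rho>' a"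
        by (rule tmap_tmap_id[OF vA vQ lin_id' hl(1) vA vQ' lin_id' hl(2) _ inv \<rho>'m]) simp_all
      finally show ?thesis .
    qed
    fix g' x assume g': "alg_hom B Q g' \<and> (\<forall>a. tmap A B A Q id g' (\<rho> a) = \<rho>' a)" and x: "x \<in> vcar B"
    then have g'l: "lin_map B Q g'" by (simp add: alg_hom_def)
    have "tmap A B A ?Q id (\<lambda>x. j (g' x)) (\<rho> a) = ?\<rho> a" for a
      using tmap_tmap[OF vA vB lin_id' g'l vA vQ lin_id' hl(1) vA vQ' \<rho>m, of a] g' by (simp add: id_def)
    moreover have "alg_hom B ?Q (\<lambda>x. j (g' x))" using g' alg_hom_comp[OF _ h(1)] by blast
    ultimately have "\<forall>x\<in>vcar B. j (g' x) = g x" by (intro u) auto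
    then show "g' x = ?i (g x)" using x inv[OF lin_mem[OF g'l x]] by metis
  qed
qed

section \<open>Vector spaces that embed into the universe\<close>

text \<open>Functions on lists are a common target: they contain the functions on \<open>'u\<close>
  and on pairs, which covers finite duals, their tensor squares and matrix algebras with indices in
  \<open>'u\<close>. \<open>large_universe\<close> embeds them into \<open>'t\<close>.\<close>

definition small :: "'u itself \<Rightarrow> ('k::field, 'x::ab_group_add, 'z) vsp_scheme \<Rightarrow> bool" where
  "small (_ :: 'u itself) V \<longleftrightarrow> (\<exists>e :: 'x \<Rightarrow> ('u list \<Rightarrow> 'k).
     lin_map V \<lparr>vcar = UNIV, vscale = fscale\<rparr> e \<and> inj_on e (vcar V))"

lemma small_embeds:
  fixes V :: "('k::field, 'x::ab_group_add, 'z) vsp_scheme"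
  assumes "large_universe TYPE('k) TYPE('u::ab_group_add) TYPE('t::ab_group_add)" and V: "small TYPE('u) V"
  obtains s and j :: "'x \<Rightarrow> 't::ab_group_add" where "embeds V s j"
proof -
  obtain s and j :: "('u list \<Rightarrow> 'k) \<Rightarrow> 't" where j: "Vector_Spaces.linear fscale s j" "inj j"
    using assms(1) unfolding large_universe_def by blast
  obtain e :: "'x \<Rightarrow> ('u list \<Rightarrow> 'k)" where e: "lin_map V \<lparr>vcar = UNIV, vscale = fscale\<rparr> e" "inj_on e (vcar V)"
    using V unfolding small_def by blast
  interpret j: Vector_Spaces.linear fscale s j by (rule j)
  have "lin_map \<lparr>vcar = UNIV, vscale = fscale\<rparr> \<lparr>vcar = UNIV, vscale = s\<rparr> j"
    by (rule lin_mapI) (auto simp: j.add j.scale)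
  then have "embeds V s (\<lambda>x. j (e x))"
    unfolding embeds_def using lin_comp[OF _ e(1)] e(2) j(2) j.vs2.vector_space_axioms
    by (auto simp: inj_on_def)
  then show thesis by (rule that)
qed

text \<open>Precomposition with a surjection is injective.\<close>

lemma small_functions:
  assumes V: "vscale (V :: ('k::field, 'x \<Rightarrow> 'k, 'z) vsp_scheme) = fscale" and g: "surj (g :: 'u list \<Rightarrow> 'x)"
  shows "small TYPE('u) V"
  unfolding small_def
proof (intro exI[of _ "\<lambda>f l. f (g l)"] conjI)
  show "lin_map V \<lparr>vcar = UNIV, vscale = fscale\<rparr> (\<lambda>f l. f (g l))"
    by (rule lin_mapI) (auto simp: V fscale_def)
  show "inj_on (\<lambda>f l. f (g l)) (vcar V)"
  proof (rule inj_onI, rule ext)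
    fix f f' x assume eq: "(\<lambda>l. f (g l)) = (\<lambda>l. f' (g l))"
    obtain l where "x = g l" using g by (metis surjD)
    then show "f x = f' x" using fun_cong[OF eq, of l] by simp
  qed
qed

lemma surj_hd: "surj (hd :: 'u list \<Rightarrow> 'u)"
  by (rule surjI[of _ "\<lambda>x. [x]"]) simp

lemma surj_hd2: "surj (\<lambda>l :: 'u list. (hd l, hd (tl l)))"
  by (rule surjI[of _ "\<lambda>p. [fst p, snd p]"]) simp

text \<open>Coordinates with respect to a basis of the whole type embed the space into the functions
  on that type.\<close>

lemma small_self:
  assumes V: "vspace (V :: ('k::field, 'u::ab_group_add, 'z) vsp_scheme)"
  shows "small TYPE('u) V"
proof -
  interpret vector_space "vscale V" using V by (rule vspace_vector_space)
  obtain B where B: "independent B" "span B = UNIV"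
    using independent_extend_basis[OF independent_empty] span_extend_basis[OF independent_empty] by blast
  have x: "x = (\<Sum>b | representation B x b \<noteq> 0. vscale V (representation B x b) b)" for x
    using sum_nonzero_representation_eq[OF B(1), of x] B(2) by simp
  have inj: "x = y" if "representation B x = representation B y" for x y
    using x[of x] x[of y] that by simp
  show ?thesis
    unfolding small_def
  proof (intro exI[of _ "\<lambda>x l. representation B x (hd l)"] conjI)
    show "lin_map V \<lparr>vcar = UNIV, vscale = fscale\<rparr> (\<lambda>x l. representation B x (hd l))"
      by (rule lin_mapI) (auto simp: representation_add[OF B(1)] representation_scale[OF B(1)] B(2) fscale_def)
    show "inj_on (\<lambda>x l. representation B x (hd l)) (vcar V)"
    proof (rule inj_onI, rule inj, rule ext)
      fix x y b assume "(\<lambda>l. representation B x (hd l)) = (\<lambda>l. representation B y (hd l))"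
      from fun_cong[OF this, of "[b]"] show "representation B x b = representation B y b" by simp
    qed
  qed
qed

lemma small_ground: "small TYPE('u) (ground :: ('k::field, 'k) alg)"
  unfolding small_def
proof (intro exI[of _ "\<lambda>c l. c"] conjI)
  show "lin_map (ground :: ('k, 'k) alg) \<lparr>vcar = UNIV, vscale = fscale\<rparr> (\<lambda>c l. c)"
    by (rule lin_mapI) (auto simp: fscale_def)
qed (auto simp: inj_on_def dest: fun_cong)

lemma small_finite_dual: "small TYPE('u) (finite_dual (H :: ('k::field, 'u::ab_group_add) bialg))"
  by (rule small_functions[OF _ surj_hd]) simp

text \<open>A tensor of functionals is determined by its values at pairs of points, encoded by the
  first two entries of a list.\<close>

lemma small_finite_dual_tensor:
  assumes H: "algebra (H :: ('k::field, 'u::ab_group_add) bialg)"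
  shows "small TYPE('u) (tensor_space (finite_dual H) (finite_dual H))"
  unfolding small_def
proof (intro exI[of _ "\<lambda>X l. X (\<lambda>f g. f (hd l) * g (hd (tl l)))"] conjI)
  show "lin_map (tensor_space (finite_dual H) (finite_dual H)) \<lparr>vcar = UNIV, vscale = fscale\<rparr> (\<lambda>X l. X (\<lambda>f g. f (hd l) * g (hd (tl l))))"
    by (rule lin_mapI) (auto simp: fscale_def)
  show "inj_on (\<lambda>X l. X (\<lambda>f g. f (hd l) * g (hd (tl l)))) (vcar (tensor_space (finite_dual H) (finite_dual H)))"
  proof (rule inj_onI)
    fix X Y assume X: "X \<in> vcar (tensor_space (finite_dual H) (finite_dual H))" and Y: "Y \<in> vcar (tensor_space (finite_dual H) (finite_dual H))"
      and eq: "(\<lambda>l::'u list. X (\<lambda>f g. f (hd l) * g (hd (tl l)))) = (\<lambda>l. Y (\<lambda>f g. f (hd l) * g (hd (tl l))))"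
    show "X = Y"
    proof (rule tensor_eqI[OF finite_dual_vspace'[OF H] finite_dual_vspace'[OF H] separates_evals separates_evals X Y])
      fix f g assume "f \<in> evals H" "g \<in> evals H"
      then obtain x y where "f = (\<lambda>f. f x)" "g = (\<lambda>f. f y)" by blast
      then show "X (\<lambda>v w. f v * g w) = Y (\<lambda>v w. f v * g w)" using fun_cong[OF eq, of "[x, y]"] by simp
    qed
  qed
qed

section \<open>The Hopf envelope is an epimorphism of algebras\<close>

text \<open>Each structural identity for \<open>f\<close> may be checked after applying
  \<open>j\<close> or its tensor square, both of which are injective.\<close>

lemma bialg_hom_factor_inj:
  assumes B: "bialgebra B" and B': "bialgebra B'" and D: "bialgebra D" and j: "bialg_hom B' D j" "inj_on j (vcar B')"
    and f: "\<And>x. x \<in> vcar B \<Longrightarrow> f x \<in> vcar B'" and jf: "bialg_hom B D (\<lambda>x. j (f x))"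
  shows "bialg_hom B B' f"
proof -
  note vB = bi_vspace[OF B] and vB' = bi_vspace[OF B'] and vD = bi_vspace[OF D]
  have jh: "alg_hom B' D j" and jc: "coalg_hom (coalg_of B') (coalg_of D) j" using j(1) by (auto simp: bialg_hom_def)
  have fh: "alg_hom B D (\<lambda>x. j (f x))" and fc: "coalg_hom (coalg_of B) (coalg_of D) (\<lambda>x. j (f x))"
    using jf by (auto simp: bialg_hom_def)
  note I = inj_onD[OF j(2)] and jl = alg_hom_lin[OF jh] and jfl = alg_hom_lin[OF fh]
  have fl: "lin_map B B' f"
    by (rule lin_mapI; (rule I)?)
      (auto simp: f vs_add[OF vB'] vs_scale[OF vB'] vs_add[OF vB] vs_scale[OF vB] lin_add[OF jl] lin_scale[OF jl] lin_add[OF jfl] lin_scale[OF jfl])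
  have 1: "alg_hom B B' f"
    unfolding alg_hom_def using fl
    by (auto intro!: I simp: f alg_one[OF bi_alg[OF B]] alg_one[OF bi_alg[OF B']] alg_mult[OF bi_alg[OF B]] alg_mult[OF bi_alg[OF B']]
        alg_hom_one[OF jh] alg_hom_one[OF fh] alg_hom_mult[OF jh] alg_hom_mult[OF fh])
  have "bdelta B' (f x) = tmap B B B' B' f f (bdelta B x)" if x: "x \<in> vcar B" for x
  proof (rule inj_onD[OF tmap_inj[OF vB' vB' vD vD jl jl j(2) j(2)]])
    note Dx = lin_mem[OF bi_delta[OF B] x]
    show "bdelta B' (f x) \<in> vcar (tensor_space B' B')" by (rule lin_mem[OF bi_delta[OF B'] f[OF x]])
    show "tmap B B B' B' f f (bdelta B x) \<in> vcar (tensor_space B' B')" by (rule tmap_mem[OF vB vB fl fl Dx])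
    show "tmap B' B' D D j j (bdelta B' (f x)) = tmap B' B' D D j j (tmap B B B' B' f f (bdelta B x))"
    proof -
      have "bdelta D (j (f x)) = tmap B' B' D D j j (bdelta B' (f x))" using jc f[OF x] by (simp add: coalg_hom_def)
      moreover have "bdelta D (j (f x)) = tmap B B D D (\<lambda>x. j (f x)) (\<lambda>x. j (f x)) (bdelta B x)" using fc x by (simp add: coalg_hom_def)
      ultimately show ?thesis by (simp add: tmap_tmap[OF vB vB fl fl vB' vB' jl jl vD vD Dx])
    qed
  qed
  moreover have "beps B' (f x) = beps B x" if x: "x \<in> vcar B" for x
    using coalg_hom_eps[OF jc, of "f x"] coalg_hom_eps[OF fc, of x] x f[OF x] by simp
  ultimately show ?thesis using 1 fl by (simp add: bialg_hom_def coalg_hom_def)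
qed

text \<open>The span of the pure tensors from \<open>X\<close> inside V \<otimes> V. All bilinear
  forms on \<open>V\<close> remain available, and neither type nor forms change when the subset
  \<open>X\<close> varies.\<close>

definition tensors :: "('k::field, 'u::ab_group_add, 'z) vsp_scheme \<Rightarrow> 'u set \<Rightarrow> ('u, 'u, 'k) tensor set" where
  "tensors V X = module.span fscale {tens V V u v | u v. u \<in> X \<and> v \<in> X}"

lemma tensors_carrier: "tensors V (vcar V) = vcar (tensor_space V V)"
  by (simp add: tensors_def tensor_space_def)

lemma tensors_intros:
  "u \<in> X \<Longrightarrow> v \<in> X \<Longrightarrow> tens V V u v \<in> tensors V X"
  "0 \<in> tensors V X"
  "Y \<in> tensors V X \<Longrightarrow> Z \<in> tensors V X \<Longrightarrow> Y + Z \<in> tensors V X"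
  "Z \<in> tensors V X \<Longrightarrow> fscale c Z \<in> tensors V X"
proof -
  show "tens V V u v \<in> tensors V X" if "u \<in> X" "v \<in> X"
    unfolding tensors_def by (rule fsc.span_base) (use that in blast)
  show "0 \<in> tensors V X" unfolding tensors_def by (rule fsc.span_zero)
  show "Y + Z \<in> tensors V X" if "Y \<in> tensors V X" "Z \<in> tensors V X"
    using that unfolding tensors_def by (rule fsc.span_add)
  show "fscale c Z \<in> tensors V X" if "Z \<in> tensors V X"
    using that unfolding tensors_def by (rule fsc.span_scale)
qed

lemma tensors_induct [consumes 1, case_names zero add]:
  assumes "Z \<in> tensors V X" "P 0"
    "\<And>c u v Y. u \<in> X \<Longrightarrow> v \<in> X \<Longrightarrow> Y \<in> tensors V X \<Longrightarrow> P Y \<Longrightarrow> P (fscale c (tens V V u v) + Y)"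
  shows "P Z"
proof -
  have "Z \<in> tensors V X \<and> P Z"
    using assms(1) unfolding tensors_def
  proof (rule fsc.span_induct_alt, unfold tensors_def[symmetric])
    show "0 \<in> tensors V X \<and> P 0" using assms(2) tensors_intros by blast
    fix c t Y assume "t \<in> {tens V V u v |u v. u \<in> X \<and> v \<in> X}" and Y: "Y \<in> tensors V X \<and> P Y"
    then obtain u v where t: "t = tens V V u v" "u \<in> X" "v \<in> X" by blast
    show "fscale c t + Y \<in> tensors V X \<and> P (fscale c t + Y)"
      unfolding t(1) by (intro conjI tensors_intros assms(3) t conjunct1[OF Y] conjunct2[OF Y])
  qed
  then show ?thesis ..
qed

lemma tensors_mono: "X \<subseteq> Y \<Longrightarrow> tensors V X \<subseteq> tensors V Y"
  unfolding tensors_def by (rule fsc.span_mono) blast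

lemma tensors_sub: "X \<subseteq> vcar V \<Longrightarrow> Z \<in> tensors V X \<Longrightarrow> Z \<in> vcar (tensor_space V V)"
  using tensors_mono[of X "vcar V" V] by (auto simp: tensors_carrier)

lemma tensors_apply_cong:
  assumes "Z \<in> tensors H X" and \<beta>: "bf H H \<beta>" "bf H H \<beta>'" and "\<And>u v. u \<in> X \<Longrightarrow> v \<in> X \<Longrightarrow> \<beta> u v = \<beta>' u v"
  shows "Z \<beta> = Z \<beta>'"
  using assms(1)
  by (rule tensors_induct) (auto simp: tens_apply[OF \<beta>(1)] tens_apply[OF \<beta>(2)] assms(4))

lemma tensors_lin:
  assumes f: "lin_map (tensor_space V V) (tensor_space W W) f" and X: "X \<subseteq> vcar V"
    and g: "\<And>u v. u \<in> X \<Longrightarrow> v \<in> X \<Longrightarrow> f (tens V V u v) \<in> tensors W Y" and Z: "Z \<in> tensors V X"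
  shows "f Z \<in> tensors W Y"
  using Z
proof (rule tensors_induct)
  show "f 0 \<in> tensors W Y" unfolding lin_zero[OF f vspace_tensor] by (rule tensors_intros)
  fix c u v Z assume u: "u \<in> X" "v \<in> X" and Z: "Z \<in> tensors V X" "f Z \<in> tensors W Y"
  have t: "tens V V u v \<in> vcar (tensor_space V V)" using u X by (intro tens_mem) auto
  have ct: "fscale c (tens V V u v) \<in> vcar (tensor_space V V)" using vs_scale[OF vspace_tensor t] by simp
  show "f (fscale c (tens V V u v) + Z) \<in> tensors W Y"
    unfolding lin_add[OF f ct tensors_sub[OF X Z(1)]] lin_scale[OF f t, unfolded tensor_space_simps]
    by (intro tensors_intros g u Z)
qed

text \<open>
  Composed with the antipode, both algebra maps become convolution inverses of their common
  restriction to the subcoalgebra.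
\<close>

lemma alg_homs_agree_antipode:
  assumes H: "bialgebra H" and S: "is_antipode H S" and R: "algebra R" and p: "alg_hom H R p" and q: "alg_hom H R q"
    and X: "X \<subseteq> vcar H" "\<And>x. x \<in> X \<Longrightarrow> bdelta H x \<in> tensors H X" and eq: "\<And>x. x \<in> X \<Longrightarrow> p x = q x" and x: "x \<in> X"
  shows "p (S x) = q (S x)"
proof -
  note vs = bi_vspace[OF H] and Sl = antipode_lin[OF H S] and Sm = antipode_mem[OF H S]
  note pl = alg_hom_lin[OF p] and ql = alg_hom_lin[OF q] and m = alg_bilin[OF R] and mm = alg_mult[OF R]
  note pm = lin_mem[OF pl] and qm = lin_mem[OF ql]
  note Dm = lin_mem[OF bi_delta[OF H]]
  have xH: "x \<in> vcar H" using x X(1) by auto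
  note lins = lin_comp[OF pl Sl] lin_comp[OF ql Sl] pl ql
  show ?thesis
  proof (rule functional_sep[OF alg_vspace[OF R] pm[OF Sm[OF xH]] qm[OF Sm[OF xH]]])
    fix \<phi> assume \<phi>: "lf R \<phi>"
    have tri: "trilin H H H (\<lambda>a b c. \<phi> (amult R (amult R (p (S a)) (r b)) (q (S c))))" if "lin_map H R r" for r
      by (rule trilinI; rule lin_comp[OF \<phi>])
        (auto intro!: lin_bilin_left[OF m] lin_bilin_right[OF m] lins that mm pm qm Sm lin_mem[OF that])
    have b: "bf H H (\<lambda>a b. bdelta H a (\<lambda>u v. \<phi> (amult R (amult R (p (S u)) (r v)) (q (S b)))))" if "lin_map H R r" for r
    proof (rule bilin_mapI)
      show "lf H (\<lambda>a. bdelta H a (\<lambda>u v. \<phi> (amult R (amult R (p (S u)) (r v)) (q (S b)))))" for b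
        by (rule lf_tensor_apply[OF bi_delta[OF H]])
      fix a assume a: "a \<in> vcar H"
      show "lf H (\<lambda>b. bdelta H a (\<lambda>u v. \<phi> (amult R (amult R (p (S u)) (r v)) (q (S b)))))"
        by (rule lf_tensor_param[OF Dm[OF a] vs vs vs trilin_bf3[OF tri[OF that]] trilin_lf3[OF tri[OF that]]])
    qed
    have l1: "lf H (\<lambda>z. \<phi> (amult R (r (z)) y))" if "lin_map H R r" "y \<in> vcar R" for r y
      by (rule lin_comp[OF \<phi> lin_bilin_left[OF m that]])
    have "\<phi> (p (S x)) = bdelta H x (\<lambda>a b. \<phi> (p (S a)) * beps H b)"
      by (rule bi_counit_right[OF H xH lin_comp[OF \<phi> lins(1)], symmetric])
    also have "\<dots> = bdelta H x (\<lambda>a b. bdelta H b (\<lambda>u v. \<phi> (amult R (amult R (p (S a)) (q u)) (q (S v)))))"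
    proof (rule tensor_apply_cong[OF Dm[OF xH] vs vs])
      fix a b assume a: "a \<in> vcar H" and b: "b \<in> vcar H"
      have "lf H (\<lambda>z. \<phi> (amult R (p (S a)) (q z)))"
        by (rule lin_comp[OF \<phi> lin_bilin_right[OF m ql pm[OF Sm[OF a]]]])
      from antipode_right[OF H S b this]
      have "bdelta H b (\<lambda>u v. \<phi> (amult R (p (S a)) (q (amult H u (S v))))) = \<phi> (p (S a)) * beps H b"
        by (simp add: alg_hom_one[OF q] alg_one_right[OF R] pm Sm a mult.commute)
      moreover have "bdelta H b (\<lambda>u v. \<phi> (amult R (p (S a)) (q (amult H u (S v)))))
        = bdelta H b (\<lambda>u v. \<phi> (amult R (amult R (p (S a)) (q u)) (q (S v))))"
        by (rule tensor_apply_cong[OF Dm[OF b] vs vs]) (simp add: alg_hom_mult[OF q] alg_assoc[OF R] pm qm Sm a)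
      ultimately show "\<phi> (p (S a)) * beps H b = bdelta H b (\<lambda>u v. \<phi> (amult R (amult R (p (S a)) (q u)) (q (S v))))" by simp
    qed
    also have "\<dots> = bdelta H x (\<lambda>a b. bdelta H a (\<lambda>u v. \<phi> (amult R (amult R (p (S u)) (q v)) (q (S b)))))"
      by (rule bi_coassoc[OF H xH tri[OF ql], symmetric])
    \<comment> \<open>The agreement on \<open>X\<close> enters here: \<open>x\<close> lies in
      \<open>X\<close>, so both coproducts stay in the span of tensors from \<open>X\<close>, where
      \<open>q v\<close> may be replaced by \<open>p v\<close>.\<close>
    also have "\<dots> = bdelta H x (\<lambda>a b. bdelta H a (\<lambda>u v. \<phi> (amult R (amult R (p (S u)) (p v)) (q (S b)))))"
    proof (rule tensors_apply_cong[OF X(2)[OF x] b[OF ql] b[OF pl]])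
      fix a b assume a: "a \<in> X" and b: "b \<in> X"
      then have bH: "b \<in> vcar H" using X(1) by auto
      show "bdelta H a (\<lambda>u v. \<phi> (amult R (amult R (p (S u)) (q v)) (q (S b)))) = bdelta H a (\<lambda>u v. \<phi> (amult R (amult R (p (S u)) (p v)) (q (S b))))"
        by (rule tensors_apply_cong[OF X(2)[OF a] trilin_bf3[OF tri[OF ql] bH] trilin_bf3[OF tri[OF pl] bH]]) (simp add: eq)
    qed
    also have "\<dots> = bdelta H x (\<lambda>a b. beps H a * \<phi> (q (S b)))"
    proof (rule tensor_apply_cong[OF Dm[OF xH] vs vs])
      fix a b assume a: "a \<in> vcar H" and b: "b \<in> vcar H"
      from antipode_left[OF H S a l1[OF pl qm[OF Sm[OF b]]]]
      have "bdelta H a (\<lambda>u v. \<phi> (amult R (p (amult H (S u) v)) (q (S b)))) = beps H a * \<phi> (q (S b))"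
        by (simp add: alg_hom_one[OF p] alg_one_left[OF R] qm Sm b)
      moreover have "bdelta H a (\<lambda>u v. \<phi> (amult R (p (amult H (S u) v)) (q (S b))))
        = bdelta H a (\<lambda>u v. \<phi> (amult R (amult R (p (S u)) (p v)) (q (S b))))"
        by (rule tensor_apply_cong[OF Dm[OF a] vs vs]) (simp add: alg_hom_mult[OF p] Sm)
      ultimately show "bdelta H a (\<lambda>u v. \<phi> (amult R (amult R (p (S u)) (p v)) (q (S b)))) = beps H a * \<phi> (q (S b))" by simp
    qed
    also have "\<dots> = \<phi> (q (S x))" by (rule bi_counit_left[OF H xH lin_comp[OF \<phi> lins(2)]])
    finally show "\<phi> (p (S x)) = \<phi> (q (S x))" .
  qed
qed

lemma antipode_one:
  assumes H: "bialgebra H" and S: "is_antipode H S"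
  shows "S (aone H) = aone H"
proof (rule functional_sep[OF bi_vspace[OF H]])
  note one = alg_one[OF bi_alg[OF H]]
  show "S (aone H) \<in> vcar H" "aone H \<in> vcar H" using one antipode_mem[OF H S] by auto
  fix f assume f: "lf H f"
  show "f (S (aone H)) = f (aone H)"
    using antipode_left[OF H S one f] lf_bilin[OF antipode_bilin(1)[OF H antipode_lin[OF H S]] f]
    by (simp add: bi_delta_one[OF H] tens_apply bi_eps_one[OF H] alg_one_right[OF bi_alg[OF H]] antipode_mem[OF H S] one)
qed

inductive_set generated :: "('k::field, 'u::ab_group_add) bialg \<Rightarrow> 'u set \<Rightarrow> 'u set" for H X where
  gen: "x \<in> X \<Longrightarrow> x \<in> generated H X"
| one: "aone H \<in> generated H X"
| mult: "x \<in> generated H X \<Longrightarrow> y \<in> generated H X \<Longrightarrow> amult H x y \<in> generated H X"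
| add: "x \<in> generated H X \<Longrightarrow> y \<in> generated H X \<Longrightarrow> x + y \<in> generated H X"
| scale: "x \<in> generated H X \<Longrightarrow> vscale H c x \<in> generated H X"

text \<open>The generated subalgebra is a Hopf subalgebra through which \<eta> factors. Universality
  gives a map from \<open>H\<close> into it, and its composite with the inclusion is the identity by
  uniqueness, so the subalgebra is all of \<open>H\<close>.\<close>

lemma hopf_envelope_generated:
  assumes large: "large_universe TYPE('k::field) TYPE('u::ab_group_add) TYPE('t::ab_group_add)"
    and U: "hopf_left_adjoint TYPE('t) (B :: ('k, 'u) bialg) (H :: ('k, 'u) bialg) \<eta>" and B: "bialgebra B"
    and S: "is_antipode H S" and X: "X \<subseteq> vcar H" "\<And>x. x \<in> X \<Longrightarrow> S x \<in> X" "\<And>x. x \<in> X \<Longrightarrow> bdelta H x \<in> tensors H X"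
    and \<eta>X: "\<And>b. b \<in> vcar B \<Longrightarrow> \<eta> b \<in> X"
  shows "vcar H \<subseteq> generated H X"
proof
  have hH: "hopf_algebra H" and H: "bialgebra H" and \<eta>: "bialg_hom B H \<eta>"
    using U by (auto simp: hopf_left_adjoint_def hopf_algebra_def)
  note vs = bi_vspace[OF H] and A = bi_alg[OF H]
  let ?E = "generated H X"
  have EH: "x \<in> vcar H" if "x \<in> ?E" for x using that
    by induction (use X(1) in \<open>auto intro: alg_one[OF A] alg_mult[OF A] vs_add[OF vs] vs_scale[OF vs]\<close>)
  have SE: "S x \<in> ?E" if "x \<in> ?E" for x using that
    by induction (auto simp: X(2) antipode_one[OF H S] antipode_antimult[OF H S] EH lin_add[OF antipode_lin[OF H S]]
        lin_scale[OF antipode_lin[OF H S]] intro: generated.intros)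
  define EV where "EV = \<lparr>vcar = ?E, vscale = vscale H\<rparr>"
  have EV [simp]: "vcar EV = ?E" "vscale EV = vscale H" by (simp_all add: EV_def)
  have "0 \<in> ?E" using generated.scale[OF generated.one[of H X], of 0] vs_scale_zero[OF vs] by simp
  then have vE: "vspace EV"
    by (intro vspaceI) (auto intro: generated.intros vspace_vector_space[OF vs])
  have inc: "lin_map EV H (\<lambda>x. x)" and inci: "inj_on (\<lambda>x. x) (vcar EV)" by (auto intro!: lin_mapI EH)
  let ?t = "tmap EV EV H H (\<lambda>x. x) (\<lambda>x. x)"
  note tl = tmap_lin[OF vE vE inc inc]
  have img: "\<exists>Y. Y \<in> vcar (tensor_space EV EV) \<and> ?t Y = Z" if "Z \<in> tensors H ?E" for Z using that
  proof (rule tensors_induct)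
    show "\<exists>Y. Y \<in> vcar (tensor_space EV EV) \<and> ?t Y = 0"
      using lin_zero[OF tl vspace_tensor] vs_zero[OF vspace_tensor] by blast
    fix c u v y assume uv: "u \<in> ?E" "v \<in> ?E" and "\<exists>Y. Y \<in> vcar (tensor_space EV EV) \<and> ?t Y = y"
    then obtain Y where Y: "Y \<in> vcar (tensor_space EV EV)" "?t Y = y" by blast
    have m: "tens EV EV u v \<in> vcar (tensor_space EV EV)" using uv by (intro tens_mem) auto
    have m': "fscale c (tens EV EV u v) \<in> vcar (tensor_space EV EV)" using vs_scale[OF vspace_tensor m] by simp
    have "?t (fscale c (tens EV EV u v) + Y) = fscale c (tens H H u v) + y"
      using uv Y lin_scale[OF tl m, of c] by (simp add: lin_add[OF tl m' Y(1)] tmap_tens[OF vE vE inc inc])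
    then show "\<exists>Y. Y \<in> vcar (tensor_space EV EV) \<and> ?t Y = fscale c (tens H H u v) + y"
      using vs_add[OF vspace_tensor m' Y(1)] by blast
  qed
  \<comment> \<open>Since the comultiplication is multiplicative, it maps the generated subalgebra
    into the span of its tensors as soon as that span is closed under products.\<close>
  have tmul: "amult (tensor_alg H H) Y Z \<in> tensors H ?E" if Y: "Y \<in> tensors H ?E" and Z: "Z \<in> tensors H ?E" for Y Z
  proof -
    note T = tensor_algebra[OF A A] and ap = tensor_alg_apply[OF alg_bilin[OF A] alg_bilin[OF A] vs vs]
    have Es: "?E \<subseteq> vcar H" using EH by auto
    note TH = tensors_sub[OF Es]
    note ml = bilin_left[OF alg_bilin[OF T], simplified] and mr = bilin_right[OF alg_bilin[OF T], simplified]
    have tt: "amult (tensor_alg H H) (tens H H u v) (tens H H u' v') = tens H H (amult H u u') (amult H v v')"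
      if "u \<in> ?E" "v \<in> ?E" "u' \<in> ?E" "v' \<in> ?E" for u v u' v'
    proof (rule tensor_ext[OF _ _ vs vs])
      have uv: "u \<in> vcar H" "v \<in> vcar H" "u' \<in> vcar H" "v' \<in> vcar H" using that EH by auto
      note t = tens_mem[OF uv(1,2)] tens_mem[OF uv(3,4)]
      show "amult (tensor_alg H H) (tens H H u v) (tens H H u' v') \<in> vcar (tensor_space H H)"
        by (rule tensor_alg_mem[OF alg_bilin[OF A] alg_bilin[OF A] vs vs t])
      show "tens H H (amult H u u') (amult H v v') \<in> vcar (tensor_space H H)" by (intro tens_mem alg_mult[OF A] uv)
      fix \<beta> assume \<beta>: "bf H H \<beta>"
      note r = bilin_right[OF alg_bilin[OF A]] and l = bilin_left[OF alg_bilin[OF A]]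
      have b1: "bf H H (\<lambda>c d. \<beta> (amult H a c) (amult H b d))" if "a \<in> vcar H" "b \<in> vcar H" for a b
        by (rule bf_map[OF \<beta> r[OF that(1)] r[OF that(2)]])
      have "amult (tensor_alg H H) (tens H H u v) (tens H H u' v') \<beta>
        = tens H H u v (\<lambda>a b. tens H H u' v' (\<lambda>c d. \<beta> (amult H a c) (amult H b d)))" by (rule ap[OF t \<beta>])
      also have "\<dots> = tens H H u v (\<lambda>a b. \<beta> (amult H a u') (amult H b v'))"
        by (rule tensor_apply_cong[OF t(1) vs vs]) (simp add: tens_apply[OF b1])
      also have "\<dots> = tens H H (amult H u u') (amult H v v') \<beta>"
        by (simp add: tens_apply[OF bf_map[OF \<beta> l[OF uv(3)] l[OF uv(4)]]] tens_apply[OF \<beta>])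
      finally show "amult (tensor_alg H H) (tens H H u v) (tens H H u' v') \<beta> = tens H H (amult H u u') (amult H v v') \<beta>" .
    qed
    have "amult (tensor_alg H H) (tens H H u v) Z \<in> tensors H ?E" if uv: "u \<in> ?E" "v \<in> ?E" for u v
    proof (rule tensors_lin[OF mr Es _ Z])
      show "tens H H u v \<in> vcar (tensor_space H H)" using uv EH by (intro tens_mem) auto
    qed (simp add: tt[OF uv] tensors_intros generated.mult uv)
    then show ?thesis by (rule tensors_lin[OF ml[OF TH[OF Z]] Es _ Y])
  qed
  have DE: "bdelta H x \<in> tensors H ?E" if "x \<in> ?E" for x using that
  proof induction
    case (gen x)
    then show ?case using subsetD[OF tensors_mono X(3)] by (auto intro: generated.gen)
  next
    case one
    then show ?case unfolding bi_delta_one[OF H] by (intro tensors_intros generated.one)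
  next
    case (mult x y)
    then show ?case using tmul alg_hom_mult[OF bi_delta_hom[OF H] EH EH] by simp
  next
    case (add x y)
    then show ?case unfolding lin_add[OF bi_delta[OF H] EH[OF add(1)] EH[OF add(2)]] by (intro tensors_intros)
  next
    case (scale x c)
    then show ?case unfolding lin_scale[OF bi_delta[OF H] EH[OF scale(1)]] tensor_space_simps by (intro tensors_intros)
  qed
  \<comment> \<open>The coproduct so far lies in H \<otimes> H, but a bialgebra structure on the
    subalgebra needs a value in the tensor square formed on the subalgebra itself. \<open>dE\<close>
    selects the preimage, which is unique because the tensor square of the inclusion is
    injective.\<close>
  define dE where "dE x = (SOME Y. Y \<in> vcar (tensor_space EV EV) \<and> ?t Y = bdelta H x)" for x
  have dE: "dE x \<in> vcar (tensor_space EV EV)" "?t (dE x) = bdelta H x" if "x \<in> ?E" for x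
    using someI_ex[of "\<lambda>Y. Y \<in> vcar (tensor_space EV EV) \<and> ?t Y = bdelta H x"] img[OF DE[OF that]]
    unfolding dE_def by auto
  note ti = inj_onD[OF tmap_inj[OF vE vE vs vs inc inc inci inci]]
  have dEl: "lin_map EV (tensor_space EV EV) dE"
  proof (rule lin_mapI)
    fix x c assume "x \<in> vcar EV"
    then have x: "x \<in> ?E" by simp
    show "dE x \<in> vcar (tensor_space EV EV)" by (rule dE(1)[OF x])
    show "dE (vscale EV c x) = vscale (tensor_space EV EV) c (dE x)"
    proof (rule ti)
      show "dE (vscale EV c x) \<in> vcar (tensor_space EV EV)" using dE(1)[OF generated.scale[OF x]] by simp
      show "vscale (tensor_space EV EV) c (dE x) \<in> vcar (tensor_space EV EV)" by (rule vs_scale[OF vspace_tensor dE(1)[OF x]])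
      show "?t (dE (vscale EV c x)) = ?t (vscale (tensor_space EV EV) c (dE x))"
        unfolding lin_scale[OF tl dE(1)[OF x]] dE(2)[OF x] EV dE(2)[OF generated.scale[OF x]] by (rule lin_scale[OF bi_delta[OF H] EH[OF x]])
    qed
    fix y assume "y \<in> vcar EV"
    then have y: "y \<in> ?E" by simp
    show "dE (x + y) = dE x + dE y"
    proof (rule ti)
      show "dE (x + y) \<in> vcar (tensor_space EV EV)" by (rule dE(1)[OF generated.add[OF x y]])
      show "dE x + dE y \<in> vcar (tensor_space EV EV)" by (rule vs_add[OF vspace_tensor dE(1)[OF x] dE(1)[OF y]])
      show "?t (dE (x + y)) = ?t (dE x + dE y)"
        unfolding lin_add[OF tl dE(1)[OF x] dE(1)[OF y]] dE(2)[OF x] dE(2)[OF y] dE(2)[OF generated.add[OF x y]]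
        by (rule lin_add[OF bi_delta[OF H] EH[OF x] EH[OF y]])
    qed
  qed
  define EB where "EB = \<lparr>vcar = ?E, vscale = vscale H, amult = amult H, aone = aone H, bdelta = dE, beps = beps H\<rparr>"
  have EB: "vcar EB = ?E" "vscale EB = vscale H" "amult EB = amult H" "aone EB = aone H" "bdelta EB = dE" "beps EB = beps H"
    by (simp_all add: EB_def)
  note EBc = vsp_cong_left[of EB EV] vsp_cong_right[of EB EV]
  have c: "vspace EB = vspace EV" "lin_map EB H = lin_map EV H" "lin_map EB (tensor_space EB EB) = lin_map EV (tensor_space EV EV)"
    "tmap EB EB H H = tmap EV EV H H"
    by (simp_all add: EBc EB)
  have r: "bialgebra EB" "bialg_hom EB H (\<lambda>x. x)"
    by (rule bialgebra_reflect[OF H, where j = "\<lambda>x. x"]; simp add: c vE inc dEl EB dE generated.mult generated.one inj_on_def)+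
  have hE: "hopf_algebra EB"
    by (rule hopf_reflect[OF r(1) H S r(2), of S]) (auto simp: EB SE)
  have \<eta>E: "bialg_hom B EB \<eta>"
    by (rule bialg_hom_factor_inj[OF B r(1) H r(2)]) (use \<eta> \<eta>X in \<open>auto simp: EB intro: generated.gen\<close>)
  obtain s and j :: "'u \<Rightarrow> 't" where j: "embeds EB s j"
    using small_embeds[OF large small_self[OF bi_vspace[OF r(1)]]] by metis
  obtain s' and j' :: "'u \<Rightarrow> 't" where j': "embeds H s' j'"
    using small_embeds[OF large small_self[OF vs]] by metis
  obtain g where g: "hopf_hom H EB g" "\<forall>x\<in>vcar B. g (\<eta> x) = \<eta> x"
    using hopf_left_adjoint_embeds[OF U hE j \<eta>E B] by (auto simp: ex_unique_on_def)
  have "hopf_hom H H g"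
    using g(1) bialg_hom_comp[OF H r(1) H _ r(2), of g] hH by (simp add: hopf_hom_def)
  moreover have "hopf_hom H H (\<lambda>x. x)"
  proof -
    have "tmap H H H H (\<lambda>x. x) (\<lambda>x. x) Z = Z" if Z: "Z \<in> vcar (tensor_space H H)" for Z
      by (rule tensor_ext[OF tmap_mem[OF vs vs lin_id lin_id Z] Z vs vs]) (simp add: tmap_apply[OF vs vs lin_id lin_id _ Z])
    then show ?thesis using hH lin_mem[OF bi_delta[OF H]]
      by (auto simp: hopf_hom_def bialg_hom_def alg_hom_def coalg_hom_def)
  qed
  \<comment> \<open>Both \<open>g\<close> and the identity are Hopf endomorphisms that fix the
    values of \<eta>.\<close>
  ultimately have id: "g x = x" if "x \<in> vcar H" for x
    using hopf_left_adjoint_embeds[OF U hH j' \<eta> B] g(2) that unfolding ex_unique_on_def by metis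
  fix x assume x: "x \<in> vcar H"
  have "g x \<in> ?E" using g(1) lin_mem[of H EB g x] x by (simp add: hopf_hom_def bialg_hom_def alg_hom_def EB)
  then show "x \<in> ?E" by (simp add: id x)
qed

text \<open>As an algebra, \<open>H\<close> is generated by the images of \<open>B\<close> under
  \<eta> followed by powers of the antipode. Agreement of \<open>p\<close> and \<open>q\<close>
  propagates from each image to the next, because each one is closed under comultiplication.\<close>

lemma hopf_envelope_epi:
  assumes large: "large_universe TYPE('k::field) TYPE('u::ab_group_add) TYPE('t::ab_group_add)"
    and U: "hopf_left_adjoint TYPE('t) (B :: ('k, 'u) bialg) (H :: ('k, 'u) bialg) \<eta>" and B: "bialgebra B"
    and R: "algebra R" and p: "alg_hom H R p" and q: "alg_hom H R q" and eq: "\<And>b. b \<in> vcar B \<Longrightarrow> p (\<eta> b) = q (\<eta> b)"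
    and h: "h \<in> vcar H"
  shows "p h = q h"
proof -
  obtain S where H: "bialgebra H" and S: "is_antipode H S" and \<eta>: "bialg_hom B H \<eta>"
    using U by (auto simp: hopf_left_adjoint_def hopf_algebra_def)
  note vs = bi_vspace[OF H] and vB = bi_vspace[OF B] and Sl = antipode_lin[OF H S] and Sm = antipode_mem[OF H S]
  have \<eta>l: "lin_map B H \<eta>" and \<eta>D: "\<And>b. b \<in> vcar B \<Longrightarrow> bdelta H (\<eta> b) = tmap B B H H \<eta> \<eta> (bdelta B b)"
    using \<eta> by (auto simp: bialg_hom_def coalg_hom_def)
  define G where "G n = ((\<lambda>X. S ` X) ^^ n) (\<eta> ` vcar B)" for n
  have G: "G 0 = \<eta> ` vcar B" "G (Suc n) = S ` G n" for n by (simp_all add: G_def)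
  have GH: "G n \<subseteq> vcar H" for n by (induction n) (auto simp: G Sm lin_mem[OF \<eta>l] subset_iff)
  \<comment> \<open>The antipode reverses coproducts, so it maps one such image to another.\<close>
  have GD: "bdelta H x \<in> tensors H (G n)" if "x \<in> G n" for x n using that
  proof (induction n arbitrary: x)
    case 0
    then obtain b where b: "b \<in> vcar B" "x = \<eta> b" by (auto simp: G)
    note tl = tmap_lin[OF vB vB \<eta>l \<eta>l]
    have "tmap B B H H \<eta> \<eta> (bdelta B b) \<in> tensors H (G 0)"
    proof (rule tensors_lin[OF tl subset_refl])
      show "bdelta B b \<in> tensors B (vcar B)" unfolding tensors_carrier by (rule lin_mem[OF bi_delta[OF B] b(1)])
    qed (auto simp: tmap_tens[OF vB vB \<eta>l \<eta>l] G intro!: tensors_intros)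
    then show ?case using \<eta>D[OF b(1)] b(2) by simp
  next
    case (Suc n)
    then obtain y where y: "y \<in> G n" "x = S y" by (auto simp: G)
    then have yH: "y \<in> vcar H" using GH by auto
    let ?T = "tensor_space H H"
    have b: "bilin_map H H ?T (\<lambda>u v. tens H H (S v) (S u))"
      by (rule bilin_mapI) (auto intro!: lin_bilin_left[OF tens_bilin] lin_bilin_right[OF tens_bilin] Sl Sm)
    note tl = tlift_lin[OF vs vs vspace_tensor b]
    have "bdelta H x = tlift H H ?T (\<lambda>u v. tens H H (S v) (S u)) (bdelta H y)"
    proof (rule tensor_ext[OF _ lin_mem[OF tl lin_mem[OF bi_delta[OF H] yH]] vs vs])
      show "bdelta H x \<in> vcar ?T" unfolding y(2) by (rule lin_mem[OF bi_delta[OF H] Sm[OF yH]])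
      fix \<beta> assume \<beta>: "bf H H \<beta>"
      show "bdelta H x \<beta> = tlift H H ?T (\<lambda>u v. tens H H (S v) (S u)) (bdelta H y) \<beta>"
        by (simp add: y(2) antipode_anticomult[OF H S yH \<beta>] tlift_tensor_apply[OF vs vs b lin_mem[OF bi_delta[OF H] yH]] tens_apply[OF \<beta>])
    qed
    moreover have "tlift H H ?T (\<lambda>u v. tens H H (S v) (S u)) (bdelta H y) \<in> tensors H (G (Suc n))"
    proof (rule tensors_lin[OF tl GH _ Suc.IH[OF y(1)]])
      fix u v assume uv: "u \<in> G n" "v \<in> G n"
      then have "u \<in> vcar H" "v \<in> vcar H" using GH by auto
      then show "tlift H H ?T (\<lambda>u v. tens H H (S v) (S u)) (tens H H u v) \<in> tensors H (G (Suc n))"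
        using uv by (auto simp: tlift_tens[OF vs vs vspace_tensor b] G intro!: tensors_intros)
    qed
    ultimately show ?case by simp
  qed
  have Geq: "p x = q x" if "x \<in> G n" for x n using that
  proof (induction n arbitrary: x)
    case 0
    then show ?case using eq by (auto simp: G)
  next
    case (Suc n)
    then show ?case using alg_homs_agree_antipode[OF H S R p q GH GD Suc.IH] by (auto simp: G)
  qed
  have "vcar H \<subseteq> generated H (\<Union>n. G n)"
  proof (rule hopf_envelope_generated[OF large U B S])
    show "(\<Union>n. G n) \<subseteq> vcar H" using GH by auto
    show "S x \<in> (\<Union>n. G n)" if "x \<in> (\<Union>n. G n)" for x using that G(2) by blast
    show "bdelta H x \<in> tensors H (\<Union>n. G n)" if "x \<in> (\<Union>n. G n)" for x
    proof -
      from that obtain n where n: "x \<in> G n" by blast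
      have "G n \<subseteq> (\<Union>n. G n)" by blast
      from subsetD[OF tensors_mono[OF this] GD[OF n]] show ?thesis .
    qed
    show "\<eta> b \<in> (\<Union>n. G n)" if "b \<in> vcar B" for b using that G(1) by blast
  qed
  moreover have "x \<in> vcar H \<and> p x = q x" if "x \<in> generated H (\<Union>n. G n)" for x using that
    by induction
      (use GH Geq in \<open>auto simp: alg_one[OF bi_alg[OF H]] alg_mult[OF bi_alg[OF H]] vs_add[OF vs] vs_scale[OF vs]
        alg_hom_one[OF p] alg_hom_one[OF q] alg_hom_mult[OF p] alg_hom_mult[OF q] lin_add[OF alg_hom_lin[OF p]] lin_add[OF alg_hom_lin[OF q]]
        lin_scale[OF alg_hom_lin[OF p]] lin_scale[OF alg_hom_lin[OF q]]\<close>)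
  ultimately show ?thesis using h by blast
qed

section \<open>Actions and coactions\<close>

lemma
  assumes "bialg_coaction B A \<rho>"
  shows coaction_bialg: "bialgebra B" and coaction_comeas: "comeasuring B A \<rho>" and coaction_lin: "lin_map A (tensor_space A B) \<rho>"
    and coaction_counit: "contract A B (beps B) (\<rho> a) = a"
  using assms by (auto simp: bialg_coaction_def comeasuring_def)

lemma coaction_apply:
  assumes om: "omega_algebra A" and co: "bialg_coaction B A \<rho>" and T: "trilin A B B T"
  shows "\<rho> a (\<lambda>x b. \<rho> x (\<lambda>y c. T y c b)) = \<rho> a (\<lambda>x b. bdelta B b (\<lambda>u v. T x u v))"
proof -
  note B = coaction_bialg[OF co] and A = omegaD(1)[OF om]
  note \<rho> = coaction_lin[OF co] and vB = bi_vspace[OF coaction_bialg[OF co]]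
  note \<rho>a = lin_mem[OF \<rho> omegaD(2)[OF om]]
  show ?thesis
    by (rule tassoc_eqD[OF A vB vB A vB \<rho> bi_delta[OF B] \<rho>a \<rho>a _ T]) (use co in \<open>simp add: bialg_coaction_def\<close>)
qed

text \<open>A functional on \<open>R\<close> composed with \<open>f\<close> is a functional on
  \<open>Q\<close>.\<close>

lemma cosupp_tmap:
  assumes om: "omega_algebra A" and Q: "vspace Q" and R: "vspace R" and \<rho>: "lin_map A (tensor_space A Q) \<rho>" and f: "lin_map Q R f"
  shows "cosupp_comeas R A (\<lambda>a. tmap A Q A R id f (\<rho> a)) \<subseteq> cosupp_comeas Q A \<rho>"
proof
  fix v assume "v \<in> cosupp_comeas R A (\<lambda>a. tmap A Q A R id f (\<rho> a))"
  then obtain g where g: "lf R g" "v = (\<lambda>a. contract A R g (tmap A Q A R id f (\<rho> a)))" by (auto simp: cosupp_comeas_def)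
  note A = omegaD(1)[OF om]
  have "v = (\<lambda>a. contract A Q (\<lambda>x. g (f x)) (\<rho> a))"
    unfolding g(2) using contract_tmap[OF A Q A R lin_id' f g(1) lin_mem[OF \<rho> omegaD(2)[OF om]]] by simp
  then show "v \<in> cosupp_comeas Q A \<rho>" using lin_comp[OF g(1) f] by (auto simp: cosupp_comeas_def)
qed

text \<open>Coassociativity is compared on products of functionals, where it becomes that of \<rho>
  with the functionals pulled back along \<eta>.\<close>

lemma bialg_coaction_hom:
  assumes om: "omega_algebra A" and co: "bialg_coaction B A \<rho>" and H: "bialgebra H" and \<eta>: "bialg_hom B H \<eta>"
  shows "bialg_coaction H A (\<lambda>a. tmap A B A H id \<eta> (\<rho> a))"
proof -
  let ?\<rho> = "\<lambda>a. tmap A B A H id \<eta> (\<rho> a)"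
  note B = coaction_bialg[OF co] and A = omegaD(1)[OF om] and \<rho> = coaction_lin[OF co]
  note vB = bi_vspace[OF B] and vH = bi_vspace[OF H] and \<rho>a = lin_mem[OF \<rho> omegaD(2)[OF om]]
  have \<eta>h: "alg_hom B H \<eta>" and \<eta>c: "coalg_hom (coalg_of B) (coalg_of H) \<eta>" using \<eta> by (auto simp: bialg_hom_def)
  note \<eta>l = alg_hom_lin[OF \<eta>h] and tl = tmap_lin[OF A vB lin_id' alg_hom_lin[OF \<eta>h]]
  note ta = tmap_apply[OF A vB lin_id' \<eta>l]
  have 1: "comeasuring H A ?\<rho>" by (rule comeasuring_hom[OF om coaction_comeas[OF co] bi_alg[OF H] \<eta>h])
  have \<rho>': "lin_map A (tensor_space A H) ?\<rho>" by (rule lin_comp[OF tl \<rho>])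
  note \<rho>'a = lin_mem[OF \<rho>' omegaD(2)[OF om]]
  have 2: "tassoc A H H (tmap A H (tensor_space A H) H ?\<rho> id (?\<rho> a)) = tmap A H A (tensor_space H H) id (bdelta H) (?\<rho> a)" for a
  proof (rule tassoc_eqI[OF A vH vH A vH \<rho>' bi_delta[OF H] \<rho>'a \<rho>'a separates_all[OF A] separates_all[OF vH] separates_all[OF vH]])
    fix f g h assume "f \<in> {f. lf A f}" "g \<in> {f. lf H f}" "h \<in> {f. lf H f}"
    then have f: "lf A f" and g: "lf H g" and h: "lf H h" by auto
    have T: "trilin A H H (\<lambda>a b c. f a * g b * h c)" by (rule trilin_prod[OF f g h])
    have T': "trilin A B B (\<lambda>a b c. f a * g (\<eta> b) * h (\<eta> c))" by (rule trilin_prod[OF f lin_comp[OF g \<eta>l] lin_comp[OF h \<eta>l]])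
    have b1: "bf A H (\<lambda>m c. ?\<rho> m (\<lambda>a b. f a * g b * h c))"
    proof (rule bilin_mapI)
      show "lf A (\<lambda>m. ?\<rho> m (\<lambda>a b. f a * g b * h c))" for c by (rule lf_tensor_apply[OF \<rho>'])
      show "lf H (\<lambda>c. ?\<rho> m (\<lambda>a b. f a * g b * h c))" for m
        by (rule lf_tensor_param[OF \<rho>'a A vH vH trilin_bf3[OF T] trilin_lf3[OF T]])
    qed
    have b2: "bf A H (\<lambda>a n. bdelta H n (\<lambda>b c. f a * g b * h c))"
    proof (rule bilin_mapI)
      show "lf A (\<lambda>a. bdelta H n (\<lambda>b c. f a * g b * h c))" if "n \<in> vcar H" for n
        by (rule lf_tensor_param[OF lin_mem[OF bi_delta[OF H] that] vH vH A trilin_bf1[OF T] trilin_lf1[OF T]])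
      show "lf H (\<lambda>n. bdelta H n (\<lambda>b c. f a * g b * h c))" for a by (rule lf_tensor_apply[OF bi_delta[OF H]])
    qed
    have "?\<rho> a (\<lambda>m c. ?\<rho> m (\<lambda>a b. f a * g b * h c)) = \<rho> a (\<lambda>m c. \<rho> m (\<lambda>a b. f a * g (\<eta> b) * h (\<eta> c)))"
      unfolding ta[OF b1 \<rho>a]
      by (rule tensor_apply_cong[OF \<rho>a A vB]) (simp add: ta[OF trilin_bf3[OF T lin_mem[OF \<eta>l]] \<rho>a])
    also have "\<dots> = \<rho> a (\<lambda>x b. bdelta B b (\<lambda>u v. f x * g (\<eta> u) * h (\<eta> v)))"
      by (rule coaction_apply[OF om co T'])
    also have "\<dots> = \<rho> a (\<lambda>x n. bdelta H (\<eta> n) (\<lambda>b c. f x * g b * h c))"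
    proof (rule tensor_apply_cong[OF \<rho>a A vB])
      fix x n assume "x \<in> vcar A" "n \<in> vcar B"
      then show "bdelta B n (\<lambda>u v. f x * g (\<eta> u) * h (\<eta> v)) = bdelta H (\<eta> n) (\<lambda>b c. f x * g b * h c)"
        using coalg_hom_apply[OF bi_coalg[OF B] \<eta>c, of n "\<lambda>b c. f x * g b * h c"] trilin_bf1[OF T] by simp
    qed
    also have "\<dots> = ?\<rho> a (\<lambda>a n. bdelta H n (\<lambda>b c. f a * g b * h c))"
      by (simp add: ta[OF b2 \<rho>a])
    finally show "?\<rho> a (\<lambda>m c. ?\<rho> m (\<lambda>a b. f a * g b * h c)) = ?\<rho> a (\<lambda>a n. bdelta H n (\<lambda>b c. f a * g b * h c))" .
  qed
  have 3: "contract A H (beps H) (?\<rho> a) = a" for a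
  proof -
    have "contract A H (beps H) (?\<rho> a) = contract A B (\<lambda>b. beps H (\<eta> b)) (\<rho> a)"
      using contract_tmap[OF A vB A vH lin_id' \<eta>l bi_eps[OF H] \<rho>a] by simp
    also have "\<dots> = contract A B (beps B) (\<rho> a)"
    proof (rule functional_sep[OF A])
      have e: "lf B (\<lambda>b. beps H (\<eta> b))" by (rule lin_comp[OF bi_eps[OF H] \<eta>l])
      show "contract A B (\<lambda>b. beps H (\<eta> b)) (\<rho> a) \<in> vcar A" "contract A B (beps B) (\<rho> a) \<in> vcar A"
        by (rule contract_mem[OF A vB _ \<rho>a], rule e bi_eps[OF B])+
      fix f assume f: "lf A f"
      show "f (contract A B (\<lambda>b. beps H (\<eta> b)) (\<rho> a)) = f (contract A B (beps B) (\<rho> a))"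
        unfolding contract_apply[OF A vB e f \<rho>a] contract_apply[OF A vB bi_eps[OF B] f \<rho>a]
        using coalg_hom_eps[OF \<eta>c] by (intro tensor_apply_cong[OF \<rho>a A vB]) simp
    qed
    finally show ?thesis by (simp add: coaction_counit[OF co])
  qed
  show ?thesis using H 1 2 3 by (simp add: bialg_coaction_def)
qed

text \<open>With the finite dual as the coalgebra of the pairing, coactions give actions. In the
  next lemma it is the algebra, and actions give coactions.\<close>

lemma finite_dual_eval_left:
  assumes H: "bialgebra H"
  shows "bf (coalg_of (finite_dual H)) H (\<lambda>f h. f h)"
    and "f \<in> vcar (coalg_of (finite_dual H)) \<Longrightarrow> x \<in> vcar H \<Longrightarrow> y \<in> vcar H \<Longrightarrow>
      f (amult H x y) = cdelta (coalg_of (finite_dual H)) f (\<lambda>g h. g x * h y)"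
    and "f (aone H) = ceps (coalg_of (finite_dual H)) f"
proof -
  show "bf (coalg_of (finite_dual H)) H (\<lambda>f h. f h)"
    by (rule bilin_mapI) (simp_all add: lf_eval finite_dual_carrierD(1))
qed (simp_all add: finite_dual_delta[OF H])

lemma finite_dual_eval_right:
  assumes K: "bialgebra K"
  shows "bf (coalg_of K) (finite_dual K) (\<lambda>k f. f k)"
    and "k \<in> vcar (coalg_of K) \<Longrightarrow> f \<in> vcar (finite_dual K) \<Longrightarrow> g \<in> vcar (finite_dual K) \<Longrightarrow>
      amult (finite_dual K) f g k = cdelta (coalg_of K) k (\<lambda>x y. f x * g y)"
    and "k \<in> vcar (coalg_of K) \<Longrightarrow> aone (finite_dual K) k = ceps (coalg_of K) k"
    and "separates (finite_dual K) {(\<lambda>f. f k) | k. k \<in> vcar (coalg_of K)}"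
proof -
  show "bf (coalg_of K) (finite_dual K) (\<lambda>k f. f k)"
    by (rule bilin_mapI) (simp_all add: lf_eval finite_dual_carrierD(1))
  show "separates (finite_dual K) {(\<lambda>f. f k) | k. k \<in> vcar (coalg_of K)}"
    using separates_evals[of K] by simp
  show "k \<in> vcar (coalg_of K) \<Longrightarrow> aone (finite_dual K) k = ceps (coalg_of K) k" by (simp add: finite_dual_def)
qed (simp add: finite_dual_mult[OF K] finite_dual_carrierD(1) conv_def)

lemma dual_action_apply:
  assumes om: "omega_algebra A" and H: "vspace H" and \<rho>: "lin_map A (tensor_space A H) \<rho>" and f: "lf H f" and \<phi>: "lf A \<phi>"
  shows "\<phi> (dual_action H A \<rho> f a) = \<rho> a (\<lambda>x h. \<phi> x * f h)"
  unfolding dual_action_def by (rule contract_apply[OF omegaD(1)[OF om] H f \<phi> lin_mem[OF \<rho> omegaD(2)[OF om]]])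

text \<open>By coassociativity, in the convolution of \<open>f\<close> and \<open>g\<close> the
  functional \<open>g\<close> meets the last leg of the coaction and \<open>f\<close> the middle
  one; this is the composite that applies \<open>g\<close> first.\<close>

lemma dual_action_bialg_action:
  assumes om: "omega_algebra A" and co: "bialg_coaction H A \<rho>"
  shows "bialg_action (finite_dual H) A (dual_action H A \<rho>)"
proof -
  note H = coaction_bialg[OF co] and A = omegaD(1)[OF om] and \<rho> = coaction_lin[OF co] and AU = omegaD(2)[OF om]
  note vH = bi_vspace[OF H] and \<rho>a = lin_mem[OF \<rho> omegaD(2)[OF om]]
  note D = finite_dual_bialgebra[OF H] and fl = finite_dual_carrierD(1)
  note ap = dual_action_apply[OF om vH \<rho>]
  have me: "measuring (coalg_of (finite_dual H)) A (dual_action H A \<rho>)"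
    by (rule pairing_measuring[OF bi_coalg[OF D] bi_alg[OF H] A \<rho> finite_dual_eval_left[OF H] _ om coaction_comeas[OF co]])
      (simp_all add: dual_action_def)
  have mult: "dual_action H A \<rho> (amult (finite_dual H) f g) a = dual_action H A \<rho> f (dual_action H A \<rho> g a)"
    if f: "f \<in> finite_dual_carrier H" and g: "g \<in> finite_dual_carrier H" for f g a
  proof (rule functional_sep[OF A AU AU])
    fix \<phi> assume \<phi>: "lf A \<phi>"
    have lfm: "lf H (amult (finite_dual H) f g)" using finite_dual_mult_mem[OF H f g] by (rule fl)
    have l: "lf A (\<lambda>a. \<phi> (dual_action H A \<rho> f a))"
      by (rule lin_cong[OF lf_tensor_apply[OF \<rho>] A]) (rule ap[OF fl[OF f] \<phi>, symmetric])
    have "\<phi> (dual_action H A \<rho> (amult (finite_dual H) f g) a) = \<rho> a (\<lambda>x h. \<phi> x * amult (finite_dual H) f g h)"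
      by (rule ap[OF lfm \<phi>])
    also have "\<dots> = \<rho> a (\<lambda>x h. bdelta H h (\<lambda>u v. \<phi> x * f u * g v))"
    proof (rule tensor_apply_cong[OF \<rho>a A vH])
      fix x h assume h: "h \<in> vcar H"
      show "\<phi> x * amult (finite_dual H) f g h = bdelta H h (\<lambda>u v. \<phi> x * f u * g v)"
        using tensor_scale_left[OF lin_mem[OF bi_delta[OF H] h] vH vH bf_prod[OF fl[OF f] fl[OF g]], of "\<phi> x"]
        by (simp add: finite_dual_mult[OF H fl[OF f] fl[OF g]] h conv_def mult.assoc)
    qed
    also have "\<dots> = \<rho> a (\<lambda>x h. \<rho> x (\<lambda>y c. \<phi> y * f c * g h))"
      by (rule coaction_apply[OF om co trilin_prod[OF \<phi> fl[OF f] fl[OF g]], symmetric])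
    also have "\<dots> = \<rho> a (\<lambda>x h. \<phi> (dual_action H A \<rho> f x) * g h)"
      by (rule tensor_apply_cong[OF \<rho>a A vH])
        (simp add: ap[OF fl[OF f] \<phi>] tensor_scale_right[OF \<rho>a A vH bf_prod[OF \<phi> fl[OF f]]])
    also have "\<dots> = \<phi> (dual_action H A \<rho> f (dual_action H A \<rho> g a))"
      by (rule ap[OF fl[OF g] l, symmetric])
    finally show "\<phi> (dual_action H A \<rho> (amult (finite_dual H) f g) a) = \<phi> (dual_action H A \<rho> f (dual_action H A \<rho> g a))" .
  qed
  have one: "dual_action H A \<rho> (aone (finite_dual H)) a = a" for a
  proof (rule functional_sep[OF A AU AU])
    fix \<phi> assume \<phi>: "lf A \<phi>"
    have l: "lf H (aone (finite_dual H))" using alg_one[OF bi_alg[OF D]] by (simp add: fl)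
    have "\<phi> (dual_action H A \<rho> (aone (finite_dual H)) a) = \<rho> a (\<lambda>x h. \<phi> x * beps H h)"
      unfolding ap[OF l \<phi>] by (rule tensor_apply_cong[OF \<rho>a A vH]) (simp add: finite_dual_def)
    also have "\<dots> = \<phi> a"
      unfolding contract_apply[OF A vH bi_eps[OF H] \<phi> \<rho>a, symmetric] coaction_counit[OF co] ..
    finally show "\<phi> (dual_action H A \<rho> (aone (finite_dual H)) a) = \<phi> a" .
  qed
  show ?thesis using D me mult one by (simp add: bialg_action_def)
qed

lemma
  assumes "bialg_action B A \<psi>"
  shows action_bialg: "bialgebra B" and action_meas: "measuring (coalg_of B) A \<psi>" and action_bilin: "bilin_map B A A \<psi>"
    and action_mult: "x \<in> vcar B \<Longrightarrow> y \<in> vcar B \<Longrightarrow> \<psi> (amult B x y) a = \<psi> x (\<psi> y a)"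
    and action_one: "\<psi> (aone B) a = a"
  using assms by (auto simp: bialg_action_def measuring_def)

lemma bialg_action_hom:
  assumes om: "omega_algebra A" and ac: "bialg_action D A \<psi>" and K: "bialgebra K" and f: "bialg_hom K D f"
  shows "bialg_action K A (\<lambda>k. \<psi> (f k))"
proof -
  have fh: "alg_hom K D f" and fc: "coalg_hom (coalg_of K) (coalg_of D) f" using f by (auto simp: bialg_hom_def)
  show ?thesis
    using measuring_hom[OF bi_coalg[OF K] fc action_meas[OF ac] om] K lin_mem[OF alg_hom_lin[OF fh]]
    by (simp add: bialg_action_def alg_hom_mult[OF fh] alg_hom_one[OF fh] action_mult[OF ac] action_one[OF ac])
qed

text \<open>The ground field with 1 group-like. A group-like element of a coalgebra is a coalgebra
  map from it, which makes it the test coalgebra for comparing units.\<close>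

definition ground_coalg :: "('k::field, 'k) coalg" where
  "ground_coalg = \<lparr>vcar = UNIV, vscale = (*),
     cdelta = \<lambda>c. fscale c (tens (ground :: ('k, 'k) alg) (ground :: ('k, 'k) alg) 1 1), ceps = \<lambda>c. c\<rparr>"

lemma ground_coalg_simps [simp]: "vcar ground_coalg = UNIV" "vscale ground_coalg = (*)" "ceps ground_coalg c = c"
  by (simp_all add: ground_coalg_def)

lemmas ground_coalg_cong [simp] =
  vsp_cong_left[of ground_coalg "ground :: ('k::field, 'k) alg", simplified]
  vsp_cong_right[of ground_coalg "ground :: ('k::field, 'k) alg", simplified]

lemma ground_coalg_delta:
  "lin_map ground_coalg (tensor_space ground_coalg ground_coalg) (cdelta (ground_coalg :: ('k::field, 'k) coalg))"
proof -
  have t: "tens (ground :: ('k, 'k) alg) (ground :: ('k, 'k) alg) 1 1 \<in> vcar (tensor_space (ground :: ('k, 'k) alg) (ground :: ('k, 'k) alg))"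
    by (rule tens_mem) simp_all
  have "lin_map (ground :: ('k, 'k) alg) (tensor_space (ground :: ('k, 'k) alg) (ground :: ('k, 'k) alg))
      (\<lambda>c. fscale c (tens (ground :: ('k, 'k) alg) (ground :: ('k, 'k) alg) 1 1))"
  proof (rule lin_mapI)
    fix x y c :: 'k
    show "fscale x (tens (ground :: ('k, 'k) alg) (ground :: ('k, 'k) alg) 1 1) \<in> vcar (tensor_space (ground :: ('k, 'k) alg) (ground :: ('k, 'k) alg))"
      using vs_scale[OF vspace_tensor t] unfolding tensor_space_simps .
  qed (rule ext, simp add: algebra_simps)+
  then show ?thesis by (simp add: ground_coalg_def[THEN arg_cong[where f = cdelta]])
qed

lemma ground_coalg_conv: "lf ground f \<Longrightarrow> lf ground g \<Longrightarrow> conv ground_coalg f g c = c * (f 1 * g 1)"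
  by (simp add: conv_def ground_coalg_def tens_apply[OF bf_prod])

lemma ground_coalg: "coalgebra (ground_coalg :: ('k::field, 'k) coalg)"
proof (rule coalgebraI_conv[where F = "{\<lambda>x. x}"])
  show "vspace (ground_coalg :: ('k, 'k) coalg)" by simp
  show "lin_map ground_coalg (tensor_space ground_coalg ground_coalg) (cdelta (ground_coalg :: ('k, 'k) coalg))"
    by (rule ground_coalg_delta)
  have e: "ceps ground_coalg = (\<lambda>x :: 'k. x)" by (rule ext) simp
  have c: "conv ground_coalg (\<lambda>x. x) (\<lambda>x. x) = (\<lambda>c :: 'k. c)"
    by (rule ext) (simp add: ground_coalg_conv lin_id)
  show "lf ground_coalg (ceps (ground_coalg :: ('k, 'k) coalg))" by (simp add: e lin_id)
  show "separates (ground_coalg :: ('k, 'k) coalg) {\<lambda>x. x}" by (simp add: separates_def lin_id)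
  fix p :: 'k and f g h assume "f \<in> {\<lambda>x :: 'k. x}"
  then have f: "f = (\<lambda>x. x)" by simp
  show "conv ground_coalg (ceps ground_coalg) f p = f p" "conv ground_coalg f (ceps ground_coalg) p = f p"
    by (simp_all add: e f c)
  assume "g \<in> {\<lambda>x :: 'k. x}" "h \<in> {\<lambda>x :: 'k. x}"
  then show "conv ground_coalg (conv ground_coalg f g) h p = conv ground_coalg f (conv ground_coalg g h) p"
    by (simp add: f c)
qed

lemma grouplike_coalg_hom:
  assumes D: "coalgebra D" and d: "d \<in> vcar D" "ceps D d = 1" "cdelta D d = tens D D d d"
  shows "coalg_hom ground_coalg D (\<lambda>c. vscale D c d)"
proof (rule coalg_homI[OF ground_coalg D _ separates_all[OF coalg_vspace[OF D]]])
  note vs = coalg_vspace[OF D]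
  have l: "lin_map (ground :: ('a, 'a) alg) D (\<lambda>c. vscale D c d)"
    by (rule lin_mapI) (auto simp: vs_scale[OF vs d(1)] vs_add_scale[OF vs] vs_scale_scale[OF vs])
  then show "lin_map ground_coalg D (\<lambda>c. vscale D c d)" by simp
  show "ceps D (vscale D p d) = ceps ground_coalg p" for p
    by (simp add: lin_scale[OF coalg_eps[OF D] d(1)] d(2))
  fix p g h assume "g \<in> {f. lf D f}" "h \<in> {f. lf D f}"
  then have g: "lf D g" and h: "lf D h" by auto
  show "conv D g h (vscale D p d) = conv ground_coalg (\<lambda>x. g (vscale D x d)) (\<lambda>x. h (vscale D x d)) p"
    unfolding lin_scale[OF lf_conv[OF coalg_delta[OF D]] d(1)] ground_coalg_conv[OF lin_comp[OF g l] lin_comp[OF h l]]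
    by (simp add: conv_def d(3) tens_apply[OF bf_prod[OF g h]] vs_scale_one[OF vs])
qed

lemma small_cong: "vcar V = vcar W \<Longrightarrow> vscale V = vscale W \<Longrightarrow> small T V = small T W"
  by (simp add: small_def vsp_cong_left[of V W])

text \<open>Multiplicativity comes from uniqueness: \<open>f\<close> after the product and the
  product after f \<otimes> f are coalgebra maps on the tensor square of \<open>L\<close> that
  induce the same operators on \<open>A\<close>. For the units the ground field is the test
  coalgebra.\<close>

lemma universal_acting_bialg_hom:
  assumes large: "large_universe TYPE('k::field) TYPE('u::ab_group_add) TYPE('t::ab_group_add)"
    and U: "universal_acting_bialgebra TYPE('t) (A :: ('k, 'a::ab_group_add, 'o) omega_alg) V (D :: ('k, 'u) bialg) \<psi>"
    and om: "omega_algebra A" and L: "bialg_action L A \<psi>L" and sm: "small TYPE('u) (tensor_space L L)"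
    and f: "coalg_hom (coalg_of L) (coalg_of D) f" and f\<psi>: "\<And>x a. x \<in> vcar L \<Longrightarrow> \<psi> (f x) a = \<psi>L x a"
  shows "bialg_hom L D f"
proof -
  have acD: "bialg_action D A \<psi>" and VD: "\<psi> ` vcar D \<subseteq> V"
    using U by (auto simp: universal_acting_bialgebra_def cosupp_meas_def)
  note D = action_bialg[OF acD] and bL = action_bialg[OF L] and AU = omegaD(2)[OF om] and A = omegaD(1)[OF om]
  note vD = bi_vspace[OF D] and vL = bi_vspace[OF bL] and cD = bi_coalg[OF D] and cL = bi_coalg[OF bL]
  have fl: "lin_map L D f" using coalg_hom_lin[OF f] by simp
  note fm = lin_mem[OF fl]
  \<comment> \<open>Coalgebra maps from a small coalgebra into \<open>D\<close> are determined by
    the operators they induce. The measuring to be factored is the one induced by \<open>m1\<close>,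
    so its cosupport lies in \<open>V\<close>.\<close>
  have uniq: "m1 x = m2 x" if P: "coalgebra P" "small TYPE('u) P" and m: "coalg_hom P (coalg_of D) m1" "coalg_hom P (coalg_of D) m2"
    and eq: "\<And>p a. p \<in> vcar P \<Longrightarrow> \<psi> (m1 p) a = \<psi> (m2 p) a" and x: "x \<in> vcar P"
    for P :: "('k, 'x::ab_group_add) coalg" and m1 m2 x
  proof -
    obtain s and j :: "'x \<Rightarrow> 't" where j: "embeds P s j" using small_embeds[OF large P(2)] by metis
    have m1m: "m1 p \<in> vcar D" if "p \<in> vcar P" for p using lin_mem[OF coalg_hom_lin[OF m(1)] that] by simp
    have "ex_unique_on (vcar P) (\<lambda>\<phi>. coalg_hom P (coalg_of D) \<phi> \<and> (\<forall>p\<in>vcar P. \<forall>a. \<psi> (\<phi> p) a = \<psi> (m1 p) a))"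
      by (rule universal_acting_embeds[OF U om P(1) j measuring_hom[OF P(1) m(1) action_meas[OF acD] om]])
        (use VD m1m in \<open>auto simp: cosupp_meas_def\<close>)
    then show ?thesis using m eq x unfolding ex_unique_on_def by metis
  qed
  let ?T = "tcoalg (coalg_of L) (coalg_of L)"
  note mL = alg_bilin[OF bi_alg[OF bL]] and mD = alg_bilin[OF bi_alg[OF D]]
  let ?m1 = "\<lambda>X. f (tlift L L L (amult L) X)" and ?m2 = "\<lambda>X. tlift D D D (amult D) (tmap L L D D f f X)"
  note T = tcoalg_coalgebra[OF cL cL]
  have h1: "coalg_hom ?T (coalg_of D) ?m1" by (rule coalg_hom_comp[OF T cL cD mult_coalg_hom[OF bL] f])
  have h2: "coalg_hom ?T (coalg_of D) ?m2"
    using coalg_hom_comp[OF T tcoalg_coalgebra[OF cD cD] cD tcoalg_tmap_hom[OF cL cL cD cD f f] mult_coalg_hom[OF D]] by simp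
  have smT: "small TYPE('u) ?T" using sm small_cong[of ?T "tensor_space L L" "TYPE('u)"] by simp
  have eq: "\<psi> (?m1 X) a = \<psi> (?m2 X) a" if X: "X \<in> vcar ?T" for X a
  proof -
    have b: "lin_map D A (\<lambda>d. \<psi> d a)" by (rule bilin_left[OF action_bilin[OF acD] AU])
    have l1: "lin_map (tensor_space L L) D ?m1" and l2: "lin_map (tensor_space L L) D ?m2"
      using coalg_hom_lin[OF h1] coalg_hom_lin[OF h2] by simp_all
    show ?thesis
    proof (rule lin_tensor_eqI[OF lin_comp[OF b l1] lin_comp[OF b l2] vL vL])
      fix v w assume v: "v \<in> vcar L" and w: "w \<in> vcar L"
      show "\<psi> (?m1 (tens L L v w)) a = \<psi> (?m2 (tens L L v w)) a"
        by (simp add: tlift_tens[OF vL vL vL mL v w] tmap_tens[OF vL vL fl fl v w] tlift_tens[OF vD vD vD mD fm[OF v] fm[OF w]]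
            f\<psi> v w alg_mult[OF bi_alg[OF bL]] action_mult[OF L v w] action_mult[OF acD fm[OF v] fm[OF w]])
    qed (use X in simp)
  qed
  have mult: "f (amult L x y) = amult D (f x) (f y)" if x: "x \<in> vcar L" and y: "y \<in> vcar L" for x y
    using uniq[OF T smT h1 h2 eq, of "tens L L x y"] tens_mem[OF x y]
    by (simp add: tlift_tens[OF vL vL vL mL x y] tmap_tens[OF vL vL fl fl x y] tlift_tens[OF vD vD vD mD fm[OF x] fm[OF y]])
  note oneL = alg_one[OF bi_alg[OF bL]] and oneD = alg_one[OF bi_alg[OF D]]
  have g1: "coalg_hom ground_coalg (coalg_of D) (\<lambda>c. vscale D c (f (aone L)))"
    using grouplike_coalg_hom[OF cD, of "f (aone L)"] f oneL fm[OF oneL]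
    by (simp add: coalg_hom_def bi_delta_one[OF bL] bi_eps_one[OF bL] tmap_tens[OF vL vL fl fl])
  have g2: "coalg_hom ground_coalg (coalg_of D) (\<lambda>c. vscale D c (aone D))"
    using grouplike_coalg_hom[OF cD, of "aone D"] oneD by (simp add: bi_delta_one[OF D] bi_eps_one[OF D])
  have smg: "small TYPE('u) (ground_coalg :: ('k, 'k) coalg)"
    using small_ground small_cong[of "ground_coalg :: ('k, 'k) coalg" "ground :: ('k, 'k) alg" "TYPE('u)"] by simp
  have "vscale D c (f (aone L)) = vscale D c (aone D)" for c
  proof (rule uniq[OF ground_coalg smg g1 g2])
    fix p a
    have b: "lin_map D A (\<lambda>d. \<psi> d a)" by (rule bilin_left[OF action_bilin[OF acD] AU])
    show "\<psi> (vscale D p (f (aone L))) a = \<psi> (vscale D p (aone D)) a"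
      using lin_scale[OF b fm[OF oneL], of p] lin_scale[OF b oneD, of p]
      by (simp add: f\<psi> oneL action_one[OF L] action_one[OF acD])
  qed simp
  from this[of 1] have one: "f (aone L) = aone D" by (simp add: vs_scale_one[OF vD])
  show ?thesis using fl one mult f by (simp add: bialg_hom_def alg_hom_def)
qed

text \<open>The two ways round the comultiplication square are algebra maps from \<open>B\<close> to
  the tensor square of \<open>L\<close>, and the two counits are algebra maps to the ground field.
  In each case they induce the same comeasuring, so uniqueness identifies them.\<close>

lemma universal_coacting_bialg_hom:
  assumes large: "large_universe TYPE('k::field) TYPE('u::ab_group_add) TYPE('t::ab_group_add)"
    and U: "universal_coacting_bialgebra TYPE('t) (A :: ('k, 'a::ab_group_add, 'o) omega_alg) V (B :: ('k, 'u) bialg) \<rho>"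
    and om: "omega_algebra A" and L: "bialg_coaction L A \<rho>L" and sm: "small TYPE('u) (tensor_space L L)"
    and f: "alg_hom B L f" and f\<rho>: "\<And>a. tmap A B A L id f (\<rho> a) = \<rho>L a"
  shows "bialg_hom B L f"
proof -
  have coB: "bialg_coaction B A \<rho>" and VB: "cosupp_comeas B A \<rho> \<subseteq> V"
    using U by (auto simp: universal_coacting_bialgebra_def)
  note B = coaction_bialg[OF coB] and bL = coaction_bialg[OF L] and AU = omegaD(2)[OF om] and A = omegaD(1)[OF om]
  note vB = bi_vspace[OF B] and vL = bi_vspace[OF bL] and aB = bi_alg[OF B] and aL = bi_alg[OF bL]
  note \<rho> = coaction_lin[OF coB] and \<rho>L = coaction_lin[OF L]
  note \<rho>a = lin_mem[OF \<rho> AU] and \<rho>La = lin_mem[OF \<rho>L AU]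
  note fl = alg_hom_lin[OF f]
  have uniq: "m1 x = m2 x" if Q: "algebra Q" "small TYPE('u) Q" and m: "alg_hom B Q m1" "alg_hom B Q m2"
    and eq: "\<And>a. tmap A B A Q id m1 (\<rho> a) = tmap A B A Q id m2 (\<rho> a)" and x: "x \<in> vcar B"
    for Q :: "('k, 'x::ab_group_add) alg" and m1 m2 x
  proof -
    obtain s and j :: "'x \<Rightarrow> 't" where j: "embeds Q s j" using small_embeds[OF large Q(2)] by metis
    have "ex_unique_on (vcar B) (\<lambda>\<phi>. alg_hom B Q \<phi> \<and> (\<forall>a. tmap A B A Q id \<phi> (\<rho> a) = tmap A B A Q id m1 (\<rho> a)))"
      by (rule universal_coacting_embeds[OF U om Q(1) j comeasuring_hom[OF om coaction_comeas[OF coB] Q(1) m(1)]])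
        (use VB cosupp_tmap[OF om vB alg_vspace[OF Q(1)] \<rho> alg_hom_lin[OF m(1)]] in blast)
    then show ?thesis using m eq x unfolding ex_unique_on_def by metis
  qed
  let ?Q = "tensor_alg L L"
  have Q: "algebra ?Q" by (rule tensor_algebra[OF aL aL])
  have smQ: "small TYPE('u) ?Q" using sm small_cong[of ?Q "tensor_space L L" "TYPE('u)"] by simp
  have h1: "alg_hom B ?Q (\<lambda>b. bdelta L (f b))" by (rule alg_hom_comp[OF f bi_delta_hom[OF bL]])
  have h2: "alg_hom B ?Q (\<lambda>b. tmap B B L L f f (bdelta B b))"
    by (rule alg_hom_comp[OF bi_delta_hom[OF B] tmap_alg_hom[OF aB aB aL aL f f]])
  have l1: "lin_map B (tensor_space L L) (\<lambda>b. bdelta L (f b))" and l2: "lin_map B (tensor_space L L) (\<lambda>b. tmap B B L L f f (bdelta B b))"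
    using alg_hom_lin[OF h1] alg_hom_lin[OF h2] by simp_all
  have eqd: "tmap A B A (tensor_space L L) id (\<lambda>b. bdelta L (f b)) (\<rho> a)
      = tmap A B A (tensor_space L L) id (\<lambda>b. tmap B B L L f f (bdelta B b)) (\<rho> a)" for a
  proof (rule tensor_eqI[OF A vspace_tensor separates_all[OF A] separates_tensor[OF vL vL separates_all[OF vL] separates_all[OF vL]]])
    show "tmap A B A (tensor_space L L) id (\<lambda>b. bdelta L (f b)) (\<rho> a) \<in> vcar (tensor_space A (tensor_space L L))"
      by (rule tmap_mem[OF A vB lin_id' l1 \<rho>a])
    show "tmap A B A (tensor_space L L) id (\<lambda>b. tmap B B L L f f (bdelta B b)) (\<rho> a) \<in> vcar (tensor_space A (tensor_space L L))"
      by (rule tmap_mem[OF A vB lin_id' l2 \<rho>a])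
    fix \<phi> g assume "\<phi> \<in> {f. lf A f}" and "g \<in> {prodf f g | f g. f \<in> {f. lf L f} \<and> g \<in> {f. lf L f}}"
    then obtain g1 g2 where \<phi>: "lf A \<phi>" and g: "g = (\<lambda>Z. Z (\<lambda>v w. g1 v * g2 w))" and g1: "lf L g1" and g2: "lf L g2" by auto
    have gl: "lf (tensor_space L L) g" unfolding g by (rule lf_apply)
    note b = bf_prod[OF \<phi> gl]
    have T: "trilin A L L (\<lambda>x u v. \<phi> x * g1 u * g2 v)" by (rule trilin_prod[OF \<phi> g1 g2])
    have T': "trilin A B B (\<lambda>x u v. \<phi> x * g1 (f u) * g2 (f v))" by (rule trilin_prod[OF \<phi> lin_comp[OF g1 fl] lin_comp[OF g2 fl]])
    have "tmap A B A (tensor_space L L) id (\<lambda>b. tmap B B L L f f (bdelta B b)) (\<rho> a) (\<lambda>v w. \<phi> v * g w)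
      = \<rho> a (\<lambda>x b. \<phi> x * tmap B B L L f f (bdelta B b) (\<lambda>v w. g1 v * g2 w))"
      unfolding tmap_apply[OF A vB lin_id' l2 b \<rho>a] by (simp add: g)
    also have "\<dots> = \<rho> a (\<lambda>x b. bdelta B b (\<lambda>u v. \<phi> x * g1 (f u) * g2 (f v)))"
    proof (rule tensor_apply_cong[OF \<rho>a A vB])
      fix x b assume b: "b \<in> vcar B"
      note Db = lin_mem[OF bi_delta[OF B] b]
      show "\<phi> x * tmap B B L L f f (bdelta B b) (\<lambda>v w. g1 v * g2 w) = bdelta B b (\<lambda>u v. \<phi> x * g1 (f u) * g2 (f v))"
        using tensor_scale_left[OF Db vB vB bf_prod[OF lin_comp[OF g1 fl] lin_comp[OF g2 fl]], of "\<phi> x"]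
        by (simp add: tmap_apply[OF vB vB fl fl bf_prod[OF g1 g2] Db] mult.assoc)
    qed
    \<comment> \<open>Coassociativity of \<rho> converts the comultiplication of \<open>B\<close>
      into a second coaction, through which \<open>f\<close> can be pushed; coassociativity of the
      coaction of \<open>L\<close> then converts back.\<close>
    also have "\<dots> = \<rho> a (\<lambda>x b. \<rho> x (\<lambda>y c. \<phi> y * g1 (f c) * g2 (f b)))"
      by (rule coaction_apply[OF om coB T', symmetric])
    also have "\<dots> = \<rho> a (\<lambda>x b. \<rho>L x (\<lambda>y c. \<phi> y * g1 c * g2 (f b)))"
      by (rule tensor_apply_cong[OF \<rho>a A vB])
        (simp add: f\<rho>[symmetric] tmap_apply[OF A vB lin_id' fl trilin_bf3[OF T lin_mem[OF fl]] \<rho>a])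
    also have "\<dots> = \<rho>L a (\<lambda>x l. \<rho>L x (\<lambda>y c. \<phi> y * g1 c * g2 l))"
    proof -
      have "bf A L (\<lambda>x l. \<rho>L x (\<lambda>y c. \<phi> y * g1 c * g2 l))"
        by (rule bilin_mapI, rule lf_tensor_apply[OF \<rho>L], rule lf_tensor_param[OF \<rho>La A vL vL trilin_bf3[OF T] trilin_lf3[OF T]])
      from tmap_apply[OF A vB lin_id' fl this \<rho>a, of a] show ?thesis by (simp add: f\<rho>)
    qed
    also have "\<dots> = \<rho>L a (\<lambda>x l. bdelta L l (\<lambda>u v. \<phi> x * g1 u * g2 v))"
      by (rule coaction_apply[OF om L T])
    also have "\<dots> = \<rho>L a (\<lambda>x l. \<phi> x * bdelta L l (\<lambda>u v. g1 u * g2 v))"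
      by (rule tensor_apply_cong[OF \<rho>La A vL])
        (simp add: tensor_scale_left[OF lin_mem[OF bi_delta[OF bL]] vL vL bf_prod[OF g1 g2], symmetric] mult.assoc)
    also have "\<dots> = \<rho> a (\<lambda>x b. \<phi> x * bdelta L (f b) (\<lambda>u v. g1 u * g2 v))"
    proof -
      have "bf A L (\<lambda>x l. \<phi> x * bdelta L l (\<lambda>u v. g1 u * g2 v))"
        by (rule bf_prod[OF \<phi> lf_tensor_apply[OF bi_delta[OF bL]]])
      from tmap_apply[OF A vB lin_id' fl this \<rho>a, of a] show ?thesis by (simp add: f\<rho>)
    qed
    also have "\<dots> = tmap A B A (tensor_space L L) id (\<lambda>b. bdelta L (f b)) (\<rho> a) (\<lambda>v w. \<phi> v * g w)"
      unfolding tmap_apply[OF A vB lin_id' l1 b \<rho>a] by (simp add: g)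
    finally show "tmap A B A (tensor_space L L) id (\<lambda>b. bdelta L (f b)) (\<rho> a) (\<lambda>v w. \<phi> v * g w)
      = tmap A B A (tensor_space L L) id (\<lambda>b. tmap B B L L f f (bdelta B b)) (\<rho> a) (\<lambda>v w. \<phi> v * g w)" by simp
  qed
  have delta: "bdelta L (f b) = tmap B B L L f f (bdelta B b)" if "b \<in> vcar B" for b
    using uniq[OF Q smQ h1 h2 _ that] eqd by simp
  have e1: "alg_hom B ground (\<lambda>b. beps L (f b))" by (rule alg_hom_comp[OF f bi_eps_hom[OF bL]])
  note el = alg_hom_lin[OF e1] and e2 = bi_eps_hom[OF B]
  have eqe: "tmap A B A ground id (\<lambda>b. beps L (f b)) (\<rho> a) = tmap A B A ground id (beps B) (\<rho> a)" for a
  proof (rule tensor_eqI[OF A vspace_ground separates_all[OF A]])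
    show "separates (ground :: ('k, 'k) alg) {\<lambda>x. x}" by (simp add: separates_def lin_id)
    show "tmap A B A ground id (\<lambda>b. beps L (f b)) (\<rho> a) \<in> vcar (tensor_space A (ground :: ('k, 'k) alg))"
      "tmap A B A ground id (beps B) (\<rho> a) \<in> vcar (tensor_space A (ground :: ('k, 'k) alg))"
      by (rule tmap_mem[OF A vB lin_id' _ \<rho>a], rule el bi_eps[OF B])+
    fix \<phi> g assume "\<phi> \<in> {f. lf A f}" "g \<in> {\<lambda>x :: 'k. x}"
    then have \<phi>: "lf A \<phi>" and g: "g = (\<lambda>x. x)" by auto
    have bg: "bf A ground (\<lambda>v w. \<phi> v * g w)" unfolding g by (rule bf_prod[OF \<phi> lin_id])
    have "tmap A B A ground id (\<lambda>b. beps L (f b)) (\<rho> a) (\<lambda>v w. \<phi> v * g w) = tmap A B A L id f (\<rho> a) (\<lambda>x l. \<phi> x * beps L l)"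
      unfolding tmap_apply[OF A vB lin_id' el bg \<rho>a] tmap_apply[OF A vB lin_id' fl bf_prod[OF \<phi> bi_eps[OF bL]] \<rho>a]
      by (simp add: g)
    also have "\<dots> = \<phi> a"
      unfolding f\<rho> contract_apply[OF A vL bi_eps[OF bL] \<phi> \<rho>La, symmetric] coaction_counit[OF L] ..
    also have "\<dots> = \<rho> a (\<lambda>x b. \<phi> x * beps B b)"
      unfolding contract_apply[OF A vB bi_eps[OF B] \<phi> \<rho>a, symmetric] coaction_counit[OF coB] ..
    also have "\<dots> = tmap A B A ground id (beps B) (\<rho> a) (\<lambda>v w. \<phi> v * g w)"
      unfolding tmap_apply[OF A vB lin_id' bi_eps[OF B] bg \<rho>a] by (simp add: g)
    finally show "tmap A B A ground id (\<lambda>b. beps L (f b)) (\<rho> a) (\<lambda>v w. \<phi> v * g w) = tmap A B A ground id (beps B) (\<rho> a) (\<lambda>v w. \<phi> v * g w)" .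
  qed
  have aG: "algebra (ground :: ('k, 'k) alg)"
    by (auto simp: algebra_def intro!: bilin_mapI lf_mult_left lf_mult_right lin_id)
  have "beps L (f b) = beps B b" if "b \<in> vcar B" for b
    by (rule uniq[OF aG small_ground e1 e2 eqe that])
  then show ?thesis using f fl delta by (simp add: bialg_hom_def coalg_hom_def)
qed

lemma action_coaction:
  assumes om: "omega_algebra A" and ac: "bialg_action K A \<psi>"
    and fin: "\<And>a. \<exists>S. finite S \<and> (\<forall>k\<in>vcar K. \<psi> k a \<in> module.span (vscale A) S)"
  shows "\<exists>\<rho>. bialg_coaction (finite_dual K) A \<rho> \<and> (\<forall>k\<in>vcar K. \<forall>a. contract A (finite_dual K) (\<lambda>f. f k) (\<rho> a) = \<psi> k a)"
proof -
  note K = action_bialg[OF ac] and A = omegaD(1)[OF om] and AU = omegaD(2)[OF om] and b = action_bilin[OF ac]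
  note D = finite_dual_bialgebra[OF K]
  note vK = bi_vspace[OF K] and vD = bi_vspace[OF D] and QK = bi_alg[OF K]
  let ?D = "finite_dual K"
  have "\<exists>X \<in> vcar (tensor_space A ?D). \<forall>k\<in>vcar K. contract A ?D (\<lambda>f. f k) X = \<psi> k a" for a
  proof -
    obtain S where S: "finite S" "\<forall>k\<in>vcar K. \<psi> k a \<in> module.span (vscale A) S" using fin by blast
    obtain I c where I: "finite I" "\<And>i. Vector_Spaces.linear (vscale A) (*) (c i)"
      "\<And>x. x \<in> module.span (vscale A) S \<Longrightarrow> x = (\<Sum>i\<in>I. vscale A (c i x) i)"
      by (rule finite_span_coordinates[OF vspace_vector_space[OF A] S(1)]) blast
    note cl = linear_lf[OF I(2)]
    \<comment> \<open>The coordinate at the basis vector \<open>i\<close> of the orbit map of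
      \<open>a\<close>, set to 0 off the carrier as the finite dual requires.\<close>
    define F where "F i k = (if k \<in> vcar K then c i (\<psi> k a) else 0)" for i k
    have lc: "lf K (\<lambda>k. c i (\<psi> k x))" for i x by (rule lin_comp[OF cl bilin_left[OF b AU]])
    \<comment> \<open>The factorisation records that \<open>y\<close> moves \<open>a\<close> to a
      combination of \<open>I\<close>, whose members are then moved by \<open>x\<close>. They may
      leave the span, but \<open>c i\<close> is linear on all of \<open>A\<close>.\<close>
    have FD: "F i \<in> finite_dual_carrier K" for i
    proof (rule finite_dual_carrierI[OF QK, of _ I "\<lambda>j k. c i (\<psi> k j)" "\<lambda>j k. c j (\<psi> k a)"])
      show "lf K (F i)" by (rule lin_cong[OF lc[of i a] vK]) (simp add: F_def)
      fix x y assume x: "x \<in> vcar K" and y: "y \<in> vcar K"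
      note lx = lin_comp[OF cl bilin_right[OF b x]]
      have "F i (amult K x y) = c i (\<psi> x (\<psi> y a))" by (simp add: F_def alg_mult[OF QK x y] action_mult[OF ac x y])
      also have "\<psi> y a = (\<Sum>j\<in>I. vscale A (c j (\<psi> y a)) j)" by (rule I(3)) (use S(2) y in blast)
      also have "c i (\<psi> x \<dots>) = (\<Sum>j\<in>I. c i (\<psi> x (vscale A (c j (\<psi> y a)) j)))"
        by (rule lin_sum[OF lx A]) (rule AU)
      also have "\<dots> = (\<Sum>j\<in>I. c i (\<psi> x j) * c j (\<psi> y a))"
        using lin_scale[OF lx AU] by (simp add: mult.commute)
      finally show "F i (amult K x y) = (\<Sum>j\<in>I. c i (\<psi> x j) * c j (\<psi> y a))" .
    qed (use I(1) lc in \<open>auto simp: F_def\<close>)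
    let ?X = "\<Sum>i\<in>I. tens A ?D i (F i)"
    have t: "tens A ?D i (F i) \<in> vcar (tensor_space A ?D)" for i by (rule tens_mem[OF AU]) (simp add: FD)
    have "contract A ?D (\<lambda>f. f k) ?X = \<psi> k a" if k: "k \<in> vcar K" for k
    proof -
      have "contract A ?D (\<lambda>f. f k) ?X = (\<Sum>i\<in>I. contract A ?D (\<lambda>f. f k) (tens A ?D i (F i)))"
        by (rule lin_sum[OF contract_lin[OF A vD lf_eval] vspace_tensor t])
      also have "\<dots> = (\<Sum>i\<in>I. vscale A (c i (\<psi> k a)) i)"
        using FD by (simp add: contract_tens[OF A vD lf_eval AU] F_def k)
      also have "\<dots> = \<psi> k a" by (rule I(3)[symmetric]) (use S(2) k in blast)
      finally show ?thesis .
    qed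
    moreover have "?X \<in> vcar (tensor_space A ?D)" by (rule vs_sum[OF vspace_tensor t])
    ultimately show ?thesis by blast
  qed
  then obtain \<rho> where "\<forall>a. \<rho> a \<in> vcar (tensor_space A ?D) \<and> (\<forall>k\<in>vcar K. contract A ?D (\<lambda>f. f k) (\<rho> a) = \<psi> k a)" by metis
  then have \<rho>m: "\<rho> a \<in> vcar (tensor_space A ?D)" and \<rho>k: "k \<in> vcar K \<Longrightarrow> contract A ?D (\<lambda>f. f k) (\<rho> a) = \<psi> k a" for a k by auto
  have ap: "\<rho> a (\<lambda>x f. \<phi> x * f k) = \<phi> (\<psi> k a)" if "lf A \<phi>" "k \<in> vcar K" for a \<phi> k
  proof -
    have "\<phi> (contract A ?D (\<lambda>f. f k) (\<rho> a)) = \<rho> a (\<lambda>v w. \<phi> v * w k)" by (rule contract_apply[OF A vD lf_eval that(1) \<rho>m])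
    then show ?thesis using \<rho>k[OF that(2)] by simp
  qed
  note sep = tensor_eqI[OF A vD separates_all[OF A] separates_evals]
  \<comment> \<open>The tensors \<open>\<rho> a\<close> were chosen separately for each
    \<open>a\<close>. Being determined by their contractions with evaluations, they nevertheless
    depend linearly on \<open>a\<close>.\<close>
  have \<rho>l: "lin_map A (tensor_space A ?D) \<rho>"
  proof (rule lin_mapI)
    fix x y c show "\<rho> x \<in> vcar (tensor_space A ?D)" by (rule \<rho>m)
    show "\<rho> (x + y) = \<rho> x + \<rho> y"
    proof (rule sep[OF \<rho>m vs_add[OF vspace_tensor \<rho>m \<rho>m]])
      fix f g assume "f \<in> {f. lf A f}" "g \<in> evals K"
      then obtain k where f: "lf A f" and g: "g = (\<lambda>f. f k)" and k: "k \<in> vcar K" by auto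
      show "\<rho> (x + y) (\<lambda>v w. f v * g w) = (\<rho> x + \<rho> y) (\<lambda>v w. f v * g w)"
        using lin_add[OF lin_comp[OF f bilin_right[OF b k]] AU AU, of x y] by (simp add: g ap[OF f k])
    qed
    show "\<rho> (vscale A c x) = vscale (tensor_space A ?D) c (\<rho> x)"
    proof (rule sep[OF \<rho>m vs_scale[OF vspace_tensor \<rho>m]])
      fix f g assume "f \<in> {f. lf A f}" "g \<in> evals K"
      then obtain k where f: "lf A f" and g: "g = (\<lambda>f. f k)" and k: "k \<in> vcar K" by auto
      show "\<rho> (vscale A c x) (\<lambda>v w. f v * g w) = vscale (tensor_space A ?D) c (\<rho> x) (\<lambda>v w. f v * g w)"
        using lin_scale[OF lin_comp[OF f bilin_right[OF b k]] AU, of c x] by (simp add: g ap[OF f k])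
    qed
  qed
  have com: "comeasuring ?D A \<rho>"
    by (rule pairing_comeasuring[OF bi_coalg[OF K] bi_alg[OF D] A \<rho>l finite_dual_eval_right(1-3)[OF K] _ om action_meas[OF ac] finite_dual_eval_right(4)[OF K]])
      (simp_all add: \<rho>k)
  have co: "tassoc A ?D ?D (tmap A ?D (tensor_space A ?D) ?D \<rho> id (\<rho> a)) = tmap A ?D A (tensor_space ?D ?D) id (bdelta ?D) (\<rho> a)" for a
  proof (rule tassoc_eqI[OF A vD vD A vD \<rho>l bi_delta[OF D] \<rho>m \<rho>m separates_all[OF A] separates_evals separates_evals])
    fix \<phi> g h assume "\<phi> \<in> {f. lf A f}" "g \<in> evals K" "h \<in> evals K"
    then obtain k l where \<phi>: "lf A \<phi>" and g: "g = (\<lambda>f. f k)" and k: "k \<in> vcar K" and h: "h = (\<lambda>f. f l)" and l: "l \<in> vcar K" by auto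
    have "\<rho> a (\<lambda>m c. \<rho> m (\<lambda>x f. \<phi> x * g f * h c)) = \<rho> a (\<lambda>m c. \<phi> (\<psi> k m) * c l)"
      by (rule tensor_apply_cong[OF \<rho>m A vD])
        (simp add: g h tensor_scale_right[OF \<rho>m A vD bf_prod[OF \<phi> lf_eval]] ap[OF \<phi> k])
    also have "\<dots> = \<phi> (\<psi> k (\<psi> l a))"
      by (rule ap[OF lin_comp[OF \<phi> bilin_right[OF b k]] l])
    also have "\<dots> = \<rho> a (\<lambda>x f. \<phi> x * f (amult K k l))"
      using ap[OF \<phi> alg_mult[OF QK k l], of a] by (simp add: action_mult[OF ac k l])
    also have "\<dots> = \<rho> a (\<lambda>x n. bdelta ?D n (\<lambda>f f'. \<phi> x * g f * h f'))"
    proof (rule tensor_apply_cong[OF \<rho>m A vD])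
      fix x n assume "n \<in> vcar ?D"
      then have n: "n \<in> finite_dual_carrier K" by simp
      show "\<phi> x * n (amult K k l) = bdelta ?D n (\<lambda>f f'. \<phi> x * g f * h f')"
        using tensor_scale_left[OF finite_dual_delta_mem[OF K n] vD vD bf_prod[OF lf_eval lf_eval], of "\<phi> x" k l]
        by (simp add: g h finite_dual_delta[OF K n k l] mult.assoc)
    qed
    finally show "\<rho> a (\<lambda>m c. \<rho> m (\<lambda>x f. \<phi> x * g f * h c)) = \<rho> a (\<lambda>x n. bdelta ?D n (\<lambda>f f'. \<phi> x * g f * h f'))" .
  qed
  have "contract A ?D (beps ?D) (\<rho> a) = a" for a
    using \<rho>k[OF alg_one[OF QK], of a] by (simp add: action_one[OF ac])
  then have "bialg_coaction ?D A \<rho>" using D com co by (simp add: bialg_coaction_def)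
  then show ?thesis using \<rho>k by blast
qed

section \<open>Matrix coefficients\<close>

text \<open>A matrix representation of \<open>Q\<close> with entries in the finite dual. Each entry
  is a functional, so that maps of the finite dual can be applied entrywise.\<close>

definition coefficients :: "('k::field, 'u::ab_group_add, 'z) alg_scheme \<Rightarrow> 'i set \<Rightarrow> ('i \<Rightarrow> 'i \<Rightarrow> 'u \<Rightarrow> 'k) \<Rightarrow> bool" where
  "coefficients Q C M \<longleftrightarrow> finite C \<and> (\<forall>i\<in>C. \<forall>j\<in>C. M i j \<in> finite_dual_carrier Q \<and>
     M i j (aone Q) = (if i = j then 1 else 0) \<and>
     (\<forall>x\<in>vcar Q. \<forall>y\<in>vcar Q. M i j (amult Q x y) = (\<Sum>l\<in>C. M i l x * M l j y)))"

lemma coefficientsD: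
  assumes "coefficients Q C M"
  shows "finite C" "i \<in> C \<Longrightarrow> j \<in> C \<Longrightarrow> M i j \<in> finite_dual_carrier Q"
    "i \<in> C \<Longrightarrow> j \<in> C \<Longrightarrow> M i j (aone Q) = (if i = j then 1 else 0)"
    "i \<in> C \<Longrightarrow> j \<in> C \<Longrightarrow> x \<in> vcar Q \<Longrightarrow> y \<in> vcar Q \<Longrightarrow> M i j (amult Q x y) = (\<Sum>l\<in>C. M i l x * M l j y)"
  using assms by (auto simp: coefficients_def)

text \<open>The matrix coefficients of the left regular representation on the quotient by an ideal annihilated by \<open>f\<close>.\<close>

lemma coefficients_exist:
  fixes Q :: "('k::field, 'u::ab_group_add, 'z) alg_scheme"
  assumes Q: "algebra Q" and f: "f \<in> finite_dual_carrier Q"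
  shows "\<exists>(C :: 'u set) M u v. coefficients Q C M \<and> (\<forall>x\<in>vcar Q. f x = (\<Sum>i\<in>C. \<Sum>j\<in>C. u i * v j * M j i x))"
proof -
  note vs = alg_vspace[OF Q] and mb = alg_bilin[OF Q] and mm = alg_mult[OF Q] and fl = finite_dual_carrierD[OF f]
  obtain I C c where I: "finite_codim_ideal Q I" "\<forall>x\<in>I. f x = 0" and C': "finite C" "C \<subseteq> vcar Q" "\<forall>b\<in>C. lf Q (c b)"
    "\<forall>b\<in>C. \<forall>x\<in>I. c b x = 0" "\<forall>b\<in>C. \<forall>b'\<in>C. c b b' = (if b' = b then 1 else 0)"
    and key0: "\<forall>g. lf Q g \<longrightarrow> (\<forall>x\<in>I. g x = 0) \<longrightarrow> (\<forall>y\<in>vcar Q. g y = (\<Sum>b\<in>C. c b y * g b))"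
    using finite_dual_coordinates[OF Q f] by blast
  have IQ: "I \<subseteq> vcar Q" and Ii: "\<And>x y. x \<in> vcar Q \<Longrightarrow> y \<in> I \<Longrightarrow> amult Q x y \<in> I \<and> amult Q y x \<in> I"
    using I(1) by (auto simp: finite_codim_ideal_def)
  note C = C'(1) bspec[OF bspec[OF C'(4)]] bspec[OF bspec[OF C'(5)]] and CQ = subsetD[OF C'(2)] and cl = bspec[OF C'(3)]
  note key = key0[THEN spec, THEN mp, THEN mp, THEN bspec]
  \<comment> \<open>The entry in row \<open>j\<close> and column \<open>i\<close> of left
    multiplication by \<open>x\<close> on the quotient by \<open>I\<close>, with basis
    \<open>C\<close>.\<close>
  define M where "M j i x = (if x \<in> vcar Q then c j (amult Q x i) else 0)" for j i x
  have "coefficients Q C M"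
    unfolding coefficients_def
  proof (intro conjI ballI)
    show "finite C" by (rule C(1))
    fix i j assume i: "i \<in> C" and j: "j \<in> C"
    have "lf Q (M i j)"
      by (rule lin_cong[OF lin_comp[OF cl[OF i] bilin_left[OF mb CQ[OF j]]] vs]) (simp add: M_def)
    then show "M i j \<in> finite_dual_carrier Q"
      using I(1) Ii[OF CQ[OF j]] C(2)[OF i] IQ by (auto simp: finite_dual_carrier_def M_def intro!: exI[of _ I])
    show "M i j (aone Q) = (if i = j then 1 else 0)"
      using C(3)[OF i j] by (auto simp: M_def alg_one[OF Q] alg_one_left[OF Q CQ[OF j]])
    fix x y assume x: "x \<in> vcar Q" and y: "y \<in> vcar Q"
    have "c i (amult Q x (amult Q y j)) = (\<Sum>l\<in>C. c l (amult Q y j) * c i (amult Q x l))"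
      by (rule key[OF lin_comp[OF cl[OF i] bilin_right[OF mb x]]])
        (use Ii[OF x] C(2)[OF i] mm[OF y CQ[OF j]] in auto)
    then show "M i j (amult Q x y) = (\<Sum>l\<in>C. M i l x * M l j y)"
      by (simp add: M_def x y mm[OF x y] alg_assoc[OF Q x y CQ[OF j]] mult.commute)
  qed
  \<comment> \<open>Written as x times 1: the unit is expanded in \<open>C\<close> modulo the ideal,
    and \<open>f\<close> weighs the resulting columns by its values on \<open>C\<close>.\<close>
  moreover have "f x = (\<Sum>i\<in>C. \<Sum>j\<in>C. c i (aone Q) * f j * M j i x)" if x: "x \<in> vcar Q" for x
  proof -
    have "f (amult Q x (aone Q)) = (\<Sum>i\<in>C. c i (aone Q) * f (amult Q x i))"
      by (rule key[OF lin_comp[OF fl(1) bilin_right[OF mb x]]])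
        (use Ii[OF x] I(2) alg_one[OF Q] in auto)
    also have "\<dots> = (\<Sum>i\<in>C. c i (aone Q) * (\<Sum>j\<in>C. c j (amult Q x i) * f j))"
      using key[OF fl(1) I(2) mm[OF x CQ]] by simp
    finally show ?thesis by (simp add: alg_one_right[OF Q x] M_def x sum_distrib_left mult_ac)
  qed
  ultimately show ?thesis
    by (intro exI[of _ C] exI[of _ M] exI[of _ "\<lambda>i. c i (aone Q)"] exI[of _ f] conjI ballI)
qed

text \<open>Matrices as functions on pairs, extended by 0 off the index set. With indices in
  \<open>'u\<close> such functions embed into functions on lists, so the algebra can serve as a test
  object.\<close>

definition mat_alg :: "'i set \<Rightarrow> ('k::field, 'i \<times> 'i \<Rightarrow> 'k) alg" where
  "mat_alg C = \<lparr>vcar = {X. \<forall>z. z \<notin> C \<times> C \<longrightarrow> X z = 0}, vscale = fscale,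
     amult = (\<lambda>X Y (i, j). if i \<in> C \<and> j \<in> C then \<Sum>l\<in>C. X (i, l) * Y (l, j) else 0),
     aone = (\<lambda>(i, j). if i \<in> C \<and> i = j then 1 else 0)\<rparr>"

lemma mat_alg_simps [simp]: "X \<in> vcar (mat_alg C) \<longleftrightarrow> (\<forall>i j. (i, j) \<notin> C \<times> C \<longrightarrow> X (i, j) = 0)"
  "vscale (mat_alg C) = fscale"
  "amult (mat_alg C) X Y (i, j) = (if i \<in> C \<and> j \<in> C then \<Sum>l\<in>C. X (i, l) * Y (l, j) else 0)"
  "aone (mat_alg C) (i, j) = (if i \<in> C \<and> i = j then 1 else 0)"
  by (auto simp: mat_alg_def)

lemma vspace_mat: "vspace (mat_alg C)"
  by (rule vspaceI) (auto simp: vector_space_fscale fscale_def)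

lemma mat_algebra:
  assumes C: "finite C"
  shows "algebra (mat_alg C :: ('k::field, 'i \<times> 'i \<Rightarrow> 'k) alg)"
  unfolding algebra_def
proof (intro conjI ballI)
  let ?M = "mat_alg C :: ('k, 'i \<times> 'i \<Rightarrow> 'k) alg"
  show "vspace ?M" by (rule vspace_mat)
  show "bilin_map ?M ?M ?M (amult ?M)"
    by (intro bilin_mapI lin_mapI)
      (auto simp: fun_eq_iff fscale_def sum.distrib distrib_left distrib_right sum_distrib_left mult_ac)
  show "aone ?M \<in> vcar ?M" by auto
  fix X assume X: "X \<in> vcar ?M"
  have "(\<Sum>l\<in>C. (if i \<in> C \<and> i = l then 1 else 0) * X (l, j)) = X (i, j)" if "i \<in> C" for i j
    using that C by (simp add: sum.remove[of C i]) (auto intro!: sum.neutral split: if_splits)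
  then show "amult ?M (aone ?M) X = X" using X by (auto simp: fun_eq_iff)
  have "(\<Sum>l\<in>C. X (i, l) * (if l \<in> C \<and> l = j then 1 else 0)) = X (i, j)" if "j \<in> C" for i j
    using that C by (simp add: sum.remove[of C j])
  then show "amult ?M X (aone ?M) = X" using X by (auto simp: fun_eq_iff)
  fix Y Z :: "'i \<times> 'i \<Rightarrow> 'k"
  have "(\<Sum>l\<in>C. (\<Sum>m\<in>C. X (i, m) * Y (m, l)) * Z (l, j)) = (\<Sum>l\<in>C. X (i, l) * (\<Sum>m\<in>C. Y (l, m) * Z (m, j)))" for i j
    unfolding sum_distrib_left sum_distrib_right mult.assoc by (rule sum.swap)
  then show "amult ?M (amult ?M X Y) Z = amult ?M X (amult ?M Y Z)" by (auto simp: fun_eq_iff)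
qed

definition mat_map :: "'i set \<Rightarrow> ('i \<Rightarrow> 'i \<Rightarrow> 'u \<Rightarrow> 'k::field) \<Rightarrow> 'u \<Rightarrow> 'i \<times> 'i \<Rightarrow> 'k" where
  "mat_map C M x = (\<lambda>(i, j). if i \<in> C \<and> j \<in> C then M i j x else 0)"

lemma mat_map_apply [simp]: "mat_map C M x (i, j) = (if i \<in> C \<and> j \<in> C then M i j x else 0)"
  by (simp add: mat_map_def)

lemma mat_map_alg_hom:
  assumes Q: "algebra Q" and M: "coefficients Q C M"
  shows "alg_hom Q (mat_alg C) (mat_map C M)"
proof -
  note Ml = finite_dual_carrierD(1)[OF coefficientsD(2)[OF M]]
  have "lin_map Q (mat_alg C) (mat_map C M)"
    by (rule lin_mapI) (auto simp: fun_eq_iff fscale_def lin_add[OF Ml] lin_scale[OF Ml])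
  then show ?thesis
    unfolding alg_hom_def
    by (auto simp: fun_eq_iff coefficientsD(3,4)[OF M])
qed

lemma small_mat_alg: "small TYPE('u) (mat_alg C :: ('k::field, 'u \<times> 'u \<Rightarrow> 'k) alg)"
  by (rule small_functions[OF _ surj_hd2]) simp

lemma separates_entries: "separates (mat_alg C :: ('k::field, 'i \<times> 'i \<Rightarrow> 'k) alg) {\<lambda>X. X (i, j) | i j. True}"
proof -
  have "X = 0" if "\<forall>f\<in>{\<lambda>X. X (i, j) | i j. True}. f X = (0::'k)" for X :: "'i \<times> 'i \<Rightarrow> 'k"
    using bspec[OF that, of "\<lambda>X. X (i, j)" for i j] by (auto simp: fun_eq_iff)
  moreover have "lf (mat_alg C) f" if "f \<in> {\<lambda>X. X (i, j) | i j. True}" for f :: "_ \<Rightarrow> 'k"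
    using that by (auto intro!: lin_mapI simp: fscale_def)
  ultimately show ?thesis by (auto simp: separates_def)
qed

text \<open>In the finite dual the coproduct of an entry follows the rule of matrix multiplication,
  so a coalgebra endomorphism applied entrywise gives a representation again.\<close>

lemma coefficients_coalg_hom:
  assumes H: "bialgebra H" and M: "coefficients H C M" and g: "coalg_hom (coalg_of (finite_dual H)) (coalg_of (finite_dual H)) g"
  shows "coefficients H C (\<lambda>i j. g (M i j))"
  unfolding coefficients_def
proof (intro conjI ballI)
  let ?D = "finite_dual H"
  note M' = coefficientsD[OF M]
  have cD: "coalgebra (coalg_of ?D)" by (rule bi_coalg[OF finite_dual_bialgebra[OF H]])
  note vD = bi_vspace[OF finite_dual_bialgebra[OF H]]
  have gl: "lin_map ?D ?D g" using coalg_hom_lin[OF g] by simp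
  show "finite C" by (rule M'(1))
  fix i j assume i: "i \<in> C" and j: "j \<in> C"
  show gM: "g (M i j) \<in> finite_dual_carrier H" using lin_mem[OF gl] M'(2)[OF i j] by simp
  show "g (M i j) (aone H) = (if i = j then 1 else 0)"
    using coalg_hom_eps[OF g, of "M i j"] M'(2,3)[OF i j] by simp
  fix x y assume x: "x \<in> vcar H" and y: "y \<in> vcar H"
  have b: "bf ?D ?D (\<lambda>f h. f x * h y)" by (rule bf_prod[OF lf_eval lf_eval])
  have b': "bf ?D ?D (\<lambda>f h. g f x * g h y)"
    by (rule bf_prod[OF lin_comp[OF lf_eval gl] lin_comp[OF lf_eval gl]])
  have t: "tens ?D ?D (M i l) (M l j) \<in> vcar (tensor_space ?D ?D)" if "l \<in> C" for l
    by (rule tens_mem) (simp_all add: M'(2) i j that)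
  have D: "bdelta ?D (M i j) = (\<Sum>l\<in>C. tens ?D ?D (M i l) (M l j))"
  proof (rule tensor_eqI[OF vD vD separates_evals separates_evals finite_dual_delta_mem[OF H M'(2)[OF i j]] vs_sum[OF vspace_tensor t]], assumption)
    fix e1 e2 assume "e1 \<in> evals H" "e2 \<in> evals H"
    then obtain x y where e: "e1 = (\<lambda>f. f x)" "e2 = (\<lambda>f. f y)" and x: "x \<in> vcar H" and y: "y \<in> vcar H" by auto
    show "bdelta ?D (M i j) (\<lambda>v w. e1 v * e2 w) = (\<Sum>l\<in>C. tens ?D ?D (M i l) (M l j)) (\<lambda>v w. e1 v * e2 w)"
      unfolding e by (simp add: finite_dual_delta[OF H M'(2)[OF i j] x y] M'(4)[OF i j x y] 
        tens_apply[OF bf_prod[OF lf_eval lf_eval]] M'(2) i j)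
  qed
  have "g (M i j) (amult H x y) = bdelta ?D (g (M i j)) (\<lambda>f h. f x * h y)"
    by (rule finite_dual_delta[OF H gM x y, symmetric])
  also have "\<dots> = bdelta ?D (M i j) (\<lambda>f h. g f x * g h y)"
    using coalg_hom_apply[OF cD g, of "M i j" "\<lambda>f h. f x * h y"] M'(2)[OF i j] b by simp
  also have "\<dots> = (\<Sum>l\<in>C. g (M i l) x * g (M l j) y)"
    unfolding D by (simp add: tens_apply[OF b'] M'(2) i j)
  finally show "g (M i j) (amult H x y) = (\<Sum>l\<in>C. g (M i l) x * g (M l j) y)" .
qed

text \<open>Meant for \<beta>\<theta>. Single elements of the finite dual need not be determined by
  their operators on \<open>A\<close>; it is the compatibility of \<open>g\<close> with coproducts
  that makes \<open>?q\<close> an algebra map, which can then be compared with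
  \<open>?p\<close>.\<close>

lemma dual_action_faithful:
  assumes large: "large_universe TYPE('k::field) TYPE('u::ab_group_add) TYPE('t::ab_group_add)"
    and om: "omega_algebra (A :: ('k, 'a::ab_group_add, 'o) omega_alg)"
    and U: "universal_coacting_bialgebra TYPE('t) A V (B :: ('k, 'u) bialg) \<rho>"
    and L: "hopf_left_adjoint TYPE('t) B (H :: ('k, 'u) bialg) \<eta>"
    and g: "coalg_hom (coalg_of (finite_dual H)) (coalg_of (finite_dual H)) g"
    and ga: "\<And>f a. f \<in> finite_dual_carrier H \<Longrightarrow>
      dual_action H A (\<lambda>a. tmap A B A H id \<eta> (\<rho> a)) (g f) a = dual_action H A (\<lambda>a. tmap A B A H id \<eta> (\<rho> a)) f a"
    and f: "f \<in> finite_dual_carrier H"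
  shows "g f = f"
proof (rule ext)
  fix x
  let ?\<rho> = "\<lambda>a. tmap A B A H id \<eta> (\<rho> a)"
  have co: "bialg_coaction B A \<rho>" and cV: "cosupp_comeas B A \<rho> \<subseteq> V"
    using U by (auto simp: universal_coacting_bialgebra_def)
  have H: "bialgebra H" and \<eta>: "bialg_hom B H \<eta>" using L by (auto simp: hopf_left_adjoint_def hopf_algebra_def)
  note B = coaction_bialg[OF co] and A = omegaD(1)[OF om] and \<rho> = coaction_lin[OF co]
  note vB = bi_vspace[OF B] and vH = bi_vspace[OF H] and \<rho>a = lin_mem[OF \<rho> omegaD(2)[OF om]] and QH = bi_alg[OF H]
  have \<eta>h: "alg_hom B H \<eta>" using \<eta> by (simp add: bialg_hom_def)
  note \<eta>l = alg_hom_lin[OF \<eta>h]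
  have \<rho>': "lin_map A (tensor_space A H) ?\<rho>" by (rule lin_comp[OF tmap_lin[OF A vB lin_id' \<eta>l] \<rho>])
  have gl: "lin_map (finite_dual H) (finite_dual H) g" using coalg_hom_lin[OF g] by simp
  have gm: "g f \<in> finite_dual_carrier H" if "f \<in> finite_dual_carrier H" for f using lin_mem[OF gl] that by simp
  obtain C :: "'u set" and M u v where M: "coefficients H C M" and fM: "\<forall>x\<in>vcar H. f x = (\<Sum>i\<in>C. \<Sum>j\<in>C. u i * v j * M j i x)"
    using coefficients_exist[OF QH f] by blast
  note N = coefficients_coalg_hom[OF H M g]
  let ?R = "mat_alg C :: ('k, 'u \<times> 'u \<Rightarrow> 'k) alg"
  let ?p = "mat_map C M" and ?q = "mat_map C (\<lambda>i j. g (M i j))"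
  have R: "algebra ?R" by (rule mat_algebra[OF coefficientsD(1)[OF M]])
  note p = mat_map_alg_hom[OF QH M] and q = mat_map_alg_hom[OF QH N]
  have p\<eta>: "alg_hom B ?R (\<lambda>b. ?p (\<eta> b))" and q\<eta>: "alg_hom B ?R (\<lambda>b. ?q (\<eta> b))"
    by (rule alg_hom_comp[OF \<eta>h p], rule alg_hom_comp[OF \<eta>h q])
  note pl = alg_hom_lin[OF p\<eta>] and ql = alg_hom_lin[OF q\<eta>]
  have eq: "tmap A B A ?R id (\<lambda>b. ?p (\<eta> b)) (\<rho> a) = tmap A B A ?R id (\<lambda>b. ?q (\<eta> b)) (\<rho> a)" for a
  proof (rule tensor_eqI[OF A vspace_mat separates_all[OF A] separates_entries tmap_mem[OF A vB lin_id' pl \<rho>a] tmap_mem[OF A vB lin_id' ql \<rho>a]])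
    fix \<phi> and e :: "('u \<times> 'u \<Rightarrow> 'k) \<Rightarrow> 'k" assume "\<phi> \<in> {f. lf A f}" and e0: "e \<in> {\<lambda>X. X (i, j) | i j. True}"
    then obtain i j where \<phi>: "lf A \<phi>" and e: "e = (\<lambda>X. X (i, j))" by auto
    note b = bf_prod[OF \<phi> separatesD[OF separates_entries e0]]
    \<comment> \<open>Pairing the pushed-forward coaction with \<open>F\<close> gives the operator
      of \<open>F\<close> on \<open>A\<close>. An entry and its image under \<open>g\<close> have
      the same operator, so the two comeasurings have equal entries.\<close>
    have s: "\<rho> a (\<lambda>v w. \<phi> v * F (\<eta> w)) = \<phi> (dual_action H A ?\<rho> F a)" if F: "F \<in> finite_dual_carrier H" for F
      using dual_action_apply[OF om vH \<rho>' finite_dual_carrierD(1)[OF F] \<phi>, of a]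
      by (simp add: tmap_apply[OF A vB lin_id' \<eta>l bf_prod[OF \<phi> finite_dual_carrierD(1)[OF F]] \<rho>a])
    show "tmap A B A ?R id (\<lambda>b. ?p (\<eta> b)) (\<rho> a) (\<lambda>v w. \<phi> v * e w) = tmap A B A ?R id (\<lambda>b. ?q (\<eta> b)) (\<rho> a) (\<lambda>v w. \<phi> v * e w)"
      unfolding tmap_apply[OF A vB lin_id' pl b \<rho>a] tmap_apply[OF A vB lin_id' ql b \<rho>a]
      using s[OF coefficientsD(2)[OF M]] s[OF gm[OF coefficientsD(2)[OF M]]] ga[OF coefficientsD(2)[OF M]]
        lin_zero[OF lf_apply vspace_tensor]
      by (cases "i \<in> C \<and> j \<in> C") (auto simp: e)
  qed
  obtain s and j :: "_ \<Rightarrow> 't" where j: "embeds ?R s j" using small_embeds[OF large small_mat_alg[of C]] by metis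
  have "ex_unique_on (vcar B) (\<lambda>\<phi>. alg_hom B ?R \<phi> \<and> (\<forall>a. tmap A B A ?R id \<phi> (\<rho> a) = tmap A B A ?R id (\<lambda>b. ?p (\<eta> b)) (\<rho> a)))"
    by (rule universal_coacting_embeds[OF U om R j comeasuring_hom[OF om coaction_comeas[OF co] R p\<eta>]])
      (use cosupp_tmap[OF om vB vspace_mat \<rho> pl] cV in blast)
  then obtain m where m: "\<And>\<phi> b. alg_hom B ?R \<phi> \<Longrightarrow> \<forall>a. tmap A B A ?R id \<phi> (\<rho> a) = tmap A B A ?R id (\<lambda>b. ?p (\<eta> b)) (\<rho> a) \<Longrightarrow> b \<in> vcar B \<Longrightarrow> \<phi> b = m b"
    unfolding ex_unique_on_def by blast
  have pq: "?p (\<eta> b) = ?q (\<eta> b)" if "b \<in> vcar B" for b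
    using m[OF p\<eta> _ that] m[OF q\<eta> _ that] eq by simp
  have MN: "M j i x = g (M j i) x" if "i \<in> C" "j \<in> C" "x \<in> vcar H" for i j x
    using fun_cong[OF hopf_envelope_epi[OF large L B R p q pq that(3)], of "(j, i)"] that by simp
  show "g f x = f x"
  proof (cases "x \<in> vcar H")
    case True
    have fs: "f = (\<Sum>i\<in>C. \<Sum>j\<in>C. fscale (u i * v j) (M j i))"
    proof (rule ext)
      fix x show "f x = (\<Sum>i\<in>C. \<Sum>j\<in>C. fscale (u i * v j) (M j i)) x"
        using fM finite_dual_carrierD(2)[OF f] finite_dual_carrierD(2)[OF coefficientsD(2)[OF M]]
        by (cases "x \<in> vcar H") (simp_all add: fscale_def)
    qed
    have vD: "vspace (finite_dual H)" by (rule bi_vspace[OF finite_dual_bialgebra[OF H]])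
    have gl': "lf (finite_dual H) (\<lambda>f. g f x)" by (rule lin_comp[OF lf_eval gl])
    have t: "fscale (u i * v j) (M j i) \<in> vcar (finite_dual H)" if "i \<in> C" "j \<in> C" for i j
      using vs_scale[OF vD, of "M j i"] coefficientsD(2)[OF M that(2,1)] by simp
    have "g f x = (\<Sum>i\<in>C. g (\<Sum>j\<in>C. fscale (u i * v j) (M j i)) x)"
      unfolding fs by (rule lin_sum[OF gl' vD]) (rule vs_sum[OF vD t])
    also have "\<dots> = (\<Sum>i\<in>C. \<Sum>j\<in>C. g (fscale (u i * v j) (M j i)) x)"
      by (rule sum.cong[OF refl], rule lin_sum[OF gl' vD t])
    also have "\<dots> = (\<Sum>i\<in>C. \<Sum>j\<in>C. u i * v j * M j i x)"
      using lin_scale[OF gl'] coefficientsD(2)[OF M] by (simp add: MN[OF _ _ True])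
    finally show ?thesis using fM True by simp
  qed (use finite_dual_carrierD(2)[OF f] finite_dual_carrierD(2)[OF gm[OF f]] in simp)
qed

section \<open>Duality of the universal Hopf algebras\<close>

text \<open>The transpose of \<gamma>. Its values lie in the finite dual because \<gamma> is
  multiplicative and the coproduct of \<open>k\<close> is a finite sum, which together give a
  factorisation.\<close>

lemma dual_bialg_hom:
  assumes H: "bialgebra H" and K: "bialgebra K" and \<gamma>: "bialg_hom H (finite_dual K) \<gamma>"
  shows "bialg_hom K (finite_dual H) (\<lambda>k h. if h \<in> vcar H then \<gamma> h k else 0)"
proof -
  let ?\<beta> = "\<lambda>k h. if h \<in> vcar H then \<gamma> h k else 0" and ?DH = "finite_dual H" and ?DK = "finite_dual K"
  note vH = bi_vspace[OF H] and vK = bi_vspace[OF K] and QH = bi_alg[OF H] and QK = bi_alg[OF K]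
  note DH = finite_dual_bialgebra[OF H] and DK = finite_dual_bialgebra[OF K]
  note vDH = bi_vspace[OF DH]
  have \<gamma>h: "alg_hom H ?DK \<gamma>" and \<gamma>c: "coalg_hom (coalg_of H) (coalg_of ?DK) \<gamma>" using \<gamma> by (auto simp: bialg_hom_def)
  note \<gamma>l = alg_hom_lin[OF \<gamma>h]
  have \<gamma>m: "\<gamma> h \<in> finite_dual_carrier K" if "h \<in> vcar H" for h using lin_mem[OF \<gamma>l that] by simp
  note \<gamma>f = finite_dual_carrierD(1)[OF \<gamma>m]
  have \<gamma>k: "lf H (\<lambda>h. \<gamma> h k)" for k by (rule lin_comp[OF lf_eval \<gamma>l])
  have \<beta>l: "lf H (?\<beta> k)" for k by (rule lin_cong[OF \<gamma>k vH]) simp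
  have mult: "\<gamma> (amult H x y) k = bdelta K k (\<lambda>v w. \<gamma> x v * \<gamma> y w)" if "x \<in> vcar H" "y \<in> vcar H" "k \<in> vcar K" for x y k
    using alg_hom_mult[OF \<gamma>h that(1,2)] that by (simp add: finite_dual_mult[OF K] \<gamma>f conv_def)
  have \<beta>m: "?\<beta> k \<in> finite_dual_carrier H" if k: "k \<in> vcar K" for k
  proof -
    obtain n :: nat and l r where lr: "\<And>i. l i \<in> vcar K" "\<And>i. r i \<in> vcar K"
      "\<And>\<beta>. bf K K \<beta> \<Longrightarrow> bdelta K k \<beta> = (\<Sum>i<n. \<beta> (l i) (r i))"
      by (rule tensor_apply_rep[OF lin_mem[OF bi_delta[OF K] k] vK vK]) blast
    show ?thesis
    proof (rule finite_dual_carrierI[OF QH \<beta>l, of _ "{..<n}" "\<lambda>i h. \<gamma> h (l i)" "\<lambda>i h. \<gamma> h (r i)"])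
      fix x y assume x: "x \<in> vcar H" and y: "y \<in> vcar H"
      show "?\<beta> k (amult H x y) = (\<Sum>i<n. \<gamma> x (l i) * \<gamma> y (r i))"
        using lr(3)[OF bf_prod[OF \<gamma>f[OF x] \<gamma>f[OF y]]] by (simp add: alg_mult[OF QH x y] mult[OF x y k])
    qed (simp_all add: \<gamma>k)
  qed
  have lin: "lin_map K ?DH ?\<beta>"
    by (rule lin_mapI) (auto simp: \<beta>m fun_eq_iff fscale_def lin_add[OF \<gamma>f] lin_scale[OF \<gamma>f])
  have one: "?\<beta> (aone K) = aone ?DH"
  proof (rule separates_eqI[OF separates_evals vDH lin_mem[OF lin alg_one[OF QK]] alg_one[OF bi_alg[OF DH]]])
    fix e assume "e \<in> evals H"
    then obtain h where e: "e = (\<lambda>f. f h)" and h: "h \<in> vcar H" by auto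
    show "e (?\<beta> (aone K)) = e (aone ?DH)"
      using coalg_hom_eps[OF \<gamma>c, of h] h by (simp add: e finite_dual_def)
  qed
  have mul: "?\<beta> (amult K x y) = amult ?DH (?\<beta> x) (?\<beta> y)" if x: "x \<in> vcar K" and y: "y \<in> vcar K" for x y
  proof
    fix h
    have "\<gamma> h (amult K x y) = amult ?DH (?\<beta> x) (?\<beta> y) h" if h: "h \<in> vcar H"
    proof -
      have "\<gamma> h (amult K x y) = bdelta ?DK (\<gamma> h) (\<lambda>f g. f x * g y)"
        by (rule finite_dual_delta[OF K \<gamma>m[OF h] x y, symmetric])
      also have "\<dots> = bdelta H h (\<lambda>v w. \<gamma> v x * \<gamma> w y)"
        using coalg_hom_apply[OF bi_coalg[OF H] \<gamma>c, of h "\<lambda>f g. f x * g y"] h bf_prod[OF lf_eval[of K x] lf_eval[of K y]] by simp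
      also have "\<dots> = bdelta H h (\<lambda>v w. ?\<beta> x v * ?\<beta> y w)"
        by (rule tensor_apply_cong[OF lin_mem[OF bi_delta[OF H] h] vH vH]) simp
      finally show ?thesis by (simp add: finite_dual_mult[OF H] \<beta>l h conv_def)
    qed
    then show "?\<beta> (amult K x y) h = amult ?DH (?\<beta> x) (?\<beta> y) h" by (simp add: finite_dual_mult[OF H] \<beta>l)
  qed
  have delta: "bdelta ?DH (?\<beta> k) = tmap K K ?DH ?DH ?\<beta> ?\<beta> (bdelta K k)" if k: "k \<in> vcar K" for k
  proof (rule tensor_eqI[OF vDH vDH separates_evals separates_evals finite_dual_delta_mem[OF H \<beta>m[OF k]]
      tmap_mem[OF vK vK lin lin lin_mem[OF bi_delta[OF K] k]]])
    fix e1 e2 assume "e1 \<in> evals H" "e2 \<in> evals H"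
    then obtain x y where e: "e1 = (\<lambda>f. f x)" "e2 = (\<lambda>f. f y)" and x: "x \<in> vcar H" and y: "y \<in> vcar H" by auto
    have "bdelta ?DH (?\<beta> k) (\<lambda>v w. v x * w y) = ?\<beta> k (amult H x y)" by (rule finite_dual_delta[OF H \<beta>m[OF k] x y])
    also have "\<dots> = bdelta K k (\<lambda>v w. \<gamma> x v * \<gamma> y w)" by (simp add: alg_mult[OF QH x y] mult[OF x y k])
    also have "\<dots> = tmap K K ?DH ?DH ?\<beta> ?\<beta> (bdelta K k) (\<lambda>v w. v x * w y)"
      unfolding tmap_apply[OF vK vK lin lin bf_prod[OF lf_eval lf_eval] lin_mem[OF bi_delta[OF K] k]] by (simp add: x y)
    finally show "bdelta ?DH (?\<beta> k) (\<lambda>v w. e1 v * e2 w) = tmap K K ?DH ?DH ?\<beta> ?\<beta> (bdelta K k) (\<lambda>v w. e1 v * e2 w)"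
      unfolding e .
  qed
  have eps: "?\<beta> k (aone H) = beps K k" if "k \<in> vcar K" for k
    using alg_hom_one[OF \<gamma>h] that by (simp add: alg_one[OF QH] finite_dual_def)
  show ?thesis
    unfolding bialg_hom_def alg_hom_def coalg_hom_def using lin one mul delta eps by simp
qed

subsection \<open>The finite topology\<close>

text \<open>The basic sets are closed under intersection: the finite sets of prescribed pairs are
  united.\<close>

lemma openin_finite_topology:
  fixes A :: "('k::field, 'a::ab_group_add, 'z) vsp_scheme"
  shows
  "openin (finite_topology A) = arbitrary union_of (\<lambda>U. \<exists>S. finite S \<and> U = {f \<in> End A. \<forall>(a, b)\<in>S. f a = b})"
  unfolding finite_topology_def
proof (rule topology_inverse', rule istopology_base)
  fix U W :: "('a \<Rightarrow> 'a) set"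
  assume "\<exists>S. finite S \<and> U = {f \<in> End A. \<forall>(a, b)\<in>S. f a = b}" "\<exists>S. finite S \<and> W = {f \<in> End A. \<forall>(a, b)\<in>S. f a = b}"
  then obtain S T where "finite S" "U = {f \<in> End A. \<forall>(a, b)\<in>S. f a = b}" "finite T" "W = {f \<in> End A. \<forall>(a, b)\<in>T. f a = b}"
    by blast
  then have "finite (S \<union> T)" "U \<inter> W = {f \<in> End A. \<forall>(a, b)\<in>S \<union> T. f a = b}" by (auto simp: ball_Un)
  then show "\<exists>S. finite S \<and> U \<inter> W = {f \<in> End A. \<forall>(a, b)\<in>S. f a = b}" by blast
qed

lemma topspace_finite_topology: "topspace (finite_topology A) = End A"
proof
  show "topspace (finite_topology A) \<subseteq> End A"
    by (auto simp: topspace_def openin_finite_topology union_of_def)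
  have "openin (finite_topology A) (End A)"
    unfolding openin_finite_topology
    by (rule union_of_inc[of arbitrary]) (auto simp: arbitrary_def intro: exI[of _ "{}"])
  then show "End A \<subseteq> topspace (finite_topology A)" by (rule openin_subset)
qed

text \<open>A basic neighbourhood of \<open>f\<close> prescribes finitely many values, and these are
  values of \<open>f\<close>, so it meets \<open>V\<close>.\<close>

lemma closedin_finite_topologyD:
  assumes V: "closedin (finite_topology A) V" and f: "f \<in> End A"
    and ap: "\<And>F. finite F \<Longrightarrow> \<exists>v\<in>V. \<forall>a\<in>F. v a = f a"
  shows "f \<in> V"
proof (rule ccontr)
  assume "f \<notin> V"
  then have f': "f \<in> End A - V" using f by simp
  have "openin (finite_topology A) (End A - V)"
    using V by (simp add: closedin_def topspace_finite_topology)
  then obtain Us where Us: "Us \<subseteq> {U. \<exists>S. finite S \<and> U = {f \<in> End A. \<forall>(a, b)\<in>S. f a = b}}" "\<Union>Us = End A - V"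
    unfolding openin_finite_topology union_of_def by auto
  have "f \<in> \<Union>Us" using f' by (simp only: Us(2))
  then obtain U where U0: "U \<in> Us" "f \<in> U" by (rule UnionE)
  have U: "f \<in> U" "U \<subseteq> End A - V" using U0 unfolding Us(2)[symmetric] by (auto intro: Union_upper)
  obtain S where S: "finite S" "U = {f \<in> End A. \<forall>(a, b)\<in>S. f a = b}" using subsetD[OF Us(1) U0(1)] by (elim CollectE exE conjE)
  obtain v where v: "v \<in> V" "\<forall>a\<in>fst ` S. v a = f a" using ap[of "fst ` S"] S(1) by blast
  have "v \<in> End A" using closedin_subset[OF V] v(1) by (auto simp: topspace_finite_topology)
  then have "v \<in> U" using v(2) U(1) S(2) by force
  then show False using U(2) v(1) by blast
qed

text \<open>Otherwise some linear relation among the members of \<open>Fs\<close> would hold at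
  every \<open>k\<close> but fail under \<open>q\<close>. A relation that holds at every
  \<open>k\<close> already holds in the finite dual, and \<open>q\<close> respects it.\<close>

lemma finite_dual_approx:
  fixes K :: "('k::field, 'u::ab_group_add) bialg"
  assumes K: "bialgebra K" and q: "lf (finite_dual K) q" and Fs: "finite Fs" "Fs \<subseteq> finite_dual_carrier K"
  shows "\<exists>k\<in>vcar K. \<forall>f\<in>Fs. f k = q f"
proof -
  note vK = bi_vspace[OF K] and vD = bi_vspace[OF finite_dual_bialgebra[OF K]]
  define w where "w q f = (if f \<in> Fs then q f else 0)" for q :: "('u \<Rightarrow> 'k) \<Rightarrow> 'k" and f
  let ?W = "(\<lambda>k. w (\<lambda>f. f k)) ` vcar K"
  have fl: "lf K f" if "f \<in> Fs" for f using that Fs(2) finite_dual_carrierD(1) by blast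
  have W: "fsc.subspace ?W"
  proof (rule fsc.subspaceI)
    show "0 \<in> ?W" using vs_zero[OF vK] lin_zero[OF fl vK] by (auto simp: w_def fun_eq_iff intro!: image_eqI[of _ _ 0])
    fix a c assume "a \<in> ?W"
    then obtain k where k: "a = w (\<lambda>f. f k)" "k \<in> vcar K" by blast
    show "fscale c a \<in> ?W"
      using vs_scale[OF vK k(2)] lin_scale[OF fl k(2)] by (auto simp: k(1) w_def fun_eq_iff fscale_def intro!: image_eqI[of _ _ "vscale K c k"])
    fix b assume "b \<in> ?W"
    then obtain l where l: "b = w (\<lambda>f. f l)" "l \<in> vcar K" by blast
    show "a + b \<in> ?W"
      using vs_add[OF vK k(2) l(2)] lin_add[OF fl k(2) l(2)] by (auto simp: k(1) l(1) w_def fun_eq_iff intro!: image_eqI[of _ _ "k + l"])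
  qed
  have "w q \<in> ?W"
  proof (rule ccontr)
    assume "w q \<notin> ?W"
    then obtain F where F: "Vector_Spaces.linear fscale (*) F" "F (w q) = (1::'k)" "\<And>x. x \<in> ?W \<Longrightarrow> F x = 0"
      using functional_avoiding[OF vector_space_fscale W] by blast
    interpret F: Vector_Spaces.linear fscale "(*)" F by (rule F(1))
    define d where "d f = (\<lambda>g. if g = f then 1 else (0::'k))" for f :: "'u \<Rightarrow> 'k"
    have Fw: "F (w p) = (\<Sum>f\<in>Fs. p f * F (d f))" for p
    proof -
      have "w p = (\<Sum>f\<in>Fs. fscale (p f) (d f))"
      proof
        fix g show "w p g = (\<Sum>f\<in>Fs. fscale (p f) (d f)) g"
          using Fs(1) by (simp add: w_def fscale_def d_def if_distrib[of "\<lambda>x. _ * x"] cong: if_cong)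
      qed
      then show ?thesis by (simp add: F.sum F.scale)
    qed
    \<comment> \<open>\<open>F\<close> kills the value vectors of all \<open>k\<close>, so its
      coefficients combine \<open>Fs\<close> to the zero functional, while \<open>q\<close> would
      send this combination to 1.\<close>
    let ?e = "\<Sum>f\<in>Fs. fscale (F (d f)) f"
    have "?e k = 0" for k
    proof (cases "k \<in> vcar K")
      case True
      then show ?thesis using F(3)[of "w (\<lambda>f. f k)"] by (simp add: Fw fscale_def mult.commute)
    next
      case False
      then show ?thesis
        using finite_dual_carrierD(2)[OF subsetD[OF Fs(2)] False] by (auto simp: fscale_def intro!: sum.neutral)
    qed
    then have "?e = 0" by (simp add: fun_eq_iff)
    moreover have "q ?e = (\<Sum>f\<in>Fs. q (fscale (F (d f)) f))"
      by (rule lin_sum[OF q vD]) (use vs_scale[OF vD] Fs(2) in auto)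
    moreover have "\<dots> = F (w q)"
      using lin_scale[OF q] Fs(2) by (simp add: Fw subset_iff mult.commute)
    ultimately show False using F(2) lin_zero[OF q vD] by simp
  qed
  then obtain k where k: "w q = w (\<lambda>f. f k)" "k \<in> vcar K" by (rule imageE)
  have "f k = q f" if "f \<in> Fs" for f using fun_cong[OF k(1), of f] that by (simp add: w_def)
  then show ?thesis using k(2) by blast
qed

text \<open>At finitely many points of \<open>A\<close> the operator of \<open>q\<close> depends
  only on finitely many values of \<open>q\<close>, those at the right factors of the tensors
  \<open>\<rho> a\<close>. These values are also attained by evaluation at some
  \<open>k\<close>.\<close>

lemma cosupp_finite_dual:
  assumes om: "omega_algebra A" and K: "bialgebra K" and \<rho>: "lin_map A (tensor_space A (finite_dual K)) \<rho>"
    and V: "closedin (finite_topology A) V"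
    and \<psi>: "\<And>k a. k \<in> vcar K \<Longrightarrow> contract A (finite_dual K) (\<lambda>f. f k) (\<rho> a) = \<psi> k a" and \<psi>V: "\<psi> ` vcar K \<subseteq> V"
  shows "cosupp_comeas (finite_dual K) A \<rho> \<subseteq> V"
proof
  let ?D = "finite_dual K"
  note A = omegaD(1)[OF om] and AU = omegaD(2)[OF om] and vD = bi_vspace[OF finite_dual_bialgebra[OF K]]
  note \<rho>a = lin_mem[OF \<rho> AU]
  fix v assume "v \<in> cosupp_comeas ?D A \<rho>"
  then obtain q where q: "lf ?D q" and v: "v = (\<lambda>a. contract A ?D q (\<rho> a))" by (auto simp: cosupp_comeas_def)
  have vl: "lin_map A A v" unfolding v by (rule lin_comp[OF contract_lin[OF A vD q] \<rho>])
  have "vector_space (vscale A)" by (rule vspace_vector_space[OF A])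
  then have "v \<in> End A"
    using lin_add[OF vl AU AU] lin_scale[OF vl AU]
    by (simp add: End_def Vector_Spaces.linear_def module_hom_def module_hom_axioms_def vector_space_def module_def)
  then show "v \<in> V"
  proof (rule closedin_finite_topologyD[OF V])
    fix F :: "'b set" assume F: "finite F"
    have "\<exists>R. finite R \<and> R \<subseteq> finite_dual_carrier K \<and> (\<forall>k\<in>vcar K. (\<forall>f\<in>R. f k = q f) \<longrightarrow> \<psi> k a = v a)" for a
    proof -
      obtain n :: nat and l r where lr: "\<And>i. l i \<in> vcar A" "\<And>i. r i \<in> vcar ?D" "\<rho> a = (\<Sum>i<n. tens A ?D (l i) (r i))"
        by (rule tensor_apply_rep[OF \<rho>a A vD]) blast
      have c: "contract A ?D p (\<rho> a) = (\<Sum>i<n. vscale A (p (r i)) (l i))" if p: "lf ?D p" for p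
        using lin_sum[OF contract_lin[OF A vD p] vspace_tensor, of "{..<n}" "\<lambda>i. tens A ?D (l i) (r i)"] lr
        by (simp add: tens_mem contract_tens[OF A vD p])
      have "\<psi> k a = v a" if "k \<in> vcar K" "\<forall>f\<in>r ` {..<n}. f k = q f" for k
        using that(2) unfolding \<psi>[OF that(1), symmetric] v c[OF lf_eval] c[OF q] by simp
      then show ?thesis using lr(2) by (intro exI[of _ "r ` {..<n}"]) auto
    qed
    then obtain R where R: "\<forall>a. finite (R a) \<and> R a \<subseteq> finite_dual_carrier K \<and> (\<forall>k\<in>vcar K. (\<forall>f\<in>R a. f k = q f) \<longrightarrow> \<psi> k a = v a)"
      by metis
    obtain k where "k \<in> vcar K" "\<forall>f\<in>(\<Union>a\<in>F. R a). f k = q f"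
      using finite_dual_approx[OF K q, of "\<Union>a\<in>F. R a"] R F by blast
    then show "\<exists>v'\<in>V. \<forall>a\<in>F. v' a = v a" using R \<psi>V by (intro bexI[of _ "\<psi> k"]) auto
  qed
qed

subsection \<open>The universal property of the universal Hopf algebras\<close>

text \<open>Uniqueness in two stages: operators determine the composite into the acting bialgebra
  \<open>D\<close>, and that composite determines the map into its right adjoint
  \<open>K\<close>.\<close>

lemma acting_hopf_unique:
  assumes large: "large_universe TYPE('k::field) TYPE('u::ab_group_add) TYPE('t::ab_group_add)"
    and om: "omega_algebra (A :: ('k, 'a::ab_group_add, 'o) omega_alg)"
    and U: "universal_acting_hopf TYPE('t) A V (K :: ('k, 'u) bialg) \<psi>"
    and sm: "small TYPE('u) L" and \<theta>: "hopf_hom L K \<theta>" and \<theta>': "hopf_hom L K \<theta>'"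
    and eq: "\<And>x a. x \<in> vcar L \<Longrightarrow> \<psi> (\<theta> x) a = \<psi> (\<theta>' x) a" and x: "x \<in> vcar L"
  shows "\<theta> x = \<theta>' x"
proof -
  obtain D :: "('k, 'u) bialg" and \<psi>0 \<kappa> where UD: "universal_acting_bialgebra TYPE('t) A V D \<psi>0"
    and RD: "hopf_right_adjoint TYPE('t) D K \<kappa>" and \<psi>: "\<psi> = (\<lambda>k. \<psi>0 (\<kappa> k))"
    using U unfolding universal_acting_hopf_def by blast
  have acD: "bialg_action D A \<psi>0" and V: "cosupp_meas (coalg_of D) \<psi>0 \<subseteq> V" using UD by (auto simp: universal_acting_bialgebra_def)
  have \<kappa>: "bialg_hom K D \<kappa>" using RD by (simp add: hopf_right_adjoint_def)
  have L: "hopf_algebra L" "bialgebra L" and K: "bialgebra K" using \<theta> by (auto simp: hopf_hom_def hopf_algebra_def)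
  note D = action_bialg[OF acD]
  have c: "bialg_hom L D (\<lambda>x. \<kappa> (t x))" if "hopf_hom L K t" for t
    by (rule bialg_hom_comp[OF L(2) K D _ \<kappa>]) (use that in \<open>simp add: hopf_hom_def\<close>)
  have cc: "coalg_hom (coalg_of L) (coalg_of D) (\<lambda>x. \<kappa> (t x))" if "hopf_hom L K t" for t
    using c[OF that] by (simp add: bialg_hom_def)
  obtain s and j :: "_ \<Rightarrow> 't" where j: "embeds L s j" using small_embeds[OF large sm] by metis
  then have j': "embeds (coalg_of L) s j" by (simp add: embeds_def)
  note mm = lin_mem[OF coalg_hom_lin[OF cc[OF \<theta>]]]
  have me: "measuring (coalg_of L) A (\<lambda>p. \<psi>0 (\<kappa> (\<theta> p)))"
    by (rule measuring_hom[OF bi_coalg[OF L(2)] cc[OF \<theta>] action_meas[OF acD] om])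
  have "cosupp_meas (coalg_of L) (\<lambda>p. \<psi>0 (\<kappa> (\<theta> p))) \<subseteq> V" using V mm by (auto simp: cosupp_meas_def)
  from universal_acting_embeds[OF UD om bi_coalg[OF L(2)] j' me this]
  have "ex_unique_on (vcar L) (\<lambda>\<phi>. coalg_hom (coalg_of L) (coalg_of D) \<phi> \<and> (\<forall>p\<in>vcar L. \<forall>a. \<psi>0 (\<phi> p) a = \<psi>0 (\<kappa> (\<theta> p)) a))"
    by simp
  then obtain m where m: "\<And>\<phi>. coalg_hom (coalg_of L) (coalg_of D) \<phi> \<Longrightarrow>
      \<forall>p\<in>vcar L. \<forall>a. \<psi>0 (\<phi> p) a = \<psi>0 (\<kappa> (\<theta> p)) a \<Longrightarrow> \<forall>p\<in>vcar L. \<phi> p = m p"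
    unfolding ex_unique_on_def by blast
  have \<kappa>\<theta>: "\<kappa> (\<theta>' p) = \<kappa> (\<theta> p)" if "p \<in> vcar L" for p
    using m[OF cc[OF \<theta>']] m[OF cc[OF \<theta>]] eq that by (simp add: \<psi>)
  have "ex_unique_on (vcar L) (\<lambda>g. hopf_hom L K g \<and> (\<forall>x\<in>vcar L. \<kappa> (g x) = \<kappa> (\<theta> x)))"
    by (rule hopf_right_adjoint_embeds[OF RD L(1) j c[OF \<theta>] D])
  then show ?thesis using \<theta> \<theta>' \<kappa>\<theta> x unfolding ex_unique_on_def by metis
qed

text \<open>The coalgebra map supplied by universality of \<open>D\<close> is a bialgebra map, and
  as such it lifts to \<open>K\<close>.\<close>

lemma acting_hopf_exists:
  assumes large: "large_universe TYPE('k::field) TYPE('u::ab_group_add) TYPE('t::ab_group_add)"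
    and om: "omega_algebra (A :: ('k, 'a::ab_group_add, 'o) omega_alg)"
    and U: "universal_acting_hopf TYPE('t) A V (K :: ('k, 'u) bialg) \<psi>"
    and L: "hopf_algebra L" and ac: "bialg_action L A \<psi>L" and cV: "cosupp_meas (coalg_of L) \<psi>L \<subseteq> V"
    and sm: "small TYPE('u) L" "small TYPE('u) (tensor_space L L)"
  shows "\<exists>\<theta>. hopf_hom L K \<theta> \<and> (\<forall>x\<in>vcar L. \<forall>a. \<psi> (\<theta> x) a = \<psi>L x a)"
proof -
  obtain D :: "('k, 'u) bialg" and \<psi>0 \<kappa> where UD: "universal_acting_bialgebra TYPE('t) A V D \<psi>0"
    and RD: "hopf_right_adjoint TYPE('t) D K \<kappa>" and \<psi>: "\<psi> = (\<lambda>k. \<psi>0 (\<kappa> k))"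
    using U unfolding universal_acting_hopf_def by blast
  have D: "bialgebra D" using UD by (auto simp: universal_acting_bialgebra_def bialg_action_def)
  note bL = action_bialg[OF ac]
  obtain s and j :: "_ \<Rightarrow> 't" where j: "embeds L s j" using small_embeds[OF large sm(1)] by metis
  then have j': "embeds (coalg_of L) s j" by (simp add: embeds_def)
  have "ex_unique_on (vcar (coalg_of L)) (\<lambda>\<phi>. coalg_hom (coalg_of L) (coalg_of D) \<phi> \<and>
      (\<forall>p\<in>vcar (coalg_of L). \<forall>a. \<psi>0 (\<phi> p) a = \<psi>L p a))"
    by (rule universal_acting_embeds[OF UD om bi_coalg[OF bL] j' action_meas[OF ac] cV])
  then obtain \<phi> where \<phi>: "coalg_hom (coalg_of L) (coalg_of D) \<phi>" "\<And>p a. p \<in> vcar L \<Longrightarrow> \<psi>0 (\<phi> p) a = \<psi>L p a"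
    unfolding ex_unique_on_def by auto
  have "bialg_hom L D \<phi>" by (rule universal_acting_bialg_hom[OF large UD om ac sm(2) \<phi>(1)]) (rule \<phi>(2))
  from hopf_right_adjoint_embeds[OF RD L j this D] obtain \<theta> where "hopf_hom L K \<theta>" "\<forall>x\<in>vcar L. \<kappa> (\<theta> x) = \<phi> x"
    unfolding ex_unique_on_def by blast
  then show ?thesis using \<phi>(2) by (intro exI[of _ \<theta>]) (simp add: \<psi>)
qed

lemma coacting_hopf_exists:
  assumes large: "large_universe TYPE('k::field) TYPE('u::ab_group_add) TYPE('t::ab_group_add)"
    and om: "omega_algebra (A :: ('k, 'a::ab_group_add, 'o) omega_alg)"
    and U: "universal_coacting_hopf TYPE('t) A V (H :: ('k, 'u) bialg) \<rho>"
    and L: "hopf_algebra L" and co: "bialg_coaction L A \<rho>L" and cV: "cosupp_comeas L A \<rho>L \<subseteq> V"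
    and sm: "small TYPE('u) L" "small TYPE('u) (tensor_space L L)"
  shows "\<exists>\<gamma>. hopf_hom H L \<gamma> \<and> (\<forall>a. tmap A H A L id \<gamma> (\<rho> a) = \<rho>L a)"
proof -
  obtain B :: "('k, 'u) bialg" and \<rho>0 \<eta> where UB: "universal_coacting_bialgebra TYPE('t) A V B \<rho>0"
    and LB: "hopf_left_adjoint TYPE('t) B H \<eta>" and \<rho>: "\<rho> = (\<lambda>a. tmap A B A H id \<eta> (\<rho>0 a))"
    using U unfolding universal_coacting_hopf_def by blast
  have coB: "bialg_coaction B A \<rho>0" using UB by (auto simp: universal_coacting_bialgebra_def)
  note B = coaction_bialg[OF coB] and bL = coaction_bialg[OF co] and A = omegaD(1)[OF om]
  have H: "bialgebra H" and \<eta>: "alg_hom B H \<eta>" using LB by (auto simp: hopf_left_adjoint_def hopf_algebra_def bialg_hom_def)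
  obtain s and j :: "_ \<Rightarrow> 't" where j: "embeds L s j" using small_embeds[OF large sm(1)] by metis
  obtain \<alpha> where \<alpha>: "alg_hom B L \<alpha>" "\<And>a. tmap A B A L id \<alpha> (\<rho>0 a) = \<rho>L a"
    using universal_coacting_embeds[OF UB om bi_alg[OF bL] j coaction_comeas[OF co] cV] unfolding ex_unique_on_def by blast
  have "bialg_hom B L \<alpha>" by (rule universal_coacting_bialg_hom[OF large UB om co sm(2) \<alpha>])
  from hopf_left_adjoint_embeds[OF LB L j this B] obtain \<gamma> where \<gamma>: "hopf_hom H L \<gamma>" "\<And>x. x \<in> vcar B \<Longrightarrow> \<gamma> (\<eta> x) = \<alpha> x"
    unfolding ex_unique_on_def by blast
  have \<gamma>l: "lin_map H L \<gamma>" using \<gamma>(1) by (simp add: hopf_hom_def bialg_hom_def alg_hom_def)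
  note \<eta>l = alg_hom_lin[OF \<eta>] and vB = bi_vspace[OF B] and vH = bi_vspace[OF H] and vL = bi_vspace[OF bL]
  note \<rho>a = lin_mem[OF coaction_lin[OF coB] omegaD(2)[OF om]]
  have "tmap A H A L id \<gamma> (\<rho> a) = \<rho>L a" for a
  proof -
    have "tmap A H A L id \<gamma> (\<rho> a) = tmap A B A L (\<lambda>x. id (id x)) (\<lambda>x. \<gamma> (\<eta> x)) (\<rho>0 a)"
      unfolding \<rho> by (rule tmap_tmap[OF A vB lin_id' \<eta>l A vH lin_id' \<gamma>l A vL \<rho>a])
    also have "\<dots> = tmap A B A L id \<alpha> (\<rho>0 a)"
      by (rule tmap_cong[OF A vB lin_comp[OF lin_id' lin_id'] lin_comp[OF \<gamma>l \<eta>l] A vL _ \<gamma>(2) \<rho>a]) simp_all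
    finally show ?thesis using \<alpha>(2) by simp
  qed
  then show ?thesis using \<gamma>(1) by blast
qed

lemma bialg_hom_id:
  assumes K: "bialgebra K"
  shows "bialg_hom K K (\<lambda>k. k)"
proof -
  note vK = bi_vspace[OF K]
  have l: "lin_map K K (\<lambda>k. k)" by (simp add: lin_map_def)
  have "tmap K K K K (\<lambda>k. k) (\<lambda>k. k) X = X" if X: "X \<in> vcar (tensor_space K K)" for X
    by (rule tensor_ext[OF tmap_mem[OF vK vK l l X] X vK vK], rule tmap_apply[OF vK vK l l _ X])
  then show ?thesis using l lin_mem[OF bi_delta[OF K]] by (simp add: bialg_hom_def alg_hom_def coalg_hom_def)
qed

lemma contract_cong:
  assumes V: "vspace V" and W: "vspace W" and f: "lf W f" and fg: "\<And>w. w \<in> vcar W \<Longrightarrow> f w = g w"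
    and X: "X \<in> vcar (tensor_space V W)"
  shows "contract V W f X = contract V W g X"
proof -
  have g: "lf W g" by (rule lin_cong[OF f W fg])
  show ?thesis
  proof (rule functional_sep[OF V contract_mem[OF V W f X] contract_mem[OF V W g X]])
    fix h assume h: "lf V h"
    show "h (contract V W f X) = h (contract V W g X)"
      unfolding contract_apply[OF V W f h X] contract_apply[OF V W g h X]
      by (rule tensor_apply_cong[OF X V W]) (simp add: fg)
  qed
qed

text \<open>Finite dimensionality is phrased as containment in a finite span, the form that is
  immediate for all endomorphisms of a finite dimensional space.\<close>

lemma universal_hopf_duality:
  assumes large: "large_universe TYPE('k::field) TYPE('u::ab_group_add) TYPE('t::ab_group_add)"
    and om: "omega_algebra (A :: ('k, 'a::ab_group_add, 'o) omega_alg)"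
    and fin: "\<And>a. \<exists>S. finite S \<and> (\<lambda>v. v a) ` V \<subseteq> module.span (vscale A) S"
    and cl: "closedin (finite_topology A) V"
    and UH: "universal_coacting_hopf TYPE('t) A V (H :: ('k, 'u) bialg) \<rho>"
    and UK: "universal_acting_hopf TYPE('t) A V (K :: ('k, 'u) bialg) \<psi>"
  shows "\<exists>\<theta>. hopf_hom (finite_dual H) K \<theta> \<and>
         (\<forall>f\<in>vcar (finite_dual H). \<forall>a. \<psi> (\<theta> f) a = dual_action H A \<rho> f a) \<and>
         (\<forall>\<theta>'. hopf_hom (finite_dual H) K \<theta>' \<and>
            (\<forall>f\<in>vcar (finite_dual H). \<forall>a. \<psi> (\<theta>' f) a = dual_action H A \<rho> f a) \<longrightarrow>
            (\<forall>f\<in>vcar (finite_dual H). \<theta>' f = \<theta> f)) \<and>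
         hopf_iso (finite_dual H) K \<theta>"
proof -
  let ?DH = "finite_dual H" and ?DK = "finite_dual K"
  note A = omegaD(1)[OF om] and AU = omegaD(2)[OF om]
  obtain B :: "('k, 'u) bialg" and \<rho>0 \<eta> where UB: "universal_coacting_bialgebra TYPE('t) A V B \<rho>0"
    and LB: "hopf_left_adjoint TYPE('t) B H \<eta>" and \<rho>: "\<rho> = (\<lambda>a. tmap A B A H id \<eta> (\<rho>0 a))"
    using UH unfolding universal_coacting_hopf_def by blast
  obtain D :: "('k, 'u) bialg" and \<psi>0 \<kappa> where UD: "universal_acting_bialgebra TYPE('t) A V D \<psi>0"
    and RD: "hopf_right_adjoint TYPE('t) D K \<kappa>" and \<psi>: "\<psi> = (\<lambda>k. \<psi>0 (\<kappa> k))"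
    using UK unfolding universal_acting_hopf_def by blast
  have coB: "bialg_coaction B A \<rho>0" and VB: "cosupp_comeas B A \<rho>0 \<subseteq> V" using UB by (auto simp: universal_coacting_bialgebra_def)
  have acD: "bialg_action D A \<psi>0" and VD: "cosupp_meas (coalg_of D) \<psi>0 \<subseteq> V" using UD by (auto simp: universal_acting_bialgebra_def)
  have hH: "hopf_algebra H" and \<eta>: "bialg_hom B H \<eta>" using LB by (auto simp: hopf_left_adjoint_def)
  have hK: "hopf_algebra K" and \<kappa>: "bialg_hom K D \<kappa>" using RD by (auto simp: hopf_right_adjoint_def)
  obtain SH SK where H: "bialgebra H" and SH: "is_antipode H SH" and K: "bialgebra K" and SK: "is_antipode K SK"
    using hH hK by (auto simp: hopf_algebra_def)
  note hDH = finite_dual_hopf[OF H SH] and hDK = finite_dual_hopf[OF K SK]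
  note DH = finite_dual_bialgebra[OF H] and DK = finite_dual_bialgebra[OF K] and B = coaction_bialg[OF coB]
  note vH = bi_vspace[OF H] and vK = bi_vspace[OF K] and vDK = bi_vspace[OF DK]
  have \<eta>l: "lin_map B H \<eta>" using \<eta> by (simp add: bialg_hom_def alg_hom_def)
  have \<kappa>l: "lin_map K D \<kappa>" using \<kappa> by (simp add: bialg_hom_def alg_hom_def)

  have coH: "bialg_coaction H A \<rho>" unfolding \<rho> by (rule bialg_coaction_hom[OF om coB H \<eta>])
  note \<rho>a = lin_mem[OF coaction_lin[OF coH] AU]
  have cH: "cosupp_comeas H A \<rho> \<subseteq> V"
    unfolding \<rho> using cosupp_tmap[OF om bi_vspace[OF B] vH coaction_lin[OF coB] \<eta>l] VB by blast
  have "dual_action H A \<rho> f \<in> cosupp_comeas H A \<rho>" if "f \<in> finite_dual_carrier H" for f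
    using finite_dual_carrierD(1)[OF that] by (auto simp: cosupp_comeas_def dual_action_def[abs_def])
  then have VH: "cosupp_meas (coalg_of ?DH) (dual_action H A \<rho>) \<subseteq> V"
    using cH by (auto simp: cosupp_meas_def)
  obtain \<theta> where \<theta>: "hopf_hom ?DH K \<theta>" and \<psi>\<theta>: "\<And>f a. f \<in> finite_dual_carrier H \<Longrightarrow> \<psi> (\<theta> f) a = dual_action H A \<rho> f a"
    using acting_hopf_exists[OF large om UK hDH dual_action_bialg_action[OF om coH] VH small_finite_dual small_finite_dual_tensor[OF bi_alg[OF H]]]
    by auto

  have acK: "bialg_action K A \<psi>" unfolding \<psi> by (rule bialg_action_hom[OF om acD K \<kappa>])
  have VK: "\<psi> ` vcar K \<subseteq> V" using VD lin_mem[OF \<kappa>l] by (auto simp: \<psi> cosupp_meas_def)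
  have "\<exists>S. finite S \<and> (\<forall>k\<in>vcar K. \<psi> k a \<in> module.span (vscale A) S)" for a
    using fin[of a] VK by blast
  from action_coaction[OF om acK this]
  obtain \<rho>' where co': "bialg_coaction ?DK A \<rho>'" and \<rho>'k: "\<And>k a. k \<in> vcar K \<Longrightarrow> contract A ?DK (\<lambda>f. f k) (\<rho>' a) = \<psi> k a"
    by blast
  have V': "cosupp_comeas ?DK A \<rho>' \<subseteq> V" by (rule cosupp_finite_dual[OF om K coaction_lin[OF co'] cl \<rho>'k VK])
  obtain \<gamma> where \<gamma>: "hopf_hom H ?DK \<gamma>" and \<gamma>\<rho>: "\<And>a. tmap A H A ?DK id \<gamma> (\<rho> a) = \<rho>' a"
    using coacting_hopf_exists[OF large om UH hDK co' V' small_finite_dual small_finite_dual_tensor[OF bi_alg[OF K]]] by blast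
  have \<gamma>b: "bialg_hom H ?DK \<gamma>" using \<gamma> by (simp add: hopf_hom_def)
  have \<gamma>l: "lin_map H ?DK \<gamma>" using \<gamma>b by (simp add: bialg_hom_def alg_hom_def)

  \<comment> \<open>The transpose of \<gamma>, with the default value 0 that the finite dual
    prescribes off the carrier.\<close>
  define \<beta> where "\<beta> k h = (if h \<in> vcar H then \<gamma> h k else 0)" for k h
  have \<beta>b: "bialg_hom K ?DH \<beta>" unfolding \<beta>_def by (rule dual_bialg_hom[OF H K \<gamma>b])
  have \<beta>m: "\<beta> k \<in> finite_dual_carrier H" if "k \<in> vcar K" for k
    using lin_mem[of K ?DH \<beta> k] \<beta>b that by (simp add: bialg_hom_def alg_hom_def)
  have \<theta>b: "bialg_hom ?DH K \<theta>" using \<theta> by (simp add: hopf_hom_def)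
  have \<theta>m: "\<theta> f \<in> vcar K" if "f \<in> finite_dual_carrier H" for f
    using lin_mem[of ?DH K \<theta> f] \<theta>b that by (simp add: bialg_hom_def alg_hom_def)
  \<comment> \<open>The link between the two constructions: the finite dual of \<open>H\<close>,
    acting through \<beta>, restores the action of \<open>K\<close>. Both inverse laws rest on
    it.\<close>
  have \<beta>a: "dual_action H A \<rho> (\<beta> k) a = \<psi> k a" if k: "k \<in> vcar K" for k a
  proof -
    have l: "lf H (\<lambda>h. \<gamma> h k)" by (rule lin_comp[OF lf_eval \<gamma>l])
    have "\<psi> k a = contract A ?DK (\<lambda>f. f k) (tmap A H A ?DK id \<gamma> (\<rho> a))" by (simp add: \<gamma>\<rho> \<rho>'k[OF k])
    also have "\<dots> = id (contract A H (\<lambda>h. \<gamma> h k) (\<rho> a))"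
      by (rule contract_tmap[OF A vH A vDK lin_id' \<gamma>l lf_eval \<rho>a])
    also have "\<dots> = contract A H (\<beta> k) (\<rho> a)"
      by (simp, rule contract_cong[OF A vH l _ \<rho>a]) (simp add: \<beta>_def)
    finally show ?thesis by (simp add: dual_action_def)
  qed
  have \<theta>\<beta>: "\<theta> (\<beta> k) = k" if k: "k \<in> vcar K" for k
  proof (rule acting_hopf_unique[OF large om UK small_self[OF vK] _ _ _ k])
    show "hopf_hom K K (\<lambda>k. \<theta> (\<beta> k))"
      unfolding hopf_hom_def using hK bialg_hom_comp[OF K DH K \<beta>b \<theta>b] by simp
    show "hopf_hom K K (\<lambda>k. k)" unfolding hopf_hom_def using hK bialg_hom_id[OF K] by simp
  qed (simp add: \<psi>\<theta> \<beta>m \<beta>a)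
  have \<beta>\<theta>: "\<beta> (\<theta> f) = f" if f: "f \<in> finite_dual_carrier H" for f
  proof (rule dual_action_faithful[OF large om UB LB _ _ f])
    show "coalg_hom (coalg_of ?DH) (coalg_of ?DH) (\<lambda>f. \<beta> (\<theta> f))"
      using bialg_hom_comp[OF DH K DH \<theta>b \<beta>b] by (simp add: bialg_hom_def)
  qed (simp add: \<rho>[symmetric] \<psi>\<theta> \<theta>m \<beta>a)
  have bij: "bij_betw \<theta> (vcar ?DH) (vcar K)"
    by (rule bij_betw_byWitness[of _ \<beta>]) (auto simp: \<theta>\<beta> \<beta>\<theta> \<theta>m \<beta>m)
  have uq: "\<theta>' f = \<theta> f" if "hopf_hom ?DH K \<theta>'" "\<forall>f\<in>vcar ?DH. \<forall>a. \<psi> (\<theta>' f) a = dual_action H A \<rho> f a" "f \<in> vcar ?DH" for \<theta>' f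
    by (rule acting_hopf_unique[OF large om UK small_finite_dual that(1) \<theta> _ that(3)]) (use that(2) \<psi>\<theta> in simp)
  show ?thesis
  proof (intro exI[of _ \<theta>] conjI allI impI)
    show "\<forall>f\<in>vcar ?DH. \<forall>a. \<psi> (\<theta> f) a = dual_action H A \<rho> f a" using \<psi>\<theta> by simp
    show "hopf_iso ?DH K \<theta>" unfolding hopf_iso_def using \<theta> bij by (rule conjI)
  qed (rule \<theta>, use uq in blast)
qed

subsection \<open>Finite dimensional algebras and coalgebras\<close>

text \<open>\<theta> after its inverse is the identity, hence a homomorphism, and \<theta> is
  injective, so the inverse is a homomorphism as well. It is used to state the finite dimensional
  cases in the direction opposite to \<theta>.\<close>

lemma hopf_iso_inverse:
  assumes \<theta>: "hopf_iso H K \<theta>"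
  shows "\<exists>\<phi>. hopf_iso K H \<phi>"
proof -
  have H: "hopf_algebra H" "bialgebra H" and K: "hopf_algebra K" "bialgebra K" and b: "bialg_hom H K \<theta>"
    and bij: "bij_betw \<theta> (vcar H) (vcar K)"
    using \<theta> by (auto simp: hopf_iso_def hopf_hom_def hopf_algebra_def)
  let ?i = "inv_into (vcar H) \<theta>"
  have i: "?i x \<in> vcar H" "\<theta> (?i x) = x" if "x \<in> vcar K" for x
    using bij that by (auto simp: bij_betw_def inv_into_into f_inv_into_f)
  note vK = bi_vspace[OF K(2)]
  have l: "lin_map K K (\<lambda>x. \<theta> (?i x))" by (rule lin_cong[OF _ vK, of _ "\<lambda>x. x"]) (simp_all add: i lin_map_def)
  have "bialg_hom K K (\<lambda>x. \<theta> (?i x))"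
  proof -
    have "tmap K K K K (\<lambda>x. \<theta> (?i x)) (\<lambda>x. \<theta> (?i x)) X = X" if X: "X \<in> vcar (tensor_space K K)" for X
      by (rule tensor_ext[OF tmap_mem[OF vK vK l l X] X vK vK], subst tmap_apply[OF vK vK l l _ X], assumption,
        rule tensor_apply_cong[OF X vK vK]) (simp add: i)
    then show ?thesis
      using l lin_mem[OF bi_delta[OF K(2)]] alg_one[OF bi_alg[OF K(2)]] alg_mult[OF bi_alg[OF K(2)]]
      by (simp add: bialg_hom_def alg_hom_def coalg_hom_def i)
  qed
  then have "bialg_hom K H ?i"
    by (rule bialg_hom_factor_inj[OF K(2) H(2) K(2) b bij_betw_imp_inj_on[OF bij] i(1), rotated]) simp
  then show ?thesis using bij_betw_inv_into[OF bij] H K by (auto simp: hopf_iso_def hopf_hom_def)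
qed

text \<open>All endomorphisms form the whole space of the finite topology, which is closed, and
  every orbit lies in a finite span.\<close>

lemma universal_hopf_iso_finite_dim:
  assumes large: "large_universe TYPE('k::field) TYPE('u::ab_group_add) TYPE('t::ab_group_add)"
    and om: "omega_algebra (A :: ('k, 'a::ab_group_add, 'o) omega_alg)" and fin: "\<exists>S. finite S \<and> module.span (vscale A) S = UNIV"
    and UH: "universal_coacting_hopf TYPE('t) A (End A) (H :: ('k, 'u) bialg) \<rho>"
    and UK: "universal_acting_hopf TYPE('t) A (End A) (K :: ('k, 'u) bialg) \<psi>"
  shows "\<exists>\<phi>. hopf_iso K (finite_dual H) \<phi>"
proof -
  have cl: "closedin (finite_topology A) (End A)"
    using closedin_topspace[of "finite_topology A"] by (simp only: topspace_finite_topology)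
  have "\<exists>S. finite S \<and> (\<lambda>v. v a) ` End A \<subseteq> module.span (vscale A) S" for a using fin by blast
  from universal_hopf_duality[OF large om this cl UH UK]
  obtain \<theta> where "hopf_iso (finite_dual H) K \<theta>" by blast
  then show ?thesis by (rule hopf_iso_inverse)
qed

section \<open>Finite dimensional algebras and coalgebras over their signatures\<close>

lemma power_space_cong:
  fixes V :: "('k::field, 'u::ab_group_add, 'y) vsp_scheme" and W :: "('k, 'u, 'z) vsp_scheme"
  assumes "vcar V = vcar W" "vscale V = vscale W"
  shows "power_space V = power_space W"
proof -
  have "vlists V = vlists W" using assms by (simp add: vlists_def fun_eq_iff)
  moreover have "multilin_map V n (ground :: ('k, 'k) alg) = multilin_map W n ground" for n
    using calculation by (simp add: multilin_map_def fun_eq_iff vsp_cong_left(2)[OF assms])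
  ultimately show ?thesis by (simp add: power_space_def ptens_def[abs_def] fun_eq_iff)
qed

lemma ptens1_lin: "vspace V \<Longrightarrow> lin_map V (power_space V 1) (\<lambda>x. ptens V [x])"
  using multilin_hd[of V 0 "power_space V 1" "ptens V" "[]"] ptens_multilin[of V 1] by simp

lemma ptens2_bilin:
  assumes V: "vspace V"
  shows "bilin_map V V (power_space V 2) (\<lambda>x y. ptens V [x, y])"
proof -
  have m: "multilin_map V (Suc (Suc 0)) (power_space V 2) (ptens V)"
    using ptens_multilin[OF V, of 2] by (simp add: numeral_2_eq_2)
  show ?thesis
  proof (rule bilin_mapI)
    show "lin_map V (power_space V 2) (\<lambda>y. ptens V [x, y])" if "x \<in> vcar V" for x
      by (rule multilin_hd[OF multilin_Cons[OF m that] V]) simp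
    show "lin_map V (power_space V 2) (\<lambda>x. ptens V [x, y])" if "y \<in> vcar V" for y
      by (rule multilin_hd[OF m V]) (simp add: that)
  qed
qed

lemma multilin_0: "b [] \<in> vcar Z \<Longrightarrow> multilin_map V 0 Z b"
  by (simp add: multilin_map_def)

lemma multilin_1: "lin_map V Z f \<Longrightarrow> multilin_map V 1 Z (\<lambda>xs. f (xs ! 0))"
  unfolding One_nat_def
  by (rule multilin_ConsI) (simp, rule multilin_0, simp, rule lin_mem)

lemma multilin_2:
  assumes "bilin_map V V Z b"
  shows "multilin_map V 2 Z (\<lambda>xs. b (xs ! 0) (xs ! 1))"
  unfolding numeral_2_eq_2
proof (rule multilin_ConsI)
  fix x xs assume "x \<in> vcar V" "xs \<in> vlists V (Suc 0)"
  then show "lin_map V Z (\<lambda>x. b ((x # xs) ! 0) ((x # xs) ! 1))"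
    using bilin_left[OF assms vlists_nth[of xs V "Suc 0" 0]] by simp
next
  fix x assume "x \<in> vcar V"
  then show "multilin_map V (Suc 0) Z (\<lambda>xs. b ((x # xs) ! 0) ((x # xs) ! 1))"
    using multilin_1[OF bilin_right[OF assms]] by simp
qed

lemma omega_of_alg_algebra:
  assumes R: "algebra R" and U: "vcar R = UNIV"
  shows "omega_algebra (omega_of_alg R)"
proof -
  note v = alg_vspace[OF R]
  let ?A = "omega_of_alg R"
  have "vspace ?A = vspace R" by (rule vsp_cong_left(1)) (simp_all add: omega_of_alg_def)
  then have vA: "vspace ?A" using v by simp
  have UA: "vcar ?A = UNIV" using U by (simp add: omega_of_alg_def)
  have p: "power_space ?A = power_space R" by (rule power_space_cong) (simp_all add: omega_of_alg_def)
  have b: "bilin_map R R (power_space R 1) (\<lambda>x y. ptens R [amult R x y])"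
    by (rule bilin_mapI; rule lin_comp[OF ptens1_lin[OF v]]; rule bilin_left[OF alg_bilin[OF R]] bilin_right[OF alg_bilin[OF R]])
  have "lin_map (power_space R 2) (power_space R 1) (plift R 2 (power_space R 1) (\<lambda>xs. ptens R [amult R (xs ! 0) (xs ! 1)]))"
    by (rule plift_lin[OF v vspace_power multilin_2[OF b]])
  moreover have "lin_map (power_space R 0) (power_space R 1) (plift R 0 (power_space R 1) (\<lambda>xs. ptens R [aone R]))"
    by (rule plift_lin[OF v vspace_power multilin_0]) (rule lin_mem[OF ptens1_lin[OF v] alg_one[OF R]])
  ultimately have "lin_map (power_space R (osrc ?A w)) (power_space R (otgt ?A w)) (oper ?A w)" for w
    by (cases w) (simp_all add: omega_of_alg_def)
  then show ?thesis unfolding omega_algebra_def p using vA UA by blast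
qed

lemma omega_of_coalg_algebra:
  assumes C: "coalgebra C" and U: "vcar C = UNIV"
  shows "omega_algebra (omega_of_coalg C)"
proof -
  note v = coalg_vspace[OF C]
  let ?A = "omega_of_coalg C"
  have "vspace ?A = vspace C" by (rule vsp_cong_left(1)) (simp_all add: omega_of_coalg_def)
  then have vA: "vspace ?A" using v by simp
  have UA: "vcar ?A = UNIV" using U by (simp add: omega_of_coalg_def)
  have p: "power_space ?A = power_space C" by (rule power_space_cong) (simp_all add: omega_of_coalg_def)
  have "lin_map (power_space C 1) (power_space C 2) (plift C 1 (power_space C 2)
      (\<lambda>xs. tlift C C (power_space C 2) (\<lambda>x y. ptens C [x, y]) (cdelta C (xs ! 0))))"
    by (rule plift_lin[OF v vspace_power multilin_1[OF lin_comp[OF tlift_lin[OF v v vspace_power ptens2_bilin[OF v]] coalg_delta[OF C]]]])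
  moreover have "lin_map C (power_space C 0) (\<lambda>x. fscale (ceps C x) (ptens C []))"
    using lin_add[OF coalg_eps[OF C]] lin_scale[OF coalg_eps[OF C]] vs_scale[OF vspace_power[of C 0] ptens_mem[of "[]" C 0]]
    by (intro lin_mapI) (auto simp: fscale_def fun_eq_iff algebra_simps)
  then have "lin_map (power_space C 1) (power_space C 0) (plift C 1 (power_space C 0) (\<lambda>xs. fscale (ceps C (xs ! 0)) (ptens C [])))"
    by (rule plift_lin[OF v vspace_power multilin_1])
  ultimately have "lin_map (power_space C (osrc ?A w)) (power_space C (otgt ?A w)) (oper ?A w)" for w
    by (cases w) (simp_all add: omega_of_coalg_def)
  then show ?thesis unfolding omega_algebra_def p using vA UA by blast
qed

lemma End_cong: "vscale V = vscale W \<Longrightarrow> End V = End W"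
  by (simp add: End_def)

theorem theorem4p15:
  assumes large: "large_universe TYPE('k::field) TYPE('u::ab_group_add) TYPE('t::ab_group_add)"
  shows
   "(\<forall>(A :: ('k, 'a::ab_group_add, 'o) omega_alg) (V :: ('a \<Rightarrow> 'a) set)
      (H :: ('k, 'u) bialg) \<rho> (K :: ('k, 'u) bialg) \<psi>.
      omega_algebra A \<and> unital_subalgebra A V \<and> pointwise_finite_dim A V \<and>
      closedin (finite_topology A) V \<and>
      universal_coacting_hopf TYPE('t) A V H \<rho> \<and> universal_acting_hopf TYPE('t) A V K \<psi> \<longrightarrow>
      (\<exists>\<theta>. hopf_hom (finite_dual H) K \<theta> \<and>
         (\<forall>f\<in>vcar (finite_dual H). \<forall>a. \<psi> (\<theta> f) a = dual_action H A \<rho> f a) \<and>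
         (\<forall>\<theta>'. hopf_hom (finite_dual H) K \<theta>' \<and>
            (\<forall>f\<in>vcar (finite_dual H). \<forall>a. \<psi> (\<theta>' f) a = dual_action H A \<rho> f a) \<longrightarrow>
            (\<forall>f\<in>vcar (finite_dual H). \<theta>' f = \<theta> f)) \<and>
         hopf_iso (finite_dual H) K \<theta>))
    \<and>
    (\<forall>(R :: ('k, 'b::ab_group_add) alg) (H :: ('k, 'u) bialg) \<rho> (K :: ('k, 'u) bialg) \<psi>.
      algebra R \<and> finite_dim_type R \<and>
      universal_coacting_hopf TYPE('t) (omega_of_alg R) (End R) H \<rho> \<and>
      universal_acting_hopf TYPE('t) (omega_of_alg R) (End R) K \<psi> \<longrightarrow>
      (\<exists>\<phi>. hopf_iso K (finite_dual H) \<phi>))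
    \<and>
    (\<forall>(C :: ('k, 'c::ab_group_add) coalg) (H :: ('k, 'u) bialg) \<rho> (K :: ('k, 'u) bialg) \<psi>.
      coalgebra C \<and> finite_dim_type C \<and>
      universal_coacting_hopf TYPE('t) (omega_of_coalg C) (End C) H \<rho> \<and>
      universal_acting_hopf TYPE('t) (omega_of_coalg C) (End C) K \<psi> \<longrightarrow>
      (\<exists>\<phi>. hopf_iso K (finite_dual H) \<phi>))"
proof (intro conjI allI impI)
  fix A :: "('k, 'a, 'o) omega_alg" and V and H K :: "('k, 'u) bialg" and \<rho> \<psi>
  assume "omega_algebra A \<and> unital_subalgebra A V \<and> pointwise_finite_dim A V \<and>
      closedin (finite_topology A) V \<and>
      universal_coacting_hopf TYPE('t) A V H \<rho> \<and> universal_acting_hopf TYPE('t) A V K \<psi>"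
  then have h: "omega_algebra A" "pointwise_finite_dim A V" "closedin (finite_topology A) V"
      "universal_coacting_hopf TYPE('t) A V H \<rho>" "universal_acting_hopf TYPE('t) A V K \<psi>"
    by blast+
  have "\<exists>S. finite S \<and> (\<lambda>v. v a) ` V \<subseteq> module.span (vscale A) S" for a
    using h(2) unfolding pointwise_finite_dim_def by (metis order_refl)
  from universal_hopf_duality[OF large h(1) this h(3-5)]
  show "\<exists>\<theta>. hopf_hom (finite_dual H) K \<theta> \<and>
         (\<forall>f\<in>vcar (finite_dual H). \<forall>a. \<psi> (\<theta> f) a = dual_action H A \<rho> f a) \<and>
         (\<forall>\<theta>'. hopf_hom (finite_dual H) K \<theta>' \<and>
            (\<forall>f\<in>vcar (finite_dual H). \<forall>a. \<psi> (\<theta>' f) a = dual_action H A \<rho> f a) \<longrightarrow>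
            (\<forall>f\<in>vcar (finite_dual H). \<theta>' f = \<theta> f)) \<and>
         hopf_iso (finite_dual H) K \<theta>" .
next
  fix R :: "('k, 'b) alg" and H K :: "('k, 'u) bialg" and \<rho> \<psi>
  assume h: "algebra R \<and> finite_dim_type R \<and>
      universal_coacting_hopf TYPE('t) (omega_of_alg R) (End R) H \<rho> \<and>
      universal_acting_hopf TYPE('t) (omega_of_alg R) (End R) K \<psi>"
  then have om: "omega_algebra (omega_of_alg R)" by (intro omega_of_alg_algebra) (auto simp: finite_dim_type_def)
  \<comment> \<open>Endomorphisms depend only on the scaling, which \<open>R\<close> shares with its
    record over the signature.\<close>
  have "End R = End (omega_of_alg R)" by (rule End_cong) (simp add: omega_of_alg_def)
  with h show "\<exists>\<phi>. hopf_iso K (finite_dual H) \<phi>"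
    by (intro universal_hopf_iso_finite_dim[OF large om]) (auto simp: finite_dim_type_def omega_of_alg_def)
next
  fix C :: "('k, 'c) coalg" and H K :: "('k, 'u) bialg" and \<rho> \<psi>
  assume h: "coalgebra C \<and> finite_dim_type C \<and>
      universal_coacting_hopf TYPE('t) (omega_of_coalg C) (End C) H \<rho> \<and>
      universal_acting_hopf TYPE('t) (omega_of_coalg C) (End C) K \<psi>"
  then have om: "omega_algebra (omega_of_coalg C)" by (intro omega_of_coalg_algebra) (auto simp: finite_dim_type_def)
  have "End C = End (omega_of_coalg C)" by (rule End_cong) (simp add: omega_of_coalg_def)
  with h show "\<exists>\<phi>. hopf_iso K (finite_dual H) \<phi>"
    by (intro universal_hopf_iso_finite_dim[OF large om]) (auto simp: finite_dim_type_def omega_of_coalg_def)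
qed

end
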